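(* Let $0<\varepsilon<1$. There is an algorithm which, for every sufficiently large positive integer $m$, on input $m$ and with $n=2\phi(m)$, constructs a lattice $\Lambda\subset\mathbb{R}^n$ satisfying $$\Delta(\Lambda)>\frac{(1-\varepsilon)m}{2^{2\phi(m)}}$$ using at most $\exp\big(1.5\,n\log n\,(1+o(1))\big)$ binary operations, where $o(1)$ denotes a quantity tending to $0$ as $m\to\infty$.
   Context: $\phi$ is Euler's totient function. A lattice in a Euclidean space $E$ of dimension $n$ is a discrete free $\mathbb{Z}$-submodule of rank $n$. $\mathrm{Vol}(\Lambda)$ is the volume of a fundamental region of $\Lambda$, $\mu_\Lambda=\min\{\|x\| : x\in\Lambda\setminus\{0\}\}$, $B(r)$ the closed ball of radius $r$ centered at $0$, and the density of $\Lambda$ is $\Delta(\Lambda)=\frac{\mathrm{Vol}(B(\mu_\Lambda))}{2^n\,\mathrm{Vol}(\Lambda)}$. Constructing a lattice means outputting an exact finite description of it up to isometry, e.g. the Gram matrix of a $\mathbb{Z}$-basis, with exactly encoded entries. *)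

theory Defs
  imports
    "HOL-Analysis.Analysis"
    "HOL-Library.Log_Nat"
    "HOL-Number_Theory.Totient"
begin

section \<open>Lattices in Euclidean space\<close>

text \<open>
  The dimension varies inside the statement, so \<open>\<real>\<^sup>n\<close> is the set of real functions on
  \<open>{0..<n}\<close>, extended by \<open>undefined\<close>.  It is the carrier of the product measure
  \<open>leb n\<close>, which is the \<open>n\<close>-dimensional Lebesgue measure.  The Euclidean norm of \<open>x\<close>
  is \<open>L2_set x {..<n}\<close>.
\<close>

abbreviation leb :: "nat \<Rightarrow> (nat \<Rightarrow> real) measure" where
  "leb n \<equiv> Pi\<^sub>M {..<n} (\<lambda>_. lborel)"

definition Rn :: "nat \<Rightarrow> (nat \<Rightarrow> real) set" where
  "Rn n = {..<n} \<rightarrow>\<^sub>E UNIV"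

definition vzero :: "nat \<Rightarrow> nat \<Rightarrow> real" where
  "vzero n = (\<lambda>k\<in>{..<n}. 0)"

definition vdiff :: "nat \<Rightarrow> (nat \<Rightarrow> real) \<Rightarrow> (nat \<Rightarrow> real) \<Rightarrow> nat \<Rightarrow> real" where
  "vdiff n x y = (\<lambda>k\<in>{..<n}. x k - y k)"

definition int_comb :: "nat \<Rightarrow> (nat \<Rightarrow> int) \<Rightarrow> (nat \<Rightarrow> nat \<Rightarrow> real) \<Rightarrow> nat \<Rightarrow> real" where
  "int_comb n c b = (\<lambda>k\<in>{..<n}. \<Sum>i<n. of_int (c i) * b i k)"

definition int_basis :: "nat \<Rightarrow> (nat \<Rightarrow> nat \<Rightarrow> real) \<Rightarrow> (nat \<Rightarrow> real) set \<Rightarrow> bool" where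
  "int_basis n b \<Lambda> \<longleftrightarrow>
     (\<forall>i<n. b i \<in> Rn n) \<and>
     \<Lambda> = range (\<lambda>c. int_comb n c b) \<and>
     (\<forall>c. int_comb n c b = vzero n \<longrightarrow> (\<forall>i<n. c i = 0))"

definition is_lattice :: "nat \<Rightarrow> (nat \<Rightarrow> real) set \<Rightarrow> bool" where
  "is_lattice n \<Lambda> \<longleftrightarrow>
     (\<exists>b. int_basis n b \<Lambda>) \<and>
     (\<forall>x\<in>\<Lambda>. \<exists>e>0. \<forall>y\<in>\<Lambda>. L2_set (vdiff n x y) {..<n} < e \<longrightarrow> y = x)"

definition fundamental_region ::
    "nat \<Rightarrow> (nat \<Rightarrow> real) set \<Rightarrow> (nat \<Rightarrow> real) set \<Rightarrow> bool" where
  "fundamental_region n \<Lambda> F \<longleftrightarrow>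
     F \<in> sets (leb n) \<and> (\<forall>x\<in>Rn n. \<exists>!y. y \<in> F \<and> vdiff n x y \<in> \<Lambda>)"

text \<open>
  All (measurable) fundamental regions of a lattice have the same finite volume, so the choice
  below is immaterial.
\<close>

definition lattice_vol :: "nat \<Rightarrow> (nat \<Rightarrow> real) set \<Rightarrow> real" where
  "lattice_vol n \<Lambda> = measure (leb n) (SOME F. fundamental_region n \<Lambda> F)"

definition min_norm :: "nat \<Rightarrow> (nat \<Rightarrow> real) set \<Rightarrow> real" where
  "min_norm n \<Lambda> = (LEAST r. r \<in> (\<lambda>x. L2_set x {..<n}) ` (\<Lambda> - {vzero n}))"

definition closed_ball :: "nat \<Rightarrow> real \<Rightarrow> (nat \<Rightarrow> real) set" where
  "closed_ball n r = {x \<in> Rn n. L2_set x {..<n} \<le> r}"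

definition lattice_density :: "nat \<Rightarrow> (nat \<Rightarrow> real) set \<Rightarrow> real" where
  "lattice_density n \<Lambda> =
     measure (leb n) (closed_ball n (min_norm n \<Lambda>)) / (2 ^ n * lattice_vol n \<Lambda>)"

text \<open>
  A list of integers describes \<open>\<Lambda>\<close> up to isometry if it lists, row by row, the entries of the
  Gram matrix of some \<open>\<int>\<close>-basis of \<open>\<Lambda>\<close>, each entry being a rational number given by a numerator
  followed by a positive denominator.
\<close>

definition describes_lattice :: "nat \<Rightarrow> int list \<Rightarrow> (nat \<Rightarrow> real) set \<Rightarrow> bool" where
  "describes_lattice n out \<Lambda> \<longleftrightarrow>
     length out = 2 * n * n \<and>
     (\<exists>b. int_basis n b \<Lambda> \<and>
        (\<forall>i<n. \<forall>j<n.
           out ! (2 * (i * n + j) + 1) > 0 \<and>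
           (\<Sum>k<n. b i k * b j k) =
             of_int (out ! (2 * (i * n + j))) / of_int (out ! (2 * (i * n + j) + 1))))"


section \<open>Algorithms and their number of binary operations\<close>

text \<open>
  Algorithms are programs of a random access machine with integer registers, indexed by the
  integers, and a write-only output tape.  The cost is logarithmic: reading or addressing a
  register costs the bit lengths of all addresses and contents involved, addition, subtraction and
  comparison are linear in the bit lengths of the arguments, and multiplication, division and
  remainder (rounding down) cost the product of the bit lengths, as in the schoolbook algorithms.
\<close>

datatype operand =
    Const int
  | Reg int  \<comment> \<open>content of a register\<close>
  | Ind int  \<comment> \<open>content of the register whose address is the content of the given register\<close>

datatype dest = ToReg int | ToInd int

datatype arith = Add | Sub | Mul | Div | Mod

datatype test = Eq operand operand | Lt operand operand

datatype prog =
    Skip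
  | Assign dest arith operand operand
  | Write operand
  | Seq prog prog
  | IfElse test prog prog
  | While test prog

type_synonym memory = "int \<Rightarrow> int"

text \<open>Number of binary digits plus one sign bit.\<close>

definition len :: "int \<Rightarrow> nat" where
  "len x = floorlog 2 (nat \<bar>x\<bar>) + 1"

fun operand_val :: "memory \<Rightarrow> operand \<Rightarrow> int" where
  "operand_val M (Const c) = c"
| "operand_val M (Reg a) = M a"
| "operand_val M (Ind a) = M (M a)"

fun operand_cost :: "memory \<Rightarrow> operand \<Rightarrow> nat" where
  "operand_cost M (Const c) = len c"
| "operand_cost M (Reg a) = len a + len (M a)"
| "operand_cost M (Ind a) = len a + len (M a) + len (M (M a))"

fun dest_addr :: "memory \<Rightarrow> dest \<Rightarrow> int" where
  "dest_addr M (ToReg a) = a"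
| "dest_addr M (ToInd a) = M a"

fun dest_cost :: "memory \<Rightarrow> dest \<Rightarrow> nat" where
  "dest_cost M (ToReg a) = len a"
| "dest_cost M (ToInd a) = len a + len (M a)"

fun arith_val :: "arith \<Rightarrow> int \<Rightarrow> int \<Rightarrow> int" where
  "arith_val Add x y = x + y"
| "arith_val Sub x y = x - y"
| "arith_val Mul x y = x * y"
| "arith_val Div x y = x div y"
| "arith_val Mod x y = x mod y"

fun arith_cost :: "arith \<Rightarrow> int \<Rightarrow> int \<Rightarrow> nat" where
  "arith_cost Add x y = len x + len y"
| "arith_cost Sub x y = len x + len y"
| "arith_cost Mul x y = len x * len y"
| "arith_cost Div x y = len x * len y"
| "arith_cost Mod x y = len x * len y"

fun test_val :: "memory \<Rightarrow> test \<Rightarrow> bool" where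
  "test_val M (Eq u v) \<longleftrightarrow> operand_val M u = operand_val M v"
| "test_val M (Lt u v) \<longleftrightarrow> operand_val M u < operand_val M v"

fun test_cost :: "memory \<Rightarrow> test \<Rightarrow> nat" where
  "test_cost M (Eq u v) = operand_cost M u + operand_cost M v"
| "test_cost M (Lt u v) = operand_cost M u + operand_cost M v"

text \<open>
  \<open>exec p M t M' out\<close>: started with memory \<open>M\<close>, the program \<open>p\<close> halts with memory \<open>M'\<close> after
  \<open>t\<close> binary operations, having written the list \<open>out\<close>.
\<close>

inductive exec :: "prog \<Rightarrow> memory \<Rightarrow> nat \<Rightarrow> memory \<Rightarrow> int list \<Rightarrow> bool" where
  Skip: "exec Skip M 1 M []"
| Assign: "x = operand_val M u \<Longrightarrow> y = operand_val M v \<Longrightarrow>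
    exec (Assign d f u v) M
      (dest_cost M d + operand_cost M u + operand_cost M v + arith_cost f x y)
      (M(dest_addr M d := arith_val f x y)) []"
| Write: "exec (Write u) M (operand_cost M u) M [operand_val M u]"
| Seq: "exec p M t M' out \<Longrightarrow> exec q M' t' M'' out' \<Longrightarrow>
    exec (Seq p q) M (t + t') M'' (out @ out')"
| IfTrue: "test_val M b \<Longrightarrow> exec p M t M' out \<Longrightarrow>
    exec (IfElse b p q) M (test_cost M b + t) M' out"
| IfFalse: "\<not> test_val M b \<Longrightarrow> exec q M t M' out \<Longrightarrow>
    exec (IfElse b p q) M (test_cost M b + t) M' out"
| WhileFalse: "\<not> test_val M b \<Longrightarrow> exec (While b p) M (test_cost M b) M []"
| WhileTrue: "test_val M b \<Longrightarrow> exec p M t M' out \<Longrightarrow> exec (While b p) M' t' M'' out' \<Longrightarrow>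
    exec (While b p) M (test_cost M b + t + t') M'' (out @ out')"

lemma exec_deterministic:
  assumes "exec p M t M' out" "exec p M t' M'' out'"
  shows "t' = t \<and> M'' = M' \<and> out' = out"
  using assms
proof (induction arbitrary: t' M'' out' rule: exec.induct)
  case (Seq p M t M1 o1 q t2 M2 o2)
  from Seq.prems show ?case
    by (cases rule: exec.cases) (use Seq.IH in blast)+
next
  case (WhileTrue M b p t M1 o1 t2 M2 o2)
  from WhileTrue.prems show ?case
    by (cases rule: exec.cases) (use WhileTrue.IH WhileTrue.hyps in blast)+
next
  case (IfTrue M b p t M1 o1 q)
  from IfTrue.prems show ?case
    by (cases rule: exec.cases) (use IfTrue.IH IfTrue.hyps in blast)+
next
  case (IfFalse M b q t M1 o1 p)
  from IfFalse.prems show ?case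
    by (cases rule: exec.cases) (use IfFalse.IH IfFalse.hyps in blast)+
qed (auto elim: exec.cases)

text \<open>The input \<open>m\<close> is placed in register \<open>0\<close>; all other registers are initially \<open>0\<close>.\<close>

definition computes :: "prog \<Rightarrow> nat \<Rightarrow> nat \<Rightarrow> int list \<Rightarrow> bool" where
  "computes p m t out \<longleftrightarrow> (\<exists>M'. exec p ((\<lambda>_. 0)(0 := int m)) t M' out)"

end

theory Submission
imports Defs "HOL-Computational_Algebra.Computational_Algebra" "HOL-Number_Theory.Residues" "HOL-Real_Asymp.Real_Asymp"
begin

text \<open>Let \<open>R = \<int>[\<zeta>]\<close> be the ring of integers of the \<open>m\<close>-th cyclotomic field, of rank \<open>f = \<phi>(m)\<close>, with the
  trace form.  For \<open>u \<in> R\<close> consider the lattice of all \<open>(t x, u x + N y)\<close> with \<open>x, y \<in> R\<close>, of dimension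
  \<open>n = 2 f\<close> and of a covolume independent of \<open>u\<close>.  The number of its short vectors, averaged over \<open>u\<close>
  modulo \<open>N\<close>, is nearly the volume of the ball divided by the covolume, and short vectors come in orbits
  of length \<open>m\<close> under multiplication by \<open>\<zeta>\<close>.  So if this volume is slightly less than \<open>m\<close> times the
  covolume, then some \<open>u\<close> has no short vector at all.  This works with \<open>t = K n\<close> and
  \<open>N = n\<^sup>(2 + o(1))\<close>.  The algorithm tries all \<open>N\<^sup>f\<close> values of \<open>u\<close>; the minimum of a lattice is found by
  trying all \<open>x\<close> with coordinates bounded by \<open>B = n\<^sup>(1 + o(1))\<close>, since \<open>u x + N y\<close> has to be the centred
  residue of \<open>u x\<close> modulo \<open>N\<close>.  This takes \<open>(N B)\<^sup>(f (1 + o(1))) = n\<^sup>(3 f (1 + o(1)))\<close> operations.\<close>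

section \<open>Triangular bases and ball volumes\<close>

text \<open>The obstacle is precision in growing dimension. The volume of an
  \<open>n\<close>-dimensional ball changes by a bounded factor only if the radius changes by a
  factor \<open>1 + O(1 / n)\<close>, so points must be counted sharply on that scale, in all slices
  at once. Comparing cells with balls by the triangle inequality would need cells of diameter
  \<open>r / n\<close>. The second moment of a uniform point of a box allows sides of that order, a
  gain of \<open>sqrt n\<close>; this brings \<open>t\<close> down to order \<open>n\<close> and
  \<open>N\<close> to order \<open>n\<^sup>2\<close>, hence the exponent to
  \<open>1.5 n log n\<close>. The factor \<open>L = 4 ^ card P\<close> is the price of elementary
  bounds for coefficients and discriminant; it is \<open>m\<close> to a power tending to 0 and
  vanishes in the o(1). The field is never built: elements are coefficient vectors, compared through
  their embeddings, and that one zero conjugate forces all to vanish (irreducibility of the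
  cyclotomic polynomial) comes from Frobenius congruences. The search maximises the minimum, so it
  needs neither the radius nor a test of goodness: the existence of one good \<open>u\<close>
  suffices.\<close>

interpretation leb: product_sigma_finite "\<lambda>_::nat. lborel :: real measure"
  by standard

lemma space_leb [simp]: "space (leb k) = Rn k"
  by (simp add: space_PiM Rn_def)

definition vshift :: "nat \<Rightarrow> (nat \<Rightarrow> real) \<Rightarrow> (nat \<Rightarrow> real) \<Rightarrow> nat \<Rightarrow> real" where
  "vshift k p x = (\<lambda>j\<in>{..<k}. x j + p j)"

lemma vshift_measurable [measurable]: "vshift k p \<in> leb k \<rightarrow>\<^sub>M leb k"
  unfolding vshift_def by measurable

lemma vshift_Rn [simp]: "vshift k p x \<in> Rn k"
  by (auto simp: vshift_def Rn_def)

lemma emeasure_lborel_translate: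
  assumes "A \<in> sets (lborel :: real measure)"
  shows "emeasure lborel ((\<lambda>x::real. x + p) -` A) = emeasure lborel A"
proof -
  have "emeasure lborel A = emeasure (distr lborel borel ((+) p)) A"
    by (subst lborel_distr_plus) simp
  also have "\<dots> = emeasure lborel (((+) p) -` A)"
    using assms by (subst emeasure_distr) auto
  also have "((+) p) -` A = (\<lambda>x. x + p) -` A" by (auto simp: add.commute)
  finally show ?thesis ..
qed

text \<open>A product measure is determined by its values on boxes, and a translated box has
  translated factors, so one-dimensional invariance suffices.\<close>

lemma distr_vshift: "distr (leb k) (leb k) (vshift k p) = leb k"
proof (rule leb.PiM_eqI)
  fix A :: "nat \<Rightarrow> real set"
  assume A: "\<And>i. i \<in> {..<k} \<Longrightarrow> A i \<in> sets lborel"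
  have meas: "(\<lambda>x. x + p i) -` A i \<in> sets lborel" if "i < k" for i
  proof -
    have "(\<lambda>x. x + p i) \<in> borel_measurable borel" by measurable
    from measurable_sets[OF this, of "A i"] show ?thesis using A that by simp
  qed
  have "emeasure (distr (leb k) (leb k) (vshift k p)) (Pi\<^sub>E {..<k} A)
      = emeasure (leb k) (vshift k p -` (Pi\<^sub>E {..<k} A) \<inter> space (leb k))"
    using A by (intro emeasure_distr sets_PiM_I_finite) auto
  also have "vshift k p -` (Pi\<^sub>E {..<k} A) \<inter> space (leb k) = Pi\<^sub>E {..<k} (\<lambda>i. (\<lambda>x. x + p i) -` A i)"
    by (auto simp: vshift_def Rn_def PiE_def Pi_def)
  also have "emeasure (leb k) \<dots> = (\<Prod>i<k. emeasure lborel ((\<lambda>x. x + p i) -` A i))"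
    using meas by (intro leb.emeasure_PiM) auto
  also have "\<dots> = (\<Prod>i<k. emeasure lborel (A i))"
    using A by (intro prod.cong refl emeasure_lborel_translate) auto
  finally show "emeasure (distr (leb k) (leb k) (vshift k p)) (Pi\<^sub>E {..<k} A)
     = (\<Prod>i\<in>{..<k}. emeasure lborel (A i))" .
qed auto

lemma emeasure_vshift:
  assumes "S \<in> sets (leb k)"
  shows "emeasure (leb k) (vshift k p -` S \<inter> Rn k) = emeasure (leb k) S"
proof -
  have "emeasure (leb k) S = emeasure (distr (leb k) (leb k) (vshift k p)) S"
    by (simp add: distr_vshift)
  also have "\<dots> = emeasure (leb k) (vshift k p -` S \<inter> space (leb k))"
    using assms by (intro emeasure_distr) auto
  finally show ?thesis by simp
qed

definition nsq :: "nat \<Rightarrow> (nat \<Rightarrow> real) \<Rightarrow> real" where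
  "nsq k x = (\<Sum>j<k. (x j)\<^sup>2)"

lemma nsq_nonneg [simp]: "0 \<le> nsq k x"
  by (simp add: nsq_def sum_nonneg)

lemma L2_set_nsq: "L2_set x {..<k} = sqrt (nsq k x)"
  by (simp add: L2_set_def nsq_def)

lemma nsq_measurable [measurable]: "(\<lambda>x. nsq k x) \<in> borel_measurable (leb k)"
  unfolding nsq_def by measurable

lemma nsq_vshift [simp]: "nsq k (vshift k p x) = nsq k (\<lambda>j. x j + p j)"
  by (simp add: nsq_def vshift_def)

lemma closed_ball_sets [measurable]: "closed_ball k r \<in> sets (leb k)"
proof -
  have "closed_ball k r = {x \<in> space (leb k). sqrt (nsq k x) \<le> r}"
    by (auto simp: closed_ball_def L2_set_nsq)
  also have "\<dots> \<in> sets (leb k)" by measurable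
  finally show ?thesis .
qed

lemma emeasure_closed_ball:
  assumes "r > 0"
  shows "emeasure (leb k) (closed_ball k r) = ennreal (unit_ball_vol (real k) * r ^ k)"
proof -
  have "closed_ball k r = {f. sqrt (\<Sum>i<k. (f i)\<^sup>2) \<le> r} \<inter> space (leb k)"
    by (auto simp: closed_ball_def L2_set_def)
  with emeasure_cball_aux[of "{..<k}" r] assms show ?thesis by simp
qed

lemma measure_closed_ball:
  assumes "r > 0"
  shows "measure (leb k) (closed_ball k r) = unit_ball_vol (real k) * r ^ k"
  using emeasure_closed_ball[OF assms, of k] assms by (simp add: measure_def)

text \<open>Rows are basis vectors. Every lattice below is rotated into this lower triangular form,
  in which cells are boxes and the covolume is the product of the diagonal.\<close>

definition tri :: "nat \<Rightarrow> (nat \<Rightarrow> nat \<Rightarrow> real) \<Rightarrow> bool" where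
  "tri k b \<longleftrightarrow> (\<forall>i<k. 0 < b i i \<and> (\<forall>j<k. i < j \<longrightarrow> b i j = 0))"

lemma tri_pos: "tri k b \<Longrightarrow> i < k \<Longrightarrow> 0 < b i i"
  and tri_zero: "tri k b \<Longrightarrow> i < j \<Longrightarrow> j < k \<Longrightarrow> b i j = 0"
  by (auto simp: tri_def)

lemma tri_SucD: "tri (Suc k) b \<Longrightarrow> tri k b"
  by (auto simp: tri_def)

definition comb :: "nat \<Rightarrow> (nat \<Rightarrow> nat \<Rightarrow> real) \<Rightarrow> (nat \<Rightarrow> real) \<Rightarrow> nat \<Rightarrow> real" where
  "comb k b c j = (\<Sum>i<k. c i * b i j)"

lemma comb_Suc_last:
  assumes "tri (Suc k) b"
  shows "comb (Suc k) b c k = c k * b k k"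
  using assms by (auto simp: comb_def tri_def)

lemma comb_Suc: "comb (Suc k) b c j = comb k b c j + c k * b k j"
  by (simp add: comb_def)

text \<open>Only the last row reaches the last coordinate, so its coefficient is forced by rounding
  there (the floor \<open>q\<close>); the other rows then correct the remaining coordinates by
  induction.\<close>

lemma cell_exists:
  assumes "tri k b"
  shows "\<exists>c::nat \<Rightarrow> int. \<forall>j<k. lo j \<le> v j - comb k b (\<lambda>i. of_int (c i)) j \<and>
            v j - comb k b (\<lambda>i. of_int (c i)) j < lo j + b j j"
  using assms
proof (induction k arbitrary: v)
  case (Suc k)
  define q where "q = \<lfloor>(v k - lo k) / b k k\<rfloor>"
  have bk: "b k k > 0" using Suc.prems by (auto simp: tri_def)
  have q: "of_int q * b k k \<le> v k - lo k" "v k - lo k < (of_int q + 1) * b k k"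
  proof -
    have "of_int q \<le> (v k - lo k) / b k k" "(v k - lo k) / b k k < of_int q + 1"
      unfolding q_def by linarith+
    then show "of_int q * b k k \<le> v k - lo k" "v k - lo k < (of_int q + 1) * b k k"
      using bk by (auto simp: pos_le_divide_eq pos_divide_less_eq)
  qed
  obtain c where c: "\<And>j. j < k \<Longrightarrow> lo j \<le> v j - of_int q * b k j - comb k b (\<lambda>i. of_int (c i :: int)) j \<and>
            v j - of_int q * b k j - comb k b (\<lambda>i. of_int (c i)) j < lo j + b j j"
    using Suc.IH[OF tri_SucD[OF Suc.prems], of "\<lambda>j. v j - of_int q * b k j"] by auto
  define c' where "c' = c(k := q)"
  have eq: "comb k b (\<lambda>i. of_int (c' i)) j = comb k b (\<lambda>i. of_int (c i)) j" for j
    unfolding comb_def by (intro sum.cong) (auto simp: c'_def)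
  have "lo j \<le> v j - comb (Suc k) b (\<lambda>i. of_int (c' i)) j \<and>
            v j - comb (Suc k) b (\<lambda>i. of_int (c' i)) j < lo j + b j j" if "j < Suc k" for j
  proof (cases "j = k")
    case True
    then show ?thesis using q comb_Suc_last[OF Suc.prems, of "\<lambda>i. of_int (c' i)"]
      by (auto simp: c'_def algebra_simps)
  next
    case False
    with that c[of j] show ?thesis unfolding comb_Suc eq by (auto simp: c'_def algebra_simps)
  qed
  then show ?case by blast
qed auto

text \<open>Read from the last coordinate: there the vector equals \<open>c k * b k k\<close>, and
  an integer multiple of \<open>b k k\<close> shorter than \<open>b k k\<close> is zero.\<close>

lemma comb_zero_imp:
  assumes "tri k b" "\<forall>j<k. \<bar>comb k b (\<lambda>i. of_int (c i :: int)) j\<bar> < b j j"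
  shows "\<forall>i<k. c i = 0"
  using assms
proof (induction k)
  case (Suc k)
  have bk: "b k k > 0" using Suc.prems by (auto simp: tri_def)
  have "\<bar>of_int (c k)\<bar> * b k k < b k k"
    using Suc.prems(2)[rule_format, of k] comb_Suc_last[OF Suc.prems(1), of "\<lambda>i. of_int (c i)"] bk
    by (simp add: abs_mult)
  with bk have "\<bar>real_of_int (c k)\<bar> < 1" by simp
  then have ck: "c k = 0" by linarith
  have "\<forall>j<k. \<bar>comb k b (\<lambda>i. of_int (c i :: int)) j\<bar> < b j j"
    using Suc.prems(2) ck by (auto simp: comb_Suc)
  with Suc.IH[OF tri_SucD[OF Suc.prems(1)]] ck show ?case
    by (auto simp: less_Suc_eq)
qed auto

lemma comb_diff: "comb k b (\<lambda>i. c i - d i) j = comb k b c j - comb k b d j"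
  by (simp add: comb_def sum_subtractf algebra_simps)

lemma comb_add: "comb k b (\<lambda>i. c i + d i) j = comb k b c j + comb k b d j"
  by (simp add: comb_def sum.distrib algebra_simps)

lemma cell_unique:
  assumes "tri k b"
    and "\<forall>j<k. lo j \<le> v j - comb k b (\<lambda>i. of_int (c i :: int)) j \<and>
            v j - comb k b (\<lambda>i. of_int (c i)) j < lo j + b j j"
    and "\<forall>j<k. lo j \<le> v j - comb k b (\<lambda>i. of_int (d i :: int)) j \<and>
            v j - comb k b (\<lambda>i. of_int (d i)) j < lo j + b j j"
  shows "\<forall>i<k. c i = d i"
proof -
  have "\<forall>j<k. \<bar>comb k b (\<lambda>i. of_int (c i - d i)) j\<bar> < b j j"
  proof (intro allI impI)
    fix j assume "j < k"
    with assms(2,3) have "lo j \<le> v j - comb k b (\<lambda>i. of_int (c i :: int)) j \<and>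
            v j - comb k b (\<lambda>i. of_int (c i)) j < lo j + b j j"
         "lo j \<le> v j - comb k b (\<lambda>i. of_int (d i :: int)) j \<and>
            v j - comb k b (\<lambda>i. of_int (d i)) j < lo j + b j j" by auto
    then show "\<bar>comb k b (\<lambda>i. of_int (c i - d i)) j\<bar> < b j j"
      unfolding of_int_diff comb_diff by linarith
  qed
  from comb_zero_imp[OF assms(1) this] show ?thesis by auto
qed

text \<open>By \<open>cell_exists\<close> and \<open>cell_unique\<close> this axis-parallel box
  tiles space under the lattice just as the skew parallelepiped of the rows does.\<close>

definition cell :: "nat \<Rightarrow> (nat \<Rightarrow> nat \<Rightarrow> real) \<Rightarrow> (nat \<Rightarrow> real) \<Rightarrow> (nat \<Rightarrow> real) set" where
  "cell k b lo = Pi\<^sub>E {..<k} (\<lambda>j. {lo j ..< lo j + b j j})"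

lemma cell_sets [measurable]: "cell k b lo \<in> sets (leb k)"
  unfolding cell_def by (intro sets_PiM_I_finite) auto

lemma cell_Rn: "x \<in> cell k b lo \<Longrightarrow> x \<in> Rn k"
  by (auto simp: cell_def Rn_def)

lemma emeasure_cell:
  assumes "tri k b"
  shows "emeasure (leb k) (cell k b lo) = ennreal (\<Prod>j<k. b j j)"
proof -
  have "emeasure (leb k) (cell k b lo) = (\<Prod>j<k. emeasure lborel {lo j ..< lo j + b j j})"
    unfolding cell_def by (intro leb.emeasure_PiM) auto
  also have "\<dots> = (\<Prod>j<k. ennreal (b j j))"
    using assms by (intro prod.cong refl) (auto dest: tri_pos simp: less_imp_le)
  also have "\<dots> = ennreal (\<Prod>j<k. b j j)"
    using assms by (intro prod_ennreal) (auto dest: tri_pos simp: less_imp_le)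
  finally show ?thesis .
qed

lemma prod_diag_pos: "tri k b \<Longrightarrow> 0 < (\<Prod>j<k. b j j)"
  by (intro prod_pos) (auto dest: tri_pos)

section \<open>Independence of the covolume from the fundamental region\<close>

lemma int_basis_add:
  assumes "int_basis n b \<Lambda>" "x \<in> \<Lambda>" "y \<in> \<Lambda>"
  shows "vdiff n x y \<in> \<Lambda>"
proof -
  have "x \<in> range (\<lambda>c. int_comb n c b)" "y \<in> range (\<lambda>c. int_comb n c b)"
    using assms unfolding int_basis_def by metis+
  then obtain c d where "x = int_comb n c b" "y = int_comb n d b" by blast
  then have "vdiff n x y = int_comb n (\<lambda>i. c i - d i) b"
    by (auto simp: vdiff_def int_comb_def fun_eq_iff sum_subtractf algebra_simps)
  with assms(1) show ?thesis by (auto simp: int_basis_def)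
qed

lemma int_basis_Rn: "int_basis n b \<Lambda> \<Longrightarrow> x \<in> \<Lambda> \<Longrightarrow> x \<in> Rn n"
  unfolding int_basis_def int_comb_def Rn_def by (metis (no_types, lifting) imageE restrict_PiE_iff UNIV_I)

lemma int_basis_vzero:
  assumes "int_basis n b \<Lambda>"
  shows "vzero n \<in> \<Lambda>"
proof -
  have "vzero n = int_comb n (\<lambda>_. 0) b"
    by (auto simp: vzero_def int_comb_def)
  with assms show ?thesis by (auto simp: int_basis_def)
qed

lemma int_basis_countable:
  assumes "int_basis n b \<Lambda>"
  shows "countable \<Lambda>"
proof -
  have "\<Lambda> \<subseteq> (\<lambda>c. int_comb n c b) ` (Pi\<^sub>E {..<n} (\<lambda>_. UNIV))"
  proof
    fix x assume "x \<in> \<Lambda>"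
    then have "x \<in> range (\<lambda>c. int_comb n c b)" using assms unfolding int_basis_def by metis
    then obtain c where "x = int_comb n c b" by blast
    also have "\<dots> = int_comb n (restrict c {..<n}) b"
      unfolding int_comb_def by (intro restrict_ext sum.cong) auto
    finally show "x \<in> (\<lambda>c. int_comb n c b) ` (Pi\<^sub>E {..<n} (\<lambda>_. UNIV))"
      by (intro image_eqI[where x = "restrict c {..<n}"]) (auto simp: PiE_def)
  qed
  moreover have "countable ((\<lambda>c. int_comb n c b) ` (Pi\<^sub>E {..<n} (\<lambda>_. UNIV)))"
    by (intro countable_image countable_PiE) auto
  ultimately show ?thesis using countable_subset by blast
qed

lemma Rn_eqI: "x \<in> Rn n \<Longrightarrow> y \<in> Rn n \<Longrightarrow> (\<And>j. j < n \<Longrightarrow> x j = y j) \<Longrightarrow> x = y"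
  unfolding Rn_def by (rule PiE_ext) auto

lemma vshift_sets:
  assumes "S \<in> sets (leb n)"
  shows "{x \<in> Rn n. vshift n p x \<in> S} \<in> sets (leb n)"
proof -
  have "{x \<in> Rn n. vshift n p x \<in> S} = vshift n p -` S \<inter> space (leb n)" by auto
  then show ?thesis using measurable_sets[OF vshift_measurable assms] by simp
qed

text \<open>Needed because \<open>lattice_vol\<close> picks an arbitrary region. The part of
  \<open>F\<close> carried into \<open>G\<close> by subtracting \<open>l\<close> is a translate of
  the part of \<open>G\<close> carried into \<open>F\<close> by adding \<open>l\<close>, and there
  are countably many \<open>l\<close>.\<close>

lemma fundamental_region_emeasure:
  assumes \<Lambda>: "int_basis n b \<Lambda>"
    and F: "fundamental_region n \<Lambda> F" and G: "fundamental_region n \<Lambda> G"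
  shows "emeasure (leb n) F = emeasure (leb n) G"
proof -
  define A where "A = (\<lambda>l. {x \<in> F. vshift n (\<lambda>j. - l j) x \<in> G})"
  define B where "B = (\<lambda>l. {y \<in> G. vshift n l y \<in> F})"
  have Fs: "F \<in> sets (leb n)" "G \<in> sets (leb n)"
    using F G by (auto simp: fundamental_region_def)
  have FR: "F \<subseteq> Rn n" "G \<subseteq> Rn n"
    using sets.sets_into_space[OF Fs(1)] sets.sets_into_space[OF Fs(2)] by auto
  have neg: "vshift n (\<lambda>j. - l j) x = y \<longleftrightarrow> vshift n l y = x" if "x \<in> Rn n" "y \<in> Rn n" for x y l
  proof
    assume y: "vshift n (\<lambda>j. - l j) x = y"
    show "vshift n l y = x"
      by (rule Rn_eqI[of _ n], simp, simp add: that) (use y in \<open>auto simp: vshift_def\<close>)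
  next
    assume x: "vshift n l y = x"
    show "vshift n (\<lambda>j. - l j) x = y"
      by (rule Rn_eqI[of _ n], simp, simp add: that) (use x in \<open>auto simp: vshift_def\<close>)
  qed
  have sA: "A l \<in> sets (leb n)" for l
  proof -
    have "A l = F \<inter> {x \<in> Rn n. vshift n (\<lambda>j. - l j) x \<in> G}" using FR by (auto simp: A_def)
    then show ?thesis using Fs vshift_sets by auto
  qed
  have sB: "B l \<in> sets (leb n)" for l
  proof -
    have "B l = G \<inter> {x \<in> Rn n. vshift n l x \<in> F}" using FR by (auto simp: B_def)
    then show ?thesis using Fs vshift_sets by auto
  qed
  have eqAB: "emeasure (leb n) (A l) = emeasure (leb n) (B l)" for l
  proof -
    have "B l = vshift n l -` A l \<inter> Rn n"
    proof (intro Set.set_eqI iffI)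
      fix y assume "y \<in> B l"
      then have y: "y \<in> G" "vshift n l y \<in> F" "y \<in> Rn n" using FR by (auto simp: B_def)
      with neg[of "vshift n l y" y l] show "y \<in> vshift n l -` A l \<inter> Rn n" by (auto simp: A_def)
    next
      fix y assume "y \<in> vshift n l -` A l \<inter> Rn n"
      then have y: "vshift n l y \<in> F" "vshift n (\<lambda>j. - l j) (vshift n l y) \<in> G" "y \<in> Rn n"
        by (auto simp: A_def)
      with neg[of "vshift n l y" y l] show "y \<in> B l" by (auto simp: B_def)
    qed
    with emeasure_vshift[OF sA[of l], of l] show ?thesis by simp
  qed
  have mem: "vdiff n x y \<in> \<Lambda> \<longleftrightarrow> vdiff n y x \<in> \<Lambda>" for x y
  proof -
    have "vdiff n (vzero n) (vdiff n x y) = vdiff n y x" for x y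
      by (auto simp: vdiff_def vzero_def)
    with int_basis_add[OF \<Lambda> int_basis_vzero[OF \<Lambda>]] show ?thesis by metis
  qed
  have shift: "vshift n (\<lambda>j. - l j) x = y \<longleftrightarrow> vdiff n x y = l"
    if "x \<in> Rn n" "y \<in> Rn n" "l \<in> Rn n" for x y l
  proof
    assume y: "vshift n (\<lambda>j. - l j) x = y"
    have "vdiff n x y \<in> Rn n" by (simp add: vdiff_def Rn_def)
    then show "vdiff n x y = l"
      by (rule Rn_eqI, simp add: that) (use y in \<open>auto simp: vshift_def vdiff_def\<close>)
  next
    assume l: "vdiff n x y = l"
    show "vshift n (\<lambda>j. - l j) x = y"
      by (rule Rn_eqI[of _ n], simp, simp add: that) (use l in \<open>auto simp: vshift_def vdiff_def\<close>)
  qed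
  have UA: "(\<Union>l\<in>\<Lambda>. A l) = F"
  proof (intro equalityI subsetI)
    fix x assume x: "x \<in> F"
    then have "x \<in> Rn n" using FR by auto
    with G obtain y where y: "y \<in> G" "vdiff n x y \<in> \<Lambda>"
      by (auto simp: fundamental_region_def)
    have "vshift n (\<lambda>j. - (vdiff n x y) j) x = y"
      using shift[of x y "vdiff n x y"] \<open>x \<in> Rn n\<close> y FR int_basis_Rn[OF \<Lambda> y(2)] by auto
    with x y have "x \<in> A (vdiff n x y)" by (simp add: A_def)
    with y show "x \<in> (\<Union>l\<in>\<Lambda>. A l)" by blast
  qed (auto simp: A_def)
  have UB: "(\<Union>l\<in>\<Lambda>. B l) = G"
  proof (intro equalityI subsetI)
    fix y assume y: "y \<in> G"
    then have yR: "y \<in> Rn n" using FR by auto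
    with F obtain x where x: "x \<in> F" "vdiff n y x \<in> \<Lambda>"
      by (auto simp: fundamental_region_def)
    have l: "vdiff n x y \<in> \<Lambda>" using x mem by auto
    have "x \<in> Rn n" using x FR by auto
    have "vshift n (\<lambda>j. - (vdiff n x y) j) x = y"
      using shift[of x y "vdiff n x y"] \<open>x \<in> Rn n\<close> yR int_basis_Rn[OF \<Lambda> l] by auto
    then have "vshift n (vdiff n x y) y = x" using neg \<open>x \<in> Rn n\<close> yR by blast
    with x y have "y \<in> B (vdiff n x y)" by (simp add: B_def)
    with l show "y \<in> (\<Union>l\<in>\<Lambda>. B l)" by blast
  qed (auto simp: B_def)
  have dA: "disjoint_family_on A \<Lambda>"
    unfolding disjoint_family_on_def
  proof (intro ballI impI equals0I)
    fix l l' x assume l: "l \<in> \<Lambda>" "l' \<in> \<Lambda>" "l \<noteq> l'" "x \<in> A l \<inter> A l'"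
    then have x: "x \<in> F" "x \<in> Rn n" using FR by (auto simp: A_def)
    have lR: "l \<in> Rn n" "l' \<in> Rn n" using l int_basis_Rn[OF \<Lambda>] by auto
    define y y' where "y = vshift n (\<lambda>j. - l j) x" and "y' = vshift n (\<lambda>j. - l' j) x"
    have "y \<in> G" "y' \<in> G" using l by (auto simp: A_def y_def y'_def)
    have yl: "vdiff n x y = l" "vdiff n x y' = l'"
      using shift[of x y l] shift[of x y' l'] x lR by (auto simp: y_def y'_def)
    have "y = y'" using G \<open>y \<in> G\<close> \<open>y' \<in> G\<close> yl l x(2) unfolding fundamental_region_def by blast
    with yl l show False by simp
  qed
  have dB: "disjoint_family_on B \<Lambda>"
    unfolding disjoint_family_on_def
  proof (intro ballI impI equals0I)
    fix l l' y assume l: "l \<in> \<Lambda>" "l' \<in> \<Lambda>" "l \<noteq> l'" "y \<in> B l \<inter> B l'"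
    then have y: "y \<in> G" "y \<in> Rn n" using FR by (auto simp: B_def)
    have lR: "l \<in> Rn n" "l' \<in> Rn n" using l int_basis_Rn[OF \<Lambda>] by auto
    define x x' where "x = vshift n l y" and "x' = vshift n l' y"
    have x: "x \<in> F" "x' \<in> F" using l by (auto simp: B_def x_def x'_def)
    have xl: "vdiff n x y = l" "vdiff n x' y = l'"
      using shift[of x y l] shift[of x' y l'] neg[of x y l] neg[of x' y l'] y lR
      by (auto simp: x_def x'_def)
    then have "vdiff n y x \<in> \<Lambda>" "vdiff n y x' \<in> \<Lambda>" using l mem by auto
    with F x y(2) have "x = x'" unfolding fundamental_region_def by blast
    with xl l show False by simp
  qed
  have "emeasure (leb n) F = (\<integral>\<^sup>+l. emeasure (leb n) (A l) \<partial>count_space \<Lambda>)"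
    unfolding UA[symmetric] using sA dA int_basis_countable[OF \<Lambda>]
    by (intro emeasure_UN_countable) auto
  also have "\<dots> = (\<integral>\<^sup>+l. emeasure (leb n) (B l) \<partial>count_space \<Lambda>)"
    by (simp add: eqAB)
  also have "\<dots> = emeasure (leb n) G"
    unfolding UB[symmetric] using sB dB int_basis_countable[OF \<Lambda>]
    by (intro emeasure_UN_countable[symmetric]) auto
  finally show ?thesis .
qed

section \<open>Lattices given by triangular bases\<close>

definition rows :: "nat \<Rightarrow> (nat \<Rightarrow> nat \<Rightarrow> real) \<Rightarrow> nat \<Rightarrow> nat \<Rightarrow> real" where
  "rows n b i = restrict (b i) {..<n}"

definition lat :: "nat \<Rightarrow> (nat \<Rightarrow> nat \<Rightarrow> real) \<Rightarrow> (nat \<Rightarrow> real) set" where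
  "lat n b = range (\<lambda>c. int_comb n c (rows n b))"

lemma int_comb_rows: "int_comb n c (rows n b) = restrict (comb n b (\<lambda>i. of_int (c i))) {..<n}"
  by (auto simp: int_comb_def comb_def rows_def fun_eq_iff)

lemma int_basis_lat:
  assumes "tri n b"
  shows "int_basis n (rows n b) (lat n b)"
  unfolding int_basis_def
proof (intro conjI allI impI)
  fix c i assume "int_comb n c (rows n b) = vzero n" "i < n"
  then have "\<forall>j<n. comb n b (\<lambda>i. of_int (c i)) j = 0"
    by (auto simp: int_comb_rows vzero_def restrict_def fun_eq_iff split: if_splits)
  then have "\<forall>j<n. \<bar>comb n b (\<lambda>i. of_int (c i)) j\<bar> < b j j"
    using tri_pos[OF assms] by auto
  from comb_zero_imp[OF assms this] \<open>i < n\<close> show "c i = 0" by auto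
qed (auto simp: rows_def Rn_def lat_def)

lemma is_lattice_lat:
  assumes "tri n b"
  shows "is_lattice n (lat n b)"
  unfolding is_lattice_def
proof (intro conjI ballI)
  show "\<exists>b'. int_basis n b' (lat n b)" using int_basis_lat[OF assms] by blast
  fix x assume "x \<in> lat n b"
  then obtain c where c: "x = int_comb n c (rows n b)" by (auto simp: lat_def)
  \<comment> \<open>The smallest diagonal entry separates lattice points, by
    \<open>comb_zero_imp\<close>; in dimension 0 any positive number does.\<close>
  obtain e where e: "e > 0" "\<And>j. j < n \<Longrightarrow> e \<le> b j j"
  proof (cases "n = 0")
    case False
    then show ?thesis
      using tri_pos[OF assms]
      by (intro that[of "Min ((\<lambda>j. b j j) ` {..<n})"]) (auto simp: lessThan_empty_iff)
  qed (use that[of 1] in auto)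
  show "\<exists>e>0. \<forall>y\<in>lat n b. L2_set (vdiff n x y) {..<n} < e \<longrightarrow> y = x"
  proof (intro exI[of _ e] conjI ballI impI e)
    fix y assume "y \<in> lat n b" and less: "L2_set (vdiff n x y) {..<n} < e"
    then obtain d where d: "y = int_comb n d (rows n b)" by (auto simp: lat_def)
    have "\<bar>comb n b (\<lambda>i. of_int (c i - d i)) j\<bar> < b j j" if "j < n" for j
    proof -
      have "\<bar>vdiff n x y j\<bar> \<le> L2_set (\<lambda>j. \<bar>vdiff n x y j\<bar>) {..<n}"
        using that by (intro member_le_L2_set) auto
      also have "\<dots> = L2_set (vdiff n x y) {..<n}" by (simp add: L2_set_def)
      finally have "\<bar>vdiff n x y j\<bar> < b j j" using less e(2)[OF that] by simp
      moreover have "vdiff n x y j = comb n b (\<lambda>i. of_int (c i - d i)) j"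
        using that by (simp add: vdiff_def c d int_comb_rows comb_diff)
      ultimately show ?thesis by simp
    qed
    then have "\<forall>i<n. c i - d i = 0" by (intro comb_zero_imp[OF assms]) auto
    then show "y = x" by (auto simp: c d int_comb_def fun_eq_iff)
  qed
qed

text \<open>The box at the origin is one fundamental region, and the unknown one chosen in
  \<open>lattice_vol\<close> has the same measure.\<close>

lemma lattice_vol_lat:
  assumes "tri n b"
  shows "lattice_vol n (lat n b) = (\<Prod>j<n. b j j)"
proof -
  have F: "fundamental_region n (lat n b) (cell n b (\<lambda>_. 0))"
    unfolding fundamental_region_def
  proof (intro conjI ballI cell_sets)
    fix x assume x: "x \<in> Rn n"
    obtain c :: "nat \<Rightarrow> int" where c: "\<And>j. j < n \<Longrightarrow> 0 \<le> x j - comb n b (\<lambda>i. of_int (c i)) j \<and>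
            x j - comb n b (\<lambda>i. of_int (c i)) j < 0 + b j j"
      using cell_exists[OF assms, of "\<lambda>_. 0" x] by auto
    show "\<exists>!y. y \<in> cell n b (\<lambda>_. 0) \<and> vdiff n x y \<in> lat n b"
    proof (rule ex1I)
      let ?y = "restrict (\<lambda>j. x j - comb n b (\<lambda>i. of_int (c i)) j) {..<n}"
      have "vdiff n x ?y = int_comb n c (rows n b)"
        by (auto simp: vdiff_def int_comb_rows fun_eq_iff)
      then show "?y \<in> cell n b (\<lambda>_. 0) \<and> vdiff n x ?y \<in> lat n b"
        using c by (auto simp: cell_def lat_def)
      fix y assume y: "y \<in> cell n b (\<lambda>_. 0) \<and> vdiff n x y \<in> lat n b"
      then obtain d where d: "vdiff n x y = int_comb n d (rows n b)" by (auto simp: lat_def)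
      have yj: "y j = x j - comb n b (\<lambda>i. of_int (d i)) j" if "j < n" for j
        using fun_cong[OF d, of j] that by (simp add: vdiff_def int_comb_rows)
      have "\<forall>i<n. d i = c i"
        by (rule cell_unique[OF assms, of "\<lambda>_. 0" x])
           (use c y yj in \<open>auto simp: cell_def PiE_def Pi_def\<close>)
      then have "comb n b (\<lambda>i. of_int (d i)) = comb n b (\<lambda>i. of_int (c i))"
        by (auto simp: comb_def fun_eq_iff)
      with yj y show "y = ?y"
        by (intro Rn_eqI[of _ n]) (auto simp: Rn_def cell_def)
    qed
  qed
  then have "fundamental_region n (lat n b) (SOME F. fundamental_region n (lat n b) F)"
    by (rule someI)
  from fundamental_region_emeasure[OF int_basis_lat[OF assms] this F]
  have "lattice_vol n (lat n b) = measure (leb n) (cell n b (\<lambda>_. 0))"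
    by (simp add: lattice_vol_def measure_def)
  also have "\<dots> = (\<Prod>j<n. b j j)"
    using emeasure_cell[OF assms, of "\<lambda>_. 0"] prod_diag_pos[OF assms] by (simp add: measure_def)
  finally show ?thesis .
qed

section \<open>Triangular bases from Gram matrices\<close>

lemma comb_solve:
  assumes "tri k b"
  shows "\<exists>c. \<forall>j<k. comb k b c j = v j"
  using assms
proof (induction k arbitrary: v)
  case (Suc k)
  have bk: "b k k > 0" using Suc.prems by (auto simp: tri_def)
  define q where "q = v k / b k k"
  obtain c where c: "\<And>j. j < k \<Longrightarrow> comb k b c j = v j - q * b k j"
    using Suc.IH[OF tri_SucD[OF Suc.prems], of "\<lambda>j. v j - q * b k j"] by auto
  define c' where "c' = c(k := q)"
  have eq: "comb k b c' j = comb k b c j" for j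
    unfolding comb_def by (intro sum.cong) (auto simp: c'_def)
  have "comb (Suc k) b c' j = v j" if "j < Suc k" for j
  proof (cases "j = k")
    case True
    then show ?thesis using comb_Suc_last[OF Suc.prems, of c'] bk by (auto simp: c'_def q_def)
  next
    case False
    with that c[of j] show ?thesis unfolding comb_Suc eq by (auto simp: c'_def)
  qed
  then show ?case by blast
qed auto

lemma tri_solve:
  assumes "tri k b"
  shows "\<exists>\<beta>. \<forall>j<k. (\<Sum>l<k. b j l * \<beta> l) = (v j :: real)"
  using assms
proof (induction k)
  case (Suc k)
  have bk: "b k k > 0" using Suc.prems by (auto simp: tri_def)
  obtain \<beta> where \<beta>: "\<And>j. j < k \<Longrightarrow> (\<Sum>l<k. b j l * \<beta> l) = v j"
    using Suc.IH[OF tri_SucD[OF Suc.prems]] by auto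
  define q where "q = (v k - (\<Sum>l<k. b k l * \<beta> l)) / b k k"
  define \<beta>' where "\<beta>' = \<beta>(k := q)"
  have eq: "(\<Sum>l<k. b j l * \<beta>' l) = (\<Sum>l<k. b j l * \<beta> l)" for j
    by (intro sum.cong) (auto simp: \<beta>'_def)
  have "(\<Sum>l<Suc k. b j l * \<beta>' l) = v j" if "j < Suc k" for j
  proof (cases "j = k")
    case True
    then show ?thesis using bk by (simp add: eq) (simp add: \<beta>'_def q_def)
  next
    case False
    with that have "j < k" "b j k = 0" using Suc.prems by (auto simp: tri_def)
    then show ?thesis using \<beta>[of j] by (simp add: eq)
  qed
  then show ?case by blast
qed auto

text \<open>One row is added at a time: \<open>\<beta>\<close>, fixed by the inner products with the
  old rows, followed by \<open>sqrt d\<close>. Here \<open>d\<close> is the Schur complement; it is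
  the value of the form at the vector \<open>(- c, 1)\<close>, where \<open>c\<close> expresses
  \<open>\<beta>\<close> in the old rows, and so it is positive.\<close>

lemma cholesky:
  fixes g :: "nat \<Rightarrow> nat \<Rightarrow> real"
  assumes sym: "\<And>i j. g i j = g j i"
    and pos: "\<And>c. \<exists>i<k. c i \<noteq> 0 \<Longrightarrow> 0 < (\<Sum>i<k. \<Sum>j<k. c i * c j * g i j)"
  shows "\<exists>b. tri k b \<and> (\<forall>i<k. \<forall>j<k. (\<Sum>l<k. b i l * b j l) = g i j)"
  using pos
proof (induction k)
  case (Suc k)
  have "0 < (\<Sum>i<k. \<Sum>j<k. c i * c j * g i j)" if "\<exists>i<k. c i \<noteq> 0" for c
  proof -
    have "0 < (\<Sum>i<Suc k. \<Sum>j<Suc k. (c(k := 0)) i * (c(k := 0)) j * g i j)"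
      using that by (intro Suc.prems) auto
    also have "\<dots> = (\<Sum>i<k. \<Sum>j<k. c i * c j * g i j)" by simp
    finally show ?thesis .
  qed
  from Suc.IH[OF this] obtain b where b: "tri k b"
    and bg: "\<And>i j. i < k \<Longrightarrow> j < k \<Longrightarrow> (\<Sum>l<k. b i l * b j l) = g i j" by auto
  obtain \<beta> where \<beta>: "\<And>j. j < k \<Longrightarrow> (\<Sum>l<k. b j l * \<beta> l) = g k j"
    using tri_solve[OF b, of "g k"] by auto
  obtain c where c: "\<And>j. j < k \<Longrightarrow> comb k b c j = \<beta> j"
    using comb_solve[OF b, of \<beta>] by auto
  define d where "d = g k k - (\<Sum>l<k. (\<beta> l)\<^sup>2)"
  have s1: "(\<Sum>i<k. c i * g k i) = (\<Sum>l<k. (\<beta> l)\<^sup>2)"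
  proof -
    have "(\<Sum>i<k. c i * g k i) = (\<Sum>i<k. \<Sum>l<k. c i * (b i l * \<beta> l))"
      by (intro sum.cong refl) (auto simp: \<beta>[symmetric] sum_distrib_left)
    also have "\<dots> = (\<Sum>l<k. \<Sum>i<k. c i * (b i l * \<beta> l))" by (rule sum.swap)
    also have "\<dots> = (\<Sum>l<k. comb k b c l * \<beta> l)"
      unfolding comb_def sum_distrib_right by (simp add: mult_ac)
    also have "\<dots> = (\<Sum>l<k. (\<beta> l)\<^sup>2)"
      by (intro sum.cong refl) (auto simp: c power2_eq_square)
    finally show ?thesis .
  qed
  have s2: "(\<Sum>i<k. \<Sum>j<k. c i * c j * g i j) = (\<Sum>l<k. (\<beta> l)\<^sup>2)"
  proof -
    have "(\<Sum>i<k. \<Sum>j<k. c i * c j * g i j) = (\<Sum>i<k. \<Sum>j<k. \<Sum>l<k. (c i * b i l) * (c j * b j l))"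
      by (intro sum.cong refl) (auto simp: bg[symmetric] sum_distrib_left mult_ac)
    also have "\<dots> = (\<Sum>i<k. \<Sum>l<k. \<Sum>j<k. (c i * b i l) * (c j * b j l))"
      by (intro sum.cong refl sum.swap)
    also have "\<dots> = (\<Sum>l<k. \<Sum>i<k. \<Sum>j<k. (c i * b i l) * (c j * b j l))" by (rule sum.swap)
    also have "\<dots> = (\<Sum>l<k. (comb k b c l)\<^sup>2)"
      by (simp add: comb_def power2_eq_square sum_product)
    also have "\<dots> = (\<Sum>l<k. (\<beta> l)\<^sup>2)" by (intro sum.cong refl) (auto simp: c)
    finally show ?thesis .
  qed
  have dpos: "d > 0"
  proof -
    define c' where "c' = (\<lambda>i. - c i)(k := 1)"
    have "0 < (\<Sum>i<Suc k. \<Sum>j<Suc k. c' i * c' j * g i j)"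
      by (intro Suc.prems) (auto simp: c'_def)
    also have "\<dots> = (\<Sum>i<k. \<Sum>j<k. c i * c j * g i j) - (\<Sum>i<k. c i * g i k) - (\<Sum>i<k. c i * g k i) + g k k"
      by (simp add: c'_def sum.distrib sum_negf sum_subtractf)
    also have "(\<Sum>i<k. c i * g i k) = (\<Sum>i<k. c i * g k i)" by (simp add: sym)
    finally show ?thesis using s1 s2 by (simp add: d_def)
  qed
  define b' where "b' = (\<lambda>i j. if i < k then (if j < k then b i j else 0)
     else if j < k then \<beta> j else sqrt d)"
  have "tri (Suc k) b'"
    using b dpos by (auto simp: tri_def b'_def)
  moreover have "(\<Sum>l<Suc k. b' i l * b' j l) = g i j" if ij: "i < Suc k" "j < Suc k" for i j
  proof -
    consider "i < k" "j < k" | "i = k" "j < k" | "i < k" "j = k" | "i = k" "j = k"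
      using ij unfolding less_Suc_eq by blast
    then show ?thesis
    proof cases
      case 1
      then show ?thesis using bg[of i j] by (simp add: b'_def)
    next
      case 2
      then show ?thesis using \<beta>[of j] by (simp add: b'_def mult_ac)
    next
      case 3
      then show ?thesis using \<beta>[of i] by (simp add: b'_def mult_ac sym[of i k])
    next
      case 4
      then show ?thesis using dpos by (simp add: b'_def d_def power2_eq_square)
    qed
  qed
  ultimately show ?case by blast
qed (auto simp: tri_def)

lemma nsq_comb:
  assumes "\<And>i j. i < k \<Longrightarrow> j < k \<Longrightarrow> (\<Sum>l<k. b i l * b j l) = g i j"
  shows "nsq k (comb k b c) = (\<Sum>i<k. \<Sum>j<k. c i * c j * g i j)"
proof -
  have "nsq k (comb k b c) = (\<Sum>l<k. \<Sum>i<k. \<Sum>j<k. (c i * b i l) * (c j * b j l))"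
    by (simp add: nsq_def comb_def power2_eq_square sum_product)
  also have "\<dots> = (\<Sum>i<k. \<Sum>l<k. \<Sum>j<k. (c i * b i l) * (c j * b j l))" by (rule sum.swap)
  also have "\<dots> = (\<Sum>i<k. \<Sum>j<k. \<Sum>l<k. (c i * b i l) * (c j * b j l))"
    by (intro sum.cong refl sum.swap)
  also have "\<dots> = (\<Sum>i<k. \<Sum>j<k. c i * c j * g i j)"
    by (intro sum.cong refl) (auto simp: assms[symmetric] sum_distrib_left mult_ac)
  finally show ?thesis .
qed

section \<open>Counting lattice points in balls\<close>

definition dot :: "nat \<Rightarrow> (nat \<Rightarrow> real) \<Rightarrow> (nat \<Rightarrow> real) \<Rightarrow> real" where
  "dot k p u = (\<Sum>j<k. p j * u j)"

lemma dot_measurable [measurable]: "(\<lambda>u. dot k p u) \<in> borel_measurable (leb k)"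
  unfolding dot_def by measurable

lemma nsq_add: "nsq k (\<lambda>j. u j + p j) = nsq k u + 2 * dot k p u + nsq k p"
  by (simp add: nsq_def dot_def power2_sum sum.distrib sum_distrib_left mult_ac)

text \<open>A product of one-dimensional indicators, so that integrals of monomials split. It
  dominates the indicator of the half-open centred cell, which is what Markov's inequality
  uses.\<close>

definition cbox_at :: "nat \<Rightarrow> (nat \<Rightarrow> real) \<Rightarrow> (nat \<Rightarrow> real) \<Rightarrow> real" where
  "cbox_at k h u = (\<Prod>j<k. indicator {- h j..h j} (u j))"

lemma integral_moment:
  fixes h :: real
  assumes "0 \<le> h"
  shows "integrable lborel (\<lambda>x. indicator {-h..h} x * x ^ e)"
    and "(\<integral>x. indicator {-h..h} x * x ^ e \<partial>lborel) = (if even e then 2 * h ^ Suc e / Suc e else 0)"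
proof -
  have "integrable lborel (\<lambda>x. indicator {-h..h} x *\<^sub>R x ^ e)"
    by (intro borel_integrable_compact) (auto intro!: continuous_intros)
  then show "integrable lborel (\<lambda>x. indicator {-h..h} x * x ^ e)" by simp
  have "(\<integral>x. indicator {-h..h} x * x ^ e \<partial>lborel) = (\<integral>x. x ^ e * indicator {-h..h} x \<partial>lborel)"
    by (simp add: mult_ac)
  also have "\<dots> = (h ^ Suc e - (- h) ^ Suc e) / Suc e"
    using assms by (intro integral_power) auto
  also have "\<dots> = (if even e then 2 * h ^ Suc e / Suc e else 0)"
    by auto
  finally show "(\<integral>x. indicator {-h..h} x * x ^ e \<partial>lborel) = (if even e then 2 * h ^ Suc e / Suc e else 0)" .
qed

text \<open>The coordinates of a uniform point of a centred box are independent with mean 0 and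
  variance \<open>h\<^sup>2 / 3\<close>. The exponents \<open>e\<close> write
  \<open>u i * u j\<close> as one monomial, so that both cases are products of one-dimensional
  moments.\<close>

lemma integral_box_prod:
  assumes h: "\<And>j. j < k \<Longrightarrow> 0 < h j" and ij: "i < k" "j < k"
  shows "integrable (leb k) (\<lambda>u. cbox_at k h u * (u i * u j))"
    and "(\<integral>u. cbox_at k h u * (u i * u j) \<partial>leb k) =
      (if i = j then (\<Prod>l<k. 2 * h l) * ((h i)\<^sup>2 / 3) else 0)"
proof -
  define e where "e = (\<lambda>l. (if l = i then 1 else 0) + (if l = j then 1 else 0 :: nat))"
  have eq: "cbox_at k h u * (u i * u j) = (\<Prod>l<k. indicator {- h l..h l} (u l) * u l ^ e l)" for u
  proof -
    have "(\<Prod>l<k. u l ^ e l) = (\<Prod>l<k. (if l = i then u l else 1) * (if l = j then u l else 1))"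
      by (intro prod.cong) (auto simp: e_def)
    also have "\<dots> = u i * u j"
      using ij by (simp add: prod.distrib)
    finally show ?thesis by (simp add: cbox_at_def prod.distrib)
  qed
  have int: "integrable lborel (\<lambda>x. indicator {- h l..h l} x * x ^ e l)" if "l < k" for l
    using h[OF that] by (intro integral_moment) auto
  show "integrable (leb k) (\<lambda>u. cbox_at k h u * (u i * u j))"
    unfolding eq using int by (intro leb.product_integrable_prod) auto
  have "(\<integral>u. cbox_at k h u * (u i * u j) \<partial>leb k) =
      (\<Prod>l<k. \<integral>x. indicator {- h l..h l} x * x ^ e l \<partial>lborel)"
    unfolding eq using int by (intro leb.product_integral_prod) auto
  also have "\<dots> = (\<Prod>l<k. if even (e l) then 2 * h l ^ Suc (e l) / Suc (e l) else 0)"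
    using h by (intro prod.cong refl integral_moment(2)) (auto intro: less_imp_le)
  also have "\<dots> = (if i = j then (\<Prod>l<k. 2 * h l) * ((h i)\<^sup>2 / 3) else 0)"
  proof (cases "i = j")
    case True
    have "(\<Prod>l<k. if even (e l) then 2 * h l ^ Suc (e l) / Suc (e l) else 0)
      = (\<Prod>l<k. (2 * h l) * (if l = i then (h l)\<^sup>2 / 3 else 1))"
      using True by (intro prod.cong) (auto simp: e_def eval_nat_numeral)
    also have "\<dots> = (\<Prod>l<k. 2 * h l) * ((h i)\<^sup>2 / 3)"
      unfolding prod.distrib using ij by simp
    finally show ?thesis using True by simp
  next
    case False
    have "(\<Prod>l<k. if even (e l) then 2 * h l ^ Suc (e l) / Suc (e l) else 0) = 0"
      using ij False by (intro prod_zero) (auto simp: e_def intro!: bexI[of _ i])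
    then show ?thesis using False by simp
  qed
  finally show "(\<integral>u. cbox_at k h u * (u i * u j) \<partial>leb k) =
      (if i = j then (\<Prod>l<k. 2 * h l) * ((h i)\<^sup>2 / 3) else 0)" .
qed

lemma integral_box_dot:
  assumes h: "\<And>j. j < k \<Longrightarrow> 0 < h j"
  shows "integrable (leb k) (\<lambda>u. cbox_at k h u * (dot k p u)\<^sup>2)"
    and "(\<integral>u. cbox_at k h u * (dot k p u)\<^sup>2 \<partial>leb k) =
      (\<Prod>l<k. 2 * h l) * (\<Sum>i<k. (p i)\<^sup>2 * (h i)\<^sup>2 / 3)"
proof -
  have eq: "cbox_at k h u * (dot k p u)\<^sup>2 =
     (\<Sum>i<k. \<Sum>j<k. p i * p j * (cbox_at k h u * (u i * u j)))" for u
    by (simp add: dot_def power2_eq_square sum_product sum_distrib_left mult_ac)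
  show "integrable (leb k) (\<lambda>u. cbox_at k h u * (dot k p u)\<^sup>2)"
    unfolding eq by (intro Bochner_Integration.integrable_sum integrable_mult_right integral_box_prod h) auto
  have "(\<integral>u. cbox_at k h u * (dot k p u)\<^sup>2 \<partial>leb k) =
    (\<Sum>i<k. \<Sum>j<k. p i * p j * (\<integral>u. cbox_at k h u * (u i * u j) \<partial>leb k))"
  proof -
    have I: "integrable (leb k) (\<lambda>u. p i * p j * (cbox_at k h u * (u i * u j)))" if "i < k" "j < k" for i j
      using integral_box_prod(1)[of k h i j] h that by (intro integrable_mult_right) auto
    have "(\<integral>u. (\<Sum>i<k. \<Sum>j<k. p i * p j * (cbox_at k h u * (u i * u j))) \<partial>leb k)
      = (\<Sum>i<k. \<integral>u. (\<Sum>j<k. p i * p j * (cbox_at k h u * (u i * u j))) \<partial>leb k)"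
      using I by (intro Bochner_Integration.integral_sum Bochner_Integration.integrable_sum) auto
    also have "\<dots> = (\<Sum>i<k. \<Sum>j<k. \<integral>u. p i * p j * (cbox_at k h u * (u i * u j)) \<partial>leb k)"
      using I by (intro sum.cong refl Bochner_Integration.integral_sum) auto
    finally show ?thesis unfolding eq by simp
  qed
  also have "\<dots> = (\<Sum>i<k. \<Sum>j<k. if i = j then (p i)\<^sup>2 * ((\<Prod>l<k. 2 * h l) * ((h i)\<^sup>2 / 3)) else 0)"
    by (intro sum.cong refl) (simp add: integral_box_prod(2)[OF h] power2_eq_square)
  also have "\<dots> = (\<Prod>l<k. 2 * h l) * (\<Sum>i<k. (p i)\<^sup>2 * (h i)\<^sup>2 / 3)"
    by (simp add: sum_distrib_left mult_ac)
  finally show "(\<integral>u. cbox_at k h u * (dot k p u)\<^sup>2 \<partial>leb k) =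
      (\<Prod>l<k. 2 * h l) * (\<Sum>i<k. (p i)\<^sup>2 * (h i)\<^sup>2 / 3)" .
qed

text \<open>Chebyshev's inequality for a uniformly distributed point of the cell: the cell may be as
  large as \<open>s / k\<close> in every direction, whereas the triangle inequality would only allow a
  diameter of this size.\<close>

lemma cell_chebyshev:
  assumes b: "tri k b" and \<beta>: "\<And>i. i < k \<Longrightarrow> b i i \<le> \<beta>"
    and s: "nsq k p \<le> s\<^sup>2" and \<eta>: "0 < \<eta>" "real k * \<beta>\<^sup>2 \<le> 2 * \<eta>"
  shows "measure (leb k) {u \<in> cell k b (\<lambda>i. - b i i / 2). s\<^sup>2 + \<eta> < nsq k (\<lambda>j. u j + p j)}
    \<le> 4 * s\<^sup>2 * \<beta>\<^sup>2 / (3 * \<eta>\<^sup>2) * (\<Prod>l<k. b l l)"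
proof -
  define h where "h = (\<lambda>i. b i i / 2)"
  have h: "0 < h i" if "i < k" for i using tri_pos[OF b that] by (simp add: h_def)
  let ?B = "{u \<in> cell k b (\<lambda>i. - b i i / 2). s\<^sup>2 + \<eta> < nsq k (\<lambda>j. u j + p j)}"
  have cell: "cbox_at k h u = 1" "nsq k u \<le> \<eta> / 2" if u: "u \<in> cell k b (\<lambda>i. - b i i / 2)" for u
  proof -
    have uj: "- h j \<le> u j" "u j < h j" if "j < k" for j
      using PiE_mem[OF u[unfolded cell_def], of j] that by (auto simp: h_def)
    then show "cbox_at k h u = 1"
      unfolding cbox_at_def by (intro prod.neutral) (auto simp: less_imp_le)
    have "nsq k u \<le> (\<Sum>j<k. (\<beta> / 2)\<^sup>2)"
      unfolding nsq_def
    proof (intro sum_mono)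
      fix j assume j: "j \<in> {..<k}"
      have "\<bar>u j\<bar> \<le> \<beta> / 2" using uj[of j] \<beta>[of j] j by (auto simp: h_def abs_le_iff)
      then show "(u j)\<^sup>2 \<le> (\<beta> / 2)\<^sup>2" by (metis abs_ge_zero power2_abs power_mono)
    qed
    also have "\<dots> \<le> \<eta> / 2" using \<eta> by (simp add: power_divide)
    finally show "nsq k u \<le> \<eta> / 2" .
  qed
  have Bsets: "?B \<in> sets (leb k)"
  proof -
    have "{u \<in> space (leb k). s\<^sup>2 + \<eta> < nsq k (vshift k p u)} \<in> sets (leb k)" by measurable
    then have "cell k b (\<lambda>i. - b i i / 2) \<inter> {u \<in> space (leb k). s\<^sup>2 + \<eta> < nsq k (vshift k p u)} \<in> sets (leb k)"
      by (intro sets.Int cell_sets)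
    also have "cell k b (\<lambda>i. - b i i / 2) \<inter> {u \<in> space (leb k). s\<^sup>2 + \<eta> < nsq k (vshift k p u)} = ?B"
      using cell_Rn by auto
    finally show ?thesis .
  qed
  have Bfin: "emeasure (leb k) ?B < \<infinity>"
  proof -
    have "emeasure (leb k) ?B \<le> emeasure (leb k) (cell k b (\<lambda>i. - b i i / 2))"
      by (intro emeasure_mono) auto
    then show ?thesis using emeasure_cell[OF b] by (simp add: order_le_less_trans)
  qed
  \<comment> \<open>On the bad set \<open>nsq k u \<le> \<eta> / 2\<close> and
    \<open>nsq k p \<le> s\<^sup>2\<close> push the cross term \<open>2 * dot k p u\<close> above
    \<open>\<eta> / 2\<close>, so \<open>dot k p u\<close> exceeds \<open>\<eta> / 4\<close>;
    Markov's inequality for its square does the rest.\<close>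
  have "(\<eta> / 4)\<^sup>2 * measure (leb k) ?B = (\<integral>u. (\<eta> / 4)\<^sup>2 * indicator ?B u \<partial>leb k)"
  proof -
    have "?B \<inter> space (leb k) = ?B" using sets.sets_into_space[OF Bsets] by blast
    then show ?thesis by (simp only: integral_mult_right_zero Bochner_Integration.integral_indicator)
  qed
  also have "\<dots> \<le> (\<integral>u. cbox_at k h u * (dot k p u)\<^sup>2 \<partial>leb k)"
  proof (rule integral_mono)
    show "integrable (leb k) (\<lambda>u. (\<eta> / 4)\<^sup>2 * indicator ?B u)"
      using Bsets Bfin by (intro integrable_mult_right integrable_real_indicator) auto
    show "integrable (leb k) (\<lambda>u. cbox_at k h u * (dot k p u)\<^sup>2)"
      using h by (rule integral_box_dot)
    fix u
    show "(\<eta> / 4)\<^sup>2 * indicator ?B u \<le> cbox_at k h u * (dot k p u)\<^sup>2"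
    proof (cases "u \<in> ?B")
      case True
      then have "s\<^sup>2 + \<eta> < nsq k u + 2 * dot k p u + nsq k p" by (simp add: nsq_add)
      with True cell(2)[of u] s have "\<eta> / 4 \<le> dot k p u" by auto
      then have "(\<eta> / 4)\<^sup>2 \<le> (dot k p u)\<^sup>2" using \<eta> by (intro power_mono) auto
      with True cell(1)[of u] show ?thesis by simp
    next
      case False
      have "0 \<le> cbox_at k h u * (dot k p u)\<^sup>2" by (auto simp: cbox_at_def intro!: prod_nonneg mult_nonneg_nonneg)
      with False show ?thesis by simp
    qed
  qed
  also have "(\<integral>u. cbox_at k h u * (dot k p u)\<^sup>2 \<partial>leb k) =
      (\<Prod>l<k. 2 * h l) * (\<Sum>i<k. (p i)\<^sup>2 * (h i)\<^sup>2 / 3)"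
    using h by (rule integral_box_dot)
  also have "(\<Prod>l<k. 2 * h l) = (\<Prod>l<k. b l l)" by (simp add: h_def)
  also have "(\<Sum>i<k. (p i)\<^sup>2 * (h i)\<^sup>2 / 3) \<le> (\<Sum>i<k. (p i)\<^sup>2 * (\<beta>\<^sup>2 / 12))"
  proof (intro sum_mono)
    fix i assume i: "i \<in> {..<k}"
    have "(b i i)\<^sup>2 \<le> \<beta>\<^sup>2" using \<beta>[of i] tri_pos[OF b, of i] i by (intro power_mono) auto
    then have "(p i)\<^sup>2 * (b i i)\<^sup>2 \<le> (p i)\<^sup>2 * \<beta>\<^sup>2" by (intro mult_left_mono) auto
    then show "(p i)\<^sup>2 * (h i)\<^sup>2 / 3 \<le> (p i)\<^sup>2 * (\<beta>\<^sup>2 / 12)"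
      by (simp add: h_def power_divide)
  qed
  also have "\<dots> = nsq k p * (\<beta>\<^sup>2 / 12)" by (simp add: nsq_def sum_distrib_right)
  also have "\<dots> \<le> s\<^sup>2 * (\<beta>\<^sup>2 / 12)" using s by (intro mult_right_mono) auto
  finally have "(\<eta> / 4)\<^sup>2 * measure (leb k) ?B \<le> (\<Prod>l<k. b l l) * (s\<^sup>2 * (\<beta>\<^sup>2 / 12))"
    using prod_diag_pos[OF b] by (simp add: mult_left_mono)
  then have "measure (leb k) ?B \<le> (\<Prod>l<k. b l l) * (s\<^sup>2 * (\<beta>\<^sup>2 / 12)) / (\<eta> / 4)\<^sup>2"
    using \<eta> by (simp add: pos_le_divide_eq mult.commute)
  also have "\<dots> = 4 * s\<^sup>2 * \<beta>\<^sup>2 / (3 * \<eta>\<^sup>2) * (\<Prod>l<k. b l l)"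
    using \<eta> by (simp add: field_simps power2_eq_square)
  finally show ?thesis .
qed

text \<open>Each point of \<open>A\<close> owns the cell centred at it. The cells are disjoint, and
  all but a small fraction of each lies in the slightly larger ball, even for points on the boundary
  of the small one; so the count is at most little more than the volume ratio. The shift
  \<open>z\<close> admits translates of a lattice, \<open>co\<close> an arbitrary indexing of its
  points.\<close>

lemma count_chebyshev:
  assumes b: "tri k b" and \<beta>: "\<And>i. i < k \<Longrightarrow> b i i \<le> \<beta>"
    and \<eta>: "0 < \<eta>" "real k * \<beta>\<^sup>2 \<le> 2 * \<eta>"
    and A: "finite A" "\<And>x. x \<in> A \<Longrightarrow> nsq k (\<lambda>j. comb k b (\<lambda>i. of_int (co x i :: int)) j + z j) \<le> s\<^sup>2"
    and inj: "\<And>x y. x \<in> A \<Longrightarrow> y \<in> A \<Longrightarrow> \<forall>i<k. co x i = co y i \<Longrightarrow> x = y"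
  shows "real (card A) * (1 - 4 * s\<^sup>2 * \<beta>\<^sup>2 / (3 * \<eta>\<^sup>2)) * (\<Prod>l<k. b l l)
    \<le> unit_ball_vol (real k) * sqrt (s\<^sup>2 + \<eta>) ^ k"
proof -
  define p where "p = (\<lambda>x j. comb k b (\<lambda>i. of_int (co x i)) j + z j)"
  define C where "C = cell k b (\<lambda>i. - b i i / 2)"
  define S where "S = (\<lambda>x. {y \<in> Rn k. vshift k (\<lambda>j. - p x j) y \<in> C} \<inter> closed_ball k (sqrt (s\<^sup>2 + \<eta>)))"
  define D where "D = (\<Prod>l<k. b l l)"
  have D: "D > 0" unfolding D_def by (rule prod_diag_pos[OF b])
  have Ssets: "S x \<in> sets (leb k)" for x
    unfolding S_def C_def by (intro sets.Int vshift_sets cell_sets closed_ball_sets)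
  have pos: "0 < sqrt (s\<^sup>2 + \<eta>)" using \<eta> by (simp add: add_nonneg_pos)
  have ball: "emeasure (leb k) (closed_ball k (sqrt (s\<^sup>2 + \<eta>)))
      = ennreal (unit_ball_vol (real k) * sqrt (s\<^sup>2 + \<eta>) ^ k)"
    by (rule emeasure_closed_ball[OF pos])
  have fm: "X \<in> fmeasurable (leb k)" if "X \<in> sets (leb k)" "X \<subseteq> closed_ball k (sqrt (s\<^sup>2 + \<eta>))" for X
    using that ball emeasure_mono[OF that(2) closed_ball_sets] by (intro fmeasurableI) (auto simp: order_le_less_trans)
  have disj: "disjoint_family_on S A"
    unfolding disjoint_family_on_def
  proof (intro ballI impI equals0I)
    fix x x' y assume x: "x \<in> A" "x' \<in> A" "x \<noteq> x'" "y \<in> S x \<inter> S x'"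
    have m: "- b j j / 2 \<le> y j - p x j \<and> y j - p x j < b j j / 2"
            "- b j j / 2 \<le> y j - p x' j \<and> y j - p x' j < b j j / 2" if "j < k" for j
      using x that by (auto simp: S_def C_def cell_def vshift_def PiE_def Pi_def)
    have "\<forall>i<k. co x i = co x' i"
      by (rule cell_unique[OF b, of "\<lambda>j. - b j j / 2" "\<lambda>j. y j - z j"])
         (use m in \<open>force simp: p_def algebra_simps\<close>)+
    with inj x show False by blast
  qed
  have meas: "(1 - 4 * s\<^sup>2 * \<beta>\<^sup>2 / (3 * \<eta>\<^sup>2)) * D \<le> measure (leb k) (S x)" if x: "x \<in> A" for x
  proof -
    let ?B = "{u \<in> C. s\<^sup>2 + \<eta> < nsq k (\<lambda>j. u j + p x j)}"
    let ?G = "{u \<in> C. nsq k (\<lambda>j. u j + p x j) \<le> s\<^sup>2 + \<eta>}"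
    have bad: "measure (leb k) ?B \<le> 4 * s\<^sup>2 * \<beta>\<^sup>2 / (3 * \<eta>\<^sup>2) * D"
      unfolding C_def D_def by (rule cell_chebyshev[OF b \<beta> _ \<eta>]) (use A x in \<open>auto simp: p_def\<close>)
    have G: "?G = vshift k (p x) -` S x \<inter> Rn k"
    proof (intro Set.set_eqI iffI)
      fix u assume u: "u \<in> ?G"
      then have uR: "u \<in> Rn k" by (auto simp: C_def dest: cell_Rn)
      have "vshift k (\<lambda>j. - p x j) (vshift k (p x) u) = u"
        by (rule Rn_eqI[of _ k], simp, rule uR) (auto simp: vshift_def)
      with u uR show "u \<in> vshift k (p x) -` S x \<inter> Rn k"
        by (auto simp: S_def closed_ball_def L2_set_nsq)
    next
      fix u assume u: "u \<in> vshift k (p x) -` S x \<inter> Rn k"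
      have "vshift k (\<lambda>j. - p x j) (vshift k (p x) u) = u"
        by (rule Rn_eqI[of _ k], simp) (use u in \<open>auto simp: vshift_def\<close>)
      with u show "u \<in> ?G"
        by (auto simp: S_def closed_ball_def L2_set_nsq)
    qed
    have Gs: "?G \<in> sets (leb k)" unfolding G
      using measurable_sets[OF vshift_measurable Ssets[of x], of "p x"] by simp
    have Cs: "C \<in> fmeasurable (leb k)"
      using emeasure_cell[OF b] cell_sets unfolding C_def by (intro fmeasurableI) auto
    have "?B = C - ?G" by auto
    then have "measure (leb k) ?B = measure (leb k) C - measure (leb k) ?G"
      using Cs Gs by (simp add: measure_Diff fmeasurableD2 fmeasurableD)
    moreover have "measure (leb k) C = D"
      using emeasure_cell[OF b, of "\<lambda>i. - b i i / 2"] D by (simp add: measure_def C_def D_def)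
    moreover have "measure (leb k) ?G = measure (leb k) (S x)"
      unfolding G measure_def using emeasure_vshift[OF Ssets[of x], of "p x"] by simp
    ultimately show ?thesis using bad by (simp add: algebra_simps)
  qed
  have "real (card A) * ((1 - 4 * s\<^sup>2 * \<beta>\<^sup>2 / (3 * \<eta>\<^sup>2)) * D) \<le> (\<Sum>x\<in>A. measure (leb k) (S x))"
    using sum_mono[of A "\<lambda>_. (1 - 4 * s\<^sup>2 * \<beta>\<^sup>2 / (3 * \<eta>\<^sup>2)) * D", OF meas] by simp
  also have "\<dots> = measure (leb k) (\<Union>x\<in>A. S x)"
    using A(1) disj Ssets fm[OF Ssets] by (intro measure_UNION'[symmetric])
      (auto simp: S_def disjoint_family_on_def pairwise_def disjnt_def)
  also have "\<dots> \<le> measure (leb k) (closed_ball k (sqrt (s\<^sup>2 + \<eta>)))"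
  proof (intro measure_mono_fmeasurable fm)
    show "(\<Union>x\<in>A. S x) \<in> sets (leb k)" using A(1) Ssets by (intro sets.finite_UN) auto
  qed (auto simp: S_def)
  also have "\<dots> = unit_ball_vol (real k) * sqrt (s\<^sup>2 + \<eta>) ^ k"
    by (rule measure_closed_ball[OF pos])
  finally show ?thesis by (simp add: D_def mult_ac)
qed

lemma nsq_triangle: "sqrt (nsq k (\<lambda>j. u j + p j)) \<le> sqrt (nsq k u) + sqrt (nsq k p)"
  using L2_set_triangle_ineq[of u p "{..<k}"] by (simp add: L2_set_nsq)

lemma cell_nsq:
  assumes b: "tri k b" and \<beta>: "\<And>i. i < k \<Longrightarrow> b i i \<le> \<beta>" and u: "u \<in> cell k b (\<lambda>_. 0)"
  shows "sqrt (nsq k u) \<le> sqrt (real k) * \<beta>"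
proof (cases "k = 0")
  case False
  have \<beta>0: "0 \<le> \<beta>" using \<beta>[of 0] tri_pos[OF b, of 0] False by simp
  have "nsq k u \<le> (\<Sum>j<k. \<beta>\<^sup>2)"
    unfolding nsq_def
  proof (intro sum_mono power_mono)
    fix j assume j: "j \<in> {..<k}"
    have "0 \<le> u j" "u j < b j j"
      using PiE_mem[OF u[unfolded cell_def], of j] j by auto
    then show "u j \<le> \<beta>" "0 \<le> u j" using \<beta>[of j] j by auto
  qed
  then have "sqrt (nsq k u) \<le> sqrt (real k * \<beta>\<^sup>2)" by simp
  also have "\<dots> = sqrt (real k) * \<beta>" using \<beta>0 by (simp add: real_sqrt_mult)
  finally show ?thesis .
qed (auto simp: nsq_def)

text \<open>The crude packing bound with the diameter of a cell; it suffices where the radius will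
  tend to infinity.\<close>

lemma count_upper:
  assumes b: "tri k b" and \<beta>: "\<And>i. i < k \<Longrightarrow> b i i \<le> \<beta>"
    and pos: "0 < s + sqrt (real k) * \<beta>"
    and A: "finite A" "\<And>x. x \<in> A \<Longrightarrow> sqrt (nsq k (\<lambda>j. comb k b (\<lambda>i. of_int (co x i :: int)) j + z j)) \<le> s"
    and inj: "\<And>x y. x \<in> A \<Longrightarrow> y \<in> A \<Longrightarrow> \<forall>i<k. co x i = co y i \<Longrightarrow> x = y"
  shows "real (card A) * (\<Prod>l<k. b l l) \<le> unit_ball_vol (real k) * (s + sqrt (real k) * \<beta>) ^ k"
proof -
  define p where "p = (\<lambda>x j. comb k b (\<lambda>i. of_int (co x i)) j + z j)"
  define C where "C = cell k b (\<lambda>i. 0)"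
  define S where "S = (\<lambda>x. {y \<in> Rn k. vshift k (\<lambda>j. - p x j) y \<in> C})"
  have Ssets: "S x \<in> sets (leb k)" for x
    unfolding S_def C_def by (intro vshift_sets cell_sets)
  have Sm: "emeasure (leb k) (S x) = ennreal (\<Prod>l<k. b l l)" for x
  proof -
    have "S x = vshift k (\<lambda>j. - p x j) -` C \<inter> Rn k" by (auto simp: S_def)
    then show ?thesis
      using emeasure_vshift[of C k "\<lambda>j. - p x j"] emeasure_cell[OF b, of "\<lambda>_. 0"] cell_sets[of k b "\<lambda>_. 0"]
      by (simp add: C_def)
  qed
  have disj: "disjoint_family_on S A"
    unfolding disjoint_family_on_def
  proof (intro ballI impI equals0I)
    fix x x' y assume x: "x \<in> A" "x' \<in> A" "x \<noteq> x'" "y \<in> S x \<inter> S x'"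
    have m: "0 \<le> y j - p x j \<and> y j - p x j < b j j"
            "0 \<le> y j - p x' j \<and> y j - p x' j < b j j" if "j < k" for j
      using x that by (auto simp: S_def C_def cell_def vshift_def PiE_def Pi_def)
    have "\<forall>i<k. co x i = co x' i"
      by (rule cell_unique[OF b, of "\<lambda>j. 0" "\<lambda>j. y j - z j"])
         (use m in \<open>force simp: p_def algebra_simps\<close>)+
    with inj x show False by blast
  qed
  have sub: "S x \<subseteq> closed_ball k (s + sqrt (real k) * \<beta>)" if x: "x \<in> A" for x
  proof
    fix y assume y: "y \<in> S x"
    then have yR: "y \<in> Rn k" and yC: "vshift k (\<lambda>j. - p x j) y \<in> C" by (auto simp: S_def)
    have "nsq k y = nsq k (\<lambda>j. vshift k (\<lambda>j. - p x j) y j + p x j)"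
      by (auto simp: nsq_def vshift_def)
    also have "sqrt \<dots> \<le> sqrt (nsq k (vshift k (\<lambda>j. - p x j) y)) + sqrt (nsq k (p x))"
      by (rule nsq_triangle)
    also have "\<dots> \<le> sqrt (real k) * \<beta> + s"
      using A(2)[OF x] by (intro add_mono cell_nsq[OF b \<beta>] yC[unfolded C_def]) (auto simp: p_def)
    finally show "y \<in> closed_ball k (s + sqrt (real k) * \<beta>)"
      using yR by (simp add: closed_ball_def L2_set_nsq)
  qed
  have "ennreal (real (card A) * (\<Prod>l<k. b l l)) = (\<Sum>x\<in>A. emeasure (leb k) (S x))"
    using prod_diag_pos[OF b] by (simp add: Sm ennreal_mult ennreal_of_nat_eq_real_of_nat)
  also have "\<dots> = emeasure (leb k) (\<Union>x\<in>A. S x)"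
    using A(1) disj Ssets by (intro sum_emeasure) auto
  also have "\<dots> \<le> emeasure (leb k) (closed_ball k (s + sqrt (real k) * \<beta>))"
    using sub by (intro emeasure_mono) auto
  also have "\<dots> = ennreal (unit_ball_vol (real k) * (s + sqrt (real k) * \<beta>) ^ k)"
    by (rule emeasure_closed_ball[OF pos])
  finally show ?thesis using pos by (subst (asm) ennreal_le_iff) auto
qed

text \<open>The matching covering bound: the cells of the points in the ball of radius
  \<open>s\<close> cover the ball shrunk by a cell diameter. It serves where the radius is large or
  the lattice arbitrarily fine.\<close>

lemma count_lower:
  assumes b: "tri k b" and \<beta>: "\<And>i. i < k \<Longrightarrow> b i i \<le> \<beta>"
    and pos: "0 < s - sqrt (real k) * \<beta>"
    and A: "finite A" "\<And>c. sqrt (nsq k (\<lambda>j. comb k b (\<lambda>i. of_int (c i :: int)) j + z j)) \<le> s \<Longrightarrow>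
       \<exists>x\<in>A. \<forall>i<k. co x i = c i"
  shows "unit_ball_vol (real k) * (s - sqrt (real k) * \<beta>) ^ k \<le> real (card A) * (\<Prod>l<k. b l l)"
proof -
  define p where "p = (\<lambda>c j. comb k b (\<lambda>i. of_int (c i)) j + z j)"
  define C where "C = cell k b (\<lambda>i. 0)"
  define S where "S = (\<lambda>x. {y \<in> Rn k. vshift k (\<lambda>j. - p (co x) j) y \<in> C})"
  have Ssets: "S x \<in> sets (leb k)" for x
    unfolding S_def C_def by (intro vshift_sets cell_sets)
  have Sm: "emeasure (leb k) (S x) = ennreal (\<Prod>l<k. b l l)" for x
  proof -
    have "S x = vshift k (\<lambda>j. - p (co x) j) -` C \<inter> Rn k" by (auto simp: S_def)
    then show ?thesis
      using emeasure_vshift[of C k "\<lambda>j. - p (co x) j"] emeasure_cell[OF b, of "\<lambda>_. 0"] cell_sets[of k b "\<lambda>_. 0"]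
      by (simp add: C_def)
  qed
  have sub: "closed_ball k (s - sqrt (real k) * \<beta>) \<subseteq> (\<Union>x\<in>A. S x)"
  proof
    fix y assume "y \<in> closed_ball k (s - sqrt (real k) * \<beta>)"
    then have y: "y \<in> Rn k" "sqrt (nsq k y) \<le> s - sqrt (real k) * \<beta>"
      by (auto simp: closed_ball_def L2_set_nsq)
    obtain c :: "nat \<Rightarrow> int" where c: "\<And>j. j < k \<Longrightarrow> 0 \<le> y j - z j - comb k b (\<lambda>i. of_int (c i)) j \<and>
            y j - z j - comb k b (\<lambda>i. of_int (c i)) j < 0 + b j j"
      using cell_exists[OF b, of "\<lambda>_. 0" "\<lambda>j. y j - z j"] by auto
    define u where "u = vshift k (\<lambda>j. - p c j) y"
    have uC: "u \<in> cell k b (\<lambda>_. 0)"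
      using c by (fastforce simp: u_def vshift_def cell_def p_def algebra_simps)
    have "nsq k (p c) = nsq k (\<lambda>j. y j + (- u j))"
      by (auto simp: nsq_def u_def vshift_def)
    also have "sqrt \<dots> \<le> sqrt (nsq k y) + sqrt (nsq k (\<lambda>j. - u j))"
      by (rule nsq_triangle)
    also have "nsq k (\<lambda>j. - u j) = nsq k u" by (simp add: nsq_def)
    also have "sqrt (nsq k y) + sqrt (nsq k u) \<le> s"
      using y(2) cell_nsq[OF b \<beta> uC] by simp
    finally have "sqrt (nsq k (\<lambda>j. comb k b (\<lambda>i. of_int (c i)) j + z j)) \<le> s" by (simp add: p_def)
    from A(2)[OF this] obtain x where x: "x \<in> A" "\<And>i. i < k \<Longrightarrow> co x i = c i" by blast
    have "p (co x) = p c" using x by (auto simp: p_def comb_def fun_eq_iff)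
    then have "y \<in> S x" using uC y by (simp add: S_def C_def u_def)
    with x show "y \<in> (\<Union>x\<in>A. S x)" by blast
  qed
  have "ennreal (unit_ball_vol (real k) * (s - sqrt (real k) * \<beta>) ^ k)
      = emeasure (leb k) (closed_ball k (s - sqrt (real k) * \<beta>))"
    by (rule emeasure_closed_ball[OF pos, symmetric])
  also have "\<dots> \<le> emeasure (leb k) (\<Union>x\<in>A. S x)"
    using sub Ssets A(1) by (intro emeasure_mono sets.finite_UN) auto
  also have "\<dots> \<le> (\<Sum>x\<in>A. emeasure (leb k) (S x))"
    using A(1) Ssets by (intro emeasure_subadditive_finite) auto
  also have "\<dots> = ennreal (real (card A) * (\<Prod>l<k. b l l))"
    using prod_diag_pos[OF b] by (simp add: Sm ennreal_mult ennreal_of_nat_eq_real_of_nat)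
  finally show ?thesis using prod_diag_pos[OF b] by (subst (asm) ennreal_le_iff) (auto intro: less_imp_le)
qed

section \<open>Arithmetic of the ring of cyclotomic integers\<close>

locale cyc =
  fixes m :: nat
  assumes m2: "2 \<le> m"
begin

text \<open>An element \<open>\<Sum> c\<^sub>a \<zeta>\<^sup>a\<close> of the cyclotomic field is represented by the function \<open>c\<close>,
  of which only the values below \<open>m\<close> matter, and \<open>hat c k\<close> is its image under the embedding
  that takes \<open>\<zeta>\<close> to its \<open>k\<close>-th power.\<close>

definition w :: "int \<Rightarrow> complex" where
  "w e = cis (2 * pi * of_int e / of_nat m)"

definition hat :: "(nat \<Rightarrow> complex) \<Rightarrow> nat \<Rightarrow> complex" where
  "hat c k = (\<Sum>a<m. c a * w (int (k * a)))"

definition Kc :: "nat set" where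
  "Kc = {k. k < m \<and> coprime k m}"

text \<open>The squared Euclidean norm in the canonical embedding, that is, the trace form.\<close>

definition nQ :: "(nat \<Rightarrow> complex) \<Rightarrow> real" where
  "nQ c = (\<Sum>k\<in>Kc. (cmod (hat c k))\<^sup>2)"

definition P :: "nat set" where "P = {p. prime p \<and> p dvd m}"
definition m0 :: nat where "m0 = \<Prod>P"
definition m1 :: nat where "m1 = m div m0"
definition pd :: "nat \<Rightarrow> nat \<Rightarrow> bool" where "pd p a \<longleftrightarrow> p dvd (a div m1)"
text \<open>With \<open>a = m1 * q + r\<close>, \<open>r < m1\<close>, these are the exponents whose
  \<open>q\<close> is prime to the radical \<open>m0\<close>: the normal basis of the squarefree
  cyclotomic ring times the powers \<open>\<zeta>^r\<close>. It is used because its dual basis,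
  scaled by \<open>m\<close>, has conjugates bounded by \<open>2 ^ card P\<close>.\<close>

definition E :: "nat set" where "E = {a. a < m \<and> (\<forall>p\<in>P. \<not> pd p a)}"
text \<open>The square of the bound \<open>2 ^ card P\<close> for the dual basis in
  \<open>coef_bound\<close>.\<close>

definition L :: nat where "L = 4 ^ card P"

lemma m_pos: "0 < m" using m2 by simp

lemma w_add: "w (a + b) = w a * w b"
  by (simp add: w_def cis_mult algebra_simps add_divide_distrib)

lemma w_0 [simp]: "w 0 = 1" by (simp add: w_def)

lemma norm_w [simp]: "cmod (w e) = 1" by (simp add: w_def)

lemma cnj_w: "cnj (w e) = w (- e)"
  by (simp add: w_def cis_cnj)

lemma w_mult_m [simp]: "w (int m * e) = 1"
proof -
  have "2 * pi * of_int (int m * e) / of_nat m = 2 * pi * of_int e"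
    using m_pos by simp
  then show ?thesis unfolding w_def by (simp add: cis_multiple_2pi)
qed

lemma w_eq_1_iff: "w e = 1 \<longleftrightarrow> int m dvd e"
proof
  assume "w e = 1"
  then have "cos (2 * pi * of_int e / of_nat m) = 1" by (simp add: w_def complex_eq_iff)
  then obtain n :: int where "2 * pi * of_int e / of_nat m = of_int n * 2 * pi"
    using cos_one_2pi_int by blast
  then have "real_of_int e = of_int (n * int m)" using m_pos by (simp add: field_simps)
  then have "e = n * int m" by (simp only: of_int_eq_iff)
  then show "int m dvd e" by simp
qed auto

lemma w_dvd [simp]: "int m dvd e \<Longrightarrow> w e = 1"
  by (simp add: w_eq_1_iff)

lemma w_cong: "[a = b] (mod int m) \<Longrightarrow> w a = w b"
proof -
  assume "[a = b] (mod int m)"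
  then have "int m dvd a - b" by (simp add: cong_iff_dvd_diff)
  then have "w (a - b) = 1" by simp
  moreover have "w a = w (a - b) * w b" by (simp flip: w_add)
  ultimately show ?thesis by simp
qed

lemma w_mod: "w (int (k * (a mod m))) = w (int (k * a))"
proof (rule w_cong)
  show "[int (k * (a mod m)) = int (k * a)] (mod int m)"
    by (simp add: cong_def zmod_int mod_mult_right_eq)
qed

lemma w_pow: "w e ^ n = w (int n * e)"
  by (induction n) (simp_all add: w_add algebra_simps)

lemma sum_w: "(\<Sum>k<m. w (int k * e)) = (if int m dvd e then of_nat m else 0)"
proof (cases "int m dvd e")
  case False
  then have "w e \<noteq> 1" by (simp add: w_eq_1_iff)
  then have "(\<Sum>k<m. w e ^ k) = (w e ^ m - 1) / (w e - 1)"
    by (rule geometric_sum)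
  with False show ?thesis by (simp add: w_pow)
qed auto

lemma finite_Kc [simp]: "finite Kc" by (simp add: Kc_def)

lemma Kc_eq_totatives: "Kc = totatives m"
  using m2 by (auto simp: Kc_def totatives_def intro!: Nat.gr0I le_neq_implies_less)

lemma card_Kc: "card Kc = totient m"
  by (simp add: Kc_eq_totatives totient_def)

lemma one_Kc: "1 \<in> Kc" using m2 by (simp add: Kc_def)

lemma finite_P [simp]: "finite P"
proof -
  have "P \<subseteq> {..m}" using m_pos by (auto simp: P_def dvd_imp_le)
  then show ?thesis by (rule finite_subset) simp
qed

lemma prime_P: "p \<in> P \<Longrightarrow> prime p" and dvd_P: "p \<in> P \<Longrightarrow> p dvd m"
  by (auto simp: P_def)

lemma m0_dvd: "m0 dvd m"
proof -
  have "S \<subseteq> P \<Longrightarrow> \<Prod>S dvd m" if "finite S" for S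
    using that
  proof (induction S)
    case (insert p S)
    have "coprime p q" if "q \<in> S" for q
      using insert that by (intro primes_coprime prime_P) auto
    then have "coprime p (\<Prod>S)" by (rule prod_coprime_right)
    with insert show ?case by (simp add: divides_mult dvd_P)
  qed auto
  then show ?thesis by (simp add: m0_def)
qed

lemma m_eq: "m = m1 * m0"
  using m0_dvd by (simp add: m1_def)

lemma m0_pos: "0 < m0" and m1_pos: "0 < m1"
  using m_pos m_eq by (auto intro!: Nat.gr0I)

lemma P_dvd_m0: "p \<in> P \<Longrightarrow> p dvd m0"
  unfolding m0_def by (rule dvd_prodI) auto

lemma m_div_p: "p \<in> P \<Longrightarrow> m div p = m1 * (m0 div p)"
  using m_eq P_dvd_m0 by (metis div_mult_swap)

lemma m0_div: assumes "p \<in> P" shows "m0 div p = \<Prod>(P - {p})"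
proof -
  have "m0 = p * \<Prod>(P - {p})" unfolding m0_def using assms by (subst prod.remove[of P p]) auto
  then show ?thesis using prime_P[OF assms] by (simp add: prime_gt_0_nat)
qed

lemma coprime_m0_div: assumes "p \<in> P" shows "coprime p (m0 div p)"
  unfolding m0_div[OF assms]
  by (rule prod_coprime_right) (use assms in \<open>auto intro: primes_coprime prime_P\<close>)

lemma dvd_m0_div: assumes "p \<in> P" "q \<in> P" "q \<noteq> p" shows "q dvd m0 div p"
  unfolding m0_div[OF assms(1)] using assms by (intro dvd_prodI) auto

lemma pd_mod [simp]: assumes "p \<in> P" shows "pd p (a mod m) \<longleftrightarrow> pd p a"
proof -
  have "a mod m = m1 * (a div m1 mod m0) + a mod m1"
    by (subst m_eq) (rule mod_mult2_eq)
  then have "(a mod m) div m1 = a div m1 mod m0" using m1_pos by simp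
  then show ?thesis using P_dvd_m0[OF assms] by (simp add: pd_def dvd_mod_iff)
qed

lemma div_add_m: "p \<in> P \<Longrightarrow> (a + t * (m div p)) div m1 = a div m1 + t * (m0 div p)"
proof -
  assume "p \<in> P"
  then have "a + t * (m div p) = a + t * (m0 div p) * m1" by (simp add: m_div_p)
  then show ?thesis using m1_pos by (simp only: div_mult_self1)
qed

lemma pd_add_other: assumes "p \<in> P" "q \<in> P" "q \<noteq> p" shows "pd q (a + t * (m div p)) \<longleftrightarrow> pd q a"
  using dvd_m0_div[OF assms] by (simp add: pd_def div_add_m assms dvd_add_left_iff)

lemma finite_E [simp]: "finite E" by (simp add: E_def)

lemma E_less: "a \<in> E \<Longrightarrow> a < m" by (simp add: E_def)

text \<open>A unit \<open>k\<close> is sent to the exponent with quotient \<open>k mod m0\<close>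
  and remainder \<open>k div m0\<close> by \<open>m1\<close>, so that coprimality to
  \<open>m\<close> becomes the condition defining \<open>E\<close>.\<close>

lemma card_E: "card E = totient m"
proof -
  have cop: "coprime i m0 \<longleftrightarrow> (\<forall>p\<in>P. \<not> p dvd i)" for i
  proof
    assume "coprime i m0"
    then show "\<forall>p\<in>P. \<not> p dvd i"
      using P_dvd_m0 prime_P by (metis coprime_common_divisor not_prime_unit)
  next
    assume *: "\<forall>p\<in>P. \<not> p dvd i"
    show "coprime i m0" unfolding m0_def
      by (rule prod_coprime_right) (use * prime_P in \<open>auto simp: coprime_commute prime_imp_coprime\<close>)
  qed
  have cop': "coprime i m \<longleftrightarrow> (\<forall>p\<in>P. \<not> p dvd i)" for i
  proof
    assume "coprime i m"
    then show "\<forall>p\<in>P. \<not> p dvd i"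
      using dvd_P prime_P by (metis coprime_common_divisor not_prime_unit)
  next
    assume *: "\<forall>p\<in>P. \<not> p dvd i"
    show "coprime i m"
    proof (rule ccontr)
      assume "\<not> coprime i m"
      then obtain p where "prime p" "p dvd i" "p dvd m"
        using coprime_iff_gcd_eq_1 prime_factor_nat by (metis gcd_dvd1 gcd_dvd2 dvd_trans)
      with * show False by (auto simp: P_def)
    qed
  qed
  define f where "f = (\<lambda>k. (k div m0) + m1 * (k mod m0))"
  define g where "g = (\<lambda>a. (a div m1) + m0 * (a mod m1))"
  have mm: "m1 * m0 = m" "m0 * m1 = m" using m_eq by (simp_all add: mult.commute)
  have "bij_betw f Kc E"
  proof (rule bij_betwI[where g = g])
    show "f \<in> Kc \<rightarrow> E"
    proof
      fix k assume k: "k \<in> Kc"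
      have "k div m0 < m1" using k by (intro less_mult_imp_div_less) (simp add: Kc_def mm)
      moreover have "k mod m0 < m0" using m0_pos by simp
      ultimately have "f k div m1 = k mod m0" "f k < m1 * (k mod m0 + 1)" "m1 * (k mod m0 + 1) \<le> m1 * m0"
        using m1_pos by (simp add: f_def, simp add: f_def) (intro mult_le_mono2, use m0_pos in \<open>simp add: Suc_le_eq\<close>)
      then have "f k div m1 = k mod m0" "f k < m" using mm(1) by auto
      then show "f k \<in> E" using k P_dvd_m0 by (auto simp: E_def pd_def Kc_def cop' dvd_mod_iff)
    qed
    show "g \<in> E \<rightarrow> Kc"
    proof
      fix a assume a: "a \<in> E"
      have "a div m1 < m0" using a by (intro less_mult_imp_div_less) (simp add: E_def mm)
      moreover have "a mod m1 < m1" using m1_pos by simp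
      ultimately have "g a mod m0 = a div m1" "g a < m0 * (a mod m1 + 1)" "m0 * (a mod m1 + 1) \<le> m0 * m1"
        by (simp add: g_def, simp add: g_def, intro mult_le_mono2) (use m1_pos in \<open>simp add: Suc_le_eq\<close>)
      then have "g a mod m0 = a div m1" and "g a < m" using mm(2) by auto
      have "\<not> p dvd g a" if p: "p \<in> P" for p
      proof -
        have "p dvd g a \<longleftrightarrow> p dvd g a mod m0" using P_dvd_m0[OF p] by (simp add: dvd_mod_iff)
        also have "\<dots> \<longleftrightarrow> p dvd a div m1" by (simp only: \<open>g a mod m0 = a div m1\<close>)
        finally show ?thesis using a p by (simp add: E_def pd_def)
      qed
      with \<open>g a < m\<close> show "g a \<in> Kc" by (simp add: Kc_def cop')
    qed
    fix k assume "k \<in> Kc"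
    then have "k div m0 < m1" by (intro less_mult_imp_div_less) (simp add: Kc_def mm)
    then show "g (f k) = k" by (simp add: f_def g_def)
  next
    fix a assume "a \<in> E"
    then have "a div m1 < m0" by (intro less_mult_imp_div_less) (simp add: E_def mm)
    then show "f (g a) = a" by (simp add: f_def g_def)
  qed
  from bij_betw_same_card[OF this] show ?thesis by (simp add: card_Kc)
qed

lemma not_coprime_P: assumes "k < m" "k \<notin> Kc" shows "\<exists>p\<in>P. p dvd k"
proof -
  have "\<not> coprime k m" using assms by (simp add: Kc_def)
  then obtain p where "prime p" "p dvd k" "p dvd m"
    using coprime_iff_gcd_eq_1 prime_factor_nat by (metis gcd_dvd1 gcd_dvd2 dvd_trans)
  then show ?thesis by (auto simp: P_def)
qed

lemma hat_add: "hat (\<lambda>a. c a + d a) k = hat c k + hat d k"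
  and hat_diff: "hat (\<lambda>a. c a - d a) k = hat c k - hat d k"
  and hat_cmult: "hat (\<lambda>a. z * c a) k = z * hat c k"
  by (simp_all add: hat_def sum.distrib sum_subtractf sum_distrib_left algebra_simps)

text \<open>The dual basis: \<open>s p\<close> moves \<open>j\<close> to the element of its coset modulo \<open>m div p\<close> which is
  missing from \<open>E\<close>, so that all but the first term of the expansion of the product vanish on \<open>E\<close>.\<close>

lemma coef_bound:
  assumes supp: "\<And>a. a \<notin> E \<Longrightarrow> c a = 0" and j: "j \<in> E"
  shows "real m * (c j)\<^sup>2 \<le> real L * nQ (\<lambda>a. complex_of_real (c a))"
proof -
  \<comment> \<open>\<open>m0 div p\<close> is invertible modulo \<open>p\<close> because
    \<open>m0\<close> is squarefree.\<close>
  have "\<exists>t. p dvd j div m1 + t * (m0 div p)" if p: "p \<in> P" for p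
  proof -
    have "coprime (m0 div p) p" using coprime_m0_div[OF p] by (simp add: coprime_commute)
    then obtain x where x: "[(m0 div p) * x = 1] (mod p)" using cong_solve_coprime_nat by (auto simp: One_nat_def)
    have "0 < p" using prime_P[OF p] by (simp add: prime_gt_0_nat)
    have "[j div m1 + ((p - 1) * (j div m1) * x) * (m0 div p) = j div m1 + (p - 1) * (j div m1) * 1] (mod p)"
      using cong_add[OF cong_refl[of "j div m1"] cong_mult[OF cong_refl[of "(p - 1) * (j div m1)"] x]]
      by (simp add: mult_ac)
    also have "j div m1 + (p - 1) * (j div m1) * 1 = p * (j div m1)"
      using \<open>0 < p\<close> by (cases p) auto
    finally have "p dvd j div m1 + ((p - 1) * (j div m1) * x) * (m0 div p)"
      by (simp add: cong_def mod_eq_0_iff_dvd)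
    then show ?thesis by blast
  qed
  then obtain t where t: "\<And>p. p \<in> P \<Longrightarrow> p dvd j div m1 + t p * (m0 div p)" by metis
  define s where "s = (\<lambda>p. t p * (m div p))"
  define U where "U = (\<lambda>k. w (int (k * j)) * (\<Prod>p\<in>P. 1 - w (int (k * s p))))"
  have U0: "U k = 0" if k: "k < m" "k \<notin> Kc" for k
  proof -
    obtain p where p: "p \<in> P" "p dvd k" using not_coprime_P[OF k] by blast
    have "m dvd k * s p"
      using p dvd_P[OF p(1)] by (auto simp: s_def elim!: dvdE)
    then have "w (int (k * s p)) = 1" by (intro w_dvd) (simp only: of_nat_dvd_iff)
    then have "(\<Prod>p\<in>P. 1 - w (int (k * s p))) = 0"
      using p by (intro prod_zero) auto
    then show ?thesis by (simp add: U_def)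
  qed
  have Ub: "cmod (U k) \<le> 2 ^ card P" for k
  proof -
    have "cmod (U k) = (\<Prod>p\<in>P. cmod (1 - w (int (k * s p))))"
      by (simp add: U_def norm_mult prod_norm)
    also have "\<dots> \<le> (\<Prod>p\<in>P. 2)"
    proof (intro prod_mono conjI)
      fix p show "cmod (1 - w (int (k * s p))) \<le> 2"
        using norm_triangle_ineq4[of 1 "w (int (k * s p))"] by simp
    qed auto
    finally show ?thesis by simp
  qed
  have Uexp: "cnj (U k) = (\<Sum>S\<in>Pow P. (-1) ^ card S * w (- int (k * (j + sum s S))))" for k
  proof -
    have "(\<Prod>p\<in>P. - w (int (k * s p)) + 1) =
       (\<Sum>S\<in>Pow P. (\<Prod>p\<in>S. - w (int (k * s p))) * (\<Prod>p\<in>P-S. 1))"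
      by (rule prod_add) simp
    also have "\<dots> = (\<Sum>S\<in>Pow P. (-1) ^ card S * w (int (k * sum s S)))"
    proof (intro sum.cong refl)
      fix S assume "S \<in> Pow P"
      then have "finite S" by (auto intro: finite_subset)
      then have "(\<Prod>p\<in>S. w (int (k * s p))) = w (int (k * sum s S))"
        by (induction S) (auto simp: w_add algebra_simps)
      then show "(\<Prod>p\<in>S. - w (int (k * s p))) * (\<Prod>p\<in>P-S. 1) = (-1) ^ card S * w (int (k * sum s S))"
        by (simp add: prod_uminus)
    qed
    finally have "U k = (\<Sum>S\<in>Pow P. (-1) ^ card S * w (int (k * (j + sum s S))))"
      by (simp add: U_def sum_distrib_left w_add algebra_simps)
    then show ?thesis by (simp add: cnj_w)
  qed
  have key: "int m dvd int a - int (j + sum s S) \<longleftrightarrow> S = {} \<and> a = j"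
    if a: "a \<in> E" and S: "S \<subseteq> P" for a S
  proof (cases "S = {}")
    case True
    have "a < m" "j < m" using a j by (auto simp: E_def)
    then have "int m dvd int a - int j \<longleftrightarrow> a = j"
      by (metis cong_iff_dvd_diff cong_int_iff cong_less_modulus_unique_nat cong_refl)
    with True show ?thesis by simp
  next
    case False
    then obtain p where p: "p \<in> S" by blast
    with S have pP: "p \<in> P" by blast
    have finS: "finite S" using S by (auto intro: finite_subset)
    have "\<not> int m dvd int a - int (j + sum s S)"
    proof
      assume "int m dvd int a - int (j + sum s S)"
      then have "[int a = int (j + sum s S)] (mod int m)"
        by (simp add: cong_iff_dvd_diff)
      then have "a mod m = (j + sum s S) mod m"
        by (simp add: cong_def flip: zmod_int of_nat_add)
      then have "pd p a = pd p (j + sum s S)"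
        using pd_mod[OF pP] by metis
      moreover have "pd p (j + sum s S)"
      proof -
        have "sum s S = s p + sum s (S - {p})" using finS p by (rule sum.remove)
        moreover have "pd p (x + sum s T) \<longleftrightarrow> pd p x" if "T \<subseteq> P - {p}" for x T
        proof -
          have "finite T" using that by (auto intro: finite_subset)
          then show ?thesis using that
          proof (induction T arbitrary: x)
            case (insert q T)
            have "pd p (x + sum s (insert q T)) \<longleftrightarrow> pd p ((x + s q) + sum s T)"
              using insert by (simp add: add.assoc)
            also have "\<dots> \<longleftrightarrow> pd p (x + s q)" using insert by blast
            also have "\<dots> \<longleftrightarrow> pd p x"
              using insert pP unfolding s_def by (intro pd_add_other) auto
            finally show ?case .
          qed simp
        qed
        ultimately have "pd p (j + sum s S) \<longleftrightarrow> pd p (j + s p)"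
          using S by (simp add: add.assoc[symmetric] Diff_mono)
        also have "pd p (j + s p)" using t[OF pP] by (simp add: pd_def s_def div_add_m[OF pP])
        finally show ?thesis .
      qed
      ultimately show False using a pP by (auto simp: E_def)
    qed
    with False show ?thesis by simp
  qed
  let ?c = "\<lambda>a. complex_of_real (c a)"
  have "(\<Sum>k<m. cnj (U k) * hat ?c k) =
     (\<Sum>k<m. \<Sum>S\<in>Pow P. \<Sum>a<m. (-1) ^ card S * ?c a * w (int k * (int a - int (j + sum s S))))"
    unfolding Uexp hat_def sum_product
    by (intro sum.cong refl) (simp add: algebra_simps flip: w_add)
  also have "\<dots> = (\<Sum>S\<in>Pow P. \<Sum>k<m. \<Sum>a<m. (-1) ^ card S * ?c a * w (int k * (int a - int (j + sum s S))))"
    by (rule sum.swap)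
  also have "\<dots> = (\<Sum>S\<in>Pow P. \<Sum>a<m. \<Sum>k<m. (-1) ^ card S * ?c a * w (int k * (int a - int (j + sum s S))))"
    by (intro sum.cong refl sum.swap)
  also have "\<dots> = (\<Sum>S\<in>Pow P. \<Sum>a<m. if S = {} \<and> a = j then of_nat m * ?c j else 0)"
  proof (intro sum.cong refl)
    fix S a assume S: "S \<in> Pow P" and a: "a \<in> {..<m}"
    show "(\<Sum>k<m. (-1) ^ card S * ?c a * w (int k * (int a - int (j + sum s S)))) =
       (if S = {} \<and> a = j then of_nat m * ?c j else 0)"
    proof (cases "a \<in> E")
      case True
      have "int m dvd int a - int (j + sum s S) \<longleftrightarrow> S = {} \<and> a = j"
        using key[OF True, of S] S by simp
      then show ?thesis by (simp only: sum_distrib_left[symmetric] sum_w) auto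
    next
      case False
      then show ?thesis using supp[OF False] j by auto
    qed
  qed
  also have "\<dots> = (\<Sum>S\<in>Pow P. if S = {} then of_nat m * ?c j else 0)"
  proof (intro sum.cong refl)
    fix S show "(\<Sum>a<m. if S = {} \<and> a = j then of_nat m * ?c j else 0) = (if S = {} then of_nat m * ?c j else 0)"
      using j by (cases "S = {}") (auto simp: E_def)
  qed
  also have "\<dots> = of_nat m * ?c j" by (subst sum.delta) auto
  finally have "of_nat m * ?c j = (\<Sum>k<m. cnj (U k) * hat ?c k)" ..
  \<comment> \<open>Summing over all \<open>k < m\<close> made orthogonality of characters
    available; the factors of \<open>U\<close> kill those \<open>k\<close> that are no
    embeddings.\<close>
  also have "\<dots> = (\<Sum>k\<in>Kc. cnj (U k) * hat ?c k)"
    by (rule sum.mono_neutral_right) (use U0 in \<open>auto simp: Kc_def\<close>)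
  finally have eq: "of_nat m * ?c j = (\<Sum>k\<in>Kc. cnj (U k) * hat ?c k)" .
  have "real m * \<bar>c j\<bar> = cmod (of_nat m * ?c j)" by (simp add: norm_mult)
  also have "\<dots> \<le> (\<Sum>k\<in>Kc. cmod (cnj (U k) * hat ?c k))"
    unfolding eq by (rule norm_sum)
  also have "\<dots> \<le> (\<Sum>k\<in>Kc. 2 ^ card P * cmod (hat ?c k))"
    using Ub by (intro sum_mono) (simp add: norm_mult mult_right_mono)
  also have "\<dots> = 2 ^ card P * (\<Sum>k\<in>Kc. cmod (hat ?c k))" by (simp add: sum_distrib_left)
  finally have "(real m * \<bar>c j\<bar>)\<^sup>2 \<le> (2 ^ card P * (\<Sum>k\<in>Kc. cmod (hat ?c k)))\<^sup>2"
    by (intro power_mono) auto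
  also have "\<dots> = real L * (\<Sum>k\<in>Kc. cmod (hat ?c k))\<^sup>2"
  proof -
    have "((2::real) ^ card P)\<^sup>2 = 4 ^ card P" by (simp add: power2_eq_square flip: power_mult_distrib)
    then show ?thesis by (simp add: power_mult_distrib L_def)
  qed
  finally have fin: "(real m * \<bar>c j\<bar>)\<^sup>2 \<le> real L * (\<Sum>k\<in>Kc. cmod (hat ?c k))\<^sup>2" .
  have "(\<Sum>k\<in>Kc. cmod (hat ?c k))\<^sup>2 \<le> real (card Kc) * nQ ?c"
  proof -
    have "(\<Sum>k\<in>Kc. 1 * cmod (hat ?c k))\<^sup>2 \<le> (\<Sum>k\<in>Kc. 1\<^sup>2) * (\<Sum>k\<in>Kc. (cmod (hat ?c k))\<^sup>2)"
      by (rule Cauchy_Schwarz_ineq_sum)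
    then show ?thesis by (simp add: nQ_def)
  qed
  also have "real (card Kc) * nQ ?c \<le> real m * nQ ?c"
    using totient_le[of m] by (intro mult_right_mono) (auto simp: card_Kc nQ_def intro: sum_nonneg)
  finally have "real L * (\<Sum>k\<in>Kc. cmod (hat ?c k))\<^sup>2 \<le> real L * (real m * nQ ?c)"
    by (intro mult_left_mono) auto
  with fin have "(real m * \<bar>c j\<bar>)\<^sup>2 \<le> real L * (real m * nQ ?c)" by (rule order_trans)
  then have "real m * (real m * (c j)\<^sup>2) \<le> real m * (real L * nQ ?c)"
    by (simp add: power_mult_distrib power2_eq_square mult_ac)
  then show ?thesis using m_pos by (subst (asm) mult_le_cancel_left_pos) auto
qed

lemma hat_cong: "(\<And>a. a < m \<Longrightarrow> c a = d a) \<Longrightarrow> hat c k = hat d k"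
  unfolding hat_def by (intro sum.cong) auto

text \<open>The vanishing of the sum of \<open>\<zeta>^(a + t m / p)\<close> over
  \<open>t < p\<close>, in functional form: shifting by \<open>m div p\<close> multiplies
  \<open>hat g k\<close> by a root of unity different from 1, but leaves \<open>g\<close>
  fixed.\<close>

lemma hat_periodic:
  assumes p: "p \<in> P" and k: "k \<in> Kc" and g: "\<And>b. g ((b + m div p) mod m) = g b"
  shows "hat g k = 0"
proof -
  let ?x = "w (int (k * (m div p)))" and ?s = "\<lambda>b. (b + m div p) mod m"
  have mp: "m = p * (m div p)" using dvd_P[OF p] by simp
  have "\<not> m dvd k * (m div p)"
  proof
    assume "m dvd k * (m div p)"
    moreover have "0 < m div p" using m_pos mp by (metis gr0I mult_0_right)
    ultimately have "p dvd k" by (metis dvd_mult_cancel2 mp mult.commute mult_cancel_right1 nat_mult_dvd_cancel1 not_gr_zero)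
    with k dvd_P[OF p] have "is_unit p" by (auto simp: Kc_def coprime_def)
    with prime_P[OF p] show False by (simp add: not_prime_unit)
  qed
  then have x: "?x \<noteq> 1" unfolding w_eq_1_iff of_nat_dvd_iff .
  have "inj_on ?s {..<m}"
  proof (rule inj_onI)
    fix a b assume ab: "a \<in> {..<m}" "b \<in> {..<m}" "?s a = ?s b"
    then have "[a + m div p = b + m div p] (mod m)" by (simp add: cong_def)
    then have "[a = b] (mod m)" by (simp only: cong_add_rcancel_nat)
    with ab show "a = b" by (simp add: cong_def)
  qed
  moreover have "?s ` {..<m} \<subseteq> {..<m}" using m_pos by auto
  ultimately have "bij_betw ?s {..<m} {..<m}"
    by (simp add: bij_betw_def endo_inj_surj)
  then have "hat g k = (\<Sum>b<m. g (?s b) * w (int (k * ?s b)))"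
    unfolding hat_def by (rule sum.reindex_bij_betw[symmetric])
  also have "\<dots> = (\<Sum>b<m. ?x * (g b * w (int (k * b))))"
    unfolding g w_mod by (intro sum.cong refl) (simp add: distrib_left w_add mult_ac)
  also have "\<dots> = ?x * hat g k" by (simp add: hat_def sum_distrib_left)
  finally show ?thesis using x by simp
qed

abbreviation ic :: "(nat \<Rightarrow> int) \<Rightarrow> nat \<Rightarrow> complex" where "ic c \<equiv> \<lambda>a. of_int (c a)"
abbreviation rc :: "(nat \<Rightarrow> real) \<Rightarrow> nat \<Rightarrow> complex" where "rc c \<equiv> \<lambda>a. of_real (c a)"

text \<open>\<open>Sg a b\<close> is the coefficient of \<open>\<zeta>\<^sup>b\<close> in the expansion of \<open>\<zeta>\<^sup>a\<close> in the basis \<open>E\<close>; it uses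
  \<open>\<zeta>\<^sup>a = - (\<Sum>0<t<p. \<zeta>\<^sup>(a + t m/p))\<close> once for each prime \<open>p\<close> dividing \<open>m\<close>.\<close>

definition Sg :: "nat \<Rightarrow> nat \<Rightarrow> int" where
  "Sg a b = (if b \<in> E \<and> a mod m1 = b mod m1
     then \<Prod>p\<in>P. (if pd p a then -1 else if a div m1 mod p = b div m1 mod p then 1 else 0) else 0)"

lemma div_m1_mod: "p \<in> P \<Longrightarrow> (a mod m) div m1 mod p = a div m1 mod p"
proof -
  assume p: "p \<in> P"
  have "a mod m = m1 * (a div m1 mod m0) + a mod m1"
    by (subst m_eq) (rule mod_mult2_eq)
  then have "(a mod m) div m1 = a div m1 mod m0" using m1_pos by simp
  then show ?thesis using P_dvd_m0[OF p] by (simp add: mod_mod_cancel)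
qed

text \<open>\<open>SQ Q\<close> has the relation applied for the primes in \<open>Q\<close> only. It
  joins the unit vector at \<open>a\<close> (\<open>Q\<close> empty) to \<open>Sg a\<close>
  (\<open>Q = P\<close>), and adding a prime \<open>p\<close> changes it by a function of period
  \<open>m div p\<close>, which no embedding sees.\<close>

lemma hat_Sg:
  assumes a: "a < m" and k: "k \<in> Kc"
  shows "hat (ic (Sg a)) k = w (int (k * a))"
proof -
  define fac :: "nat set \<Rightarrow> nat \<Rightarrow> nat \<Rightarrow> int" where
    "fac Q p b = (if p \<in> Q \<and> pd p a then (if pd p b then 0 else -1) else if a div m1 mod p = b div m1 mod p then 1 else 0)" for Q p b
  define SQ :: "nat set \<Rightarrow> nat \<Rightarrow> int" where
    "SQ Q b = (if a mod m1 = b mod m1 then \<Prod>p\<in>P. fac Q p b else 0)" for Q b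
  have "hat (ic (SQ Q)) k = hat (ic (SQ {})) k" if "Q \<subseteq> P" for Q
  proof -
    have "finite Q" using that by (auto intro: finite_subset)
    then show ?thesis using that
    proof (induction Q)
      case (insert p Q)
      then have p: "p \<in> P" by simp
      have "hat (ic (SQ (insert p Q))) k = hat (ic (SQ Q)) k"
      proof (cases "pd p a")
        case False
        then have e: "fac (insert p Q) q b = fac Q q b" for q b by (auto simp: fac_def)
        show ?thesis unfolding SQ_def e ..
      next
        case True
        define g :: "nat \<Rightarrow> int" where "g b = (if a mod m1 = b mod m1 then \<Prod>q\<in>P-{p}. fac Q q b else 0)" for b
        have "SQ Q b - SQ (insert p Q) b = g b" for b
        proof -
          have 1: "(\<Prod>q\<in>P-{p}. fac (insert p Q) q b) = (\<Prod>q\<in>P-{p}. fac Q q b)"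
            by (rule prod.cong) (auto simp: fac_def)
          have "fac Q p b - fac (insert p Q) p b = 1"
            using True insert.hyps by (auto simp: fac_def pd_def mod_eq_0_iff_dvd)
          then have "fac Q p b * X - fac (insert p Q) p b * X = X" for X
            by (metis left_diff_distrib mult_1)
          then show ?thesis using prod.remove[OF finite_P p, of "\<lambda>q. fac Q q b"]
              prod.remove[OF finite_P p, of "\<lambda>q. fac (insert p Q) q b"] 1
            by (simp add: SQ_def g_def)
        qed
        moreover have "hat (ic g) k = 0"
        proof (rule hat_periodic[OF p k])
          fix b
          have m1d: "m1 dvd m div p" by (simp add: m_div_p[OF p])
          have "(b + m div p) mod m mod m1 = (b + m div p) mod m1"
            by (intro mod_mod_cancel dvdI[OF m_eq])
          also have "\<dots> = b mod m1" using m1d by (auto elim!: dvdE)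
          finally have e1: "(b + m div p) mod m mod m1 = b mod m1" .
          have e2: "(b + m div p) mod m div m1 mod q = b div m1 mod q" if q: "q \<in> P - {p}" for q
          proof -
            have "(b + m div p) mod m div m1 mod q = (b div m1 + m0 div p) mod q"
              using q div_add_m[OF p, of b 1] by (simp add: div_m1_mod)
            also have "\<dots> = b div m1 mod q" using dvd_m0_div[OF p, of q] q by (auto elim!: dvdE)
            finally show ?thesis .
          qed
          have "(\<Prod>q\<in>P-{p}. fac Q q ((b + m div p) mod m)) = (\<Prod>q\<in>P-{p}. fac Q q b)"
            unfolding fac_def pd_def dvd_eq_mod_eq_0 using e2 by (intro prod.cong refl) (simp only:)
          then show "ic g ((b + m div p) mod m) = ic g b" unfolding g_def e1 by simp
        qed
        ultimately show ?thesis using hat_diff[of "ic (SQ Q)" "ic (SQ (insert p Q))" k]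
          by (metis (no_types, lifting) ext eq_iff_diff_eq_0 of_int_diff)
      qed
      with insert show ?case by simp
    qed simp
  qed
  from this[of P] have "hat (ic (SQ P)) k = hat (ic (SQ {})) k" by simp
  moreover have "hat (ic (Sg a)) k = hat (ic (SQ P)) k"
  proof (rule hat_cong)
    fix b assume b: "b < m"
    show "ic (Sg a) b = ic (SQ P) b"
    proof (cases "b \<in> E")
      case True
      then have "fac P p b = (if pd p a then -1 else if a div m1 mod p = b div m1 mod p then 1 else 0)" if "p \<in> P" for p
        using that by (auto simp: fac_def E_def)
      then show ?thesis using True by (simp add: Sg_def SQ_def)
    next
      case False
      then obtain p where p: "p \<in> P" "pd p b" using b by (auto simp: E_def)
      then have "fac P p b = 0" by (auto simp: fac_def pd_def mod_eq_0_iff_dvd)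
      then have "(\<Prod>p\<in>P. fac P p b) = 0" using p by (auto simp: prod_zero_iff)
      then show ?thesis using False by (simp add: Sg_def SQ_def)
    qed
  qed
  moreover have "SQ {} b = (if b = a then 1 else 0)" if b: "b < m" for b
  proof (cases "a mod m1 = b mod m1 \<and> (\<forall>p\<in>P. a div m1 mod p = b div m1 mod p)")
    case True
    have "a div m1 < m0" "b div m1 < m0"
      using a b m_eq by (metis less_mult_imp_div_less mult.commute)+
    moreover have "[a div m1 = b div m1] (mod m0)"
      unfolding m0_def using True prime_P by (intro coprime_cong_prod_nat) (auto simp: cong_def primes_coprime)
    ultimately have "a div m1 = b div m1" by (simp add: cong_def)
    then have "a = b" using True by (metis div_mult_mod_eq)
    then show ?thesis by (simp add: SQ_def fac_def)
  next
    case False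
    then have "b \<noteq> a" by auto
    moreover have "SQ {} b = 0" using False by (auto simp: SQ_def fac_def prod_zero_iff)
    ultimately show ?thesis by simp
  qed
  then have "hat (ic (SQ {})) k = hat (\<lambda>b. if b = a then 1 else 0) k" by (intro hat_cong) simp
  moreover have "hat (\<lambda>b. if b = a then 1 else 0) k = w (int (k * a))"
    using a by (simp add: hat_def if_distrib[of "\<lambda>x. x * _"] cong: if_cong)
  ultimately show ?thesis by simp
qed

text \<open>The representative, supported on \<open>E\<close>, of the element with coefficients
  \<open>c\<close>. By \<open>supp_eq_int\<close> it is unique, so equality of elements becomes
  equality of functions.\<close>

definition red :: "(nat \<Rightarrow> int) \<Rightarrow> nat \<Rightarrow> int" where
  "red c b = (\<Sum>a<m. c a * Sg a b)"

lemma red_supp: "a \<notin> E \<Longrightarrow> red c a = 0"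
  by (simp add: red_def Sg_def)

lemma hat_red: assumes "k \<in> Kc" shows "hat (ic (red c)) k = hat (ic c) k"
proof -
  have "hat (ic (red c)) k = (\<Sum>b<m. \<Sum>a<m. of_int (c a) * (of_int (Sg a b) * w (int (k * b))))"
    unfolding hat_def red_def by (simp add: sum_distrib_right mult.assoc)
  also have "\<dots> = (\<Sum>a<m. of_int (c a) * hat (ic (Sg a)) k)"
    unfolding hat_def sum_distrib_left by (rule sum.swap)
  also have "\<dots> = hat (ic c) k" unfolding hat_def[of "ic c"] by (intro sum.cong refl) (simp add: hat_Sg assms)
  finally show ?thesis .
qed

lemma nQ_cong: "(\<And>k. k \<in> Kc \<Longrightarrow> hat c k = hat d k) \<Longrightarrow> nQ c = nQ d"
  by (simp add: nQ_def)

lemma nQ_nonneg [simp]: "0 \<le> nQ c" by (simp add: nQ_def sum_nonneg)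

lemma nQ_zero_iff: "nQ c = 0 \<longleftrightarrow> (\<forall>k\<in>Kc. hat c k = 0)"
  unfolding nQ_def by (subst sum_nonneg_eq_0_iff) auto

lemma coef_bound_int:
  assumes supp: "\<And>a. a \<notin> E \<Longrightarrow> c a = (0::int)"
  shows "real m * (real_of_int (c j))\<^sup>2 \<le> real L * nQ (ic c)"
proof (cases "j \<in> E")
  case True
  from coef_bound[of "\<lambda>a. real_of_int (c a)", OF _ True] supp show ?thesis by simp
qed (use supp in auto)

text \<open>Linear independence of the basis over the reals, as the case of norm 0 in the
  coefficient bound.\<close>

lemma supp_zero:
  assumes supp: "\<And>a. a \<notin> E \<Longrightarrow> c a = (0::real)" and z: "\<And>k. k \<in> Kc \<Longrightarrow> hat (rc c) k = 0"
  shows "c a = 0"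
proof (cases "a \<in> E")
  case True
  have "nQ (rc c) = 0" using z by (simp add: nQ_zero_iff)
  with coef_bound[of c a, OF supp True] m_pos show ?thesis by (simp add: mult_le_0_iff)
qed (use supp in auto)

lemma supp_zero_int:
  assumes supp: "\<And>a. a \<notin> E \<Longrightarrow> c a = (0::int)" and z: "\<And>k. k \<in> Kc \<Longrightarrow> hat (ic c) k = 0"
  shows "c a = 0"
  using supp_zero[of "\<lambda>a. real_of_int (c a)" a] supp z by simp

lemma supp_eq_int:
  assumes "\<And>a. a \<notin> E \<Longrightarrow> c a = (0::int)" "\<And>a. a \<notin> E \<Longrightarrow> d a = (0::int)"
    and z: "\<And>k. k \<in> Kc \<Longrightarrow> hat (ic c) k = hat (ic d) k"
  shows "c = d"
proof
  fix a
  have "c a - d a = 0"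
    by (rule supp_zero_int[of "\<lambda>a. c a - d a"]) (use assms in \<open>auto simp: hat_diff\<close>)
  then show "c a = d a" by simp
qed

text \<open>Multiplication in \<open>\<int>[x] / (x^m - 1)\<close>; polymorphic because it is
  applied to integer coefficients and to their complex images.\<close>

definition conv :: "(nat \<Rightarrow> 'a::comm_ring_1) \<Rightarrow> (nat \<Rightarrow> 'a) \<Rightarrow> nat \<Rightarrow> 'a" where
  "conv c d b = (\<Sum>a<m. \<Sum>a'<m. if (a + a') mod m = b then c a * d a' else 0)"

lemma hat_conv: "hat (conv c d) k = hat c k * hat d k"
proof -
  have "hat (conv c d) k = (\<Sum>b<m. \<Sum>a<m. \<Sum>a'<m. if (a + a') mod m = b then c a * d a' * w (int (k * b)) else 0)"
    unfolding hat_def conv_def sum_distrib_right by (intro sum.cong refl) auto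
  also have "\<dots> = (\<Sum>a<m. \<Sum>b<m. \<Sum>a'<m. if (a + a') mod m = b then c a * d a' * w (int (k * b)) else 0)"
    by (rule sum.swap)
  also have "\<dots> = (\<Sum>a<m. \<Sum>a'<m. \<Sum>b<m. if (a + a') mod m = b then c a * d a' * w (int (k * b)) else 0)"
    by (intro sum.cong refl sum.swap)
  also have "\<dots> = (\<Sum>a<m. \<Sum>a'<m. c a * d a' * w (int (k * ((a + a') mod m))))"
    using m_pos by (intro sum.cong refl) simp
  also have "\<dots> = (\<Sum>a<m. \<Sum>a'<m. (c a * w (int (k * a))) * (d a' * w (int (k * a'))))"
    unfolding w_mod by (intro sum.cong refl) (simp add: distrib_left w_add mult_ac)
  also have "\<dots> = hat c k * hat d k" by (simp add: hat_def sum_product)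
  finally show ?thesis .
qed

lemma ic_conv: "ic (conv c d) = conv (ic c) (ic d)"
  by (auto simp: conv_def fun_eq_iff intro!: sum.cong)

lemma hat_iconv: "hat (ic (conv c d)) k = hat (ic c) k * hat (ic d) k"
  by (simp only: ic_conv hat_conv)

end

section \<open>Ramanujan sums\<close>

lemma sum_cis_roots:
  assumes "0 < M"
  shows "(\<Sum>k<M. cis (2 * pi * real (a * k) / real M)) = (if M dvd a then of_nat M else 0)"
proof (cases "2 \<le> M")
  case True
  interpret cyc M by standard (rule True)
  have "(\<Sum>k<M. cis (2 * pi * real (a * k) / real M)) = (\<Sum>k<M. w (int k * int a))"
    by (intro sum.cong refl) (simp add: w_def mult_ac)
  with sum_w[of "int a"] show ?thesis by simp
next
  case False
  with assms have "M = 1" by simp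
  then show ?thesis by (simp add: lessThan_Suc)
qed

text \<open>Sieves out the multiples of one more prime \<open>q\<close>: the unsieved sum has the
  same shape with \<open>h * q\<close> in place of \<open>h\<close>, and the multiples of
  \<open>q\<close> give the sum for \<open>h\<close> itself. The parameter \<open>h\<close> exists
  for this induction.\<close>

lemma ramanujan_sum:
  fixes S :: "nat set"
  assumes "finite S" "\<And>p. p \<in> S \<Longrightarrow> prime p" "0 < h"
  shows "(\<Sum>k | k < h * \<Prod>S \<and> (\<forall>p\<in>S. \<not> p dvd k). cis (2 * pi * real (a * k) / real (h * \<Prod>S)))
    = (if h dvd a then of_int (int h * (\<Prod>p\<in>S. if p dvd a div h then int p - 1 else -1)) else 0)"
  using assms
proof (induction S arbitrary: h rule: finite_induct)
  case empty
  have "{k. k < h} = {..<h}" by auto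
  then show ?case using sum_cis_roots[of h a] empty by simp
next
  case (insert q S)
  have q: "prime q" and S: "\<And>p. p \<in> S \<Longrightarrow> prime p" using insert.prems by auto
  have q0: "0 < q" using q by (rule prime_gt_0_nat)
  define M where "M = h * \<Prod>S"
  have prodS: "0 < \<Prod>S" using S prime_gt_0_nat by (intro prod_pos) auto
  then have M0: "0 < M" using insert.prems by (simp add: M_def)
  have Mq: "h * \<Prod>(insert q S) = q * M" using insert by (simp add: M_def)
  let ?f = "\<lambda>k. cis (2 * pi * real (a * k) / real (q * M))"
  let ?A = "{k. k < q * M \<and> (\<forall>p\<in>S. \<not> p dvd k)}"
  let ?B = "(\<lambda>k. q * k) ` {k. k < M \<and> (\<forall>p\<in>S. \<not> p dvd k)}"
  have npq: "p dvd q * k \<longleftrightarrow> p dvd k" if "p \<in> S" for p k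
  proof -
    have "p \<noteq> q" using insert that by auto
    then have "coprime p q" using S[OF that] q by (simp add: primes_coprime)
    then show ?thesis by (simp add: coprime_dvd_mult_right_iff)
  qed
  have B: "?B = {k \<in> ?A. q dvd k}"
  proof (intro Set.set_eqI iffI)
    fix k assume "k \<in> {k \<in> ?A. q dvd k}"
    then obtain j where "k = q * j" "k \<in> ?A" by (auto elim!: dvdE)
    then show "k \<in> ?B" using npq q0 by auto
  qed (use npq q0 in auto)
  have "(\<Sum>k | k < h * \<Prod>(insert q S) \<and> (\<forall>p\<in>insert q S. \<not> p dvd k). cis (2 * pi * real (a * k) / real (h * \<Prod>(insert q S))))
    = (\<Sum>k\<in>?A - ?B. ?f k)"
    unfolding Mq B by (intro sum.cong) auto
  also have "\<dots> = (\<Sum>k\<in>?A. ?f k) - (\<Sum>k\<in>?B. ?f k)"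
    by (rule sum_diff) (auto simp: B)
  also have "(\<Sum>k\<in>?A. ?f k) = (if h * q dvd a then of_int (int (h * q) * (\<Prod>p\<in>S. if p dvd a div (h * q) then int p - 1 else -1)) else 0)"
  proof -
    have qM: "q * M = (h * q) * \<Prod>S" by (simp add: M_def)
    show ?thesis unfolding qM using S insert.prems q0 by (intro insert.IH) auto
  qed
  also have "(\<Sum>k\<in>?B. ?f k) = (if h dvd a then of_int (int h * (\<Prod>p\<in>S. if p dvd a div h then int p - 1 else -1)) else 0)"
  proof -
    have "(\<Sum>k\<in>?B. ?f k) = (\<Sum>k | k < M \<and> (\<forall>p\<in>S. \<not> p dvd k). ?f (q * k))"
      using q0 by (subst sum.reindex) (auto simp: inj_on_def)
    also have "\<dots> = (\<Sum>k | k < M \<and> (\<forall>p\<in>S. \<not> p dvd k). cis (2 * pi * real (a * k) / real M))"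
      using q0 M0 by (intro sum.cong refl) (simp add: field_simps)
    finally show ?thesis using insert.IH[of h] S insert.prems by (simp add: M_def)
  qed
  finally have eq: "(\<Sum>k | k < h * \<Prod>(insert q S) \<and> (\<forall>p\<in>insert q S. \<not> p dvd k). cis (2 * pi * real (a * k) / real (h * \<Prod>(insert q S))))
    = (if h * q dvd a then of_int (int (h * q) * (\<Prod>p\<in>S. if p dvd a div (h * q) then int p - 1 else -1)) else 0)
    - (if h dvd a then of_int (int h * (\<Prod>p\<in>S. if p dvd a div h then int p - 1 else -1)) else 0)" .
  show ?case
  proof (cases "h dvd a")
    case False
    then have "\<not> h * q dvd a" by (meson dvd_mult_left)
    with False eq show ?thesis by simp
  next
    case True
    then obtain b where b: "a = h * b" by (elim dvdE)
    have hq: "h * q dvd a \<longleftrightarrow> q dvd b" using insert.prems b by simp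
    have ah: "a div h = b" using b insert.prems by simp
    show ?thesis
    proof (cases "q dvd b")
      case True
      then obtain c where c: "b = q * c" by (elim dvdE)
      have "a div (h * q) = c" using b c insert.prems q0 by simp
      moreover have "p dvd b \<longleftrightarrow> p dvd c" if "p \<in> S" for p using npq[OF that, of c] c by simp
      then have "(\<Prod>p\<in>S. if p dvd b then int p - 1 else -1) = (\<Prod>p\<in>S. if p dvd c then int p - 1 else -1)"
        by (intro prod.cong) auto
      ultimately show ?thesis unfolding eq using insert True hq ah \<open>h dvd a\<close> by (simp add: algebra_simps)
    next
      case False
      then show ?thesis unfolding eq using insert hq ah True by simp
    qed
  qed
qed

section \<open>Conjugates of nonzero elements are nonzero\<close>

context cyc
begin

text \<open>Membership in the ring, for all embeddings at once; divisibility of \<open>F\<close> by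
  \<open>p\<close> can then be stated as \<open>F k = of_nat p * G k\<close> with
  \<open>ihat G\<close>.\<close>

definition ihat :: "(nat \<Rightarrow> complex) \<Rightarrow> bool" where
  "ihat F \<longleftrightarrow> (\<exists>g::nat \<Rightarrow> int. \<forall>k. F k = hat (ic g) k)"

lemma ihat_w: "ihat (\<lambda>k. w (int (k * a)))"
  unfolding ihat_def
proof (intro exI allI)
  fix k
  have "hat (ic (\<lambda>b. if b = a mod m then 1 else 0)) k = (\<Sum>b<m. if b = a mod m then w (int (k * b)) else 0)"
    unfolding hat_def by (intro sum.cong) auto
  also have "\<dots> = w (int (k * a))" using m_pos w_mod[of k a] by simp
  finally show "w (int (k * a)) = hat (ic (\<lambda>b. if b = a mod m then 1 else 0)) k" ..
qed

lemma ihat_mult: "ihat F \<Longrightarrow> ihat G \<Longrightarrow> ihat (\<lambda>k. F k * G k)"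
  unfolding ihat_def by (metis hat_iconv)

lemma ihat_add: assumes "ihat F" "ihat G" shows "ihat (\<lambda>k. F k + G k)"
proof -
  obtain f g where "\<forall>k. F k = hat (ic f) k" "\<forall>k. G k = hat (ic g) k"
    using assms by (auto simp: ihat_def)
  then have "\<forall>k. F k + G k = hat (ic (\<lambda>a. f a + g a)) k" by (simp add: hat_add)
  then show ?thesis unfolding ihat_def by (rule exI[where P = "\<lambda>g. \<forall>k. F k + G k = hat (ic g) k"])
qed

lemma ihat_cmult: assumes "ihat F" shows "ihat (\<lambda>k. of_int z * F k)"
proof -
  obtain f where "\<forall>k. F k = hat (ic f) k"
    using assms by (auto simp: ihat_def)
  then have "\<forall>k. of_int z * F k = hat (ic (\<lambda>a. z * f a)) k" by (simp add: hat_cmult)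
  then show ?thesis unfolding ihat_def by (rule exI[where P = "\<lambda>g. \<forall>k. of_int z * F k = hat (ic g) k"])
qed

lemma ihat_const: "ihat (\<lambda>k. of_int z)"
  using ihat_cmult[OF ihat_w[of 0], of z] by simp

lemma ihat_power: "ihat F \<Longrightarrow> ihat (\<lambda>k. F k ^ n)"
proof (induction n)
  case 0
  then show ?case using ihat_const[of 1] by simp
qed (auto intro: ihat_mult)

lemma ihat_sum: "finite A \<Longrightarrow> (\<And>a. a \<in> A \<Longrightarrow> ihat (F a)) \<Longrightarrow> ihat (\<lambda>k. \<Sum>a\<in>A. F a k)"
proof (induction A rule: finite_induct)
  case empty
  then show ?case using ihat_const[of 0] by simp
qed (auto intro: ihat_add)

lemma ihat_freshman:
  assumes "prime p" "ihat x" "ihat y"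
  shows "\<exists>G. ihat G \<and> (\<forall>k. (x k + y k) ^ p = x k ^ p + y k ^ p + of_nat p * G k)"
proof (intro exI conjI allI)
  define G where "G = (\<lambda>k. \<Sum>i\<in>{1..<p}. of_int (int ((p choose i) div p)) * (x k ^ i * y k ^ (p - i)))"
  have p1: "1 < p" using assms(1) by (rule prime_gt_1_nat)
  show "ihat G" unfolding G_def
    using assms by (intro ihat_sum ihat_cmult ihat_mult ihat_power) auto
  fix k
  have "(x k + y k) ^ p = (\<Sum>i\<le>p. of_nat (p choose i) * x k ^ i * y k ^ (p - i))"
    by (rule binomial_ring)
  also have "{..p} = insert 0 (insert p {1..<p})" using p1 by auto
  also have "(\<Sum>i\<in>insert 0 (insert p {1..<p}). of_nat (p choose i) * x k ^ i * y k ^ (p - i))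
    = y k ^ p + (x k ^ p + (\<Sum>i\<in>{1..<p}. of_nat (p choose i) * x k ^ i * y k ^ (p - i)))"
    using p1 by simp
  also have "(\<Sum>i\<in>{1..<p}. of_nat (p choose i) * x k ^ i * y k ^ (p - i)) = of_nat p * G k"
    unfolding G_def sum_distrib_left
  proof (intro sum.cong refl)
    fix i assume i: "i \<in> {1..<p}"
    then have "p dvd (p choose i)" using assms(1) by (intro dvd_choose_prime) auto
    then have "p choose i = p * ((p choose i) div p)" by simp
    then have "(of_nat (p choose i) :: complex) = of_nat p * of_int (int ((p choose i) div p))"
      by (metis of_int_of_nat_eq of_nat_mult)
    then show "of_nat (p choose i) * x k ^ i * y k ^ (p - i) =
       of_nat p * (of_int (int ((p choose i) div p)) * (x k ^ i * y k ^ (p - i)))"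
      by (simp only: mult.assoc)
  qed
  finally show "(x k + y k) ^ p = x k ^ p + y k ^ p + of_nat p * G k" by simp
qed

lemma ihat_freshman_sum:
  assumes "prime p" "finite A" "\<And>a. a \<in> A \<Longrightarrow> ihat (F a)"
  shows "\<exists>G. ihat G \<and> (\<forall>k. (\<Sum>a\<in>A. F a k) ^ p = (\<Sum>a\<in>A. F a k ^ p) + of_nat p * G k)"
  using assms(2,3)
proof (induction A rule: finite_induct)
  case empty
  then show ?case using ihat_const[of 0] assms(1) by (intro exI[of _ "\<lambda>_. 0"]) (auto simp: prime_gt_0_nat)
next
  case (insert a A)
  then obtain G where G: "ihat G" "\<forall>k. (\<Sum>a\<in>A. F a k) ^ p = (\<Sum>a\<in>A. F a k ^ p) + of_nat p * G k" by auto
  have "ihat (\<lambda>k. \<Sum>a\<in>A. F a k)" using insert by (intro ihat_sum) auto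
  with ihat_freshman[OF assms(1), of "F a" "\<lambda>k. \<Sum>a\<in>A. F a k"] insert.prems obtain H where
    H: "ihat H" "\<forall>k. (F a k + (\<Sum>a\<in>A. F a k)) ^ p = F a k ^ p + (\<Sum>a\<in>A. F a k) ^ p + of_nat p * H k"
    by auto
  show ?case
  proof (intro exI conjI allI)
    show "ihat (\<lambda>k. G k + H k)" using G H by (intro ihat_add)
    fix k
    show "(\<Sum>a\<in>insert a A. F a k) ^ p = (\<Sum>a\<in>insert a A. F a k ^ p) + of_nat p * (G k + H k)"
      using insert(1,2) H(2) G(2) by (simp add: algebra_simps)
  qed
qed

lemma fermat_int:
  fixes c :: int
  assumes "prime p"
  shows "int p dvd c ^ p - c"
proof -
  have p0: "0 < p" using assms by (rule prime_gt_0_nat)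
  define r where "r = nat (c mod int p)"
  have r: "[c = int r] (mod int p)" using p0 by (simp add: r_def cong_def)
  have "[r ^ p = r] (mod p)"
  proof (cases "p dvd r")
    case True
    then have "p dvd r ^ p" using p0 by (meson dvd_power dvd_trans)
    with True show ?thesis by (simp add: cong_def)
  next
    case False
    then have "[r ^ (p - 1) * r = 1 * r] (mod p)"
      by (intro cong_mult fermat_theorem assms cong_refl)
    then show ?thesis using p0 power_minus_mult[of p r] by simp
  qed
  then have "[int r ^ p = int r] (mod int p)" by (simp flip: cong_int_iff)
  with cong_pow[OF r, of p] r have "[c ^ p = c] (mod int p)"
    using cong_sym cong_trans by blast
  then show ?thesis by (simp add: cong_iff_dvd_diff)
qed

text \<open>Modulo \<open>p\<close>, the \<open>p\<close>-th power is additive, fixes integer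
  coefficients (Fermat) and multiplies exponents by \<open>p\<close>. The factor \<open>K\<close>
  makes the step iterable.\<close>

lemma frobenius:
  fixes c :: "nat \<Rightarrow> int"
  assumes "prime p"
  shows "\<exists>G. ihat G \<and> (\<forall>k. hat (ic c) (K * k) ^ p = hat (ic c) (p * K * k) + of_nat p * G k)"
proof -
  have "\<exists>G. ihat G \<and> (\<forall>k. (\<Sum>a<m. of_int (c a) * w (int (k * (K * a)))) ^ p
      = (\<Sum>a<m. (of_int (c a) * w (int (k * (K * a)))) ^ p) + of_nat p * G k)"
    by (intro ihat_freshman_sum assms ihat_cmult ihat_w) auto
  then obtain G where G: "ihat G"
    "\<forall>k. (\<Sum>a<m. of_int (c a) * w (int (k * (K * a)))) ^ p
      = (\<Sum>a<m. (of_int (c a) * w (int (k * (K * a)))) ^ p) + of_nat p * G k" by auto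
  define q where "q = (\<lambda>a. (c a ^ p - c a) div int p)"
  have q: "c a ^ p = c a + int p * q a" for a using fermat_int[OF assms, of "c a"] by (simp add: q_def)
  define H where "H = (\<lambda>k. \<Sum>a<m. of_int (q a) * w (int (k * (p * K * a))))"
  have "ihat (\<lambda>k. G k + H k)" unfolding H_def
    by (intro ihat_add G ihat_sum ihat_cmult ihat_w) auto
  moreover have "hat (ic c) (K * k) ^ p = hat (ic c) (p * K * k) + of_nat p * (G k + H k)" for k
  proof -
    have 1: "hat (ic c) (K * k) = (\<Sum>a<m. of_int (c a) * w (int (k * (K * a))))"
      unfolding hat_def by (intro sum.cong) (auto simp: mult_ac)
    have "(of_int (c a) * w (int (k * (K * a)))) ^ p
       = of_int (c a) * w (int (p * K * k * a)) + of_nat p * (of_int (q a) * w (int (k * (p * K * a))))" for a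
    proof -
      have "(of_int (c a) * w (int (k * (K * a)))) ^ p = of_int (c a ^ p) * w (int (p * K * k * a))"
        by (simp add: power_mult_distrib w_pow mult_ac)
      also have "\<dots> = of_int (c a) * w (int (p * K * k * a)) + of_nat p * (of_int (q a) * w (int (k * (p * K * a))))"
        unfolding q by (simp add: algebra_simps)
      finally show ?thesis .
    qed
    then have s: "(\<Sum>a<m. (of_int (c a) * w (int (k * (K * a)))) ^ p) = hat (ic c) (p * K * k) + of_nat p * H k"
      by (simp add: hat_def H_def sum.distrib sum_distrib_left)
    show ?thesis unfolding 1 G(2)[rule_format, of k] s by (simp only: distrib_left add.assoc) simp
  qed
  ultimately show ?thesis by blast
qed

lemma hat_bound: "cmod (hat (ic c) k) \<le> (\<Sum>a<m. \<bar>real_of_int (c a)\<bar>)"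
proof -
  have "cmod (hat (ic c) k) \<le> (\<Sum>a<m. cmod (of_int (c a) * w (int (k * a))))"
    unfolding hat_def by (rule norm_sum)
  also have "\<dots> = (\<Sum>a<m. \<bar>real_of_int (c a)\<bar>)" by (simp add: norm_mult)
  finally show ?thesis .
qed

text \<open>Modulo \<open>p\<close> the \<open>p\<close>-th power of \<open>c(\<zeta>)\<close> is \<open>c(\<zeta>\<^sup>p)\<close>, so the product below is divisible by \<open>p\<close>; an element
  divisible by a prime larger than its size is zero.\<close>

lemma frobenius_kill:
  fixes c d :: "nat \<Rightarrow> int"
  assumes p: "prime p" and z: "\<And>k. k \<in> Kc \<Longrightarrow> hat (ic c) (K * k) * hat (ic d) k = 0"
    and big: "real L * ((\<Sum>a<m. \<bar>real_of_int (c a)\<bar>) * (\<Sum>a<m. \<bar>real_of_int (d a)\<bar>))\<^sup>2 < (real p)\<^sup>2"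
    and k: "k \<in> Kc"
  shows "hat (ic c) (p * K * k) * hat (ic d) k = 0"
proof -
  let ?A = "\<Sum>a<m. \<bar>real_of_int (c a)\<bar>" and ?B = "\<Sum>a<m. \<bar>real_of_int (d a)\<bar>"
  have p0: "0 < p" using p by (rule prime_gt_0_nat)
  obtain G where G: "ihat G" "\<forall>k. hat (ic c) (K * k) ^ p = hat (ic c) (p * K * k) + of_nat p * G k"
    using frobenius[OF p] by blast
  have "ihat (\<lambda>k. of_int (-1) * (G k * hat (ic d) k))"
    by (intro ihat_cmult ihat_mult G) (auto simp: ihat_def)
  then obtain e where e: "\<And>k. - (G k * hat (ic d) k) = hat (ic e) k" by (auto simp: ihat_def)
  have eq: "hat (ic c) (p * K * k) * hat (ic d) k = of_nat p * hat (ic e) k" if "k \<in> Kc" for k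
  proof -
    have "hat (ic c) (K * k) ^ p * hat (ic d) k = 0"
      using z[OF that] p0 by auto
    then have "hat (ic c) (p * K * k) * hat (ic d) k + of_nat p * (G k * hat (ic d) k) = 0"
      unfolding G(2)[rule_format, of k] by (simp only: distrib_right mult.assoc)
    then have "hat (ic c) (p * K * k) * hat (ic d) k = of_nat p * (- (G k * hat (ic d) k))"
      by (simp only: add_eq_0_iff2 mult_minus_right)
    then show ?thesis by (simp only: e)
  qed
  define e' where "e' = red e"
  have "e' a = 0" for a
  proof (rule ccontr)
    assume "e' a \<noteq> 0"
    then have "0 < (e' a)\<^sup>2" by simp
    then have "1 \<le> (e' a)\<^sup>2" by linarith
    then have "1 \<le> (real_of_int (e' a))\<^sup>2" by (metis of_int_1_le_iff of_int_power)
    then have "real m \<le> real m * (real_of_int (e' a))\<^sup>2" using m_pos by simp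
    also have "\<dots> \<le> real L * nQ (ic e')"
      by (rule coef_bound_int) (simp add: e'_def red_supp)
    finally have 1: "real m \<le> real L * nQ (ic e')" .
    have "(real p)\<^sup>2 * nQ (ic e') = (\<Sum>k\<in>Kc. (cmod (of_nat p * hat (ic e) k))\<^sup>2)"
      unfolding nQ_def sum_distrib_left
      by (intro sum.cong refl) (simp add: e'_def hat_red norm_mult power_mult_distrib)
    also have "\<dots> \<le> (\<Sum>k\<in>Kc. (?A * ?B)\<^sup>2)"
    proof (intro sum_mono power_mono)
      fix k assume "k \<in> Kc"
      then have "cmod (of_nat p * hat (ic e) k) = cmod (hat (ic c) (p * K * k)) * cmod (hat (ic d) k)"
        by (simp only: eq[symmetric] norm_mult)
      also have "\<dots> \<le> ?A * ?B" by (intro mult_mono hat_bound) (auto intro: sum_nonneg)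
      finally show "cmod (of_nat p * hat (ic e) k) \<le> ?A * ?B" .
    qed auto
    also have "\<dots> = real (totient m) * (?A * ?B)\<^sup>2" by (simp add: card_Kc)
    also have "\<dots> \<le> real m * (?A * ?B)\<^sup>2"
      using totient_le[of m] by (intro mult_right_mono) auto
    finally have "(real p)\<^sup>2 * nQ (ic e') \<le> real m * (?A * ?B)\<^sup>2" .
    then have "real L * ((real p)\<^sup>2 * nQ (ic e')) \<le> real L * (real m * (?A * ?B)\<^sup>2)"
      by (intro mult_left_mono) auto
    moreover have "(real p)\<^sup>2 * real m \<le> (real p)\<^sup>2 * (real L * nQ (ic e'))"
      using 1 by (intro mult_left_mono) auto
    moreover have "real m * (real L * (?A * ?B)\<^sup>2) < real m * (real p)\<^sup>2"
      using big m_pos by (intro mult_strict_left_mono) auto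
    ultimately show False by (simp add: mult_ac)
  qed
  then have "hat (ic e') k = 0" by (simp add: hat_def)
  with eq[OF k] hat_red[OF k, of e] show ?thesis by (simp add: e'_def)
qed

lemma hat_mod: "hat c (k mod m) = hat c k"
proof -
  have "w (int (k mod m * a)) = w (int (k * a))" for a
    using w_mod[of a k] by (simp add: mult.commute)
  then show ?thesis by (simp add: hat_def)
qed

text \<open>Multiplying the embedding by any \<open>K\<close> without prime factors up to
  \<open>B\<close> preserves the vanishing of the product, one prime at a time; a suitable such
  \<open>K\<close> carries \<open>k1\<close> to any other \<open>k\<close>.\<close>

lemma frobenius_orbit:
  fixes c d :: "nat \<Rightarrow> int"
  assumes z: "\<And>k. k \<in> Kc \<Longrightarrow> hat (ic c) k * hat (ic d) k = 0"
    and k1: "k1 \<in> Kc" "hat (ic d) k1 \<noteq> 0" and k: "k \<in> Kc"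
  shows "hat (ic c) k = 0"
proof -
  define C where "C = real L * ((\<Sum>a<m. \<bar>real_of_int (c a)\<bar>) * (\<Sum>a<m. \<bar>real_of_int (d a)\<bar>))\<^sup>2"
  obtain B :: nat where B: "C < real B" using reals_Archimedean2 by blast
  have big: "C < (real p)\<^sup>2" if "B < p" for p
  proof -
    have "real B < real p" using that by simp
    also have "real p * 1 \<le> real p * real p" using that by (intro mult_left_mono) auto
    then have "real p \<le> (real p)\<^sup>2" by (simp add: power2_eq_square)
    finally have "real B < (real p)\<^sup>2" .
    from B this show ?thesis by (rule order.strict_trans)
  qed
  have orbit: "K \<noteq> 0 \<Longrightarrow> (\<forall>q. prime q \<longrightarrow> q dvd K \<longrightarrow> B < q) \<Longrightarrow>
      \<forall>k\<in>Kc. hat (ic c) (K * k) * hat (ic d) k = 0" for K :: nat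
  proof (induction K rule: prime_divisors_induct)
    case (unit K)
    then show ?case using z by simp
  next
    case (factor p K)
    have "\<forall>k\<in>Kc. hat (ic c) (K * k) * hat (ic d) k = 0"
      using factor by auto
    moreover have "B < p" using factor by auto
    ultimately show ?case
      using frobenius_kill[OF factor(1), of c K d] big[of p] by (auto simp: C_def)
  qed simp
  obtain x where x: "[k1 * x = 1] (mod m)"
    using k1 cong_solve_coprime_nat[of k1 m] by (auto simp: Kc_def)
  define \<kappa> where "\<kappa> = k * x"
  have \<kappa>: "coprime \<kappa> m"
  proof -
    have "coprime x m" using x by (metis coprime_1_left coprime_mult_left_iff cong_imp_coprime cong_sym)
    with k show ?thesis by (simp add: \<kappa>_def Kc_def)
  qed
  \<comment> \<open>No theorem on primes in progressions is required: a prime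
    \<open>q \<le> B\<close> divides exactly one of \<open>\<kappa>\<close> and \<open>t\<close>,
    and not \<open>m\<close> if it divides \<open>\<kappa>\<close>; so it never divides
    \<open>\<kappa> + m * t\<close>.\<close>
  define t where "t = \<Prod>{q. prime q \<and> q \<le> B \<and> \<not> q dvd \<kappa>}"
  have fin: "finite {q. prime q \<and> q \<le> B \<and> \<not> q dvd \<kappa>}"
    by (rule finite_subset[of _ "{..B}"]) auto
  define K where "K = \<kappa> + m * t"
  have "t \<noteq> 0" unfolding t_def using fin by (auto simp: prime_gt_0_nat)
  then have K0: "K \<noteq> 0" using m_pos by (simp add: K_def)
  have Kp: "B < q" if q: "prime q" "q dvd K" for q
  proof (rule ccontr)
    assume "\<not> B < q"
    show False
    proof (cases "q dvd \<kappa>")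
      case True
      then have "q dvd m * t" using q by (simp add: K_def dvd_add_right_iff)
      then have "q dvd m \<or> q dvd t" using q by (simp add: prime_dvd_mult_iff)
      moreover have "\<not> q dvd m" using True \<kappa> q(1) by (metis coprime_common_divisor not_prime_unit)
      moreover have "\<not> q dvd t"
      proof
        assume "q dvd t"
        then obtain q' where "q' \<in> {q. prime q \<and> q \<le> B \<and> \<not> q dvd \<kappa>}" "q dvd q'"
          unfolding t_def using fin q(1) by (auto simp: prime_dvd_prod_iff)
        with q(1) have "q = q'" by (auto simp: primes_dvd_imp_eq)
        with \<open>q' \<in> _\<close> True show False by simp
      qed
      ultimately show False by simp
    next
      case False
      then have "q dvd t" unfolding t_def
        using q \<open>\<not> B < q\<close> fin by (intro dvd_prodI) auto
      then have "q dvd \<kappa>" using q(2) unfolding K_def by (simp add: dvd_add_left_iff)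
      with False show False by simp
    qed
  qed
  have "hat (ic c) (K * k1) * hat (ic d) k1 = 0" using orbit[OF K0] Kp k1 by blast
  then have "hat (ic c) (K * k1) = 0" using k1 by simp
  moreover have "[K * k1 = k] (mod m)"
  proof -
    have "[K = \<kappa>] (mod m)" by (simp add: K_def cong_def)
    then have "[K * k1 = \<kappa> * k1] (mod m)" by (rule cong_mult) simp
    also have "\<kappa> * k1 = k * (k1 * x)" by (simp add: \<kappa>_def mult_ac)
    also have "[k * (k1 * x) = k * 1] (mod m)" by (intro cong_mult cong_refl x)
    finally show ?thesis by simp
  qed
  ultimately show ?thesis by (metis cong_def hat_mod)
qed

text \<open>Siegel's pigeonhole argument. Multiples of \<open>c\<close> vanish at \<open>k0\<close>,
  so their coordinate at \<open>a1\<close> is determined by the others: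
  \<open>(H + 1) ^ card E\<close> elements have products in a box with one dimension fewer, two
  products coincide, and the difference of the two elements is \<open>d\<close>.\<close>

lemma annihilator:
  fixes c :: "nat \<Rightarrow> int"
  assumes k0: "k0 \<in> Kc" "hat (ic c) k0 = 0"
  shows "\<exists>d::nat \<Rightarrow> int. (\<forall>a. a \<notin> E \<longrightarrow> d a = 0) \<and> (\<exists>a. d a \<noteq> 0) \<and>
    (\<forall>k\<in>Kc. hat (ic c) k * hat (ic d) k = 0)"
proof (rule ccontr)
  assume neg: "\<not> ?thesis"
  have E0: "E \<noteq> {}" using card_E m_pos by (metis card.empty less_numeral_extra(3) totient_gt_0_iff)
  then obtain a1 where a1: "a1 \<in> E" by blast
  \<comment> \<open>\<open>C\<close> bounds the growth of coefficients under multiplication by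
    \<open>c\<close>; \<open>H\<close> is chosen so that \<open>(H + 1) ^ card E\<close> exceeds
    \<open>(2 * C * H + 1) ^ (card E - 1)\<close>.\<close>
  obtain C :: nat where C: "sqrt (real L * real m * nQ (ic c)) \<le> real C" using real_arch_simple by blast
  define H where "H = (2 * C + 1) ^ (card E - 1)"
  define ext where "ext = (\<lambda>(d::nat \<Rightarrow> int) a. if a \<in> E then d a else 0)"
  define F where "F = (\<lambda>d. red (conv c (ext d)))"
  let ?D = "Pi\<^sub>E E (\<lambda>_. {0..int H})"
  let ?R = "Pi\<^sub>E (E - {a1}) (\<lambda>_. {- int (C * H)..int (C * H)})"
  have Fhat: "hat (ic (F d)) k = hat (ic c) k * hat (ic (ext d)) k" if "k \<in> Kc" for d k
    using that by (simp only: F_def hat_red hat_iconv)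
  have Fbound: "\<bar>F d a\<bar> \<le> int (C * H)" if d: "d \<in> ?D" for d a
  proof -
    have "(\<Sum>a<m. \<bar>real_of_int (ext d a)\<bar>) \<le> (\<Sum>a<m. real H)"
    proof (intro sum_mono)
      fix a show "\<bar>real_of_int (ext d a)\<bar> \<le> real H" using PiE_mem[OF d, of a] by (auto simp: ext_def)
    qed
    then have b: "cmod (hat (ic (ext d)) k) \<le> real m * real H" for k
      using hat_bound[of "ext d" k] by simp
    have 1: "real m * (real_of_int (F d a))\<^sup>2 \<le> real L * nQ (ic (F d))"
      by (rule coef_bound_int) (simp add: F_def red_supp)
    have "nQ (ic (F d)) \<le> (\<Sum>k\<in>Kc. (cmod (hat (ic c) k))\<^sup>2 * (real m * real H)\<^sup>2)"
      unfolding nQ_def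
    proof (intro sum_mono)
      fix k assume k: "k \<in> Kc"
      have "(cmod (hat (ic (ext d)) k))\<^sup>2 \<le> (real m * real H)\<^sup>2" using b by (intro power_mono) auto
      then have "(cmod (hat (ic c) k))\<^sup>2 * (cmod (hat (ic (ext d)) k))\<^sup>2 \<le> (cmod (hat (ic c) k))\<^sup>2 * (real m * real H)\<^sup>2"
        by (intro mult_left_mono) auto
      then show "(cmod (hat (ic (F d)) k))\<^sup>2 \<le> (cmod (hat (ic c) k))\<^sup>2 * (real m * real H)\<^sup>2"
        by (simp only: Fhat[OF k] norm_mult power_mult_distrib)
    qed
    also have "\<dots> = nQ (ic c) * (real m * real H)\<^sup>2" by (simp add: nQ_def sum_distrib_right)
    finally have "real L * nQ (ic (F d)) \<le> real L * (nQ (ic c) * (real m * real H)\<^sup>2)"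
      by (intro mult_left_mono) auto
    with 1 have "real m * (real_of_int (F d a))\<^sup>2 \<le> real L * (nQ (ic c) * (real m * real H)\<^sup>2)" by simp
    then have "real m * (real_of_int (F d a))\<^sup>2 \<le> real m * ((real L * real m * nQ (ic c)) * (real H)\<^sup>2)"
      by (simp add: power2_eq_square mult_ac)
    then have "(real_of_int (F d a))\<^sup>2 \<le> (real L * real m * nQ (ic c)) * (real H)\<^sup>2"
      using m_pos by simp
    then have "\<bar>real_of_int (F d a)\<bar> \<le> sqrt ((real L * real m * nQ (ic c)) * (real H)\<^sup>2)"
      using real_sqrt_le_mono by fastforce
    also have "\<dots> = sqrt (real L * real m * nQ (ic c)) * real H" by (simp add: real_sqrt_mult)
    also have "\<dots> \<le> real C * real H" using C by (intro mult_right_mono) auto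
    finally have "real_of_int \<bar>F d a\<bar> \<le> real_of_int (int (C * H))" by simp
    then show ?thesis by (simp only: of_int_le_iff)
  qed
  have inj: "inj_on (\<lambda>d. restrict (F d) (E - {a1})) ?D"
  proof (rule inj_onI)
    fix d d' assume dd: "d \<in> ?D" "d' \<in> ?D" and eq: "restrict (F d) (E - {a1}) = restrict (F d') (E - {a1})"
    have eqa: "F d a = F d' a" if "a \<noteq> a1" for a
    proof (cases "a \<in> E")
      case True
      then show ?thesis using fun_cong[OF eq, of a] that by simp
    qed (simp add: F_def red_supp)
    have split: "hat (ic (F d)) k0 = of_int (F d a1) * w (int (k0 * a1)) + (\<Sum>a\<in>{..<m} - {a1}. of_int (F d a) * w (int (k0 * a)))" for d
      unfolding hat_def using a1 E_less[of a1] by (subst sum.remove[of _ a1]) auto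
    have "hat (ic (F d)) k0 = 0" "hat (ic (F d')) k0 = 0" using k0 by (simp_all add: Fhat)
    moreover have "(\<Sum>a\<in>{..<m} - {a1}. of_int (F d a) * w (int (k0 * a))) = (\<Sum>a\<in>{..<m} - {a1}. of_int (F d' a) * w (int (k0 * a)))"
      by (intro sum.cong refl) (simp add: eqa)
    ultimately have "of_int (F d a1) * w (int (k0 * a1)) = of_int (F d' a1) * w (int (k0 * a1))"
      unfolding split by (metis add_right_cancel)
    moreover have "w (int (k0 * a1)) \<noteq> 0" using norm_w by (metis norm_zero zero_neq_one)
    ultimately have "F d a1 = F d' a1" by simp
    with eqa have "F d a = F d' a" for a by (cases "a = a1") auto
    then have FF: "F d = F d'" by (rule ext)
    define e where "e = (\<lambda>a. ext d a - ext d' a)"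
    have "\<forall>k\<in>Kc. hat (ic c) k * hat (ic e) k = 0"
    proof
      fix k assume k: "k \<in> Kc"
      have "hat (ic e) k = hat (ic (ext d)) k - hat (ic (ext d')) k" by (simp add: e_def hat_diff)
      moreover have "hat (ic c) k * hat (ic (ext d)) k = hat (ic c) k * hat (ic (ext d')) k"
        unfolding Fhat[OF k, symmetric] by (simp only: FF)
      ultimately show "hat (ic c) k * hat (ic e) k = 0"
        by (simp only: right_diff_distrib diff_self)
    qed
    moreover have "\<forall>a. a \<notin> E \<longrightarrow> e a = 0" by (simp add: e_def ext_def)
    ultimately have "\<forall>a. e a = 0" using neg by blast
    then have "d a = d' a" if "a \<in> E" for a using that by (metis (full_types) e_def eq_iff_diff_eq_0 ext_def)
    with dd show "d = d'" by (intro PiE_ext) auto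
  qed
  have "(\<lambda>d. restrict (F d) (E - {a1})) ` ?D \<subseteq> ?R"
  proof (rule image_subsetI)
    fix d assume "d \<in> ?D"
    from Fbound[OF this] show "restrict (F d) (E - {a1}) \<in> ?R"
      by (simp add: abs_le_iff PiE_iff) (meson minus_le_iff)
  qed
  from card_inj_on_le[OF inj this] have "card ?D \<le> card ?R" by (simp add: finite_PiE)
  moreover have "card {- int (C * H)..int (C * H)} = 2 * (C * H) + 1"
    by (simp only: card_atLeastAtMost_int)
  moreover have "card {0..int H} = H + 1" by simp
  ultimately have "(H + 1) ^ card E \<le> (2 * (C * H) + 1) ^ (card E - 1)"
    using a1 by (simp only: card_PiE finite_E finite_Diff prod_constant card_Diff_singleton)
  also have "\<dots> \<le> ((2 * C + 1) * (H + 1)) ^ (card E - 1)"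
    by (intro power_mono) (auto simp: algebra_simps)
  also have "\<dots> = H * (H + 1) ^ (card E - 1)" by (simp only: power_mult_distrib H_def[symmetric])
  also have "\<dots> < (H + 1) * (H + 1) ^ (card E - 1)" by simp
  also have "\<dots> = (H + 1) ^ card E"
    using E0 by (metis card_gt_0_iff finite_E power_eq_if less_numeral_extra(3))
  finally show False by simp
qed

text \<open>An element with one zero conjugate has a nonzero annihilator, and a nonzero conjugate of
  the annihilator spreads the zero to all embeddings. This is the irreducibility of the cyclotomic
  polynomial.\<close>

theorem hat_domain:
  fixes c :: "nat \<Rightarrow> int"
  assumes "k0 \<in> Kc" "hat (ic c) k0 = 0" "k \<in> Kc"
  shows "hat (ic c) k = 0"
proof -
  obtain d :: "nat \<Rightarrow> int" where d: "\<forall>a. a \<notin> E \<longrightarrow> d a = 0" "\<exists>a. d a \<noteq> 0"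
    "\<forall>k\<in>Kc. hat (ic c) k * hat (ic d) k = 0"
    using annihilator[OF assms(1,2)] by blast
  obtain k1 where "k1 \<in> Kc" "hat (ic d) k1 \<noteq> 0"
    using supp_zero_int[of d] d by blast
  with frobenius_orbit[of c d k1 k] d assms(3) show ?thesis by blast
qed

section \<open>The trace form in integer coefficients\<close>

lemma Kc_P: "Kc = {k. k < m \<and> (\<forall>p\<in>P. \<not> p dvd k)}"
proof (intro Set.set_eqI iffI)
  fix k assume "k \<in> Kc"
  then show "k \<in> {k. k < m \<and> (\<forall>p\<in>P. \<not> p dvd k)}"
    using dvd_P prime_P by (auto simp: Kc_def) (metis coprime_common_divisor not_prime_unit)
qed (use not_coprime_P in blast)

text \<open>The trace of \<open>\<zeta>^a\<close>, in the closed form that the program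
  tabulates.\<close>

definition T :: "nat \<Rightarrow> int" where
  "T a = (if m1 dvd a then int m1 * (\<Prod>p\<in>P. if p dvd a div m1 then int p - 1 else -1) else 0)"

lemma sum_Kc_w: "(\<Sum>k\<in>Kc. w (int (k * a))) = of_int (T a)"
proof -
  have "m1 * \<Prod>P = m" using m_eq by (simp add: m0_def)
  then show ?thesis
    using ramanujan_sum[of P m1 a] prime_P m1_pos
    by (simp add: Kc_P[symmetric] T_def w_def mult_ac)
qed

text \<open>The bilinear trace form; \<open>m - b\<close> stands for the exponent \<open>- b\<close>
  modulo \<open>m\<close>.\<close>

definition B :: "(nat \<Rightarrow> real) \<Rightarrow> (nat \<Rightarrow> real) \<Rightarrow> real" where
  "B c d = (\<Sum>a<m. \<Sum>b<m. c a * d b * of_int (T ((a + (m - b)) mod m)))"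

lemma B_hat: "(\<Sum>k\<in>Kc. hat (rc c) k * cnj (hat (rc d) k)) = of_real (B c d)"
proof -
  have "(\<Sum>k\<in>Kc. hat (rc c) k * cnj (hat (rc d) k))
     = (\<Sum>k\<in>Kc. \<Sum>a<m. \<Sum>b<m. of_real (c a * d b) * w (int (k * ((a + (m - b)) mod m))))"
  proof (intro sum.cong refl)
    fix k
    have "w (int (k * a)) * w (- int (k * b)) = w (int (k * ((a + (m - b)) mod m)))" if "b < m" for a b
    proof -
      have "[int (k * a) + - int (k * b) = int (k * (a + (m - b)))] (mod int m)"
      proof -
        have "int (k * (a + (m - b))) = int k * (int a + int m - int b)" using that by (simp add: of_nat_diff)
        then have "int (k * a) + - int (k * b) - int (k * (a + (m - b))) = int m * (- int k)"
          by (simp add: algebra_simps)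
        then show ?thesis unfolding cong_iff_dvd_diff by (simp only: dvd_triv_left)
      qed
      then have "w (int (k * a) + - int (k * b)) = w (int (k * (a + (m - b))))" by (rule w_cong)
      then show ?thesis unfolding w_mod w_add .
    qed
    then show "hat (rc c) k * cnj (hat (rc d) k) = (\<Sum>a<m. \<Sum>b<m. of_real (c a * d b) * w (int (k * ((a + (m - b)) mod m))))"
      unfolding hat_def cnj_sum sum_product by (intro sum.cong refl) (simp add: cnj_w mult_ac)
  qed
  also have "\<dots> = (\<Sum>a<m. \<Sum>k\<in>Kc. \<Sum>b<m. of_real (c a * d b) * w (int (k * ((a + (m - b)) mod m))))"
    by (rule sum.swap)
  also have "\<dots> = (\<Sum>a<m. \<Sum>b<m. \<Sum>k\<in>Kc. of_real (c a * d b) * w (int (k * ((a + (m - b)) mod m))))"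
    by (intro sum.cong refl sum.swap)
  also have "\<dots> = of_real (B c d)"
    unfolding sum_distrib_left[symmetric] sum_Kc_w by (simp add: B_def)
  finally show ?thesis .
qed

lemma nQ_B: "nQ (rc c) = B c c"
proof -
  have "complex_of_real (nQ (rc c)) = of_real (B c c)"
    unfolding B_hat[symmetric] nQ_def of_real_sum by (intro sum.cong refl) (simp only: complex_norm_square)
  then show ?thesis by (simp only: of_real_eq_iff)
qed

end

lemma norm_add_square: "(cmod (a + b))\<^sup>2 = (cmod a)\<^sup>2 + 2 * Re (a * cnj b) + (cmod b)\<^sup>2"
  by (simp only: cmod_power2) (simp add: power2_eq_square algebra_simps)

lemma Re_of_real_mult: "Re (of_real r * z) = r * Re z"
  by simp

section \<open>Averaging over a family of lattices\<close>

context cyc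
begin

definition ev :: "nat \<Rightarrow> nat" where "ev i = sorted_list_of_set E ! i"
definition idx :: "nat \<Rightarrow> nat" where "idx = inv_into {..<card E} ev"
definition up :: "(nat \<Rightarrow> 'a::zero) \<Rightarrow> nat \<Rightarrow> 'a" where "up c a = (if a \<in> E then c (idx a) else 0)"

lemma bij_ev: "bij_betw ev {..<card E} E"
  unfolding ev_def by (rule bij_betw_nth) auto

lemma ev_E: "i < card E \<Longrightarrow> ev i \<in> E"
  using bij_ev by (auto simp: bij_betw_def)

lemma idx_ev [simp]: "i < card E \<Longrightarrow> idx (ev i) = i"
  unfolding idx_def using bij_ev by (intro inv_into_f_f) (auto simp: bij_betw_def)

lemma idx_less: "a \<in> E \<Longrightarrow> idx a < card E" and ev_idx [simp]: "a \<in> E \<Longrightarrow> ev (idx a) = a"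
  unfolding idx_def using bij_ev inv_into_into[of a ev "{..<card E}"] f_inv_into_f[of a ev "{..<card E}"]
  by (auto simp: bij_betw_def)

lemma up_supp: "a \<notin> E \<Longrightarrow> up c a = 0" by (simp add: up_def)

lemma up_down: "(\<And>a. a \<notin> E \<Longrightarrow> y a = 0) \<Longrightarrow> up (\<lambda>i. y (ev i)) = y"
  by (auto simp: up_def fun_eq_iff)

lemma hat_E: assumes "\<And>a. a \<notin> E \<Longrightarrow> c a = 0" shows "hat c k = (\<Sum>a\<in>E. c a * w (int (k * a)))"
  unfolding hat_def by (rule sum.mono_neutral_right) (use assms E_less in auto)

lemma hat_up: "hat (rc (up c)) k = (\<Sum>i<card E. of_real (c i) * w (int (k * ev i)))"
proof -
  have "hat (rc (up c)) k = (\<Sum>a\<in>E. of_real (up c a) * w (int (k * a)))"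
    by (rule hat_E) (simp add: up_supp)
  also have "\<dots> = (\<Sum>i<card E. of_real (up c (ev i)) * w (int (k * ev i)))"
    by (rule sum.reindex_bij_betw[OF bij_ev, symmetric])
  also have "\<dots> = (\<Sum>i<card E. of_real (c i) * w (int (k * ev i)))"
    by (intro sum.cong refl) (simp add: up_def ev_E)
  finally show ?thesis .
qed

text \<open>Gram matrix of the basis \<open>E\<close> for the trace form with weight
  \<open>\<rho> k\<close> at the embedding \<open>k\<close>. The squares of
  \<open>cmod (hat x k)\<close> as weights give the lattice of the principal ideal of
  \<open>x\<close>.\<close>

definition Gr :: "(nat \<Rightarrow> real) \<Rightarrow> nat \<Rightarrow> nat \<Rightarrow> real" where
  "Gr \<rho> i j = (\<Sum>k\<in>Kc. \<rho> k * Re (w (int (k * ev i)) * cnj (w (int (k * ev j)))))"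

lemma gram_form:
  "(\<Sum>i<card E. \<Sum>j<card E. c i * c j * Gr \<rho> i j) = (\<Sum>k\<in>Kc. \<rho> k * (cmod (hat (rc (up c)) k))\<^sup>2)"
proof -
  have "(\<Sum>i<card E. \<Sum>j<card E. c i * c j * Gr \<rho> i j)
    = (\<Sum>i<card E. \<Sum>j<card E. \<Sum>k\<in>Kc. \<rho> k * (c i * c j * Re (w (int (k * ev i)) * cnj (w (int (k * ev j))))))"
    unfolding Gr_def sum_distrib_left by (intro sum.cong refl) (simp only: mult_ac)
  also have "\<dots> = (\<Sum>i<card E. \<Sum>k\<in>Kc. \<Sum>j<card E. \<rho> k * (c i * c j * Re (w (int (k * ev i)) * cnj (w (int (k * ev j))))))"
    by (intro sum.cong refl sum.swap)
  also have "\<dots> = (\<Sum>k\<in>Kc. \<Sum>i<card E. \<Sum>j<card E. \<rho> k * (c i * c j * Re (w (int (k * ev i)) * cnj (w (int (k * ev j))))))"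
    by (rule sum.swap)
  also have "\<dots> = (\<Sum>k\<in>Kc. \<rho> k * (cmod (hat (rc (up c)) k))\<^sup>2)"
  proof (intro sum.cong refl)
    fix k
    have "complex_of_real ((cmod (hat (rc (up c)) k))\<^sup>2) = hat (rc (up c)) k * cnj (hat (rc (up c)) k)"
      by (rule complex_norm_square)
    then have "(cmod (hat (rc (up c)) k))\<^sup>2 = Re (hat (rc (up c)) k * cnj (hat (rc (up c)) k))"
      by (metis Re_complex_of_real)
    also have "\<dots> = (\<Sum>i<card E. \<Sum>j<card E. Re ((of_real (c i) * w (int (k * ev i))) * cnj (of_real (c j) * w (int (k * ev j)))))"
      unfolding hat_up cnj_sum sum_product Re_sum ..
    also have "\<dots> = (\<Sum>i<card E. \<Sum>j<card E. c i * c j * Re (w (int (k * ev i)) * cnj (w (int (k * ev j)))))"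
    proof (intro sum.cong refl)
      fix i j
      have "(of_real (c i) * w (int (k * ev i))) * cnj (of_real (c j) * w (int (k * ev j)))
        = of_real (c i * c j) * (w (int (k * ev i)) * cnj (w (int (k * ev j))))" by simp
      then show "Re ((of_real (c i) * w (int (k * ev i))) * cnj (of_real (c j) * w (int (k * ev j))))
        = c i * c j * Re (w (int (k * ev i)) * cnj (w (int (k * ev j))))"
        by (simp only: Re_of_real_mult)
    qed
    finally show "(\<Sum>i<card E. \<Sum>j<card E. \<rho> k * (c i * c j * Re (w (int (k * ev i)) * cnj (w (int (k * ev j))))))
      = \<rho> k * (cmod (hat (rc (up c)) k))\<^sup>2" by (simp add: sum_distrib_left)
  qed
  finally show ?thesis .
qed

definition frame :: "(nat \<Rightarrow> real) \<Rightarrow> (nat \<Rightarrow> nat \<Rightarrow> real) \<Rightarrow> bool" where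
  "frame \<rho> b \<longleftrightarrow> tri (card E) b \<and> (\<forall>i<card E. \<forall>j<card E. (\<Sum>l<card E. b i l * b j l) = Gr \<rho> i j)"

lemma frame_tri: "frame \<rho> b \<Longrightarrow> tri (card E) b" by (simp add: frame_def)

text \<open>Cholesky applies: where the form vanishes, all conjugates of a real combination of
  \<open>E\<close> vanish, and \<open>supp_zero\<close> makes it trivial.\<close>

lemma frame_exists:
  assumes pos: "\<And>k. k \<in> Kc \<Longrightarrow> 0 < \<rho> k"
  shows "\<exists>b. frame \<rho> b"
  unfolding frame_def
proof (rule cholesky)
  show "Gr \<rho> i j = Gr \<rho> j i" for i j
    unfolding Gr_def by (intro sum.cong refl) (simp add: mult.commute)
  fix c :: "nat \<Rightarrow> real"
  assume "\<exists>i<card E. c i \<noteq> 0"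
  then obtain i where i: "i < card E" "c i \<noteq> 0" by blast
  have "\<exists>k\<in>Kc. hat (rc (up c)) k \<noteq> 0"
  proof (rule ccontr)
    assume "\<not> ?thesis"
    then have "up c (ev i) = 0" using supp_zero[of "up c" "ev i"] up_supp[of _ c] by blast
    with i show False by (simp add: up_def ev_E)
  qed
  then obtain k where k: "k \<in> Kc" "hat (rc (up c)) k \<noteq> 0" by blast
  have "0 < \<rho> k * (cmod (hat (rc (up c)) k))\<^sup>2" using pos k by simp
  then have "0 < (\<Sum>k\<in>Kc. \<rho> k * (cmod (hat (rc (up c)) k))\<^sup>2)"
    using k pos by (intro sum_pos2[of Kc k]) (auto intro!: mult_nonneg_nonneg simp: less_imp_le)
  then show "0 < (\<Sum>i<card E. \<Sum>j<card E. c i * c j * Gr \<rho> i j)" by (simp only: gram_form)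
qed

lemma frame_nsq:
  assumes "frame \<rho> b"
  shows "nsq (card E) (comb (card E) b c) = (\<Sum>k\<in>Kc. \<rho> k * (cmod (hat (rc (up c)) k))\<^sup>2)"
  unfolding gram_form[symmetric] using assms by (intro nsq_comb) (auto simp: frame_def)

text \<open>A diagonal entry is at most the length of its row, and all conjugates of a root of unity
  have absolute value 1.\<close>

lemma frame_diag:
  assumes "frame \<rho> b" "i < card E"
  shows "b i i \<le> sqrt (\<Sum>k\<in>Kc. \<rho> k)"
proof -
  have "(b i i)\<^sup>2 \<le> (\<Sum>l<card E. (b i l)\<^sup>2)"
    using assms(2) by (intro member_le_sum) auto
  also have "\<dots> = Gr \<rho> i i"
    using assms by (auto simp: frame_def power2_eq_square)
  also have "\<dots> = (\<Sum>k\<in>Kc. \<rho> k)"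
    unfolding Gr_def by (intro sum.cong refl) (simp add: cnj_w flip: w_add)
  finally show ?thesis by (rule real_le_rsqrt)
qed

text \<open>Completing the square. The vector \<open>U\<close> has complex entries and need not lie
  in the real span of the lattice; \<open>z\<close> models its projection to the span, and
  \<open>g\<close> is its squared distance from it, whence the sign.\<close>

lemma frame_shift:
  assumes fr: "frame (\<lambda>k. (cmod (X k))\<^sup>2) b"
  shows "\<exists>z g. 0 \<le> g \<and> (\<forall>c. (\<Sum>k\<in>Kc. (cmod (X k * hat (rc (up c)) k + U k))\<^sup>2)
     = nsq (card E) (\<lambda>j. comb (card E) b c j + z j) + g)"
proof -
  let ?n = "card E"
  define v where "v = (\<lambda>j. \<Sum>k\<in>Kc. Re (X k * w (int (k * ev j)) * cnj (U k)))"
  obtain z where z: "\<And>j. j < ?n \<Longrightarrow> (\<Sum>l<?n. b j l * z l) = v j"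
    using tri_solve[OF frame_tri[OF fr], of v] by blast
  define g where "g = (\<Sum>k\<in>Kc. (cmod (U k))\<^sup>2) - nsq ?n z"
  have eq: "(\<Sum>k\<in>Kc. (cmod (X k * hat (rc (up c)) k + U k))\<^sup>2) = nsq ?n (\<lambda>j. comb ?n b c j + z j) + g" for c
  proof -
    have "(\<Sum>k\<in>Kc. Re (X k * hat (rc (up c)) k * cnj (U k))) = (\<Sum>k\<in>Kc. \<Sum>i<?n. c i * Re (X k * w (int (k * ev i)) * cnj (U k)))"
    proof (intro sum.cong refl)
      fix k
      have "X k * hat (rc (up c)) k * cnj (U k) = (\<Sum>i<?n. of_real (c i) * (X k * w (int (k * ev i)) * cnj (U k)))"
        unfolding hat_up by (simp add: sum_distrib_left sum_distrib_right mult_ac)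
      then have "Re (X k * hat (rc (up c)) k * cnj (U k)) = (\<Sum>i<?n. Re (of_real (c i) * (X k * w (int (k * ev i)) * cnj (U k))))"
        by (simp only: Re_sum)
      also have "\<dots> = (\<Sum>i<?n. c i * Re (X k * w (int (k * ev i)) * cnj (U k)))"
        by (intro sum.cong refl Re_of_real_mult)
      finally show "Re (X k * hat (rc (up c)) k * cnj (U k)) = (\<Sum>i<?n. c i * Re (X k * w (int (k * ev i)) * cnj (U k)))" .
    qed
    also have "\<dots> = (\<Sum>i<?n. \<Sum>k\<in>Kc. c i * Re (X k * w (int (k * ev i)) * cnj (U k)))" by (rule sum.swap)
    also have "\<dots> = (\<Sum>i<?n. c i * v i)" by (simp add: v_def sum_distrib_left)
    also have "\<dots> = (\<Sum>i<?n. \<Sum>l<?n. c i * (b i l * z l))"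
      by (intro sum.cong refl) (simp add: z[symmetric] sum_distrib_left)
    also have "\<dots> = (\<Sum>l<?n. \<Sum>i<?n. c i * (b i l * z l))" by (rule sum.swap)
    also have "\<dots> = dot ?n z (comb ?n b c)"
      by (simp add: dot_def comb_def sum_distrib_left mult_ac)
    finally have cross: "(\<Sum>k\<in>Kc. Re (X k * hat (rc (up c)) k * cnj (U k))) = dot ?n z (comb ?n b c)" .
    have "(\<Sum>k\<in>Kc. (cmod (X k * hat (rc (up c)) k + U k))\<^sup>2)
      = (\<Sum>k\<in>Kc. (cmod (X k))\<^sup>2 * (cmod (hat (rc (up c)) k))\<^sup>2 + 2 * Re (X k * hat (rc (up c)) k * cnj (U k)) + (cmod (U k))\<^sup>2)"
      by (intro sum.cong refl) (simp only: norm_add_square norm_mult power_mult_distrib)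
    also have "\<dots> = nsq ?n (comb ?n b c) + 2 * dot ?n z (comb ?n b c) + (\<Sum>k\<in>Kc. (cmod (U k))\<^sup>2)"
      by (simp only: sum.distrib frame_nsq[OF fr] cross[symmetric] sum_distrib_left)
    also have "\<dots> = nsq ?n (\<lambda>j. comb ?n b c j + z j) + g"
      by (simp add: nsq_add g_def)
    finally show ?thesis .
  qed
  \<comment> \<open>Real coefficients that cancel \<open>z\<close> exhibit \<open>g\<close> as a sum
    of squares.\<close>
  obtain c where c: "\<And>j. j < ?n \<Longrightarrow> comb ?n b c j = - z j"
    using comb_solve[OF frame_tri[OF fr], of "\<lambda>j. - z j"] by blast
  have "nsq ?n (\<lambda>j. comb ?n b c j + z j) = 0" by (simp add: nsq_def c)
  then have "g = (\<Sum>k\<in>Kc. (cmod (X k * hat (rc (up c)) k + U k))\<^sup>2)" by (simp add: eq)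
  then have "0 \<le> g" by (simp add: sum_nonneg)
  with eq show ?thesis by blast
qed

lemma frame_one: "\<exists>b. frame (\<lambda>_. 1) b"
  by (rule frame_exists) simp

definition bR :: "nat \<Rightarrow> nat \<Rightarrow> real" where "bR = (SOME b. frame (\<lambda>_. 1) b)"

lemma bR: "frame (\<lambda>_. 1) bR"
  unfolding bR_def by (rule someI_ex[OF frame_one])

lemma bR_tri: "tri (card E) bR" by (rule frame_tri[OF bR])

text \<open>The covolume of the ring, that is, the square root of the absolute discriminant. It is
  not evaluated but bounded, by \<open>D_ge\<close> and \<open>D_le\<close>.\<close>

definition D :: real where "D = (\<Prod>i<card E. bR i i)"

lemma D_pos: "0 < D"
  unfolding D_def by (rule prod_diag_pos[OF bR_tri])

lemma bR_nsq: "nsq (card E) (comb (card E) bR c) = nQ (rc (up c))"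
  by (simp add: frame_nsq[OF bR] nQ_def)

lemma bR_diag: "i < card E \<Longrightarrow> bR i i \<le> sqrt (real (card E))"
  using frame_diag[OF bR] by (simp add: card_Kc card_E)

text \<open>Gram-Schmidt: row \<open>i\<close> minus its projection to the earlier rows has norm
  \<open>b i i\<close>.\<close>

lemma tri_diag_attained:
  assumes b: "tri k b" and i: "i < k"
  shows "\<exists>c. c i = 1 \<and> nsq k (comb k b c) = (b i i)\<^sup>2"
proof -
  have "tri i b" using b i by (auto simp: tri_def)
  from comb_solve[OF this, of "\<lambda>l. - b i l"] obtain c where
    c: "\<And>l. l < i \<Longrightarrow> comb i b c l = - b i l" by blast
  define c' where "c' = (\<lambda>j. if j < i then c j else if j = i then 1 else 0)"
  have comb: "comb k b c' l = (\<Sum>j<i. c j * b j l) + b i l" for l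
  proof -
    have "comb k b c' l = (\<Sum>j\<in>{..<i} \<union> {i}. c' j * b j l)"
      unfolding comb_def using i by (intro sum.mono_neutral_right) (auto simp: c'_def)
    also have "\<dots> = (\<Sum>j<i. c' j * b j l) + b i l"
      by (subst sum.union_disjoint) (auto simp: c'_def)
    also have "(\<Sum>j<i. c' j * b j l) = (\<Sum>j<i. c j * b j l)"
      by (intro sum.cong) (auto simp: c'_def)
    finally show ?thesis .
  qed
  have val: "comb k b c' l = (if l = i then b i i else 0)" if l: "l < k" for l
  proof -
    consider "l < i" | "l = i" | "i < l" by linarith
    then show ?thesis
    proof cases
      case 1
      then show ?thesis using c[OF 1] by (simp add: comb) (simp add: comb_def)
    next
      case 2
      have "(\<Sum>j<i. c j * b j i) = 0" using b i by (intro sum.neutral) (auto simp: tri_def)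
      with 2 show ?thesis by (simp add: comb)
    next
      case 3
      have "(\<Sum>j<i. c j * b j l) = 0" using b 3 l by (intro sum.neutral) (auto simp: tri_def)
      with 3 show ?thesis using b i l by (simp add: comb tri_def)
    qed
  qed
  have "nsq k (comb k b c') = (\<Sum>l<k. if l = i then (b i i)\<^sup>2 else 0)"
    unfolding nsq_def by (intro sum.cong refl) (simp add: val)
  also have "\<dots> = (b i i)\<^sup>2" using i by simp
  finally show ?thesis by (intro exI[of _ c']) (simp add: c'_def)
qed

lemma L_pos: "0 < L" by (simp add: L_def)

text \<open>The combination from \<open>tri_diag_attained\<close> has coefficient 1 at
  \<open>i\<close>, but its other coefficients are only real; this is why \<open>coef_bound\<close>
  is stated for real coefficients.\<close>

lemma bR_diag_ge:
  assumes "i < card E"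
  shows "sqrt (real m / real L) \<le> bR i i"
proof -
  obtain c where c: "c i = 1" "nsq (card E) (comb (card E) bR c) = (bR i i)\<^sup>2"
    using tri_diag_attained[OF bR_tri assms] by blast
  have "real m * (up c (ev i))\<^sup>2 \<le> real L * nQ (rc (up c))"
    by (rule coef_bound) (auto simp: up_supp ev_E assms)
  then have "real m \<le> real L * (bR i i)\<^sup>2"
    using c assms by (simp add: up_def ev_E bR_nsq)
  then have "real m / real L \<le> (bR i i)\<^sup>2" using L_pos by (simp add: field_simps)
  then show ?thesis using tri_pos[OF bR_tri assms] by (intro real_le_lsqrt) auto
qed

lemma D_ge: "sqrt (real m / real L) ^ card E \<le> D"
proof -
  have "(\<Prod>i<card E. sqrt (real m / real L)) \<le> D"
    unfolding D_def by (intro prod_mono) (auto intro: bR_diag_ge)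
  then show ?thesis by simp
qed

lemma D_le: "D \<le> sqrt (real (card E)) ^ card E"
proof -
  have "D \<le> (\<Prod>i<card E. sqrt (real (card E)))"
    unfolding D_def by (intro prod_mono) (auto intro: bR_diag less_imp_le[OF tri_pos[OF bR_tri]])
  then show ?thesis by simp
qed

definition ZE :: "(nat \<Rightarrow> int) set" where "ZE = {y. \<forall>a. a \<notin> E \<longrightarrow> y a = 0}"

lemma finite_ZE_box: "finite {y \<in> ZE. \<forall>a. \<bar>y a\<bar> \<le> M}"
proof -
  have "{y \<in> ZE. \<forall>a. \<bar>y a\<bar> \<le> M} \<subseteq> (\<lambda>y a. if a \<in> E then y a else 0) ` (Pi\<^sub>E E (\<lambda>_. {-M..M}))"
  proof
    fix y assume y: "y \<in> {y \<in> ZE. \<forall>a. \<bar>y a\<bar> \<le> M}"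
    show "y \<in> (\<lambda>y a. if a \<in> E then y a else 0) ` (Pi\<^sub>E E (\<lambda>_. {-M..M}))"
    proof (rule image_eqI)
      show "y = (\<lambda>a. if a \<in> E then restrict y E a else 0)" using y by (auto simp: ZE_def)
      show "restrict y E \<in> Pi\<^sub>E E (\<lambda>_. {-M..M})" using y by (auto simp: abs_le_iff minus_le_iff)
    qed
  qed
  then show ?thesis by (rule finite_subset) (simp add: finite_PiE)
qed

lemma finite_ZE_ball: "finite {y \<in> ZE. nQ (ic y) \<le> c}"
proof -
  have "{y \<in> ZE. nQ (ic y) \<le> c} \<subseteq> {y \<in> ZE. \<forall>a. \<bar>y a\<bar> \<le> \<lceil>real L * c\<rceil>}"
  proof
    fix y assume y: "y \<in> {y \<in> ZE. nQ (ic y) \<le> c}"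
    have "\<bar>y a\<bar> \<le> \<lceil>real L * c\<rceil>" for a
    proof -
      have "1 * (real_of_int (y a))\<^sup>2 \<le> real m * (real_of_int (y a))\<^sup>2"
        using m_pos by (intro mult_right_mono) auto
      also have "\<dots> \<le> real L * nQ (ic y)"
        using y by (intro coef_bound_int) (auto simp: ZE_def)
      also have "\<dots> \<le> real L * c" using y by (intro mult_left_mono) auto
      finally have 1: "real_of_int ((y a)\<^sup>2) \<le> real L * c" by simp
      have "\<bar>y a\<bar> \<le> (y a)\<^sup>2" using self_le_power[of "\<bar>y a\<bar>" 2] by (cases "y a = 0") auto
      with 1 show ?thesis by linarith
    qed
    with y show "y \<in> {y \<in> ZE. \<forall>a. \<bar>y a\<bar> \<le> \<lceil>real L * c\<rceil>}" by auto
  qed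
  then show ?thesis by (rule finite_subset) (rule finite_ZE_box)
qed

lemma up_ev_ZE: "y \<in> ZE \<Longrightarrow> up (\<lambda>i. y (ev i)) = y"
  by (rule up_down) (simp add: ZE_def)

lemma up_of_int: "up (\<lambda>i. real_of_int (y i)) = (\<lambda>a. real_of_int (up y a))"
  by (auto simp: up_def)

lemma ZE_inj: "x \<in> ZE \<Longrightarrow> y \<in> ZE \<Longrightarrow> \<forall>i<card E. x (ev i) = y (ev i) \<Longrightarrow> x = y"
proof
  fix a assume *: "x \<in> ZE" "y \<in> ZE" "\<forall>i<card E. x (ev i) = y (ev i)"
  show "x a = y a"
  proof (cases "a \<in> E")
    case True
    then show ?thesis using *(3)[rule_format, OF idx_less[OF True]] by simp
  qed (use * in \<open>simp add: ZE_def\<close>)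
qed

lemma nQ_up_real: "y \<in> ZE \<Longrightarrow> nQ (rc (up (\<lambda>i. real_of_int (y (ev i))))) = nQ (ic y)"
  using up_of_int[of "\<lambda>i. y (ev i)"] up_ev_ZE[of y] by simp

lemma up_ZE: "up c \<in> ZE" by (simp add: ZE_def up_supp)

text \<open>Congruence modulo the principal ideal of \<open>x\<close>.\<close>

definition eqv :: "(nat \<Rightarrow> int) \<Rightarrow> (nat \<Rightarrow> int) \<Rightarrow> (nat \<Rightarrow> int) \<Rightarrow> bool" where
  "eqv x y y' \<longleftrightarrow> (\<exists>a\<in>ZE. \<forall>k\<in>Kc. hat (ic y) k = hat (ic y') k + hat (ic x) k * hat (ic a) k)"

lemma eqv_refl: "eqv x y y"
  unfolding eqv_def by (rule bexI[of _ "\<lambda>_. 0"]) (simp_all add: ZE_def hat_def)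

lemma eqv_sym: assumes "eqv x y y'" shows "eqv x y' y"
proof -
  obtain a where a: "a \<in> ZE" "\<forall>k\<in>Kc. hat (ic y) k = hat (ic y') k + hat (ic x) k * hat (ic a) k"
    using assms by (auto simp: eqv_def)
  have "hat (ic (\<lambda>i. - a i)) k = - hat (ic a) k" for k by (simp add: hat_def sum_negf)
  then show ?thesis unfolding eqv_def using a
    by (intro bexI[of _ "\<lambda>i. - a i"]) (auto simp: ZE_def)
qed

lemma eqv_trans: assumes "eqv x y y'" "eqv x y' y''" shows "eqv x y y''"
proof -
  obtain a where a: "a \<in> ZE" "\<forall>k\<in>Kc. hat (ic y) k = hat (ic y') k + hat (ic x) k * hat (ic a) k"
    using assms by (auto simp: eqv_def)
  obtain b where b: "b \<in> ZE" "\<forall>k\<in>Kc. hat (ic y') k = hat (ic y'') k + hat (ic x) k * hat (ic b) k"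
    using assms by (auto simp: eqv_def)
  show ?thesis unfolding eqv_def
  proof (rule bexI[of _ "\<lambda>i. a i + b i"])
    show "\<forall>k\<in>Kc. hat (ic y) k = hat (ic y'') k + hat (ic x) k * hat (ic (\<lambda>i. a i + b i)) k"
      using a(2) b(2) by (simp add: hat_add algebra_simps)
  qed (use a b in \<open>auto simp: ZE_def\<close>)
qed

lemma card_ball_le:
  assumes "0 < S"
  shows "real (card {v \<in> ZE. nQ (ic v) \<le> S\<^sup>2}) * D \<le> unit_ball_vol (real (card E)) * (S + real (card E)) ^ card E"
proof -
  have "real (card {v \<in> ZE. nQ (ic v) \<le> S\<^sup>2}) * (\<Prod>l<card E. bR l l)
    \<le> unit_ball_vol (real (card E)) * (S + sqrt (real (card E)) * sqrt (real (card E))) ^ card E"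
  proof (rule count_upper[OF bR_tri bR_diag, where co = "\<lambda>y i. y (ev i)" and z = "\<lambda>_. 0"])
    show "0 < S + sqrt (real (card E)) * sqrt (real (card E))" using assms by simp
    fix v assume v: "v \<in> {v \<in> ZE. nQ (ic v) \<le> S\<^sup>2}"
    then have "nsq (card E) (comb (card E) bR (\<lambda>i. real_of_int (v (ev i)))) \<le> S\<^sup>2"
      by (simp add: bR_nsq nQ_up_real)
    then show "sqrt (nsq (card E) (\<lambda>j. comb (card E) bR (\<lambda>i. real_of_int (v (ev i))) j + 0)) \<le> S"
      using assms by (simp add: real_le_lsqrt real_sqrt_le_iff')
  qed (auto intro: finite_ZE_ball ZE_inj)
  then show ?thesis by (simp add: D_def)
qed

text \<open>The index of the ideal generated by \<open>x\<close> is the quotient of the two covolumes; the bound is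
  obtained by counting the points of both lattices in large balls.\<close>

lemma index_bound:
  assumes x: "\<And>k. k \<in> Kc \<Longrightarrow> hat (ic x) k \<noteq> 0"
    and fr: "frame (\<lambda>k. (cmod (hat (ic x) k))\<^sup>2) b"
    and Y: "finite Y" "Y \<subseteq> ZE" "\<And>y y'. y \<in> Y \<Longrightarrow> y' \<in> Y \<Longrightarrow> eqv x y y' \<Longrightarrow> y = y'"
  shows "real (card Y) * D \<le> (\<Prod>l<card E. b l l)"
proof -
  let ?n = "card E"
  define Dx where "Dx = (\<Prod>l<?n. b l l)"
  define \<beta> where "\<beta> = sqrt (\<Sum>k\<in>Kc. (cmod (hat (ic x) k))\<^sup>2)"
  have Dx: "0 < Dx" unfolding Dx_def by (rule prod_diag_pos[OF frame_tri[OF fr]])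
  define R where "R = (\<lambda>y z g. 0 \<le> g \<and> (\<forall>c. (\<Sum>k\<in>Kc. (cmod (hat (ic x) k * hat (rc (up c)) k + hat (ic y) k))\<^sup>2)
     = nsq ?n (\<lambda>j. comb ?n b c j + z j) + g))"
  have "\<exists>z g. R y z g" for y
    unfolding R_def by (rule frame_shift[OF fr])
  then have "\<forall>y. \<exists>z g. R y z g" by blast
  from choice[OF this] obtain z where "\<forall>y. \<exists>g. R y (z y) g" by blast
  from choice[OF this] obtain g where R: "\<And>y. R y (z y) (g y)" by blast
  have g: "\<And>y. 0 \<le> g y"
    and zg: "\<And>y c. (\<Sum>k\<in>Kc. (cmod (hat (ic x) k * hat (rc (up c)) k + hat (ic y) k))\<^sup>2)
       = nsq ?n (\<lambda>j. comb ?n b c j + z y j) + g y"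
    using R unfolding R_def by blast+
  define \<Gamma> where "\<Gamma> = (\<Sum>y\<in>Y. g y)"
  define h where "h = (\<lambda>(y, c). red (\<lambda>a. conv x c a + y a))"
  have hhat: "hat (ic (h (y, c))) k = hat (ic x) k * hat (ic c) k + hat (ic y) k" if "k \<in> Kc" for y c k
    using that by (simp add: h_def hat_red hat_add hat_iconv)
  have hinj: "inj_on h (Y \<times> ZE)"
  proof (rule inj_onI, clarify)
    fix y c y' c' assume yc: "y \<in> Y" "y' \<in> Y" "c \<in> ZE" "c' \<in> ZE" and eq: "h (y, c) = h (y', c')"
    have hh: "hat (ic x) k * hat (ic c) k + hat (ic y) k = hat (ic x) k * hat (ic c') k + hat (ic y') k" if "k \<in> Kc" for k
      using hhat[OF that, of y c] hhat[OF that, of y' c'] eq by simp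
    have "eqv x y y'" unfolding eqv_def
    proof (rule bexI[of _ "\<lambda>i. c' i - c i"])
      show "\<forall>k\<in>Kc. hat (ic y) k = hat (ic y') k + hat (ic x) k * hat (ic (\<lambda>i. c' i - c i)) k"
      proof
        fix k assume k: "k \<in> Kc"
        have "hat (ic (\<lambda>i. c' i - c i)) k = hat (ic c') k - hat (ic c) k" by (simp add: hat_diff)
        then show "hat (ic y) k = hat (ic y') k + hat (ic x) k * hat (ic (\<lambda>i. c' i - c i)) k"
          using hh[OF k] by (simp only: right_diff_distrib) (simp add: algebra_simps)
      qed
    qed (use yc in \<open>auto simp: ZE_def\<close>)
    with Y(3) yc have yy: "y = y'" by blast
    have "c = c'"
    proof (rule supp_eq_int)
      fix k assume k: "k \<in> Kc"
      show "hat (ic c) k = hat (ic c') k" using hh[OF k] yy x[OF k] by simp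
    qed (use yc in \<open>auto simp: ZE_def\<close>)
    with yy show "y = y' \<and> c = c'" by simp
  qed
  define \<rho> where "\<rho> = sqrt (real ?n) * \<beta>"
  \<comment> \<open>Radius \<open>S - 1\<close> in the model leaves room for the distances
    \<open>g y \<le> \<Gamma>\<close>, since
    \<open>(S - 1)\<^sup>2 + \<Gamma> \<le> S\<^sup>2\<close> once
    \<open>\<Gamma> + 1 \<le> 2 * S\<close>.\<close>
  have main: "real (card Y) * (S - 1 - \<rho>) ^ ?n * D \<le> (S + real ?n) ^ ?n * Dx"
    if S: "1 + \<rho> < S" "\<Gamma> + 1 \<le> 2 * S" "0 < S" "1 < S" for S
  proof -
    define A where "A = (\<lambda>y. {c \<in> ZE. sqrt (nsq ?n (\<lambda>j. comb ?n b (\<lambda>i. real_of_int (c (ev i))) j + z y j)) \<le> S - 1})"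
    have hA: "h (y, c) \<in> {v \<in> ZE. nQ (ic v) \<le> S\<^sup>2}" if "y \<in> Y" "c \<in> A y" for y c
    proof -
      have c: "c \<in> ZE" using that by (simp add: A_def)
      have "nQ (ic (h (y, c))) = (\<Sum>k\<in>Kc. (cmod (hat (ic x) k * hat (ic c) k + hat (ic y) k))\<^sup>2)"
        unfolding nQ_def by (intro sum.cong refl) (simp only: hhat)
      also have "\<dots> = nsq ?n (\<lambda>j. comb ?n b (\<lambda>i. real_of_int (c (ev i))) j + z y j) + g y"
        using zg[of "\<lambda>i. real_of_int (c (ev i))" y] up_of_int[of "\<lambda>i. c (ev i)"] up_ev_ZE[OF c] by simp
      also have "\<dots> \<le> (S - 1)\<^sup>2 + \<Gamma>"
      proof (rule add_mono)
        show "nsq ?n (\<lambda>j. comb ?n b (\<lambda>i. real_of_int (c (ev i))) j + z y j) \<le> (S - 1)\<^sup>2"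
          using that S by (intro sqrt_le_D) (simp add: A_def)
        show "g y \<le> \<Gamma>" unfolding \<Gamma>_def using Y(1) that g by (intro member_le_sum) auto
      qed
      also have "\<dots> \<le> S\<^sup>2" using S by (simp add: power2_eq_square algebra_simps)
      finally show ?thesis by (simp add: h_def ZE_def red_supp)
    qed
    have sub: "h ` (Sigma Y A) \<subseteq> {v \<in> ZE. nQ (ic v) \<le> S\<^sup>2}" using hA by auto
    have subZ: "Sigma Y A \<subseteq> Y \<times> ZE" by (auto simp: A_def)
    have inj: "inj_on h (Sigma Y A)" by (rule inj_on_subset[OF hinj subZ])
    have finS: "finite (Sigma Y A)"
      by (rule inj_on_finite[OF inj sub finite_ZE_ball])
    have finA: "finite (A y)" if "y \<in> Y" for y
    proof -
      have "A y = snd ` (Sigma Y A \<inter> {y} \<times> UNIV)" using that by force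
      then show ?thesis using finS by simp
    qed
    have lower: "unit_ball_vol (real ?n) * (S - 1 - \<rho>) ^ ?n \<le> real (card (A y)) * Dx" if y: "y \<in> Y" for y
      unfolding Dx_def \<rho>_def
    proof (rule count_lower[OF frame_tri[OF fr], where co = "\<lambda>c i. c (ev i)" and z = "z y"])
      show "b i i \<le> \<beta>" if "i < ?n" for i unfolding \<beta>_def by (rule frame_diag[OF fr that])
      show "0 < S - 1 - sqrt (real ?n) * \<beta>" using S by (simp add: \<rho>_def)
      show "finite (A y)" by (rule finA[OF y])
      fix c :: "nat \<Rightarrow> int"
      assume c: "sqrt (nsq ?n (\<lambda>j. comb ?n b (\<lambda>i. of_int (c i)) j + z y j)) \<le> S - 1"
      have "comb ?n b (\<lambda>i. real_of_int (up c (ev i))) = comb ?n b (\<lambda>i. of_int (c i))"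
        by (auto simp: comb_def up_def ev_E fun_eq_iff intro!: sum.cong)
      with c have "up c \<in> A y" by (simp add: A_def up_ZE)
      moreover have "\<forall>i<?n. up c (ev i) = c i" by (simp add: up_def ev_E)
      ultimately show "\<exists>x\<in>A y. \<forall>i<?n. x (ev i) = c i" by blast
    qed
    have "real (card Y) * (unit_ball_vol (real ?n) * (S - 1 - \<rho>) ^ ?n) \<le> (\<Sum>y\<in>Y. real (card (A y)) * Dx)"
      using sum_mono[of Y "\<lambda>_. unit_ball_vol (real ?n) * (S - 1 - \<rho>) ^ ?n", OF lower] by simp
    also have "\<dots> = real (card (Sigma Y A)) * Dx"
      using Y(1) finA by (simp add: card_SigmaI sum_distrib_right)
    also have "card (Sigma Y A) \<le> card {v \<in> ZE. nQ (ic v) \<le> S\<^sup>2}"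
      by (rule card_inj_on_le[OF inj sub finite_ZE_ball])
    then have "real (card (Sigma Y A)) * Dx \<le> real (card {v \<in> ZE. nQ (ic v) \<le> S\<^sup>2}) * Dx"
      using Dx by (intro mult_right_mono) auto
    finally have "real (card Y) * (unit_ball_vol (real ?n) * (S - 1 - \<rho>) ^ ?n) * D
       \<le> real (card {v \<in> ZE. nQ (ic v) \<le> S\<^sup>2}) * Dx * D"
      using D_pos by (intro mult_right_mono) auto
    also have "\<dots> = (real (card {v \<in> ZE. nQ (ic v) \<le> S\<^sup>2}) * D) * Dx" by simp
    also have "\<dots> \<le> (unit_ball_vol (real ?n) * (S + real ?n) ^ ?n) * Dx"
      using Dx by (intro mult_right_mono card_ball_le S) auto
    finally have "unit_ball_vol (real ?n) * (real (card Y) * (S - 1 - \<rho>) ^ ?n * D)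
       \<le> unit_ball_vol (real ?n) * ((S + real ?n) ^ ?n * Dx)" by (simp only: mult_ac)
    then show ?thesis by (subst (asm) mult_le_cancel_left_pos) auto
  qed
  \<comment> \<open>The changes of the radius in both counts are negligible as \<open>S\<close>
    tends to infinity.\<close>
  have lim: "((\<lambda>S. real (card Y) * ((S - 1 - \<rho>) / (S + real ?n)) ^ ?n * D) \<longlongrightarrow> real (card Y) * 1 ^ ?n * D) at_top"
    by (intro tendsto_intros) real_asymp
  have "eventually (\<lambda>S. real (card Y) * ((S - 1 - \<rho>) / (S + real ?n)) ^ ?n * D \<le> Dx) at_top"
    using eventually_gt_at_top[of "1 + \<rho>"] eventually_ge_at_top[of "(\<Gamma> + 1) / 2"] eventually_gt_at_top[of 1]
  proof eventually_elim
    case (elim S)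
    then have "real (card Y) * (S - 1 - \<rho>) ^ ?n * D \<le> (S + real ?n) ^ ?n * Dx" by (intro main) auto
    moreover have "0 < (S + real ?n) ^ ?n" using elim by (intro zero_less_power) auto
    ultimately show ?case by (simp add: power_divide field_simps)
  qed
  then have "real (card Y) * 1 ^ ?n * D \<le> Dx"
    by (intro tendsto_upperbound[OF lim]) auto
  then show ?thesis by (simp add: Dx_def)
qed

end

text \<open>The common shape of the lattices of dimension \<open>2 * n\<close>: scaled copies of one
  basis on the diagonal, an arbitrary block \<open>v\<close> below. As \<open>v\<close> does not
  enter the diagonal, the covolume will not depend on \<open>u\<close>.\<close>

lemma block_tri:
  assumes b: "tri n b" and t: "0 < \<theta>" "0 < (t::real)"
    and B: "B = (\<lambda>i j. if i < n then (if j < n then \<theta> * b i j else 0)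
       else if j < n then v (i - n) j else t * b (i - n) (j - n))"
  shows "tri (2 * n) B" "(\<Prod>i<2 * n. B i i) = \<theta> ^ n * t ^ n * (\<Prod>i<n. b i i)\<^sup>2"
    and "nsq (2 * n) (comb (2 * n) B c) =
      nsq n (\<lambda>j. \<theta> * comb n b c j + (\<Sum>i<n. c (n + i) * v i j)) + t\<^sup>2 * nsq n (comb n b (\<lambda>i. c (n + i)))"
proof -
  have split: "{..<2 * n} = {..<n} \<union> (+) n ` {..<n}"
  proof (rule Set.set_eqI)
    fix i show "i \<in> {..<2 * n} \<longleftrightarrow> i \<in> {..<n} \<union> (+) n ` {..<n}"
      by (cases "i < n") (auto intro!: image_eqI[of i "(+) n" "i - n"])
  qed
  have disj: "{..<n} \<inter> (+) n ` {..<n} = {}" by auto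
  have sum: "(\<Sum>i<2 * n. g i) = (\<Sum>i<n. g i) + (\<Sum>i<n. g (n + i))" for g :: "nat \<Rightarrow> real"
    unfolding split using disj by (subst sum.union_disjoint) (auto simp: sum.reindex)
  show "tri (2 * n) B"
    unfolding tri_def
  proof (intro allI impI conjI)
    fix i assume i: "i < 2 * n"
    show "0 < B i i" using b t i unfolding B tri_def by auto
    fix j assume "j < 2 * n" "i < j"
    with i show "B i j = 0" using b unfolding B tri_def by auto
  qed
  have "(\<Prod>i<2 * n. B i i) = (\<Prod>i<n. B i i) * (\<Prod>i<n. B (n + i) (n + i))"
    unfolding split using disj by (subst prod.union_disjoint) (auto simp: prod.reindex)
  then show "(\<Prod>i<2 * n. B i i) = \<theta> ^ n * t ^ n * (\<Prod>i<n. b i i)\<^sup>2"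
    by (simp add: B prod.distrib power2_eq_square mult_ac)
  show "nsq (2 * n) (comb (2 * n) B c) =
      nsq n (\<lambda>j. \<theta> * comb n b c j + (\<Sum>i<n. c (n + i) * v i j)) + t\<^sup>2 * nsq n (comb n b (\<lambda>i. c (n + i)))"
    unfolding nsq_def comb_def sum
    by (simp add: B sum_distrib_left power_mult_distrib mult_ac flip: power_mult_distrib)
qed

section \<open>The family of lattices and its short vectors\<close>

context cyc
begin

text \<open>Representatives of the ring modulo \<open>N\<close>.\<close>

definition box :: "nat \<Rightarrow> (nat \<Rightarrow> int) set" where
  "box N = {u \<in> ZE. \<forall>a. 0 \<le> u a \<and> u a < int N}"

text \<open>Squared norm of the component \<open>u x + N y\<close> of a lattice vector; the other
  component contributes \<open>t\<^sup>2 * nQ (ic x)\<close>.\<close>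

definition latQ :: "nat \<Rightarrow> (nat \<Rightarrow> int) \<Rightarrow> (nat \<Rightarrow> int) \<Rightarrow> (nat \<Rightarrow> int) \<Rightarrow> real" where
  "latQ N u x y = nQ (ic (\<lambda>a. conv u x a + int N * y a))"

lemma latQ_eq: "latQ N u x y = (\<Sum>k\<in>Kc. (cmod (hat (ic x) k * hat (ic u) k + of_nat N * hat (ic y) k))\<^sup>2)"
  unfolding latQ_def nQ_def
  by (intro sum.cong refl) (simp add: hat_add hat_cmult hat_iconv mult.commute del: of_int_mult of_int_add
      flip: of_int_add of_int_mult add: of_int_add of_int_mult)

lemma hat_nonzero:
  assumes "x \<in> ZE" "x \<noteq> (\<lambda>_. 0)" "k \<in> Kc"
  shows "hat (ic x) k \<noteq> 0"
proof
  assume "hat (ic x) k = 0"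
  then have "\<forall>k\<in>Kc. hat (ic x) k = 0" using hat_domain assms(3) by blast
  then have "x a = 0" for a using supp_zero_int[of x a] assms(1) by (auto simp: ZE_def)
  with assms(2) show False by auto
qed

text \<open>Decompose \<open>y = y0 + x a\<close> with \<open>y0\<close> from a system of
  representatives modulo \<open>x\<close>. Then \<open>u x + N y = x (u + N a) + N y0\<close>, and
  \<open>u + N a\<close> determines \<open>u\<close> and \<open>a\<close> because \<open>u\<close>
  lies in the box. So each class contributes points of a translate of the ideal lattice of
  \<open>x\<close> in a ball, at most about volume over \<open>Dx\<close>, and there are at most
  \<open>Dx / D\<close> classes. The covolume \<open>Dx\<close> cancels, which makes the bound
  uniform in \<open>x\<close>.\<close>

lemma fibre_bound:
  assumes N: "0 < N" and x: "x \<in> ZE" "x \<noteq> (\<lambda>_. 0)"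
    and \<eta>: "0 < \<eta>" "real (card E) * nQ (ic x) \<le> 2 * \<eta>"
    and Z: "finite Z" "\<And>u y. (u, y) \<in> Z \<Longrightarrow> u \<in> box N \<and> y \<in> ZE \<and> latQ N u x y \<le> s\<^sup>2"
    and \<delta>: "4 * s\<^sup>2 * nQ (ic x) / (3 * \<eta>\<^sup>2) \<le> \<delta>" "\<delta> < 1"
  shows "real (card Z) * (1 - \<delta>) * D \<le> unit_ball_vol (real (card E)) * sqrt (s\<^sup>2 + \<eta>) ^ card E"
proof -
  let ?n = "card E"
  have xh: "\<And>k. k \<in> Kc \<Longrightarrow> hat (ic x) k \<noteq> 0" using hat_nonzero[OF x] .
  obtain b where fr: "frame (\<lambda>k. (cmod (hat (ic x) k))\<^sup>2) b"
    using frame_exists[of "\<lambda>k. (cmod (hat (ic x) k))\<^sup>2"] xh by auto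
  define Dx where "Dx = (\<Prod>l<?n. b l l)"
  have Dx: "0 < Dx" unfolding Dx_def by (rule prod_diag_pos[OF frame_tri[OF fr]])
  define V where "V = unit_ball_vol (real ?n) * sqrt (s\<^sup>2 + \<eta>) ^ ?n"
  have "0 \<le> s\<^sup>2 + \<eta>" using \<eta>(1) by (simp add: add_nonneg_nonneg less_imp_le)
  then have V: "0 \<le> V" by (simp add: V_def)
  define rep where "rep = (\<lambda>y. SOME y'. y' \<in> ZE \<and> eqv x y y')"
  have rep: "rep y \<in> ZE" "eqv x y (rep y)" if "y \<in> ZE" for y
    using someI[of "\<lambda>y'. y' \<in> ZE \<and> eqv x y y'" y] that eqv_refl by (auto simp: rep_def)
  have rep_eq: "rep y = rep y'" if "eqv x y y'" for y y'
  proof -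
    have "eqv x y = eqv x y'" using that eqv_sym eqv_trans by blast
    then show ?thesis by (simp add: rep_def)
  qed
  define \<alpha> where "\<alpha> = (\<lambda>y. SOME a. a \<in> ZE \<and> (\<forall>k\<in>Kc. hat (ic y) k = hat (ic (rep y)) k + hat (ic x) k * hat (ic a) k))"
  have \<alpha>: "\<alpha> y \<in> ZE" "\<And>k. k \<in> Kc \<Longrightarrow> hat (ic y) k = hat (ic (rep y)) k + hat (ic x) k * hat (ic (\<alpha> y)) k"
    if "y \<in> ZE" for y
  proof -
    have "\<exists>a. a \<in> ZE \<and> (\<forall>k\<in>Kc. hat (ic y) k = hat (ic (rep y)) k + hat (ic x) k * hat (ic a) k)"
      using rep(2)[OF that] by (auto simp: eqv_def)
    then have *: "\<alpha> y \<in> ZE \<and> (\<forall>k\<in>Kc. hat (ic y) k = hat (ic (rep y)) k + hat (ic x) k * hat (ic (\<alpha> y)) k)"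
      unfolding \<alpha>_def by (rule someI_ex)
    from * show "\<alpha> y \<in> ZE" ..
    from * show "hat (ic y) k = hat (ic (rep y)) k + hat (ic x) k * hat (ic (\<alpha> y)) k" if "k \<in> Kc" for k
      using that by (elim conjE bspec)
  qed
  define Y where "Y = rep ` snd ` Z"
  have Y: "finite Y" "Y \<subseteq> ZE" using Z rep(1) by (force simp: Y_def)+
  have Yinj: "y = y'" if "y \<in> Y" "y' \<in> Y" "eqv x y y'" for y y'
  proof -
    obtain w1 y1 w2 y2 where 1: "(w1, y1) \<in> Z" "(w2, y2) \<in> Z" "y = rep y1" "y' = rep y2"
      using \<open>y \<in> Y\<close> \<open>y' \<in> Y\<close> by (auto simp: Y_def)
    then have "y1 \<in> ZE" "y2 \<in> ZE" using Z by auto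
    then have "eqv x y1 y" "eqv x y' y2" using rep(2) 1 eqv_sym by simp_all
    then have "eqv x y1 y2" using \<open>eqv x y y'\<close> by (meson eqv_trans)
    from rep_eq[OF this] 1 show ?thesis by simp
  qed
  have index: "real (card Y) * D \<le> Dx"
    unfolding Dx_def using xh fr Y Yinj by (rule index_bound)
  define F where "F = (\<lambda>y0. {p \<in> Z. rep (snd p) = y0})"
  define co where "co = (\<lambda>p i. fst p (ev i) + int N * \<alpha> (snd p) (ev i))"
  have fibre: "real (card (F y0)) * (1 - \<delta>) * Dx \<le> V" if y0: "y0 \<in> Y" for y0
  proof -
    obtain z g where g: "0 \<le> g"
      and zg: "\<And>c. (\<Sum>k\<in>Kc. (cmod (hat (ic x) k * hat (rc (up c)) k + of_nat N * hat (ic y0) k))\<^sup>2)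
         = nsq ?n (\<lambda>j. comb ?n b c j + z j) + g"
      using frame_shift[OF fr, of "\<lambda>k. of_nat N * hat (ic y0) k"] by blast
    have "real (card (F y0)) * (1 - 4 * s\<^sup>2 * (sqrt (nQ (ic x)))\<^sup>2 / (3 * \<eta>\<^sup>2)) * (\<Prod>l<?n. b l l)
       \<le> unit_ball_vol (real ?n) * sqrt (s\<^sup>2 + \<eta>) ^ ?n"
    proof (rule count_chebyshev[OF frame_tri[OF fr], where co = co and z = z])
      show "b i i \<le> sqrt (nQ (ic x))" if "i < ?n" for i
        using frame_diag[OF fr that] by (simp add: nQ_def)
      show "0 < \<eta>" by (rule \<eta>(1))
      show "real ?n * (sqrt (nQ (ic x)))\<^sup>2 \<le> 2 * \<eta>" using \<eta>(2) by simp
      show "finite (F y0)" using Z(1) by (simp add: F_def)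
      fix p assume "p \<in> F y0"
      then obtain u y where p: "p = (u, y)" "(u, y) \<in> Z" "rep y = y0" by (cases p) (auto simp: F_def)
      have wy: "u \<in> box N" "y \<in> ZE" "latQ N u x y \<le> s\<^sup>2" using Z(2)[OF p(2)] by auto
      define u' where "u' = (\<lambda>a. u a + int N * \<alpha> y a)"
      have u': "u' \<in> ZE" using wy \<alpha>(1)[OF wy(2)] by (auto simp: u'_def box_def ZE_def)
      have "up (\<lambda>i. real_of_int (co p i)) = (\<lambda>a. real_of_int (u' a))"
        using up_of_int[of "co p"] up_ev_ZE[OF u'] by (simp add: co_def p u'_def)
      then have "hat (rc (up (\<lambda>i. real_of_int (co p i)))) k = hat (ic u) k + of_nat N * hat (ic (\<alpha> y)) k" for k
        by (simp add: u'_def hat_add hat_cmult)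
      then have "nsq ?n (\<lambda>j. comb ?n b (\<lambda>i. real_of_int (co p i)) j + z j) + g
        = (\<Sum>k\<in>Kc. (cmod (hat (ic x) k * (hat (ic u) k + of_nat N * hat (ic (\<alpha> y)) k) + of_nat N * hat (ic y0) k))\<^sup>2)"
        by (simp only: zg[symmetric])
      also have "\<dots> = latQ N u x y"
        unfolding latQ_eq
      proof (intro sum.cong refl)
        fix k assume k: "k \<in> Kc"
        have "hat (ic x) k * (hat (ic u) k + of_nat N * hat (ic (\<alpha> y)) k) + of_nat N * hat (ic y0) k
           = hat (ic x) k * hat (ic u) k + of_nat N * hat (ic y) k"
          unfolding \<alpha>(2)[OF wy(2) k] p(3) by (simp add: algebra_simps)
        then show "(cmod (hat (ic x) k * (hat (ic u) k + of_nat N * hat (ic (\<alpha> y)) k) + of_nat N * hat (ic y0) k))\<^sup>2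
          = (cmod (hat (ic x) k * hat (ic u) k + of_nat N * hat (ic y) k))\<^sup>2" by (simp only:)
      qed
      finally show "nsq ?n (\<lambda>j. comb ?n b (\<lambda>i. real_of_int (co p i)) j + z j) \<le> s\<^sup>2"
        using g wy(3) by linarith
    next
      fix p p' assume pp: "p \<in> F y0" "p' \<in> F y0" and eq: "\<forall>i<?n. co p i = co p' i"
      obtain u y where p: "p = (u, y)" "(u, y) \<in> Z" "rep y = y0" using pp(1) by (cases p) (auto simp: F_def)
      obtain w2 y2 where p2: "p' = (w2, y2)" "(w2, y2) \<in> Z" "rep y2 = y0" using pp(2) by (cases p') (auto simp: F_def)
      have wy: "u \<in> box N" "y \<in> ZE" and wy2: "w2 \<in> box N" "y2 \<in> ZE" using Z(2) p(2) p2(2) by auto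
      have e: "u a + int N * \<alpha> y a = w2 a + int N * \<alpha> y2 a" if "a \<in> E" for a
        using eq[rule_format, OF idx_less[OF that]] that by (simp add: co_def p p2)
      have wa: "u a = w2 a \<and> \<alpha> y a = \<alpha> y2 a" if "a \<in> E" for a
      proof -
        have r: "0 \<le> u a" "u a < int N" "0 \<le> w2 a" "w2 a < int N" using wy wy2 by (auto simp: box_def)
        have "(u a + int N * \<alpha> y a) mod int N = (w2 a + int N * \<alpha> y2 a) mod int N" using e[OF that] by simp
        then have "u a = w2 a" using r by simp
        with e[OF that] N show ?thesis by simp
      qed
      have "u = w2"
        using wa wy wy2 by (intro ZE_inj) (auto simp: box_def ev_E)
      moreover have "\<alpha> y = \<alpha> y2"
        using wa \<alpha>(1)[OF wy(2)] \<alpha>(1)[OF wy2(2)] by (intro ZE_inj) (auto simp: ev_E)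
      then have hy: "hat (ic y) k = hat (ic y2) k" if "k \<in> Kc" for k
        unfolding \<alpha>(2)[OF wy(2) that] \<alpha>(2)[OF wy2(2) that] p(3) p2(3) by simp
      have "y = y2"
        by (rule supp_eq_int) (use wy(2) wy2(2) hy in \<open>simp_all add: ZE_def\<close>)
      ultimately show "p = p'" by (simp add: p p2)
    qed
    then have "real (card (F y0)) * (1 - 4 * s\<^sup>2 * nQ (ic x) / (3 * \<eta>\<^sup>2)) * Dx \<le> V"
      by (simp add: V_def Dx_def)
    moreover have "real (card (F y0)) * (1 - \<delta>) * Dx \<le> real (card (F y0)) * (1 - 4 * s\<^sup>2 * nQ (ic x) / (3 * \<eta>\<^sup>2)) * Dx"
      using Dx \<delta> by (intro mult_right_mono mult_left_mono) auto
    ultimately show ?thesis by linarith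
  qed
  have cardZ: "card Z = (\<Sum>y0\<in>Y. card (F y0))"
  proof -
    have "Z = (\<Union>y0\<in>Y. F y0)" by (auto simp: Y_def F_def)
    then have "card Z = card (\<Union>y0\<in>Y. F y0)" by simp
    also have "\<dots> = (\<Sum>y0\<in>Y. card (F y0))"
      using Y(1) Z(1) by (intro card_UN_disjoint) (auto simp: F_def)
    finally show ?thesis .
  qed
  have "real (card Z) * (1 - \<delta>) * Dx = (\<Sum>y0\<in>Y. real (card (F y0)) * (1 - \<delta>) * Dx)"
    by (simp add: cardZ sum_distrib_right)
  also have "\<dots> \<le> (\<Sum>y0\<in>Y. V)" using fibre by (rule sum_mono)
  finally have "real (card Z) * (1 - \<delta>) * Dx * D \<le> real (card Y) * V * D"
    using D_pos by (intro mult_right_mono) auto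
  also have "\<dots> = real (card Y) * D * V" by simp
  also have "\<dots> \<le> Dx * V" using index V by (rule mult_right_mono)
  finally have "Dx * (real (card Z) * (1 - \<delta>) * D) \<le> Dx * V" by (simp only: mult_ac)
  then show ?thesis using Dx by (simp add: V_def)
qed

text \<open>A Riemann sum for slicing a ball of dimension \<open>2 * card E\<close>, bounded by
  counting instead of integration: the slice over \<open>x\<close> is filled with points of a very
  fine multiple \<open>\<theta>\<close> of the ring, and the resulting points of a product lattice
  are counted by \<open>count_chebyshev\<close>. The scale \<open>\<theta>\<close> cancels.\<close>

lemma slice_sum:
  assumes X: "finite X" "X \<subseteq> ZE" "\<And>x. x \<in> X \<Longrightarrow> t\<^sup>2 * nQ (ic x) < R"
    and pos: "0 < t" "0 < \<eta>" "0 < R"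
    and cond: "real (2 * card E) * (t\<^sup>2 * real (card E)) \<le> 2 * \<eta>"
    and \<delta>: "4 * (R + \<eta>) * (t\<^sup>2 * real (card E)) / (3 * \<eta>\<^sup>2) \<le> \<delta>" "\<delta> < 1"
  shows "(\<Sum>x\<in>X. unit_ball_vol (real (card E)) * sqrt (R - t\<^sup>2 * nQ (ic x)) ^ card E) * (1 - \<delta>) * t ^ card E * D
    \<le> unit_ball_vol (real (2 * card E)) * sqrt (R + 2 * \<eta>) ^ (2 * card E)"
proof -
  let ?n = "card E"
  \<comment> \<open>The slice radius is enlarged by \<open>\<theta> * card E\<close>, which
    compensates exactly for the cell diameter in \<open>count_lower\<close>. \<open>M\<close> bounds
    the growth of squared norms per unit of \<open>\<theta>\<close>, so
    \<open>\<theta> * M \<le> \<eta>\<close> keeps all points within \<open>R + \<eta>\<close>;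
    \<open>\<theta> \<le> t\<close> lets one side length bound all cells.\<close>
  define M where "M = 2 * sqrt R * real ?n + (real ?n)\<^sup>2 + 1"
  have M: "0 < M" unfolding M_def using pos by (intro add_nonneg_pos) auto
  define \<theta> where "\<theta> = min t (min 1 (\<eta> / M))"
  have \<theta>: "0 < \<theta>" "\<theta> \<le> t" "\<theta> \<le> 1" "\<theta> * M \<le> \<eta>"
    using pos M by (auto simp: \<theta>_def min_le_iff_disj pos_le_divide_eq[symmetric])
  define s where "s = (\<lambda>x. sqrt (R - t\<^sup>2 * nQ (ic x)))"
  have s: "0 < s x" "(s x)\<^sup>2 = R - t\<^sup>2 * nQ (ic x)" "s x \<le> sqrt R" if "x \<in> X" for x
    using X(3)[OF that] by (auto simp: s_def)
  define A where "A = (\<lambda>x. {y \<in> ZE. \<theta>\<^sup>2 * nQ (ic y) \<le> (s x + \<theta> * real ?n)\<^sup>2})"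
  have finA: "finite (A x)" for x
  proof -
    have "A x = {y \<in> ZE. nQ (ic y) \<le> (s x + \<theta> * real ?n)\<^sup>2 / \<theta>\<^sup>2}"
      using \<theta>(1) by (auto simp: A_def field_simps)
    then show ?thesis by (simp add: finite_ZE_ball)
  qed
  have comb\<theta>: "comb ?n (\<lambda>i j. \<theta> * bR i j) c = (\<lambda>j. \<theta> * comb ?n bR c j)" for c
    by (auto simp: comb_def sum_distrib_left mult_ac)
  have nsq\<theta>: "nsq ?n (\<lambda>j. \<theta> * u j) = \<theta>\<^sup>2 * nsq ?n u" for u
    by (simp add: nsq_def power_mult_distrib sum_distrib_left)
  have lower: "unit_ball_vol (real ?n) * s x ^ ?n \<le> real (card (A x)) * (\<theta> ^ ?n * D)" if x: "x \<in> X" for x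
  proof -
    have rho: "sqrt (real ?n) * (\<theta> * sqrt (real ?n)) = \<theta> * real ?n" by simp
    have "unit_ball_vol (real ?n) * ((s x + \<theta> * real ?n) - sqrt (real ?n) * (\<theta> * sqrt (real ?n))) ^ ?n
      \<le> real (card (A x)) * (\<Prod>l<?n. \<theta> * bR l l)"
    proof (rule count_lower[where b = "\<lambda>i j. \<theta> * bR i j" and co = "\<lambda>c i. c (ev i)" and z = "\<lambda>_. 0"])
      show "tri ?n (\<lambda>i j. \<theta> * bR i j)" using bR_tri \<theta>(1) by (auto simp: tri_def)
      show "\<theta> * bR i i \<le> \<theta> * sqrt (real ?n)" if "i < ?n" for i
        using bR_diag[OF that] \<theta>(1) by (intro mult_left_mono) auto
      show "0 < s x + \<theta> * real ?n - sqrt (real ?n) * (\<theta> * sqrt (real ?n))" unfolding rho using s(1)[OF x] by simp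
      show "finite (A x)" by (rule finA)
      fix c :: "nat \<Rightarrow> int"
      assume c: "sqrt (nsq ?n (\<lambda>j. comb ?n (\<lambda>i j. \<theta> * bR i j) (\<lambda>i. of_int (c i)) j + 0)) \<le> s x + \<theta> * real ?n"
      have e: "comb ?n bR (\<lambda>i. real_of_int (up c (ev i))) = comb ?n bR (\<lambda>i. of_int (c i))"
        by (auto simp: comb_def up_def ev_E fun_eq_iff intro!: sum.cong)
      have "\<theta>\<^sup>2 * nQ (ic (up c)) = nsq ?n (\<lambda>j. comb ?n (\<lambda>i j. \<theta> * bR i j) (\<lambda>i. of_int (c i)) j + 0)"
        using nQ_up_real[OF up_ZE[of c]] by (simp add: comb\<theta> nsq\<theta> bR_nsq[symmetric] e)
      also have "\<dots> \<le> (s x + \<theta> * real ?n)\<^sup>2" using c by (rule sqrt_le_D)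
      finally have "up c \<in> A x" by (simp add: A_def up_ZE)
      moreover have "\<forall>i<?n. up c (ev i) = c i" by (simp add: up_def ev_E)
      ultimately show "\<exists>x\<in>A x. \<forall>i<?n. x (ev i) = c i" by blast
    qed
    then show ?thesis by (simp add: rho prod.distrib D_def)
  qed
  define BB where "BB = (\<lambda>i j. if i < ?n then (if j < ?n then \<theta> * bR i j else 0)
       else if j < ?n then 0 else t * bR (i - ?n) (j - ?n))"
  note block = block_tri[OF bR_tri \<theta>(1) pos(1) BB_def]
  define co where "co = (\<lambda>(x, y) i. if i < ?n then y (ev i) else x (ev (i - ?n)) :: int)"
  have "real (card (Sigma X A)) * (1 - 4 * (sqrt (R + \<eta>))\<^sup>2 * (t * sqrt (real ?n))\<^sup>2 / (3 * \<eta>\<^sup>2)) * (\<Prod>l<2 * ?n. BB l l)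
    \<le> unit_ball_vol (real (2 * ?n)) * sqrt ((sqrt (R + \<eta>))\<^sup>2 + \<eta>) ^ (2 * ?n)"
  proof (rule count_chebyshev[OF block(1), where co = co and z = "\<lambda>_. 0"])
    show "BB i i \<le> t * sqrt (real ?n)" if "i < 2 * ?n" for i
    proof (cases "i < ?n")
      case True
      have "\<theta> * bR i i \<le> t * sqrt (real ?n)"
        using \<theta> pos bR_diag[OF True] tri_pos[OF bR_tri True] by (intro mult_mono) auto
      with True show ?thesis by (simp add: BB_def)
    next
      case False
      then have "bR (i - ?n) (i - ?n) \<le> sqrt (real ?n)" using that by (intro bR_diag) auto
      with False pos show ?thesis by (simp add: BB_def)
    qed
    show "0 < \<eta>" by (rule pos(2))
    show "real (2 * ?n) * (t * sqrt (real ?n))\<^sup>2 \<le> 2 * \<eta>" using cond by (simp add: power_mult_distrib)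
    show "finite (Sigma X A)" using X(1) finA by auto
    fix p assume "p \<in> Sigma X A"
    then obtain x y where p: "p = (x, y)" "x \<in> X" "y \<in> A x" by auto
    then have xy: "x \<in> ZE" "y \<in> ZE" using X(2) by (auto simp: A_def)
    have c1: "comb ?n bR (\<lambda>i. real_of_int (co p i)) = comb ?n bR (\<lambda>i. real_of_int (y (ev i)))"
      by (auto simp: comb_def co_def p fun_eq_iff intro!: sum.cong)
    have "nsq (2 * ?n) (comb (2 * ?n) BB (\<lambda>i. real_of_int (co p i))) = \<theta>\<^sup>2 * nQ (ic y) + t\<^sup>2 * nQ (ic x)"
      unfolding block(3) using xy by (simp add: c1 nsq\<theta> bR_nsq nQ_up_real) (simp add: co_def p bR_nsq nQ_up_real)
    also have "\<dots> \<le> (s x + \<theta> * real ?n)\<^sup>2 + t\<^sup>2 * nQ (ic x)" using p by (simp add: A_def)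
    also have "\<dots> = R + \<theta> * (2 * s x * real ?n + \<theta> * (real ?n)\<^sup>2)"
      using s(2)[OF p(2)] by (simp add: power2_eq_square algebra_simps)
    also have "\<dots> \<le> R + \<theta> * M"
    proof -
      have "2 * s x * real ?n \<le> 2 * sqrt R * real ?n" using s(3)[OF p(2)] by (intro mult_right_mono) auto
      moreover have "\<theta> * (real ?n)\<^sup>2 \<le> 1 * (real ?n)\<^sup>2" using \<theta> by (intro mult_right_mono) auto
      ultimately have "2 * s x * real ?n + \<theta> * (real ?n)\<^sup>2 \<le> M" by (simp add: M_def)
      then show ?thesis using \<theta>(1) by simp
    qed
    also have "\<dots> \<le> R + \<eta>" using \<theta>(4) by simp
    finally show "nsq (2 * ?n) (\<lambda>j. comb (2 * ?n) BB (\<lambda>i. real_of_int (co p i)) j + 0) \<le> (sqrt (R + \<eta>))\<^sup>2"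
      using pos by simp
  next
    fix p p' assume pp: "p \<in> Sigma X A" "p' \<in> Sigma X A" and eq: "\<forall>i<2 * ?n. co p i = co p' i"
    obtain x y where p: "p = (x, y)" "x \<in> ZE" "y \<in> ZE" using pp(1) X(2) by (auto simp: A_def)
    obtain x' y' where p': "p' = (x', y')" "x' \<in> ZE" "y' \<in> ZE" using pp(2) X(2) by (auto simp: A_def)
    have "y (ev i) = y' (ev i) \<and> x (ev i) = x' (ev i)" if "i < ?n" for i
      using eq[rule_format, of i] eq[rule_format, of "?n + i"] that by (simp add: co_def p p')
    then show "p = p'" using ZE_inj[of x x'] ZE_inj[of y y'] p p' by simp
  qed
  then have Z: "real (card (Sigma X A)) * (1 - 4 * (R + \<eta>) * (t\<^sup>2 * real ?n) / (3 * \<eta>\<^sup>2)) * (\<theta> ^ ?n * t ^ ?n * D\<^sup>2)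
    \<le> unit_ball_vol (real (2 * ?n)) * sqrt (R + 2 * \<eta>) ^ (2 * ?n)"
    using pos unfolding block(2) D_def[symmetric] by (simp add: power_mult_distrib add.assoc)
  have "(\<Sum>x\<in>X. unit_ball_vol (real ?n) * s x ^ ?n) \<le> (\<Sum>x\<in>X. real (card (A x)) * (\<theta> ^ ?n * D))"
    using lower by (rule sum_mono)
  also have "\<dots> = real (card (Sigma X A)) * (\<theta> ^ ?n * D)"
    using X(1) finA by (simp add: card_SigmaI sum_distrib_right)
  finally have "(\<Sum>x\<in>X. unit_ball_vol (real ?n) * s x ^ ?n) * ((1 - \<delta>) * t ^ ?n * D)
      \<le> real (card (Sigma X A)) * (\<theta> ^ ?n * D) * ((1 - \<delta>) * t ^ ?n * D)"
    using \<delta> pos D_pos by (intro mult_right_mono) auto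
  also have "\<dots> = real (card (Sigma X A)) * (1 - \<delta>) * (\<theta> ^ ?n * t ^ ?n * D\<^sup>2)"
    by (simp add: power2_eq_square mult_ac)
  also have "\<dots> \<le> real (card (Sigma X A)) * (1 - 4 * (R + \<eta>) * (t\<^sup>2 * real ?n) / (3 * \<eta>\<^sup>2)) * (\<theta> ^ ?n * t ^ ?n * D\<^sup>2)"
    using \<delta> pos \<theta> D_pos by (intro mult_right_mono mult_left_mono) auto
  also note Z
  finally show ?thesis by (simp add: s_def mult.assoc)
qed

lemma card_box: "finite (box N)" "card (box N) = N ^ card E"
proof -
  let ?f = "\<lambda>y a. if a \<in> E then y a else (0::int)"
  have img: "?f ` (Pi\<^sub>E E (\<lambda>_. {0..<int N})) = box N" if "0 < N"
  proof (intro equalityI subsetI)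
    fix y assume "y \<in> box N"
    then have "y = ?f (restrict y E)" "restrict y E \<in> Pi\<^sub>E E (\<lambda>_. {0..<int N})"
      by (auto simp: box_def ZE_def)
    then show "y \<in> ?f ` (Pi\<^sub>E E (\<lambda>_. {0..<int N}))" by (rule image_eqI)
  qed (use that in \<open>auto simp: box_def ZE_def PiE_def Pi_def\<close>)
  have "inj_on ?f (Pi\<^sub>E E (\<lambda>_. {0..<int N}))"
  proof (rule inj_onI)
    fix y y' assume yy: "y \<in> Pi\<^sub>E E (\<lambda>_. {0..<int N})" "y' \<in> Pi\<^sub>E E (\<lambda>_. {0..<int N})" and eq: "?f y = ?f y'"
    have "y a = y' a" if "a \<in> E" for a using fun_cong[OF eq, of a] that by simp
    with yy show "y = y'" by (intro PiE_ext) auto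
  qed
  then have card: "card (?f ` (Pi\<^sub>E E (\<lambda>_. {0..<int N}))) = N ^ card E"
    by (simp only: card_image card_PiE finite_E card_atLeastLessThan_int prod_constant) simp
  have fin: "finite (?f ` (Pi\<^sub>E E (\<lambda>_. {0..<int N})))" by (intro finite_imageI finite_PiE) auto
  have E0: "0 < card E" using card_E m_pos by simp
  have "box 0 = {}"
  proof (intro equals0I)
    fix y assume "y \<in> box 0"
    then have "0 \<le> y 0 \<and> y 0 < int 0" unfolding box_def by blast
    then show False by linarith
  qed
  then have "finite (box N) \<and> card (box N) = N ^ card E"
  proof (cases "N = 0")
    case False
    then have "0 < N" by simp
    show ?thesis using card fin unfolding img[OF \<open>0 < N\<close>] by blast
  qed (use E0 in \<open>simp del: card_gt_0_iff\<close>)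
  then show "finite (box N)" "card (box N) = N ^ card E" by blast+
qed

text \<open>Multiplication by \<open>\<zeta>^a\<close>.\<close>

definition sh :: "nat \<Rightarrow> (nat \<Rightarrow> int) \<Rightarrow> nat \<Rightarrow> int" where
  "sh a x = red (conv (\<lambda>b. if b = a then 1 else 0) x)"

lemma sh_ZE: "sh a x \<in> ZE" by (simp add: sh_def ZE_def red_supp)

lemma hat_sh: assumes "k \<in> Kc" "a < m" shows "hat (ic (sh a x)) k = w (int (k * a)) * hat (ic x) k"
proof -
  have "hat (ic (\<lambda>b. if b = a then 1 else 0)) k = (\<Sum>b<m. if b = a then w (int (k * b)) else 0)"
    unfolding hat_def by (intro sum.cong) auto
  also have "\<dots> = w (int (k * a))" using assms(2) by simp
  finally show ?thesis using assms(1) by (simp only: sh_def hat_red hat_iconv)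
qed

lemma nQ_sh: "a < m \<Longrightarrow> nQ (ic (sh a x)) = nQ (ic x)"
  unfolding nQ_def by (intro sum.cong refl) (simp only: hat_sh norm_mult norm_w mult_1)

lemma latQ_sh: "a < m \<Longrightarrow> latQ N u (sh a x) (sh a y) = latQ N u x y"
  unfolding latQ_eq
proof (intro sum.cong refl)
  fix k assume "a < m" "k \<in> Kc"
  then have "hat (ic (sh a x)) k * hat (ic u) k + of_nat N * hat (ic (sh a y)) k
    = w (int (k * a)) * (hat (ic x) k * hat (ic u) k + of_nat N * hat (ic y) k)"
    by (simp only: hat_sh) (simp add: algebra_simps)
  then show "(cmod (hat (ic (sh a x)) k * hat (ic u) k + of_nat N * hat (ic (sh a y)) k))\<^sup>2
    = (cmod (hat (ic x) k * hat (ic u) k + of_nat N * hat (ic y) k))\<^sup>2"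
    by (simp only: norm_mult norm_w mult_1)
qed

text \<open>The conjugate of \<open>x\<close> at 1 is nonzero by \<open>hat_nonzero\<close> and can
  be cancelled, leaving distinct roots of unity.\<close>

lemma sh_inj:
  assumes "x \<in> ZE" "x \<noteq> (\<lambda>_. 0)"
  shows "inj_on (\<lambda>a. sh a x) {..<m}"
proof (rule inj_onI)
  fix a b assume ab: "a \<in> {..<m}" "b \<in> {..<m}" "sh a x = sh b x"
  then have "w (int (1 * a)) * hat (ic x) 1 = w (int (1 * b)) * hat (ic x) 1"
    using hat_sh[OF one_Kc, of a x] hat_sh[OF one_Kc, of b x] by simp
  then have "w (int a) = w (int b)" using hat_nonzero[OF assms one_Kc] by simp
  then have "w (int a - int b) = 1" by (metis diff_add_cancel mult_cancel_right2 norm_w norm_zero w_add zero_neq_one)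
  then have "int m dvd int a - int b" by (simp add: w_eq_1_iff)
  then show "a = b" using ab
    by (metis cong_iff_dvd_diff cong_int_iff cong_less_modulus_unique_nat lessThan_iff)
qed

lemma sh_nonzero: assumes "x \<in> ZE" "x \<noteq> (\<lambda>_. 0)" "a < m" shows "sh a x \<noteq> (\<lambda>_. 0)"
proof
  assume "sh a x = (\<lambda>_. 0)"
  then have "w (int (1 * a)) * hat (ic x) 1 = 0" using hat_sh[OF one_Kc assms(3), of x] by (simp add: hat_def)
  moreover have "w (int (1 * a)) \<noteq> 0" using norm_w by (metis norm_zero zero_neq_one)
  ultimately show False using hat_nonzero[OF assms(1,2) one_Kc] by simp
qed

lemma nQ_ge: assumes "y \<in> ZE" "y \<noteq> (\<lambda>_. 0)" shows "real m \<le> real L * nQ (ic y)"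
proof -
  obtain a where "y a \<noteq> 0" using assms(2) by auto
  then have "0 < (y a)\<^sup>2" by simp
  then have "1 \<le> (y a)\<^sup>2" by linarith
  then have "1 \<le> (real_of_int (y a))\<^sup>2" by (metis of_int_1_le_iff of_int_power)
  then have "real m \<le> real m * (real_of_int (y a))\<^sup>2" using m_pos by simp
  also have "\<dots> \<le> real L * nQ (ic y)" using assms(1) by (intro coef_bound_int) (simp add: ZE_def)
  finally show ?thesis .
qed

text \<open>If every \<open>u\<close> had a short vector, each would have \<open>m\<close> of them,
  hence at least \<open>m * N ^ card E\<close> triples \<open>(u, x, y)\<close>. Counting by
  \<open>x\<close> first, \<open>fibre_bound\<close> and \<open>slice_sum\<close> bound the triples
  by the volume of a slightly larger ball. The tolerance \<open>\<eta>\<close> is spent once on the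
  fibres and twice in \<open>slice_sum\<close>, whence \<open>3 * \<eta>\<close>; the two relative
  errors give \<open>(1 - \<delta>)\<^sup>2\<close>.\<close>

lemma exists_good_u:
  assumes pos: "0 < N" "0 < t" "0 < r" "0 < \<eta>"
    and A: "real L * r\<^sup>2 < real m * (real N)\<^sup>2"
    and c1: "real (card E) * (r\<^sup>2 / t\<^sup>2) \<le> 2 * \<eta>" "4 * r\<^sup>2 * (r\<^sup>2 / t\<^sup>2) / (3 * \<eta>\<^sup>2) \<le> \<delta>"
    and c2: "real (2 * card E) * (t\<^sup>2 * real (card E)) \<le> 2 * \<eta>"
      "4 * (r\<^sup>2 + 2 * \<eta>) * (t\<^sup>2 * real (card E)) / (3 * \<eta>\<^sup>2) \<le> \<delta>"
    and \<delta>: "\<delta> < 1"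
    and vol: "unit_ball_vol (real (2 * card E)) * sqrt (r\<^sup>2 + 3 * \<eta>) ^ (2 * card E)
      < real m * real N ^ card E * (1 - \<delta>)\<^sup>2 * t ^ card E * D\<^sup>2"
  shows "\<exists>u\<in>box N. \<forall>x\<in>ZE. \<forall>y\<in>ZE. (x, y) \<noteq> (\<lambda>_. 0, \<lambda>_. 0) \<longrightarrow> r\<^sup>2 < t\<^sup>2 * nQ (ic x) + latQ N u x y"
proof (rule ccontr)
  let ?n = "card E"
  assume neg: "\<not> ?thesis"
  define X where "X = {x \<in> ZE. x \<noteq> (\<lambda>_. 0) \<and> t\<^sup>2 * nQ (ic x) \<le> r\<^sup>2}"
  define Bad where "Bad = (\<lambda>u. {(x, y). x \<in> ZE \<and> y \<in> ZE \<and> x \<noteq> (\<lambda>_. 0) \<and> t\<^sup>2 * nQ (ic x) + latQ N u x y \<le> r\<^sup>2})"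
  define Z where "Z = (\<lambda>x. {(u, y). u \<in> box N \<and> y \<in> ZE \<and> latQ N u x y \<le> r\<^sup>2 - t\<^sup>2 * nQ (ic x)})"
  have latQ0: "0 \<le> latQ N u x y" for u x y by (simp add: latQ_def)
  have finX: "finite X"
  proof -
    have "X \<subseteq> {x \<in> ZE. nQ (ic x) \<le> r\<^sup>2 / t\<^sup>2}" using pos by (auto simp: X_def field_simps)
    then show ?thesis using finite_ZE_ball finite_subset by blast
  qed
  have finZ: "finite (Z x)" for x
  proof -
    let ?h = "\<lambda>(u, y). (u, red (\<lambda>a. conv u x a + int N * y a))"
    have hh: "hat (ic (red (\<lambda>a. conv u x a + int N * y a))) k = hat (ic u) k * hat (ic x) k + of_nat N * hat (ic y) k"
      if "k \<in> Kc" for u y k using that by (simp add: hat_red hat_add hat_cmult hat_iconv)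
    have "inj_on ?h (Z x)"
    proof (rule inj_onI)
      fix p p' assume a: "p \<in> Z x" "p' \<in> Z x" "?h p = ?h p'"
      obtain u y where p: "p = (u, y)" by (cases p)
      obtain u' y' where p': "p' = (u', y')" by (cases p')
      have e: "u = u'" "red (\<lambda>a. conv u x a + int N * y a) = red (\<lambda>a. conv u' x a + int N * y' a)"
        using a(3) by (auto simp: p p')
      have "y = y'"
      proof (rule supp_eq_int)
        fix k assume "k \<in> Kc"
        with hh[of k u y] hh[of k u' y'] e pos(1) show "hat (ic y) k = hat (ic y') k" by simp
      qed (use a in \<open>auto simp: p p' Z_def ZE_def\<close>)
      with e(1) show "p = p'" by (simp add: p p')
    qed
    moreover have "?h ` Z x \<subseteq> box N \<times> {v \<in> ZE. nQ (ic v) \<le> r\<^sup>2}"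
    proof (rule image_subsetI)
      fix p assume "p \<in> Z x"
      then obtain u y where p: "p = (u, y)" and a: "u \<in> box N" "y \<in> ZE" "latQ N u x y \<le> r\<^sup>2 - t\<^sup>2 * nQ (ic x)"
        by (auto simp: Z_def)
      have "nQ (ic (red (\<lambda>a. conv u x a + int N * y a))) = latQ N u x y"
        unfolding latQ_def by (rule nQ_cong) (rule hat_red)
      also have "\<dots> \<le> r\<^sup>2"
      proof -
        have "0 \<le> t\<^sup>2 * nQ (ic x)" by simp
        with a(3) show ?thesis by linarith
      qed
      finally show "?h p \<in> box N \<times> {v \<in> ZE. nQ (ic v) \<le> r\<^sup>2}"
        using a(1) by (simp add: p ZE_def red_supp)
    qed
    ultimately show ?thesis
      by (rule inj_on_finite) (simp add: card_box finite_ZE_ball)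
  qed
  have bij: "(\<lambda>(u, x, y). (x, u, y)) ` (Sigma (box N) Bad) = Sigma X Z"
  proof (intro equalityI subsetI)
    fix p assume "p \<in> (\<lambda>(u, x, y). (x, u, y)) ` (Sigma (box N) Bad)"
    then obtain u x y where "p = (x, u, y)" "u \<in> box N" "(x, y) \<in> Bad u" by auto
    then show "p \<in> Sigma X Z" using latQ0[of u x y] by (auto simp: X_def Z_def Bad_def)
  next
    fix p assume "p \<in> Sigma X Z"
    then obtain u x y where "p = (x, u, y)" "x \<in> X" "(u, y) \<in> Z x" by auto
    then show "p \<in> (\<lambda>(u, x, y). (x, u, y)) ` (Sigma (box N) Bad)"
      by (intro image_eqI[of _ _ "(u, x, y)"]) (auto simp: X_def Z_def Bad_def)
  qed
  have cards: "card (Sigma (box N) Bad) = card (Sigma X Z)"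
    unfolding bij[symmetric] by (rule card_image[symmetric]) (auto simp: inj_on_def)
  have "finite (Sigma X Z)" using finX finZ by auto
  then have finS: "finite (Sigma (box N) Bad)"
    unfolding bij[symmetric] by (rule finite_imageD) (auto simp: inj_on_def)
  have finBad: "finite (Bad u)" if "u \<in> box N" for u
  proof -
    have "Bad u = snd ` (Sigma (box N) Bad \<inter> {u} \<times> UNIV)" using that by force
    then show ?thesis using finS by simp
  qed
  have ge: "m \<le> card (Bad u)" if u: "u \<in> box N" for u
  proof -
    obtain x y where xy: "x \<in> ZE" "y \<in> ZE" "(x, y) \<noteq> (\<lambda>_. 0, \<lambda>_. 0)" "t\<^sup>2 * nQ (ic x) + latQ N u x y \<le> r\<^sup>2"
      using neg u by (auto simp: not_less)
    \<comment> \<open>With \<open>x = 0\<close> the vector is \<open>N\<close> times a ring element,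
      too long by assumption \<open>A\<close>. So \<open>x\<close> is nonzero, and its multiples by
      the powers of \<open>\<zeta>\<close> are distinct.\<close>
    have x0: "x \<noteq> (\<lambda>_. 0)"
    proof
      assume x0: "x = (\<lambda>_. 0)"
      then have y0: "y \<noteq> (\<lambda>_. 0)" using xy(3) by simp
      have "latQ N u x y = (real N)\<^sup>2 * nQ (ic y)"
      proof -
        have "hat (ic (\<lambda>_. 0)) k = 0" for k by (simp add: hat_def)
        then show ?thesis unfolding latQ_eq x0 nQ_def sum_distrib_left
          by (intro sum.cong refl) (simp only: mult_zero_left add_0 norm_mult power_mult_distrib norm_of_nat)
      qed
      then have "(real N)\<^sup>2 * nQ (ic y) \<le> r\<^sup>2" using xy(4) by (simp add: x0 nQ_def hat_def)
      then have "real L * ((real N)\<^sup>2 * nQ (ic y)) \<le> real L * r\<^sup>2" by (intro mult_left_mono) auto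
      moreover have "(real N)\<^sup>2 * real m \<le> (real N)\<^sup>2 * (real L * nQ (ic y))"
        using nQ_ge[OF xy(2) y0] by (intro mult_left_mono) auto
      ultimately show False using A by (simp add: mult_ac)
    qed
    have "(\<lambda>a. (sh a x, sh a y)) ` {..<m} \<subseteq> Bad u"
      using xy x0 by (auto simp: Bad_def sh_ZE sh_nonzero nQ_sh latQ_sh)
    moreover have "inj_on (\<lambda>a. (sh a x, sh a y)) {..<m}"
      using sh_inj[OF xy(1) x0] by (auto simp: inj_on_def)
    ultimately show ?thesis using card_inj_on_le[OF _ _ finBad[OF u]] by force
  qed
  have "card (box N) * m \<le> card (Sigma (box N) Bad)"
  proof -
    have "(\<Sum>u\<in>box N. m) \<le> (\<Sum>u\<in>box N. card (Bad u))" using ge by (rule sum_mono)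
    also have "\<dots> = card (Sigma (box N) Bad)" using card_box finBad by (intro card_SigmaI[symmetric]) auto
    finally show ?thesis by simp
  qed
  then have total: "real m * real N ^ ?n \<le> real (card (Sigma X Z))"
    unfolding cards card_box(2) by (metis mult.commute of_nat_le_iff of_nat_mult of_nat_power)
  have fib: "real (card (Z x)) * (1 - \<delta>) * D \<le> unit_ball_vol (real ?n) * sqrt ((r\<^sup>2 + \<eta>) - t\<^sup>2 * nQ (ic x)) ^ ?n"
    if x: "x \<in> X" for x
  proof -
    have s2: "(sqrt (r\<^sup>2 - t\<^sup>2 * nQ (ic x)))\<^sup>2 = r\<^sup>2 - t\<^sup>2 * nQ (ic x)" using x by (simp add: X_def)
    have q: "nQ (ic x) \<le> r\<^sup>2 / t\<^sup>2" using x pos by (simp add: X_def field_simps)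
    have "real (card (Z x)) * (1 - \<delta>) * D \<le> unit_ball_vol (real ?n) * sqrt ((sqrt (r\<^sup>2 - t\<^sup>2 * nQ (ic x)))\<^sup>2 + \<eta>) ^ ?n"
    proof (rule fibre_bound[OF pos(1)])
      show "x \<in> ZE" "x \<noteq> (\<lambda>_. 0)" using x by (auto simp: X_def)
      show "0 < \<eta>" by (rule pos)
      have "real ?n * nQ (ic x) \<le> real ?n * (r\<^sup>2 / t\<^sup>2)" using q by (intro mult_left_mono) auto
      with c1(1) show "real ?n * nQ (ic x) \<le> 2 * \<eta>" by linarith
      show "finite (Z x)" by (rule finZ)
      have "4 * (sqrt (r\<^sup>2 - t\<^sup>2 * nQ (ic x)))\<^sup>2 * nQ (ic x) / (3 * \<eta>\<^sup>2) \<le> 4 * r\<^sup>2 * (r\<^sup>2 / t\<^sup>2) / (3 * \<eta>\<^sup>2)"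
        unfolding s2 using q x by (intro divide_right_mono mult_mono) (auto simp: X_def)
      with c1(2) show "4 * (sqrt (r\<^sup>2 - t\<^sup>2 * nQ (ic x)))\<^sup>2 * nQ (ic x) / (3 * \<eta>\<^sup>2) \<le> \<delta>" by linarith
      show "\<delta> < 1" by (rule \<delta>)
      fix u y assume "(u, y) \<in> Z x"
      then show "u \<in> box N \<and> y \<in> ZE \<and> latQ N u x y \<le> (sqrt (r\<^sup>2 - t\<^sup>2 * nQ (ic x)))\<^sup>2"
        unfolding s2 by (simp add: Z_def)
    qed
    then show ?thesis unfolding s2 by (simp add: algebra_simps)
  qed
  have "real m * real N ^ ?n * ((1 - \<delta>) * D) \<le> real (card (Sigma X Z)) * ((1 - \<delta>) * D)"
    using total \<delta> D_pos by (intro mult_right_mono) auto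
  also have "\<dots> = (\<Sum>x\<in>X. real (card (Z x)) * (1 - \<delta>) * D)"
    using finX finZ by (simp add: card_SigmaI sum_distrib_right mult.assoc)
  also have "\<dots> \<le> (\<Sum>x\<in>X. unit_ball_vol (real ?n) * sqrt ((r\<^sup>2 + \<eta>) - t\<^sup>2 * nQ (ic x)) ^ ?n)"
    using fib by (rule sum_mono)
  finally have "real m * real N ^ ?n * ((1 - \<delta>) * D) * ((1 - \<delta>) * t ^ ?n * D)
    \<le> (\<Sum>x\<in>X. unit_ball_vol (real ?n) * sqrt ((r\<^sup>2 + \<eta>) - t\<^sup>2 * nQ (ic x)) ^ ?n) * ((1 - \<delta>) * t ^ ?n * D)"
    using \<delta> pos D_pos by (intro mult_right_mono) auto
  also have "\<dots> = (\<Sum>x\<in>X. unit_ball_vol (real ?n) * sqrt ((r\<^sup>2 + \<eta>) - t\<^sup>2 * nQ (ic x)) ^ ?n) * (1 - \<delta>) * t ^ ?n * D"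
    by (simp only: mult.assoc)
  also have "\<dots> \<le> unit_ball_vol (real (2 * ?n)) * sqrt ((r\<^sup>2 + \<eta>) + 2 * \<eta>) ^ (2 * ?n)"
    using finX c2 pos \<delta> by (intro slice_sum) (auto simp: X_def add_pos_nonneg add.assoc)
  also have "\<dots> = unit_ball_vol (real (2 * ?n)) * sqrt (r\<^sup>2 + 3 * \<eta>) ^ (2 * ?n)" by (simp add: algebra_simps)
  also note vol
  finally show False by (simp add: power2_eq_square mult_ac)
qed

end

section \<open>A structured language on top of the machine\<close>

lemma len_mono: "\<bar>x\<bar> \<le> \<bar>y\<bar> \<Longrightarrow> len x \<le> len y"
  unfolding len_def by (simp add: floorlog_mono nat_le_iff)

lemma len_pos: "1 \<le> len x" by (simp add: len_def)

definition bnd :: "int \<Rightarrow> memory \<Rightarrow> bool" where "bnd U M \<longleftrightarrow> (\<forall>a. \<bar>M a\<bar> \<le> U)"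

text \<open>Bounds one instruction when all addresses and contents are at most \<open>U\<close>:
  addressing and reading cost at most 8 lengths, the operation at most 2 squared lengths.\<close>

definition unit_cost :: "int \<Rightarrow> nat" where "unit_cost U = 11 * (len U)\<^sup>2"

text \<open>Scalar variables live at the addresses below \<open>32\<close>, temporary values between \<open>32\<close> and \<open>63\<close>,
  and the entry \<open>i\<close> of the array \<open>k < 16\<close> at the address \<open>64 + 16 * i + k\<close>.\<close>

definition arr :: "nat \<Rightarrow> int \<Rightarrow> int" where "arr k i = 64 + 16 * i + int k"

type_synonym state = "(nat \<Rightarrow> int) \<times> (nat \<Rightarrow> nat \<Rightarrow> int)"

text \<open>Temporaries are invisible, so evaluating an expression does not change the abstract
  state; the default 0 outside the modelled indices keeps states extensional.\<close>

definition abst :: "memory \<Rightarrow> state" where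
  "abst M = (\<lambda>x. if x < 32 then M (int x) else 0, \<lambda>k i. if k < 16 then M (arr k (int i)) else 0)"

datatype aexp = C int | V nat | Rd nat aexp | Op arith aexp aexp

primrec aval :: "state \<Rightarrow> aexp \<Rightarrow> int" where
  "aval s (C c) = c"
| "aval s (V x) = fst s x"
| "aval s (Rd k e) = snd s k (nat (aval s e))"
| "aval s (Op f a b) = arith_val f (aval s a) (aval s b)"

text \<open>Together with \<open>bnd\<close> this keeps every intermediate value and address within
  \<open>U\<close>, as a bound on logarithmic cost requires.\<close>

primrec safe :: "int \<Rightarrow> state \<Rightarrow> aexp \<Rightarrow> bool" where
  "safe U s (C c) \<longleftrightarrow> \<bar>c\<bar> \<le> U"
| "safe U s (V x) \<longleftrightarrow> x < 32"
| "safe U s (Rd k e) \<longleftrightarrow> safe U s e \<and> k < 16 \<and> 0 \<le> aval s e \<and> arr k (aval s e) \<le> U"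
| "safe U s (Op f a b) \<longleftrightarrow> safe U s a \<and> safe U s b \<and> \<bar>arith_val f (aval s a) (aval s b)\<bar> \<le> U"

text \<open>Number of temporaries used above the target: the second operand is evaluated while the
  first one is held.\<close>

primrec depth :: "aexp \<Rightarrow> nat" where
  "depth (C c) = 0"
| "depth (V x) = 0"
| "depth (Rd k e) = depth e"
| "depth (Op f a b) = max (depth a) (Suc (depth b))"

primrec esteps :: "aexp \<Rightarrow> nat" where
  "esteps (C c) = 1"
| "esteps (V x) = 1"
| "esteps (Rd k e) = esteps e + 3"
| "esteps (Op f a b) = esteps a + esteps b + 1"

definition tmp :: "nat \<Rightarrow> int" where "tmp d = 32 + int d"

definition addr :: "nat \<Rightarrow> nat \<Rightarrow> prog" where
  "addr k d = Seq (Assign (ToReg (tmp d)) Mul (Reg (tmp d)) (Const 16))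
     (Assign (ToReg (tmp d)) Add (Reg (tmp d)) (Const (arr k 0)))"

primrec comp :: "aexp \<Rightarrow> nat \<Rightarrow> prog" where
  "comp (C c) d = Assign (ToReg (tmp d)) Add (Const c) (Const 0)"
| "comp (V x) d = Assign (ToReg (tmp d)) Add (Reg (int x)) (Const 0)"
| "comp (Rd k e) d = Seq (comp e d) (Seq (addr k d) (Assign (ToReg (tmp d)) Add (Ind (tmp d)) (Const 0)))"
| "comp (Op f a b) d = Seq (comp a d) (Seq (comp b (Suc d))
     (Assign (ToReg (tmp d)) f (Reg (tmp d)) (Reg (tmp (Suc d)))))"

datatype stmt =
    SetV nat aexp
  | SetA nat aexp aexp
  | Sq stmt stmt
  | IfLt aexp aexp stmt
  | IfEq aexp aexp stmt stmt
  | For nat nat stmt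
  | Wr aexp

primrec cstmt :: "stmt \<Rightarrow> prog" where
  "cstmt (SetV x e) = Seq (comp e 0) (Assign (ToReg (int x)) Add (Reg (tmp 0)) (Const 0))"
| "cstmt (SetA k i e) = Seq (comp e 0) (Seq (comp i 1) (Seq (addr k 1) (Assign (ToInd (tmp 1)) Add (Reg (tmp 0)) (Const 0))))"
| "cstmt (Sq p q) = Seq (cstmt p) (cstmt q)"
| "cstmt (IfLt a b p) = Seq (comp a 0) (Seq (comp b 1) (IfElse (Lt (Reg (tmp 0)) (Reg (tmp 1))) (cstmt p) Skip))"
| "cstmt (IfEq a b p q) = Seq (comp a 0) (Seq (comp b 1) (IfElse (Eq (Reg (tmp 0)) (Reg (tmp 1))) (cstmt p) (cstmt q)))"
| "cstmt (For v h p) = Seq (Assign (ToReg (int v)) Add (Const 0) (Const 0))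
     (While (Lt (Reg (int v)) (Reg (int h))) (Seq (cstmt p) (Assign (ToReg (int v)) Add (Reg (int v)) (Const 1))))"
| "cstmt (Wr e) = Seq (comp e 0) (Write (Reg (tmp 0)))"

primrec mods :: "stmt \<Rightarrow> nat set" where
  "mods (SetV x e) = {x}"
| "mods (SetA k i e) = {}"
| "mods (Sq p q) = mods p \<union> mods q"
| "mods (IfLt a b p) = mods p"
| "mods (IfEq a b p q) = mods p \<union> mods q"
| "mods (For v h p) = insert v (mods p)"
| "mods (Wr e) = {}"

primrec amods :: "stmt \<Rightarrow> nat set" where
  "amods (SetV x e) = {}"
| "amods (SetA k i e) = {k}"
| "amods (Sq p q) = amods p \<union> amods q"
| "amods (IfLt a b p) = amods p"
| "amods (IfEq a b p q) = amods p \<union> amods q"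
| "amods (For v h p) = amods p"
| "amods (Wr e) = {}"

text \<open>Total correctness with cost, counted in multiples of the worst instruction. The
  postcondition sees the output of this run only.\<close>

definition xp :: "int \<Rightarrow> prog \<Rightarrow> memory \<Rightarrow> nat \<Rightarrow> (memory \<Rightarrow> int list \<Rightarrow> bool) \<Rightarrow> bool" where
  "xp U p M T Q \<longleftrightarrow> (\<exists>t M' out. exec p M t M' out \<and> t \<le> T * unit_cost U \<and> bnd U M' \<and> Q M' out)"

lemma xp_mono:
  assumes "xp U p M T Q" "T \<le> T'" "\<And>M' out. bnd U M' \<Longrightarrow> Q M' out \<Longrightarrow> Q' M' out"
  shows "xp U p M T' Q'"
proof -
  obtain t M' out where 1: "exec p M t M' out" "t \<le> T * unit_cost U" "bnd U M'" "Q M' out"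
    using assms(1) by (auto simp: xp_def)
  have "t \<le> T' * unit_cost U" using 1(2) assms(2) by (meson le_trans mult_le_mono1)
  with 1 assms(3) show ?thesis unfolding xp_def by blast
qed

lemma xp_seq:
  assumes "xp U p M T1 (\<lambda>M' o1. xp U q M' T2 (\<lambda>M'' o2. Q M'' (o1 @ o2)))"
  shows "xp U (Seq p q) M (T1 + T2) Q"
proof -
  obtain t M' out where 1: "exec p M t M' out" "t \<le> T1 * unit_cost U" "bnd U M'"
    "xp U q M' T2 (\<lambda>M'' o2. Q M'' (out @ o2))"
    using assms unfolding xp_def[of U p] by blast
  then obtain t' M'' out' where 2: "exec q M' t' M'' out'" "t' \<le> T2 * unit_cost U" "bnd U M''" "Q M'' (out @ out')"
    by (auto simp: xp_def)
  have "exec (Seq p q) M (t + t') M'' (out @ out')" using 1 2 by (intro exec.Seq)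
  moreover have "t + t' \<le> (T1 + T2) * unit_cost U" using 1 2 by (simp add: add_mult_distrib)
  ultimately show ?thesis using 2 unfolding xp_def by blast
qed

fun ok_operand :: "int \<Rightarrow> operand \<Rightarrow> bool" where
  "ok_operand U (Const c) \<longleftrightarrow> \<bar>c\<bar> \<le> U"
| "ok_operand U (Reg a) \<longleftrightarrow> \<bar>a\<bar> \<le> U"
| "ok_operand U (Ind a) \<longleftrightarrow> \<bar>a\<bar> \<le> U"

fun ok_dest :: "int \<Rightarrow> dest \<Rightarrow> bool" where
  "ok_dest U (ToReg a) \<longleftrightarrow> \<bar>a\<bar> \<le> U"
| "ok_dest U (ToInd a) \<longleftrightarrow> \<bar>a\<bar> \<le> U"

lemma len_le: "\<bar>x\<bar> \<le> U \<Longrightarrow> len x \<le> len U"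
  by (rule len_mono) simp

lemma operand_cost_le:
  assumes "bnd U M" "ok_operand U u"
  shows "operand_cost M u \<le> 3 * len U"
proof -
  have L: "len (M a) \<le> len U" for a using assms(1) by (intro len_le) (simp add: bnd_def)
  show ?thesis
  proof (cases u)
    case (Const c)
    with assms(2) have "len c \<le> len U" by (intro len_le) simp
    with Const show ?thesis by simp
  next
    case (Reg a)
    with assms(2) have "len a \<le> len U" by (intro len_le) simp
    with Reg L[of a] show ?thesis by simp
  next
    case (Ind a)
    with assms(2) have "len a \<le> len U" by (intro len_le) simp
    with Ind L[of a] L[of "M a"] show ?thesis by simp
  qed
qed

lemma dest_cost_le:
  assumes "bnd U M" "ok_dest U d"
  shows "dest_cost M d \<le> 2 * len U"
proof -
  have L: "len (M a) \<le> len U" for a using assms(1) by (intro len_le) (simp add: bnd_def)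
  show ?thesis
  proof (cases d)
    case (ToReg a)
    with assms(2) have "len a \<le> len U" by (intro len_le) simp
    with ToReg show ?thesis by simp
  next
    case (ToInd a)
    with assms(2) have "len a \<le> len U" by (intro len_le) simp
    with ToInd L[of a] show ?thesis by simp
  qed
qed

lemma operand_val_le: "bnd U M \<Longrightarrow> ok_operand U u \<Longrightarrow> \<bar>operand_val M u\<bar> \<le> U"
  by (cases u) (auto simp: bnd_def)

lemma len_square: "len U \<le> (len U)\<^sup>2"
  using len_pos[of U] by (simp add: power2_eq_square)

lemma arith_cost_le:
  assumes "\<bar>x\<bar> \<le> U" "\<bar>y\<bar> \<le> U"
  shows "arith_cost f x y \<le> 2 * (len U)\<^sup>2"
proof -
  have "len x + len y \<le> 2 * (len U)\<^sup>2"
    using len_le[OF assms(1)] len_le[OF assms(2)] len_square[of U] by linarith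
  moreover have "len x * len y \<le> (len U)\<^sup>2"
    unfolding power2_eq_square by (intro mult_le_mono len_le assms)
  ultimately show ?thesis by (cases f) auto
qed

lemma xp_assign:
  assumes "bnd U M" "ok_dest U d" "ok_operand U u" "ok_operand U v"
    and "\<bar>arith_val f (operand_val M u) (operand_val M v)\<bar> \<le> U"
    and "Q (M(dest_addr M d := arith_val f (operand_val M u) (operand_val M v))) []"
  shows "xp U (Assign d f u v) M 1 Q"
proof -
  let ?t = "dest_cost M d + operand_cost M u + operand_cost M v + arith_cost f (operand_val M u) (operand_val M v)"
  have "?t \<le> 2 * len U + 3 * len U + 3 * len U + 2 * (len U)\<^sup>2"
    using assms by (intro add_mono dest_cost_le operand_cost_le arith_cost_le operand_val_le)
  also have "\<dots> \<le> 1 * unit_cost U" using len_square[of U] by (simp add: unit_cost_def)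
  finally have t: "?t \<le> 1 * unit_cost U" .
  have "exec (Assign d f u v) M ?t (M(dest_addr M d := arith_val f (operand_val M u) (operand_val M v))) []"
    by (rule exec.Assign) auto
  moreover have "bnd U (M(dest_addr M d := arith_val f (operand_val M u) (operand_val M v)))"
    using assms by (auto simp: bnd_def)
  ultimately show ?thesis unfolding xp_def using t assms(6) by blast
qed

lemma test_cost_le:
  assumes "bnd U M" "\<bar>a\<bar> \<le> U" "\<bar>b\<bar> \<le> U"
  shows "test_cost M (Lt (Reg a) (Reg b)) \<le> unit_cost U" "test_cost M (Eq (Reg a) (Reg b)) \<le> unit_cost U"
  using operand_cost_le[OF assms(1), of "Reg a"] operand_cost_le[OF assms(1), of "Reg b"] assms(2,3) len_square[of U]
  by (auto simp: unit_cost_def simp del: operand_cost.simps)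

lemma xp_ifelse:
  assumes "test_cost M b \<le> unit_cost U"
    and "test_val M b \<Longrightarrow> xp U p M T Q" "\<not> test_val M b \<Longrightarrow> xp U q M T Q"
  shows "xp U (IfElse b p q) M (Suc T) Q"
proof (cases "test_val M b")
  case True
  then obtain t M' out where 1: "exec p M t M' out" "t \<le> T * unit_cost U" "bnd U M'" "Q M' out"
    using assms(2) by (auto simp: xp_def)
  have "exec (IfElse b p q) M (test_cost M b + t) M' out" using True 1 by (intro exec.IfTrue)
  moreover have "test_cost M b + t \<le> Suc T * unit_cost U" using 1 assms(1) by simp
  ultimately show ?thesis using 1 unfolding xp_def by blast
next
  case False
  then obtain t M' out where 1: "exec q M t M' out" "t \<le> T * unit_cost U" "bnd U M'" "Q M' out"
    using assms(3) by (auto simp: xp_def)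
  have "exec (IfElse b p q) M (test_cost M b + t) M' out" using False 1 by (intro exec.IfFalse)
  moreover have "test_cost M b + t \<le> Suc T * unit_cost U" using 1 assms(1) by simp
  ultimately show ?thesis using 1 unfolding xp_def by blast
qed

lemma xp_skip: "bnd U M \<Longrightarrow> Q M [] \<Longrightarrow> xp U Skip M 1 Q"
  unfolding xp_def using exec.Skip[of M] len_square[of U] len_pos[of U]
  by (intro exI[of _ 1] exI[of _ M] exI[of _ "[]"]) (auto simp: unit_cost_def)

lemma abst_agree:
  assumes "\<And>a. a < 32 \<or> 64 \<le> a \<Longrightarrow> M' a = M a"
  shows "abst M' = abst M"
  using assms by (auto simp: abst_def arr_def fun_eq_iff)

definition same_up :: "nat \<Rightarrow> memory \<Rightarrow> memory \<Rightarrow> bool" where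
  "same_up d M M' \<longleftrightarrow> (\<forall>a. a < tmp d \<or> 64 \<le> a \<longrightarrow> M' a = M a)"

lemma same_up_abst: "same_up d M M' \<Longrightarrow> abst M' = abst M"
  by (rule abst_agree) (auto simp: same_up_def tmp_def)

lemma aval_bnd:
  assumes "bnd U M" "safe U (abst M) e"
  shows "\<bar>aval (abst M) e\<bar> \<le> U"
proof -
  have "0 \<le> U" using assms(1) by (auto simp: bnd_def intro: order_trans[OF abs_ge_zero])
  then show ?thesis using assms by (cases e) (auto simp: bnd_def abst_def)
qed

lemma xp_addr:
  assumes M: "bnd U M" and d: "d < 32" and k: "0 \<le> M (tmp d)" "arr k (M (tmp d)) \<le> U" "k < 16" and U: "100 \<le> U"
    and Q: "Q (M(tmp d := arr k (M (tmp d)))) []"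
  shows "xp U (addr k d) M 2 Q"
proof -
  let ?M2 = "M(tmp d := M (tmp d) * 16)"
  have b2: "bnd U ?M2" using M k by (auto simp: bnd_def arr_def)
  have 2: "xp U (Assign (ToReg (tmp d)) Add (Reg (tmp d)) (Const (arr k 0))) ?M2 1 Q"
  proof (rule xp_assign[OF b2])
    have "?M2(tmp d := arr k (M (tmp d))) = M(tmp d := arr k (M (tmp d)))" by simp
    then show "Q (?M2(dest_addr ?M2 (ToReg (tmp d)) := arith_val Add (operand_val ?M2 (Reg (tmp d))) (operand_val ?M2 (Const (arr k 0))))) []"
      using Q by (simp add: arr_def algebra_simps)
  qed (use d k U in \<open>auto simp: tmp_def arr_def algebra_simps\<close>)
  have "xp U (addr k d) M (1 + 1) Q"
    unfolding addr_def
  proof (rule xp_seq, rule xp_assign[OF M])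
    show "xp U (Assign (ToReg (tmp d)) Add (Reg (tmp d)) (Const (arr k 0)))
      (M(dest_addr M (ToReg (tmp d)) := arith_val Mul (operand_val M (Reg (tmp d))) (operand_val M (Const 16)))) 1 (\<lambda>M'' o2. Q M'' ([] @ o2))"
      using 2 by simp
  qed (use d k U in \<open>auto simp: tmp_def arr_def\<close>)
  then show ?thesis by (rule xp_mono) auto
qed

text \<open>Stack discipline: code for target \<open>d\<close> leaves the temporaries below
  \<open>d\<close> intact, which protects the first operand while the second one is
  evaluated.\<close>

lemma comp_correct:
  assumes "bnd U M" "safe U (abst M) e" "d + depth e < 32" "100 \<le> U"
  shows "xp U (comp e d) M (esteps e) (\<lambda>M' out. out = [] \<and> M' (tmp d) = aval (abst M) e \<and> same_up d M M')"
  using assms(1-3)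
proof (induction e arbitrary: d M)
  case (C c)
  then show ?case unfolding comp.simps esteps.simps using assms(4)
    by (intro xp_assign) (auto simp: same_up_def tmp_def)
next
  case (V x)
  then show ?case unfolding comp.simps esteps.simps using assms(4)
    by (intro xp_assign) (auto simp: same_up_def tmp_def bnd_def abst_def)
next
  case (Rd k e)
  have d32: "d < 32" using Rd.prems by simp
  have "xp U (comp (Rd k e) d) M (esteps e + (2 + 1))
     (\<lambda>M' out. out = [] \<and> M' (tmp d) = aval (abst M) (Rd k e) \<and> same_up d M M')"
    unfolding comp.simps
  proof (rule xp_seq, rule xp_mono[OF Rd.IH order_refl])
    show "bnd U M" "safe U (abst M) e" "d + depth e < 32" using Rd.prems by auto
    fix M1 and o1 :: "int list"
    assume M1: "bnd U M1" and "o1 = [] \<and> M1 (tmp d) = aval (abst M) e \<and> same_up d M M1"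
    then have o1: "o1 = []" and v: "M1 (tmp d) = aval (abst M) e" and su: "same_up d M M1" by auto
    have a: "0 \<le> aval (abst M) e" "arr k (aval (abst M) e) \<le> U" "k < 16" using Rd.prems by auto
    let ?a = "arr k (aval (abst M) e)"
    have "M1 ?a = M ?a" using su a by (auto simp: same_up_def arr_def)
    moreover have "aval (abst M) (Rd k e) = M ?a" using a by (simp add: abst_def)
    ultimately have val: "M1 ?a = aval (abst M) (Rd k e)" by simp
    have ne: "?a \<noteq> tmp d" using a d32 by (auto simp: arr_def tmp_def)
    have mv: "\<bar>M1 ?a\<bar> \<le> U" using M1 by (simp add: bnd_def)
    have b2: "bnd U (M1(tmp d := ?a))" using M1 a by (auto simp: bnd_def arr_def)
    show "xp U (Seq (addr k d) (Assign (ToReg (tmp d)) Add (Ind (tmp d)) (Const 0))) M1 (2 + 1)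
       (\<lambda>M'' o2. o1 @ o2 = [] \<and> M'' (tmp d) = aval (abst M) (Rd k e) \<and> same_up d M M'')"
    proof (rule xp_seq, rule xp_addr[OF M1 _ _ _ _ assms(4)])
      show "d < 32" by (rule d32)
      show "0 \<le> M1 (tmp d)" "arr k (M1 (tmp d)) \<le> U" "k < 16" unfolding v by (rule a)+
      show "xp U (Assign (ToReg (tmp d)) Add (Ind (tmp d)) (Const 0)) (M1(tmp d := arr k (M1 (tmp d)))) 1
        (\<lambda>M'' o2. o1 @ [] @ o2 = [] \<and> M'' (tmp d) = aval (abst M) (Rd k e) \<and> same_up d M M'')"
        unfolding v using b2 ne mv val su o1 d32 assms(4)
        by (intro xp_assign) (auto simp: same_up_def tmp_def)
    qed
  qed
  then show ?case by (rule xp_mono) auto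
next
  case (Op f a b)
  have d32: "Suc d < 32" using Op.prems by auto
  have "xp U (comp (Op f a b) d) M (esteps a + (esteps b + 1))
     (\<lambda>M' out. out = [] \<and> M' (tmp d) = aval (abst M) (Op f a b) \<and> same_up d M M')"
    unfolding comp.simps
  proof (rule xp_seq, rule xp_mono[OF Op.IH(1) order_refl])
    show "bnd U M" "safe U (abst M) a" "d + depth a < 32" using Op.prems by auto
    fix M1 and o1 :: "int list"
    assume M1: "bnd U M1" and "o1 = [] \<and> M1 (tmp d) = aval (abst M) a \<and> same_up d M M1"
    then have o1: "o1 = []" and v: "M1 (tmp d) = aval (abst M) a" and su: "same_up d M M1" by auto
    have ab: "abst M1 = abst M" using su by (rule same_up_abst)
    show "xp U (Seq (comp b (Suc d)) (Assign (ToReg (tmp d)) f (Reg (tmp d)) (Reg (tmp (Suc d))))) M1 (esteps b + 1)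
       (\<lambda>M'' o2. o1 @ o2 = [] \<and> M'' (tmp d) = aval (abst M) (Op f a b) \<and> same_up d M M'')"
    proof (rule xp_seq, rule xp_mono[OF Op.IH(2) order_refl])
      show "bnd U M1" "safe U (abst M1) b" "Suc d + depth b < 32" using Op.prems M1 by (auto simp: ab)
      fix M2 and o2 :: "int list"
      assume M2: "bnd U M2" and "o2 = [] \<and> M2 (tmp (Suc d)) = aval (abst M1) b \<and> same_up (Suc d) M1 M2"
      then have o2: "o2 = []" and v2: "M2 (tmp (Suc d)) = aval (abst M) b" and su2: "same_up (Suc d) M1 M2"
        by (auto simp: ab)
      have v1: "M2 (tmp d) = aval (abst M) a" using su2 v by (simp add: same_up_def tmp_def)
      show "xp U (Assign (ToReg (tmp d)) f (Reg (tmp d)) (Reg (tmp (Suc d)))) M2 1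
         (\<lambda>M'' o3. o1 @ o2 @ o3 = [] \<and> M'' (tmp d) = aval (abst M) (Op f a b) \<and> same_up d M M'')"
      proof (rule xp_assign[OF M2])
        show "ok_dest U (ToReg (tmp d))" "ok_operand U (Reg (tmp d))" "ok_operand U (Reg (tmp (Suc d)))"
          using d32 assms(4) by (auto simp: tmp_def)
        show "\<bar>arith_val f (operand_val M2 (Reg (tmp d))) (operand_val M2 (Reg (tmp (Suc d))))\<bar> \<le> U"
          using Op.prems by (simp add: v1 v2)
        have "same_up d M (M2(tmp d := X))" for X
          using su su2 d32 by (auto simp: same_up_def tmp_def)
        then show "o1 @ o2 @ [] = [] \<and>
          (M2(dest_addr M2 (ToReg (tmp d)) := arith_val f (operand_val M2 (Reg (tmp d))) (operand_val M2 (Reg (tmp (Suc d)))))) (tmp d) = aval (abst M) (Op f a b) \<and>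
          same_up d M (M2(dest_addr M2 (ToReg (tmp d)) := arith_val f (operand_val M2 (Reg (tmp d))) (operand_val M2 (Reg (tmp (Suc d))))))"
          by (simp add: o1 o2 v1 v2)
      qed
    qed
  qed
  then show ?case by (rule xp_mono) auto
qed

section \<open>Proof rules for structured statements\<close>

abbreviation unchanged :: "stmt \<Rightarrow> state \<Rightarrow> state \<Rightarrow> bool" where
  "unchanged p s s' \<equiv> (\<forall>x. x \<notin> mods p \<longrightarrow> fst s' x = fst s x) \<and> (\<forall>k. k \<notin> amods p \<longrightarrow> snd s' k = snd s k)"

text \<open>The frame condition is built in: every rule also shows that nothing outside
  \<open>mods\<close> and \<open>amods\<close> changes, so a loop invariant need only speak about
  what the loop touches.\<close>

definition wp :: "int \<Rightarrow> stmt \<Rightarrow> state \<Rightarrow> nat \<Rightarrow> (state \<Rightarrow> int list \<Rightarrow> bool) \<Rightarrow> bool" where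
  "wp U p s T Q \<longleftrightarrow> (\<forall>M. bnd U M \<longrightarrow> abst M = s \<longrightarrow>
     xp U (cstmt p) M T (\<lambda>M' out. Q (abst M') out \<and>
       unchanged p s (abst M')))"

lemma wp_mono:
  assumes "wp U p s T Q" "T \<le> T'"
    and "\<And>s' out. Q s' out \<Longrightarrow> (\<And>x. x \<notin> mods p \<Longrightarrow> fst s' x = fst s x) \<Longrightarrow>
      (\<And>k. k \<notin> amods p \<Longrightarrow> snd s' k = snd s k) \<Longrightarrow> Q' s' out"
  shows "wp U p s T' Q'"
  unfolding wp_def
proof (intro allI impI)
  fix M assume M: "bnd U M" "abst M = s"
  have "xp U (cstmt p) M T (\<lambda>M' out. Q (abst M') out \<and>
       unchanged p s (abst M'))"
    using assms(1) M by (auto simp: wp_def)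
  then show "xp U (cstmt p) M T' (\<lambda>M' out. Q' (abst M') out \<and>
       unchanged p s (abst M'))"
    by (rule xp_mono[OF _ assms(2)]) (use assms(3) in auto)
qed

lemma wp_seq:
  assumes "wp U p s T1 (\<lambda>s' o1. wp U q s' T2 (\<lambda>s'' o2. Q s'' (o1 @ o2)))"
  shows "wp U (Sq p q) s (T1 + T2) Q"
  unfolding wp_def cstmt.simps
proof (intro allI impI, rule xp_seq)
  fix M assume M: "bnd U M" "abst M = s"
  have "xp U (cstmt p) M T1 (\<lambda>M' o1. wp U q (abst M') T2 (\<lambda>s'' o2. Q s'' (o1 @ o2)) \<and>
       unchanged p s (abst M'))"
    using assms M by (auto simp: wp_def[of U p])
  then show "xp U (cstmt p) M T1 (\<lambda>M' o1. xp U (cstmt q) M' T2 (\<lambda>M'' o2. Q (abst M'') (o1 @ o2) \<and>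
       unchanged (Sq p q) s (abst M'')))"
  proof (rule xp_mono[OF _ order_refl])
    fix M1 and o1 :: "int list"
    assume M1: "bnd U M1" and *: "wp U q (abst M1) T2 (\<lambda>s'' o2. Q s'' (o1 @ o2)) \<and>
       unchanged p s (abst M1)"
    then have "xp U (cstmt q) M1 T2 (\<lambda>M'' o2. Q (abst M'') (o1 @ o2) \<and>
       unchanged q (abst M1) (abst M''))"
      by (auto simp: wp_def)
    then show "xp U (cstmt q) M1 T2 (\<lambda>M'' o2. Q (abst M'') (o1 @ o2) \<and>
       unchanged (Sq p q) s (abst M''))"
      by (rule xp_mono[OF _ order_refl]) (use * in auto)
  qed
qed

lemma abst_upd_sc:
  assumes "x < 32" "abst M1 = abst M"
  shows "abst (M1(int x := v)) = ((fst (abst M))(x := v), snd (abst M))"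
proof -
  have "(M1(int x := v)) (arr k (int i)) = M1 (arr k (int i))" for k i
    using assms(1) by (simp add: arr_def)
  then have "snd (abst (M1(int x := v))) = snd (abst M1)" by (simp only: abst_def snd_conv)
  moreover have "fst (abst (M1(int x := v))) = (fst (abst M1))(x := v)"
    using assms(1) by (simp add: abst_def fun_eq_iff)
  ultimately show ?thesis by (simp add: assms(2) prod_eq_iff)
qed

lemma arr_eq_iff:
  assumes "k < 16" "k' < 16"
  shows "arr k i = arr k' i' \<longleftrightarrow> k = k' \<and> i = i'"
proof
  assume "arr k i = arr k' i'"
  then have e: "16 * i + int k = 16 * i' + int k'" by (simp add: arr_def)
  have "int k = (16 * i + int k) mod 16" using assms by simp
  also have "\<dots> = int k'" unfolding e using assms by simp
  finally show "k = k' \<and> i = i'" using e by simp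
qed simp

lemma abst_upd_ar:
  assumes "k < 16" "abst M1 = abst M"
  shows "abst (M1(arr k (int i) := v)) = (fst (abst M), (snd (abst M))(k := (snd (abst M) k)(i := v)))"
proof -
  have "(M1(arr k (int i) := v)) (int x) = M1 (int x)" if "x < 32" for x
    using that by (simp add: arr_def)
  then have "fst (abst (M1(arr k (int i) := v))) = fst (abst M1)"
    by (simp add: abst_def fun_eq_iff)
  moreover have "snd (abst (M1(arr k (int i) := v))) = (snd (abst M1))(k := (snd (abst M1) k)(i := v))"
  proof (intro ext)
    fix k' i'
    show "snd (abst (M1(arr k (int i) := v))) k' i' = ((snd (abst M1))(k := (snd (abst M1) k)(i := v))) k' i'"
      using assms(1) by (cases "k' < 16") (auto simp: abst_def arr_eq_iff)
  qed
  ultimately show ?thesis by (simp add: assms(2) prod_eq_iff)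
qed

lemma xp_comp:
  assumes "bnd U M" "abst M = s" "safe U s e" "d + depth e < 32" "100 \<le> U"
    and "\<And>M1. bnd U M1 \<Longrightarrow> abst M1 = s \<Longrightarrow> M1 (tmp d) = aval s e \<Longrightarrow> same_up d M M1 \<Longrightarrow> xp U q M1 T Q"
  shows "xp U (Seq (comp e d) q) M (esteps e + T) Q"
  by (rule xp_seq, rule xp_mono[OF comp_correct order_refl]) (use assms same_up_abst in auto)

lemma wp_SetV:
  assumes "safe U s e" "x < 32" "depth e < 32" "100 \<le> U"
    and "Q ((fst s)(x := aval s e), snd s) []"
  shows "wp U (SetV x e) s (esteps e + 1) Q"
  unfolding wp_def cstmt.simps
proof (intro allI impI, rule xp_comp)
  fix M M1 assume M: "bnd U M" "abst M = s" and M1: "bnd U M1" and ab: "abst M1 = s" and v: "M1 (tmp 0) = aval s e"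
  have "abst (M1(int x := aval s e)) = ((fst s)(x := aval s e), snd s)"
    using abst_upd_sc[OF assms(2), of M1 M1] ab by simp
  moreover have "\<bar>aval s e\<bar> \<le> U" using aval_bnd[OF M(1)] M(2) assms(1) by simp
  ultimately show "xp U (Assign (ToReg (int x)) Add (Reg (tmp 0)) (Const 0)) M1 1
     (\<lambda>M2 o2. Q (abst M2) o2 \<and> unchanged (SetV x e) s (abst M2))"
    using M1 assms v by (intro xp_assign) (auto simp: tmp_def)
qed (use assms in auto)

lemma wp_SetA:
  assumes "safe U s e" "safe U s i" "0 \<le> aval s i" "arr k (aval s i) \<le> U" "k < 16"
    "depth e < 32" "Suc (depth i) < 32" "100 \<le> U"
    and "Q (fst s, (snd s)(k := (snd s k)(nat (aval s i) := aval s e))) []"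
  shows "wp U (SetA k i e) s (esteps e + (esteps i + 3)) Q"
  unfolding wp_def cstmt.simps
proof (intro allI impI, rule xp_comp)
  fix M M1 assume M: "bnd U M" "abst M = s" and M1: "bnd U M1" and ab: "abst M1 = s" and v: "M1 (tmp 0) = aval s e"
  let ?Q = "\<lambda>M2 o2. Q (abst M2) o2 \<and> unchanged (SetA k i e) s (abst M2)"
  show "xp U (Seq (comp i 1) (Seq (addr k 1) (Assign (ToInd (tmp 1)) Add (Reg (tmp 0)) (Const 0)))) M1 (esteps i + 3) ?Q"
  proof (rule xp_comp[OF M1 ab])
    fix M2 assume M2: "bnd U M2" and ab2: "abst M2 = s" and v2: "M2 (tmp 1) = aval s i" and su: "same_up 1 M1 M2"
    have v0: "M2 (tmp 0) = aval s e" using su v by (simp add: same_up_def tmp_def)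
    let ?a = "arr k (aval s i)"
    let ?M3 = "M2(tmp 1 := ?a)"
    have b3: "bnd U ?M3" using M2 assms(3,4) by (auto simp: bnd_def arr_def)
    have ab3: "abst ?M3 = s" using ab2 same_up_abst[of 1 M2 ?M3] by (simp add: same_up_def tmp_def)
    have "abst (?M3(arr k (int (nat (aval s i))) := aval s e)) = (fst s, (snd s)(k := (snd s k)(nat (aval s i) := aval s e)))"
      using abst_upd_ar[OF assms(5), of ?M3 ?M3 "nat (aval s i)" "aval s e"] unfolding ab3 by simp
    then have ab4: "abst (?M3(?a := aval s e)) = (fst s, (snd s)(k := (snd s k)(nat (aval s i) := aval s e)))"
      using assms(3) by simp
    have ve: "\<bar>aval s e\<bar> \<le> U" using aval_bnd[OF M(1)] M(2) assms(1) by simp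
    have "xp U (Seq (addr k 1) (Assign (ToInd (tmp 1)) Add (Reg (tmp 0)) (Const 0))) M2 (2 + 1) ?Q"
    proof (rule xp_seq, rule xp_addr[OF M2])
      show "0 \<le> M2 (tmp 1)" "arr k (M2 (tmp 1)) \<le> U" using assms(3,4) by (simp_all only: v2)
      show "xp U (Assign (ToInd (tmp 1)) Add (Reg (tmp 0)) (Const 0)) (M2(tmp 1 := arr k (M2 (tmp 1)))) 1
        (\<lambda>M'' o2. ?Q M'' ([] @ o2))"
        unfolding v2
      proof (rule xp_assign[OF b3])
        have t: "tmp 0 \<noteq> tmp 1" by (simp add: tmp_def)
        show "ok_dest U (ToInd (tmp 1))" "ok_operand U (Reg (tmp 0))" "ok_operand U (Const 0)"
          using assms(8) by (auto simp: tmp_def)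
        show "\<bar>arith_val Add (operand_val ?M3 (Reg (tmp 0))) (operand_val ?M3 (Const 0))\<bar> \<le> U"
          using t ve by (simp add: v0)
        show "?Q (?M3(dest_addr ?M3 (ToInd (tmp 1)) := arith_val Add (operand_val ?M3 (Reg (tmp 0))) (operand_val ?M3 (Const 0)))) ([] @ [])"
          using t assms(9) by (simp add: v0 ab4 del: One_nat_def)
      qed
    qed (use assms in auto)
    then show "xp U (Seq (addr k 1) (Assign (ToInd (tmp 1)) Add (Reg (tmp 0)) (Const 0))) M2 3 ?Q" by (rule xp_mono) auto
  qed (use assms in auto)
qed (use assms in auto)

lemma wp_test:
  assumes ab: "safe U s a" "safe U s b" "depth a < 32" "Suc (depth b) < 32" "100 \<le> U"
    and M: "bnd U M" "abst M = s"
    and t: "\<And>M'. test_val M' b' \<longleftrightarrow> R (M' (tmp 0)) (M' (tmp 1))"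
    and tc: "\<And>M'. bnd U M' \<Longrightarrow> test_cost M' b' \<le> unit_cost U"
    and p: "\<And>M'. bnd U M' \<Longrightarrow> abst M' = s \<Longrightarrow> R (aval s a) (aval s b) \<Longrightarrow> xp U p M' T Q"
    and q: "\<And>M'. bnd U M' \<Longrightarrow> abst M' = s \<Longrightarrow> \<not> R (aval s a) (aval s b) \<Longrightarrow> xp U q M' T Q"
  shows "xp U (Seq (comp a 0) (Seq (comp b 1) (IfElse b' p q))) M (esteps a + (esteps b + Suc T)) Q"
proof (rule xp_comp[OF M])
  fix M1 assume M1: "bnd U M1" "abst M1 = s" and v: "M1 (tmp 0) = aval s a"
  show "xp U (Seq (comp b 1) (IfElse b' p q)) M1 (esteps b + Suc T) Q"
  proof (rule xp_comp[OF M1])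
    fix M2 assume M2: "bnd U M2" "abst M2 = s" and v2: "M2 (tmp 1) = aval s b" and su: "same_up 1 M1 M2"
    have v0: "M2 (tmp 0) = aval s a" using su v by (simp add: same_up_def tmp_def)
    show "xp U (IfElse b' p q) M2 (Suc T) Q"
      by (rule xp_ifelse[OF tc[OF M2(1)]]) (auto simp only: t v0 v2 intro: p[OF M2] q[OF M2])
  qed (use ab in auto)
qed (use ab in auto)

lemma wp_IfLt:
  assumes "safe U s a" "safe U s b" "depth a < 32" "Suc (depth b) < 32" "100 \<le> U"
    and p: "aval s a < aval s b \<Longrightarrow> wp U p s T Q" and q: "\<not> aval s a < aval s b \<Longrightarrow> Q s []" and T: "0 < T"
  shows "wp U (IfLt a b p) s (esteps a + (esteps b + Suc T)) Q"
  unfolding wp_def cstmt.simps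
proof (intro allI impI)
  fix M assume M: "bnd U M" "abst M = s"
  show "xp U (Seq (comp a 0) (Seq (comp b 1) (IfElse (Lt (Reg (tmp 0)) (Reg (tmp 1))) (cstmt p) Skip))) M
     (esteps a + (esteps b + Suc T)) (\<lambda>M' out. Q (abst M') out \<and>
       unchanged (IfLt a b p) s (abst M'))"
  proof (rule wp_test[OF assms(1-5) M, where R = "(<)"])
    fix M' assume M': "bnd U M'" "abst M' = s"
    show "xp U (cstmt p) M' T (\<lambda>M' out. Q (abst M') out \<and>
       unchanged (IfLt a b p) s (abst M'))" if "aval s a < aval s b"
      using p[OF that] M' by (simp add: wp_def)
    show "xp U Skip M' T (\<lambda>M' out. Q (abst M') out \<and>
       unchanged (IfLt a b p) s (abst M'))" if "\<not> aval s a < aval s b"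
      by (rule xp_mono[OF xp_skip]) (use q[OF that] M' T in auto)
  next
    fix M' assume "bnd U M'"
    then show "test_cost M' (Lt (Reg (tmp 0)) (Reg (tmp 1))) \<le> unit_cost U"
      by (rule test_cost_le(1)) (use assms(5) in \<open>auto simp: tmp_def\<close>)
  qed auto
qed

lemma wp_IfEq:
  assumes "safe U s a" "safe U s b" "depth a < 32" "Suc (depth b) < 32" "100 \<le> U"
    and p: "aval s a = aval s b \<Longrightarrow> wp U p s T Q" and q: "aval s a \<noteq> aval s b \<Longrightarrow> wp U q s T Q"
  shows "wp U (IfEq a b p q) s (esteps a + (esteps b + Suc T)) Q"
  unfolding wp_def cstmt.simps
proof (intro allI impI)
  fix M assume M: "bnd U M" "abst M = s"
  show "xp U (Seq (comp a 0) (Seq (comp b 1) (IfElse (Eq (Reg (tmp 0)) (Reg (tmp 1))) (cstmt p) (cstmt q)))) M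
     (esteps a + (esteps b + Suc T)) (\<lambda>M' out. Q (abst M') out \<and>
       unchanged (IfEq a b p q) s (abst M'))"
  proof (rule wp_test[OF assms(1-5) M, where R = "(=)"])
    fix M' assume M': "bnd U M'" "abst M' = s"
    show "xp U (cstmt p) M' T (\<lambda>M' out. Q (abst M') out \<and>
       unchanged (IfEq a b p q) s (abst M'))" if "aval s a = aval s b"
      by (rule xp_mono[OF p[OF that, unfolded wp_def, rule_format, OF M']]) auto
    show "xp U (cstmt q) M' T (\<lambda>M' out. Q (abst M') out \<and>
       unchanged (IfEq a b p q) s (abst M'))" if "aval s a \<noteq> aval s b"
      by (rule xp_mono[OF q[OF that, unfolded wp_def, rule_format, OF M']]) auto
  next
    fix M' assume "bnd U M'"
    then show "test_cost M' (Eq (Reg (tmp 0)) (Reg (tmp 1))) \<le> unit_cost U"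
      by (rule test_cost_le(2)) (use assms(5) in \<open>auto simp: tmp_def\<close>)
  qed auto
qed

lemma wp_Wr:
  assumes "safe U s e" "depth e < 32" "100 \<le> U" "Q s [aval s e]"
  shows "wp U (Wr e) s (esteps e + 1) Q"
  unfolding wp_def cstmt.simps
proof (intro allI impI, rule xp_comp)
  fix M M1 assume M1: "bnd U M1" and ab: "abst M1 = s" and v: "M1 (tmp 0) = aval s e"
  have "operand_cost M1 (Reg (tmp 0)) \<le> 3 * len U"
    using M1 assms(3) by (intro operand_cost_le) (auto simp: tmp_def)
  also have "\<dots> \<le> 1 * unit_cost U" using len_square[of U] by (simp add: unit_cost_def)
  finally have c: "operand_cost M1 (Reg (tmp 0)) \<le> 1 * unit_cost U" .
  have "exec (Write (Reg (tmp 0))) M1 (operand_cost M1 (Reg (tmp 0))) M1 [operand_val M1 (Reg (tmp 0))]"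
    by (rule exec.Write)
  moreover have "operand_val M1 (Reg (tmp 0)) = aval s e" by (simp add: v)
  ultimately show "xp U (Write (Reg (tmp 0))) M1 1 (\<lambda>M2 o2. Q (abst M2) o2 \<and> unchanged (Wr e) s (abst M2))"
    unfolding xp_def using c M1 ab assms(4) by auto
qed (use assms in auto)

text \<open>The bound register is read afresh in every test, so the body must leave \<open>h\<close>
  alone; the test and the increment add 2 units per round.\<close>

lemma wp_For:
  assumes v: "v < 32" "h < 32" "v \<noteq> h" "v \<notin> mods p" "h \<notin> mods p" and U: "100 \<le> U" and n: "fst s h = int n"
    and init: "I 0 ((fst s)(v := 0), snd s) []"
    and step: "\<And>j s' out. j < n \<Longrightarrow> I j s' out \<Longrightarrow> fst s' v = int j \<Longrightarrow> fst s' h = int n \<Longrightarrow>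
       (\<And>x. x \<notin> mods (For v h p) \<Longrightarrow> fst s' x = fst s x) \<Longrightarrow> (\<And>k. k \<notin> amods p \<Longrightarrow> snd s' k = snd s k) \<Longrightarrow>
       wp U p s' T (\<lambda>s'' o2. I (Suc j) ((fst s'')(v := int (Suc j)), snd s'') (out @ o2))"
    and fin: "\<And>s' out. I n s' out \<Longrightarrow> fst s' v = int n \<Longrightarrow> Q s' out"
  shows "wp U (For v h p) s (n * (T + 2) + 2) Q"
  unfolding wp_def cstmt.simps
proof (intro allI impI)
  fix M0 assume M0: "bnd U M0" "abst M0 = s"
  let ?t = "Lt (Reg (int v)) (Reg (int h))"
  let ?inc = "Assign (ToReg (int v)) Add (Reg (int v)) (Const 1)"
  let ?W = "While ?t (Seq (cstmt p) ?inc)"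
  let ?fr = "\<lambda>s'. (\<forall>x. x \<notin> mods (For v h p) \<longrightarrow> fst s' x = fst s x) \<and> (\<forall>k. k \<notin> amods p \<longrightarrow> snd s' k = snd s k)"
  have hn: "M0 (int h) = int n" using n M0(2) v(2) by (auto simp: abst_def)
  have nU: "int n \<le> U" using M0(1) hn by (auto simp: bnd_def dest: spec[of _ "int h"])
  have tc: "test_cost M ?t \<le> unit_cost U" if "bnd U M" for M
    by (rule test_cost_le(1)[OF that]) (use v U in auto)
  have loop: "xp U ?W M ((n - j) * (T + 2) + 1) (\<lambda>M' o2. Q (abst M') (out @ o2) \<and> ?fr (abst M'))"
    if "j \<le> n" "bnd U M" "I j (abst M) out" "fst (abst M) v = int j" "?fr (abst M)" for j M out
    using that
  proof (induction "n - j" arbitrary: j M out)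
    case 0
    then have j: "j = n" by simp
    have "fst (abst M) h = int n" using 0 n v(3,5) by auto
    then have nt: "\<not> test_val M ?t" using 0 j v by (simp add: abst_def)
    have "exec ?W M (test_cost M ?t) M []" using nt by (rule exec.WhileFalse)
    moreover have "Q (abst M) (out @ [])" using fin[of "abst M" out] 0 j by simp
    ultimately show ?case unfolding xp_def
      using tc[OF 0(3)] 0 j by (intro exI[of _ "test_cost M ?t"] exI[of _ M] exI[of _ "[]"]) auto
  next
    case (Suc d)
    then have j: "j < n" "d = n - Suc j" by auto
    have hM: "fst (abst M) h = int n" using Suc.prems n v(3,5) by auto
    then have tt: "test_val M ?t" using Suc.prems j v by (simp add: abst_def)
    have "wp U p (abst M) T (\<lambda>s'' o2. I (Suc j) ((fst s'')(v := int (Suc j)), snd s'') (out @ o2))"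
      using Suc.prems j hM by (intro step) auto
    then have 1: "xp U (cstmt p) M T (\<lambda>M' o1. I (Suc j) ((fst (abst M'))(v := int (Suc j)), snd (abst M')) (out @ o1) \<and>
       unchanged p (abst M) (abst M'))"
      using Suc.prems by (simp add: wp_def)
    have "xp U (Seq (cstmt p) ?inc) M (T + 1) (\<lambda>M' o1. I (Suc j) (abst M') (out @ o1) \<and> fst (abst M') v = int (Suc j) \<and> ?fr (abst M'))"
    proof (rule xp_seq, rule xp_mono[OF 1 order_refl])
      fix M' and o1 :: "int list"
      assume M': "bnd U M'" and *: "I (Suc j) ((fst (abst M'))(v := int (Suc j)), snd (abst M')) (out @ o1) \<and>
       unchanged p (abst M) (abst M')"
      have vj: "M' (int v) = int j"
      proof -
        have "fst (abst M') v = int j" using * v(4) Suc.prems by simp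
        then show ?thesis using v by (simp add: abst_def)
      qed
      have ab: "abst (M'(int v := int (Suc j))) = ((fst (abst M'))(v := int (Suc j)), snd (abst M'))"
        by (rule abst_upd_sc) (use v in auto)
      have fr': "?fr (abst (M'(int v := int (Suc j))))"
        unfolding ab using * Suc.prems(5) by auto
      show "xp U ?inc M' 1 (\<lambda>M'' o2. I (Suc j) (abst M'') (out @ o1 @ o2) \<and> fst (abst M'') v = int (Suc j) \<and> ?fr (abst M''))"
      proof (rule xp_assign[OF M'])
        have e: "M'(dest_addr M' (ToReg (int v)) := arith_val Add (operand_val M' (Reg (int v))) (operand_val M' (Const 1)))
          = M'(int v := int (Suc j))" by (simp add: vj add.commute)
        show "I (Suc j) (abst (M'(dest_addr M' (ToReg (int v)) := arith_val Add (operand_val M' (Reg (int v))) (operand_val M' (Const 1))))) (out @ o1 @ [])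
          \<and> fst (abst (M'(dest_addr M' (ToReg (int v)) := arith_val Add (operand_val M' (Reg (int v))) (operand_val M' (Const 1))))) v = int (Suc j)
          \<and> ?fr (abst (M'(dest_addr M' (ToReg (int v)) := arith_val Add (operand_val M' (Reg (int v))) (operand_val M' (Const 1)))))"
          unfolding e ab using fr'[unfolded ab] * by simp
      qed (use v U vj nU j in auto)
    qed
    then obtain t1 M1 o1 where e1: "exec (Seq (cstmt p) ?inc) M t1 M1 o1" "t1 \<le> (T + 1) * unit_cost U" "bnd U M1"
      "I (Suc j) (abst M1) (out @ o1)" "fst (abst M1) v = int (Suc j)" "?fr (abst M1)"
      unfolding xp_def by blast
    have "xp U ?W M1 ((n - Suc j) * (T + 2) + 1) (\<lambda>M' o2. Q (abst M') ((out @ o1) @ o2) \<and> ?fr (abst M'))"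
      using j e1 Suc.hyps(2) by (intro Suc.hyps(1)) auto
    then obtain t2 M2 o2 where e2: "exec ?W M1 t2 M2 o2" "t2 \<le> ((n - Suc j) * (T + 2) + 1) * unit_cost U" "bnd U M2"
      "Q (abst M2) ((out @ o1) @ o2)" "?fr (abst M2)"
      unfolding xp_def by blast
    have "exec ?W M (test_cost M ?t + t1 + t2) M2 (o1 @ o2)" using tt e1(1) e2(1) by (rule exec.WhileTrue)
    moreover have "test_cost M ?t + t1 + t2 \<le> ((n - j) * (T + 2) + 1) * unit_cost U"
    proof -
      have "test_cost M ?t + t1 + t2 \<le> unit_cost U + (T + 1) * unit_cost U + ((n - Suc j) * (T + 2) + 1) * unit_cost U"
        using tc[OF Suc.prems(2)] e1(2) e2(2) by linarith
      also have "\<dots> = ((n - Suc j + 1) * (T + 2) + 1) * unit_cost U" by (simp add: algebra_simps)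
      also have "n - Suc j + 1 = n - j" using j by simp
      finally show ?thesis .
    qed
    ultimately show ?case unfolding xp_def using e2 by auto
  qed
  have "xp U (Seq (Assign (ToReg (int v)) Add (Const 0) (Const 0)) ?W) M0 (1 + (n * (T + 2) + 1))
    (\<lambda>M' o2. Q (abst M') o2 \<and> ?fr (abst M'))"
  proof (rule xp_seq, rule xp_assign[OF M0(1)])
    let ?M1 = "M0(int v := 0)"
    have ab: "abst ?M1 = ((fst s)(v := 0), snd s)" using abst_upd_sc[OF v(1), of M0 M0 0] M0(2) by simp
    have "xp U ?W ?M1 ((n - 0) * (T + 2) + 1) (\<lambda>M' o2. Q (abst M') ([] @ o2) \<and> ?fr (abst M'))"
      using M0(1) init U by (intro loop) (auto simp: ab bnd_def)
    then show "xp U ?W (M0(dest_addr M0 (ToReg (int v)) := arith_val Add (operand_val M0 (Const 0)) (operand_val M0 (Const 0)))) (n * (T + 2) + 1)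
      (\<lambda>M'' o2. Q (abst M'') ([] @ o2) \<and> ?fr (abst M''))" by simp
  qed (use v U in auto)
  then show "xp U (Seq (Assign (ToReg (int v)) Add (Const 0) (Const 0)) ?W) M0 (n * (T + 2) + 2)
    (\<lambda>M' out. Q (abst M') out \<and> unchanged (For v h p) s (abst M'))"
    by (rule xp_mono) auto
qed

section \<open>Cost and size bounds read off the syntax\<close>

primrec leaves :: "aexp \<Rightarrow> nat" where
  "leaves (C c) = 1"
| "leaves (V x) = 1"
| "leaves (Rd k e) = leaves e"
| "leaves (Op f a b) = leaves a + leaves b"

lemma depth_leaves: "depth e < leaves e"
  by (induction e) auto

text \<open>An upper bound computed from the program text, given bounds \<open>hb\<close> for the
  registers that bound loops. The branches of \<open>IfEq\<close> are added instead of taking a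
  maximum.\<close>

primrec tcost :: "(nat \<Rightarrow> nat) \<Rightarrow> stmt \<Rightarrow> nat" where
  "tcost hb (SetV x e) = esteps e + 1"
| "tcost hb (SetA k i e) = esteps e + (esteps i + 3)"
| "tcost hb (Sq p q) = tcost hb p + tcost hb q"
| "tcost hb (IfLt a b p) = esteps a + (esteps b + Suc (tcost hb p))"
| "tcost hb (IfEq a b p q) = esteps a + (esteps b + Suc (tcost hb p + tcost hb q))"
| "tcost hb (For v h p) = hb h * (tcost hb p + 2) + 2"
| "tcost hb (Wr e) = esteps e + 1"

lemma tcost_pos: "0 < tcost hb p"
  by (induction p) auto

definition bs :: "int \<Rightarrow> state \<Rightarrow> bool" where
  "bs R s \<longleftrightarrow> (\<forall>x. \<bar>fst s x\<bar> \<le> R) \<and> (\<forall>k i. \<bar>snd s k i\<bar> \<le> R)"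

primrec chk :: "int \<Rightarrow> state \<Rightarrow> aexp \<Rightarrow> bool" where
  "chk R s (C c) \<longleftrightarrow> \<bar>c\<bar> \<le> R"
| "chk R s (V x) \<longleftrightarrow> x < 32"
| "chk R s (Rd k e) \<longleftrightarrow> chk R s e \<and> k < 16 \<and> 0 \<le> aval s e"
| "chk R s (Op f a b) \<longleftrightarrow> chk R s a \<and> chk R s b"

lemma abs_div_le: "\<bar>x div y\<bar> \<le> \<bar>x\<bar>" for x y :: int
proof -
  have pos: "\<bar>x div y\<bar> \<le> \<bar>x\<bar>" if y: "0 < y" for x y :: int
  proof -
    have e: "x = x div y * y + x mod y" and r: "0 \<le> x mod y" "x mod y < y" using y by simp_all
    show ?thesis
    proof (cases "0 \<le> x div y")
      case True
      then have "x div y * 1 \<le> x div y * y" using y by (intro mult_left_mono) auto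
      then show ?thesis using True e r by linarith
    next
      case False
      then have "(x div y + 1) * y \<le> (x div y + 1) * 1" using y by (intro mult_left_mono_neg) auto
      then have "x div y * y + y \<le> x div y + 1" by (simp add: algebra_simps)
      then show ?thesis using False e r by linarith
    qed
  qed
  show ?thesis using pos[of y x] pos[of "- y" "- x"] by (cases y "0 :: int" rule: linorder_cases) auto
qed

text \<open>For bounds of at least 2 every operation, sums included, is bounded by the product; so
  the size of an expression depends only on its number of leaves.\<close>

lemma arith_bound:
  assumes "\<bar>x\<bar> \<le> A" "\<bar>y\<bar> \<le> B" "2 \<le> A" "2 \<le> B"
  shows "\<bar>arith_val f x y\<bar> \<le> A * B"
proof -
  have AB: "A + B \<le> A * B"
  proof -
    have "0 \<le> (A - 1) * (B - 1) - 1"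
      using mult_mono[of 1 "A - 1" 1 "B - 1"] assms by simp
    then show ?thesis by (simp add: algebra_simps)
  qed
  have "\<bar>x * y\<bar> \<le> A * B" unfolding abs_mult using assms by (intro mult_mono) auto
  moreover have "\<bar>x mod y\<bar> \<le> \<bar>x\<bar> + \<bar>y\<bar>"
    using abs_mod_less[of y x] by (cases "y = 0") auto
  ultimately show ?thesis using assms AB abs_div_le[of x y] by (cases f) auto
qed

lemma aval_bound:
  assumes "bs R s" "chk R s e" "100 \<le> R"
  shows "\<bar>aval s e\<bar> \<le> R ^ leaves e"
  using assms(2)
proof (induction e)
  case (Rd k e)
  have "R ^ 1 \<le> R ^ leaves e" using assms(3) depth_leaves[of e] by (intro power_increasing) auto
  moreover have "\<bar>aval s (Rd k e)\<bar> \<le> R" using assms(1) by (simp add: bs_def)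
  ultimately show ?case by simp
next
  case (Op f a b)
  have 2: "2 \<le> R ^ leaves e" for e
  proof -
    have "R ^ 1 \<le> R ^ leaves e" using assms(3) depth_leaves[of e] by (intro power_increasing) auto
    then show ?thesis using assms(3) by simp
  qed
  show ?case using arith_bound[OF Op.IH(1) Op.IH(2) 2 2, of f] Op.prems by (simp add: power_add)
qed (use assms in \<open>auto simp: bs_def\<close>)

text \<open>One more factor \<open>R\<close> covers the address arithmetic
  \<open>16 * i + 80\<close>. Stored values stay within \<open>R\<close>, while temporaries may
  reach \<open>R ^ 16\<close>.\<close>

lemma safe_chk:
  assumes "bs R s" "100 \<le> R"
  shows "chk R s e \<Longrightarrow> leaves e \<le> 15 \<Longrightarrow> safe (R ^ 16) s e"
proof (induction e)
  case (C c)
  have "R ^ 1 \<le> R ^ 16" using assms(2) by (intro power_increasing) auto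
  then show ?case using C by auto
next
  case (Rd k e)
  have "\<bar>aval s e\<bar> \<le> R ^ leaves e" using Rd.prems by (intro aval_bound assms) auto
  also have "\<dots> \<le> R ^ 15" using assms(2) Rd.prems by (intro power_increasing) auto
  finally have 1: "aval s e \<le> R ^ 15" by simp
  have "R ^ 1 \<le> R ^ 15" using assms(2) by (intro power_increasing) auto
  then have "16 * R ^ 15 + 80 \<le> 100 * R ^ 15" using assms(2) by simp
  also have "\<dots> \<le> R * R ^ 15" using assms(2) by (intro mult_right_mono) auto
  finally have 2: "16 * R ^ 15 + 80 \<le> R ^ 16" by (simp add: power_numeral_reduce)
  show ?case using Rd 1 2 by (auto simp: arr_def)
next
  case (Op f a b)
  have "\<bar>aval s (Op f a b)\<bar> \<le> R ^ leaves (Op f a b)" using Op.prems by (intro aval_bound assms) auto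
  also have "\<dots> \<le> R ^ 16" using assms(2) Op.prems by (intro power_increasing) auto
  finally show ?case using Op by auto
qed auto

locale ram =
  fixes R :: int and hb :: "nat \<Rightarrow> nat"
  assumes R100: "100 \<le> R"
begin

text \<open>Puts the size invariant \<open>bs\<close> into pre- and postcondition, fixes the machine
  bound at \<open>R ^ 16\<close> and takes the cost from \<open>tcost\<close>; functional facts and
  size bounds for stored values remain as obligations.\<close>

definition wq :: "stmt \<Rightarrow> state \<Rightarrow> (state \<Rightarrow> int list \<Rightarrow> bool) \<Rightarrow> bool" where
  "wq p s Q \<longleftrightarrow> (bs R s \<longrightarrow> wp (R ^ 16) p s (tcost hb p) (\<lambda>s' out. bs R s' \<and> Q s' out))"

lemma U100: "100 \<le> R ^ 16"
proof -
  have "R ^ 1 \<le> R ^ 16" using R100 by (intro power_increasing) auto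
  then show ?thesis using R100 by simp
qed

lemma wq_mono:
  assumes "wq p s Q"
    and "\<And>s' out. bs R s' \<Longrightarrow> Q s' out \<Longrightarrow> (\<And>x. x \<notin> mods p \<Longrightarrow> fst s' x = fst s x) \<Longrightarrow>
      (\<And>k. k \<notin> amods p \<Longrightarrow> snd s' k = snd s k) \<Longrightarrow> Q' s' out"
  shows "wq p s Q'"
  unfolding wq_def
proof
  assume "bs R s"
  with assms(1) have "wp (R ^ 16) p s (tcost hb p) (\<lambda>s' out. bs R s' \<and> Q s' out)" by (simp add: wq_def)
  then show "wp (R ^ 16) p s (tcost hb p) (\<lambda>s' out. bs R s' \<and> Q' s' out)"
    by (rule wp_mono[OF _ order_refl]) (use assms(2) in blast)
qed

lemma wq_Sq:
  assumes "wq p s Q1"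
    and "\<And>s' o1. bs R s' \<Longrightarrow> Q1 s' o1 \<Longrightarrow> (\<And>x. x \<notin> mods p \<Longrightarrow> fst s' x = fst s x) \<Longrightarrow>
      (\<And>k. k \<notin> amods p \<Longrightarrow> snd s' k = snd s k) \<Longrightarrow> wq q s' (\<lambda>s'' o2. Q s'' (o1 @ o2))"
  shows "wq (Sq p q) s Q"
  unfolding wq_def tcost.simps
proof (intro impI wp_seq)
  assume "bs R s"
  with assms(1) have "wp (R ^ 16) p s (tcost hb p) (\<lambda>s' out. bs R s' \<and> Q1 s' out)" by (simp add: wq_def)
  then show "wp (R ^ 16) p s (tcost hb p) (\<lambda>s' o1. wp (R ^ 16) q s' (tcost hb q) (\<lambda>s'' o2. bs R s'' \<and> Q s'' (o1 @ o2)))"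
  proof (rule wp_mono[OF _ order_refl])
    fix s' and out :: "int list"
    assume a: "bs R s' \<and> Q1 s' out" and b: "\<And>x. x \<notin> mods p \<Longrightarrow> fst s' x = fst s x" "\<And>k. k \<notin> amods p \<Longrightarrow> snd s' k = snd s k"
    show "wp (R ^ 16) q s' (tcost hb q) (\<lambda>s'' o2. bs R s'' \<and> Q s'' (out @ o2))"
      using assms(2)[OF conjunct1[OF a] conjunct2[OF a] b] a unfolding wq_def by blast
  qed
qed

lemma wq_SetV:
  assumes "chk R s e" "leaves e \<le> 15" "x < 32" "\<bar>aval s e\<bar> \<le> R" "Q ((fst s)(x := aval s e), snd s) []"
  shows "wq (SetV x e) s Q"
  unfolding wq_def tcost.simps
proof
  assume b: "bs R s"
  show "wp (R ^ 16) (SetV x e) s (esteps e + 1) (\<lambda>s' out. bs R s' \<and> Q s' out)"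
    using assms b depth_leaves[of e] by (intro wp_SetV safe_chk[OF b R100] U100) (auto simp: bs_def)
qed

lemma wq_SetA:
  assumes "chk R s e" "leaves e \<le> 15" "chk R s (Rd k i)" "leaves i \<le> 15" "\<bar>aval s e\<bar> \<le> R"
    "Q (fst s, (snd s)(k := (snd s k)(nat (aval s i) := aval s e))) []"
  shows "wq (SetA k i e) s Q"
  unfolding wq_def tcost.simps
proof
  assume b: "bs R s"
  have "safe (R ^ 16) s (Rd k i)" by (rule safe_chk[OF b R100 assms(3)]) (use assms(4) in simp)
  then show "wp (R ^ 16) (SetA k i e) s (esteps e + (esteps i + 3)) (\<lambda>s' out. bs R s' \<and> Q s' out)"
    using assms b depth_leaves[of e] depth_leaves[of i]
    by (intro wp_SetA safe_chk[OF b R100] U100) (auto simp: bs_def)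
qed

lemma wq_IfLt:
  assumes "chk R s a" "leaves a \<le> 15" "chk R s b" "leaves b \<le> 15"
    and "aval s a < aval s b \<Longrightarrow> wq p s Q" "\<not> aval s a < aval s b \<Longrightarrow> Q s []"
  shows "wq (IfLt a b p) s Q"
  unfolding wq_def tcost.simps
proof
  assume bs: "bs R s"
  show "wp (R ^ 16) (IfLt a b p) s (esteps a + (esteps b + Suc (tcost hb p))) (\<lambda>s' out. bs R s' \<and> Q s' out)"
    using assms bs depth_leaves[of a] depth_leaves[of b] tcost_pos[of hb p]
    by (intro wp_IfLt safe_chk[OF bs R100] U100) (auto simp: wq_def)
qed

lemma wq_IfEq:
  assumes "chk R s a" "leaves a \<le> 15" "chk R s b" "leaves b \<le> 15"
    and "aval s a = aval s b \<Longrightarrow> wq p s Q" "aval s a \<noteq> aval s b \<Longrightarrow> wq q s Q"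
  shows "wq (IfEq a b p q) s Q"
  unfolding wq_def tcost.simps
proof
  assume bs: "bs R s"
  have 1: "wp (R ^ 16) p s (tcost hb p + tcost hb q) (\<lambda>s' out. bs R s' \<and> Q s' out)" if "aval s a = aval s b"
    using assms(5)[OF that] bs by (auto simp: wq_def elim: wp_mono)
  have 2: "wp (R ^ 16) q s (tcost hb p + tcost hb q) (\<lambda>s' out. bs R s' \<and> Q s' out)" if "aval s a \<noteq> aval s b"
    using assms(6)[OF that] bs by (auto simp: wq_def elim: wp_mono)
  show "wp (R ^ 16) (IfEq a b p q) s (esteps a + (esteps b + Suc (tcost hb p + tcost hb q))) (\<lambda>s' out. bs R s' \<and> Q s' out)"
    using assms(1-4) bs depth_leaves[of a] depth_leaves[of b] 1 2
    by (intro wp_IfEq safe_chk[OF bs R100] U100) auto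
qed

lemma wq_Wr:
  assumes "chk R s e" "leaves e \<le> 15" "Q s [aval s e]"
  shows "wq (Wr e) s Q"
  unfolding wq_def tcost.simps
proof
  assume bs: "bs R s"
  show "wp (R ^ 16) (Wr e) s (esteps e + 1) (\<lambda>s' out. bs R s' \<and> Q s' out)"
    using assms bs depth_leaves[of e] by (intro wp_Wr safe_chk[OF bs R100] U100) auto
qed

text \<open>The invariant sees the state before the loop counter is advanced.\<close>

lemma wq_For:
  assumes v: "v < 32" "h < 32" "v \<noteq> h" "v \<notin> mods p" "h \<notin> mods p" and n: "fst s h = int n" "n \<le> hb h"
    and I0: "\<And>x. I 0 ((fst s)(v := x), snd s) []"
    and Iv: "\<And>j s' out x. I j s' out \<Longrightarrow> I j ((fst s')(v := x), snd s') out"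
    and step: "\<And>j s' out. j < n \<Longrightarrow> bs R s' \<Longrightarrow> I j s' out \<Longrightarrow> fst s' v = int j \<Longrightarrow>
       (\<And>x. x \<notin> mods (For v h p) \<Longrightarrow> fst s' x = fst s x) \<Longrightarrow> (\<And>k. k \<notin> amods p \<Longrightarrow> snd s' k = snd s k) \<Longrightarrow>
       wq p s' (\<lambda>s'' o2. I (Suc j) s'' (out @ o2))"
    and fin: "\<And>s' out. I n s' out \<Longrightarrow> Q s' out"
  shows "wq (For v h p) s Q"
  unfolding wq_def tcost.simps
proof
  assume b: "bs R s"
  have nR: "int n \<le> R" using b n(1) by (auto simp: bs_def dest: spec[of _ h])
  have upd: "bs R ((fst s')(v := int j), snd s')" if "bs R s'" "j \<le> n" for s' j
    using that nR by (auto simp: bs_def)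
  have "wp (R ^ 16) (For v h p) s (n * (tcost hb p + 2) + 2) (\<lambda>s' out. bs R s' \<and> Q s' out)"
  proof (rule wp_For[OF v U100 n(1), where I = "\<lambda>j s' out. bs R s' \<and> I j s' out"])
    show "bs R ((fst s)(v := 0), snd s) \<and> I 0 ((fst s)(v := 0), snd s) []"
      using upd[OF b, of 0] I0 by simp
    fix j s' out
    assume j: "j < n" and i: "bs R s' \<and> I j s' out" and a: "fst s' v = int j"
      and fr: "\<And>x. x \<notin> mods (For v h p) \<Longrightarrow> fst s' x = fst s x" "\<And>k. k \<notin> amods p \<Longrightarrow> snd s' k = snd s k"
    have "wp (R ^ 16) p s' (tcost hb p) (\<lambda>s'' o2. bs R s'' \<and> I (Suc j) s'' (out @ o2))"
      using step[OF j conjunct1[OF i] conjunct2[OF i] a fr] i by (simp add: wq_def)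
    then show "wp (R ^ 16) p s' (tcost hb p) (\<lambda>s'' o2. bs R ((fst s'')(v := int (Suc j)), snd s'')
        \<and> I (Suc j) ((fst s'')(v := int (Suc j)), snd s'') (out @ o2))"
      by (rule wp_mono[OF _ order_refl]) (use upd[of _ "Suc j"] Iv j in auto)
  qed (use fin in auto)
  then show "wp (R ^ 16) (For v h p) s (hb h * (tcost hb p + 2) + 2) (\<lambda>s' out. bs R s' \<and> Q s' out)"
    by (rule wp_mono[OF _ add_le_mono1[OF mult_le_mono1[OF n(2)]]])
qed

text \<open>An assignment is executed symbolically, without an intermediate assertion, so that
  \<open>wq_intro\<close> can run through straight-line code.\<close>

lemma wq_SetV_Sq:
  assumes "chk R s e" "leaves e \<le> 15" "x < 32" "\<bar>aval s e\<bar> \<le> R" "wq q ((fst s)(x := aval s e), snd s) Q"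
  shows "wq (Sq (SetV x e) q) s Q"
  by (rule wq_Sq[where ?Q1.0 = "\<lambda>s' out. out = [] \<and> s' = ((fst s)(x := aval s e), snd s)"])
    (use assms in \<open>auto intro: wq_SetV\<close>)

lemma wq_SetA_Sq:
  assumes "chk R s e" "leaves e \<le> 15" "chk R s (Rd k i)" "leaves i \<le> 15" "\<bar>aval s e\<bar> \<le> R"
    "wq q (fst s, (snd s)(k := (snd s k)(nat (aval s i) := aval s e))) Q"
  shows "wq (Sq (SetA k i e) q) s Q"
  by (rule wq_Sq[where ?Q1.0 = "\<lambda>s' out. out = [] \<and> s' = (fst s, (snd s)(k := (snd s k)(nat (aval s i) := aval s e)))"])
    (use assms in \<open>auto intro: wq_SetA\<close>)

lemmas wq_intro = wq_SetV_Sq wq_SetA_Sq wq_SetV wq_SetA wq_IfLt wq_IfEq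

end

abbreviation add_e (infixl ".+" 65) where "a .+ b \<equiv> Op Add a b"
abbreviation sub_e (infixl ".-" 65) where "a .- b \<equiv> Op Sub a b"
abbreviation mul_e (infixl ".*" 70) where "a .* b \<equiv> Op Mul a b"
abbreviation div_e (infixl ".div" 70) where "a .div b \<equiv> Op Div a b"
abbreviation mod_e (infixl ".mod" 70) where "a .mod b \<equiv> Op arith.Mod a b"

section \<open>The search program\<close>

text \<open>Register \<open>0\<close> holds \<open>m\<close>.  The registers \<open>2\<close> to \<open>12\<close> hold the radical \<open>m0\<close> of \<open>m\<close>, \<open>L\<close>, \<open>m1 = m / m0\<close>, \<open>f\<close>,
  \<open>n\<close>, \<open>t\<close>, \<open>N\<close>, \<open>B\<close>, \<open>2 B + 1\<close>, \<open>N\<^sup>f\<close> and \<open>(2 B + 1)\<^sup>f\<close>; \<open>13\<close> and \<open>14\<close> hold the largest minimum so far and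
  the index of its \<open>u\<close>, and \<open>15\<close> the minimum for the current \<open>u\<close>.  The arrays \<open>0\<close> to \<open>7\<close> hold the prime
  divisors of \<open>m\<close>, the set \<open>E\<close>, the traces \<open>T\<close>, the table \<open>Sg\<close>, \<open>u\<close>, \<open>x\<close>, the residue of \<open>u x\<close>, and the
  first components of the two rows of generators.\<close>

definition prime_test :: stmt where
  "prime_test = For 23 24 (IfLt (C 1) (V 23) (IfLt (V 24 .mod V 23) (C 1) (SetV 25 (C 0))))"

abbreviation prime_rec :: stmt where
  "prime_rec \<equiv> IfLt (C 0) (V 25) (Sq (SetA 0 (V 24) (C 1)) (Sq (SetV 2 (V 2 .* V 24)) (SetV 3 (V 3 .* C 4))))"

abbreviation prime_step :: stmt where
  "prime_step \<equiv> IfLt (C 1) (V 24) (IfLt (V 0 .mod V 24) (C 1) (Sq (SetV 25 (C 1)) (Sq prime_test prime_rec)))"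

definition primes_p :: stmt where
  "primes_p = Sq (SetV 1 (V 0 .+ C 1)) (Sq (SetV 2 (C 1)) (Sq (SetV 3 (C 1))
     (For 24 1 prime_step)))"

lemma frame_prime_test [simp]: "mods prime_test = {23, 25}" "amods prime_test = {}"
  by (auto simp: prime_test_def)

text \<open>\<open>K\<close> will depend on \<open>\<epsilon>\<close> alone; it is a constant in the
  program text.\<close>

locale alg = cyc +
  fixes K :: nat
  assumes K1: "1 \<le> K"
begin

abbreviation f :: nat where "f \<equiv> card E"
text \<open>The cells of \<open>t R\<close> have sides up to \<open>t * sqrt f\<close>, which must
  be small against \<open>r / n\<close>, while \<open>r\<^sup>2\<close> is at least of order
  \<open>t N f m / L\<close>; this dictates \<open>NN\<close>. \<open>BB\<close> bounds the
  coefficients of \<open>x\<close> in a short vector, by \<open>coef_bound\<close>.\<close>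

definition tt :: nat where "tt = K * (2 * f)"
definition NN :: nat where "NN = K * K * L * (2 * f) * tt"
definition BB :: nat where "BB = K * L * (2 * f)"
text \<open>\<open>AA\<close> covers the sums of products of table entries, \<open>XX\<close> the
  two search ranges. Crude bounds are enough, since only the length of \<open>RR\<close> enters the
  cost.\<close>

definition AA :: nat where "AA = 100 * m ^ 4 * (NN * NN + tt * tt * BB * BB + NN * BB + 1)"
definition XX :: nat where "XX = NN ^ f * (2 * BB + 1) ^ f"
definition RR :: int where "RR = int (AA * XX)"
text \<open>Bounds for the registers that bound loops; register 24 is one of them in
  \<open>prime_test\<close>, and register 31 holds the constant 2.\<close>

definition hb :: "nat \<Rightarrow> nat" where
  "hb r = (if r = 0 \<or> r = 5 then m else if r = 1 \<or> r = 24 then m + 1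
    else if r = 11 then NN ^ f else if r = 12 then (2 * BB + 1) ^ f else 2)"

lemma f_pos: "0 < f" using card_E m_pos by simp

lemma L1: "1 \<le> L" by (simp add: L_def)

lemma NN_pos: "0 < NN" and tt_pos: "0 < tt" and BB_pos: "0 < BB"
  using f_pos K1 L1 by (auto simp: NN_def tt_def BB_def)

lemma AA_pos: "0 < AA" using m_pos by (simp add: AA_def)
lemma XX_pos: "0 < XX" using NN_pos by (simp add: XX_def)

lemma AA_RR: "x \<le> AA \<Longrightarrow> int x \<le> RR"
proof -
  assume "x \<le> AA"
  also have "AA \<le> AA * XX" using XX_pos by simp
  finally show ?thesis unfolding RR_def by linarith
qed

lemma XX_RR: "x \<le> XX \<Longrightarrow> int x \<le> RR"
proof -
  assume "x \<le> XX"
  also have "XX \<le> AA * XX" using AA_pos by simp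
  finally show ?thesis unfolding RR_def by linarith
qed

lemma AA_ge: "x \<le> 100 * m ^ 4 \<Longrightarrow> x \<le> AA"
  unfolding AA_def by (metis le_add2 mult.right_neutral mult_le_mono order.trans order_refl)

lemma m_RR: "10 * int m \<le> RR"
proof -
  have "m \<le> m ^ 4" using m_pos by (simp add: self_le_power)
  then have "int (10 * m) \<le> RR" by (intro AA_RR AA_ge) simp
  then show ?thesis by simp
qed

lemma R_100: "100 \<le> RR"
proof -
  have "1 \<le> m ^ 4" using m_pos by simp
  then have "int 100 \<le> RR" by (intro AA_RR AA_ge) linarith
  then show ?thesis by simp
qed

sublocale ram RR hb by standard (rule R_100)

lemma NN_RR: "int NN \<le> RR" "4 * int L \<le> RR" "int tt \<le> RR" "int (2 * BB + 1) \<le> RR" "int K \<le> RR"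
proof -
  define N2 where "N2 = NN * NN"
  have "100 * (N2 + 1) \<le> AA"
    unfolding AA_def N2_def using m_pos by (intro mult_le_mono) auto
  then have A: "100 * N2 + 100 \<le> AA" by simp
  have N2: "NN \<le> N2" using NN_pos by (simp add: N2_def)
  then show "int NN \<le> RR" using A by (intro AA_RR) linarith
  have k: "1 \<le> K * K" "1 \<le> K * (2 * f)" "2 \<le> 2 * f" using K1 f_pos by (auto simp: Suc_le_eq)
  have tN: "tt \<le> NN" using mult_le_mono1[of 1 "K * K * L * (2 * f)" tt] k L1 K1 f_pos by (auto simp: NN_def)
  then show "int tt \<le> RR" using A N2 by (intro AA_RR) linarith
  have "K \<le> tt" using f_pos by (simp add: tt_def)
  then show "int K \<le> RR" using A N2 tN by (intro AA_RR) linarith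
  have LN: "L * 4 \<le> NN"
  proof -
    have "L * 4 \<le> (K * K * L) * ((2 * f) * (K * (2 * f)))"
    proof (rule mult_le_mono)
      show "L \<le> K * K * L" using K1 by simp
      have "2 * 2 \<le> (2 * f) * (K * (2 * f))" using k K1 f_pos
        by (intro mult_le_mono) (auto intro: order_trans[of 2 "2 * f"])
      then show "4 \<le> (2 * f) * (K * (2 * f))" by simp
    qed
    also have "\<dots> = NN" by (simp add: NN_def tt_def mult_ac)
    finally show ?thesis .
  qed
  have "int (L * 4) \<le> RR" by (rule AA_RR) (use LN A N2 in linarith)
  then show "4 * int L \<le> RR" by simp
  have "BB \<le> NN" using K1 tt_pos by (simp add: NN_def BB_def)
  then show "int (2 * BB + 1) \<le> RR" using A N2 by (intro AA_RR) linarith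
qed

lemma P_Suc: "{p\<in>P. p < Suc j} = (if j \<in> P then insert j {p\<in>P. p < j} else {p\<in>P. p < j})"
  by (auto simp: less_Suc_eq)

lemma P_le: "p \<in> P \<Longrightarrow> p < m + 1"
  using dvd_imp_le[OF dvd_P m_pos] by (simp add: less_Suc_eq_le)

lemma P_all: "{p\<in>P. p < m + 1} = P" using P_le by blast

lemma prodP_le: "\<Prod>{p\<in>P. p < j} \<le> m"
proof -
  have "\<Prod>{p\<in>P. p < j} dvd m0" unfolding m0_def by (rule prod_dvd_prod_subset) auto
  then show ?thesis using m0_dvd m_pos by (meson dvd_imp_le dvd_trans)
qed

lemma cardP_le: "4 ^ card {p\<in>P. p < j} \<le> L"
  unfolding L_def by (intro power_increasing card_mono) auto

lemma in_P_iff: "j \<in> P \<longleftrightarrow> 1 < j \<and> j dvd m \<and> \<not> (\<exists>d<j. 1 < d \<and> d dvd j)"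
proof -
  have "prime j \<longleftrightarrow> 1 < j \<and> \<not> (\<exists>d<j. 1 < d \<and> d dvd j)"
    unfolding prime_nat_iff
    by (metis One_nat_def dvd_imp_le dvd_pos_nat gr_implies_not0 le_neq_implies_less less_one linorder_neqE_nat nat_dvd_not_less order_less_irrefl)
  then show ?thesis by (auto simp: P_def)
qed

lemma mod_less_1: "(int a mod int b < 1) = (b dvd a)"
proof -
  have "int a mod int b = int (a mod b)" by (simp add: zmod_int)
  then show ?thesis by (auto simp: dvd_eq_mod_eq_0)
qed

text \<open>The candidate in register 24 is itself the loop bound, so exactly the divisors below it
  are tried.\<close>

lemma wq_prime_test:
  assumes p: "fst s 24 = int p" "p \<le> m + 1" and 25: "fst s 25 = 1"
  shows "wq prime_test s (\<lambda>s' out. out = [] \<and> fst s' 25 = (if \<exists>d<p. 1 < d \<and> d dvd p then 0 else 1))"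
  unfolding prime_test_def
proof (rule wq_For[where n = p and I = "\<lambda>j s' out. out = [] \<and> fst s' 25 = (if \<exists>d<j. 1 < d \<and> d dvd p then 0 else 1)"])
  fix j and s' :: state and out :: "int list"
  assume j: "j < p" and I: "out = [] \<and> fst s' 25 = (if \<exists>d<j. 1 < d \<and> d dvd p then 0 else 1)" and v: "fst s' 23 = int j"
    and fr: "\<And>x. x \<notin> mods (For 23 24 (IfLt (C 1) (V 23) (IfLt (V 24 .mod V 23) (C 1) (SetV 25 (C 0))))) \<Longrightarrow> fst s' x = fst s x"
  have 24: "fst s' 24 = int p" using fr[of 24] p by simp
  show "wq (IfLt (C 1) (V 23) (IfLt (V 24 .mod V 23) (C 1) (SetV 25 (C 0)))) s'
    (\<lambda>s'' o2. out @ o2 = [] \<and> fst s'' 25 = (if \<exists>d<Suc j. 1 < d \<and> d dvd p then 0 else 1))"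
    by (intro wq_intro) (use I v 24 R_100 in \<open>auto simp: mod_less_1 less_Suc_eq\<close>)
qed (use assms in \<open>auto simp: hb_def\<close>)

lemma wq_primes:
  assumes s0: "fst s 0 = int m" and z: "\<And>i. snd s 0 i = 0"
  shows "wq primes_p s (\<lambda>s' out. out = [] \<and> fst s' 1 = int (m + 1) \<and> fst s' 2 = int m0 \<and> fst s' 3 = int L
    \<and> (\<forall>i. snd s' 0 i = (if i \<in> P then 1 else 0)))"
proof -
  define pp where "pp j = \<Prod>{p\<in>P. p < j}" for j
  define cc :: "nat \<Rightarrow> nat" where "cc j = 4 ^ card {p\<in>P. p < j}" for j
  have Suc_in: "pp (Suc j) = j * pp j" "cc (Suc j) = cc j * 4" if "j \<in> P" for j
    using that by (simp_all add: pp_def cc_def P_Suc)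
  have Suc_notin: "pp (Suc j) = pp j" "cc (Suc j) = cc j" if "j \<notin> P" for j
    using that by (simp_all add: pp_def cc_def P_Suc)
  have bnd: "int (pp j) \<le> RR" "int (cc j) \<le> RR" for j
    using prodP_le[of j] cardP_le[of j] m_RR NN_RR(2) unfolding pp_def cc_def by linarith+
  have ends: "pp 0 = 1" "cc 0 = 1" "pp (m + 1) = m0" "cc (m + 1) = L"
    using P_all by (simp_all add: pp_def cc_def m0_def L_def)
  let ?I = "\<lambda>j s' out. out = [] \<and> fst s' 2 = int (pp j) \<and> fst s' 3 = int (cc j)
     \<and> (\<forall>i. snd s' 0 i = (if i \<in> P \<and> i < j then 1 else 0))"
  have loop: "wq (For 24 1 prime_step) s
    (\<lambda>s' out. out = [] \<and> fst s' 1 = int (m + 1) \<and> fst s' 2 = int m0 \<and> fst s' 3 = int L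
    \<and> (\<forall>i. snd s' 0 i = (if i \<in> P then 1 else 0)))"
    if s: "fst s 0 = int m" "fst s 1 = int (m + 1)" "fst s 2 = 1" "fst s 3 = 1" "\<And>i. snd s 0 i = 0" for s
  proof (rule wq_mono, rule wq_For[where n = "m + 1" and I = ?I])
    fix j and s' :: state and out :: "int list"
    assume j: "j < m + 1" and I: "?I j s' out" and v: "fst s' 24 = int j"
      and "\<And>x. x \<notin> mods (For 24 1 prime_step) \<Longrightarrow> fst s' x = fst s x"
    then have fr: "fst s' 0 = int m" using s by simp
    show "wq prime_step s'
       (\<lambda>s'' o2. ?I (Suc j) s'' (out @ o2))"
    proof (intro wq_IfLt wq_SetV_Sq)
      assume 1: "aval s' (C 1) < aval s' (V 24)" "aval s' (V 0 .mod V 24) < aval s' (C 1)"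
      then have jm: "1 < j" "j dvd m" using v fr by (auto simp: mod_less_1)
      let ?s = "((fst s')(25 := aval s' (C 1)), snd s')"
      show "wq (Sq prime_test prime_rec)
        ?s (\<lambda>s'' o2. ?I (Suc j) s'' (out @ o2))"
      proof (rule wq_Sq, rule wq_prime_test[where p = j])
        fix s2 :: state and o1 :: "int list"
        assume 2: "o1 = [] \<and> fst s2 25 = (if \<exists>d<j. 1 < d \<and> d dvd j then 0 else 1)"
          and f2: "\<And>x. x \<notin> mods prime_test \<Longrightarrow> fst s2 x = fst ?s x" "\<And>k. k \<notin> amods prime_test \<Longrightarrow> snd s2 k = snd ?s k"
        have I2: "?I j s2 out" using f2 I by auto
        have v2: "fst s2 24 = int j" using f2 v by simp
        have P: "j \<in> P \<longleftrightarrow> fst s2 25 = 1" using 2 jm by (auto simp: in_P_iff)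
        show "wq prime_rec s2
          (\<lambda>s'' o2. ?I (Suc j) s'' (out @ o1 @ o2))"
        proof (cases "j \<in> P")
          case True
          have "int j * int (pp j) = int (pp (Suc j))" "int (cc j) * 4 = int (cc (Suc j))"
            by (simp_all add: Suc_in[OF True])
          then show ?thesis using True P 2 I2 v2 R_100 bnd[of "Suc j"]
            by (intro wq_intro) (auto simp: mult.commute less_Suc_eq simp del: of_nat_mult)
        next
          case False
          then show ?thesis using P 2 I2 R_100
            by (intro wq_intro) (auto simp: Suc_notin less_Suc_eq split: if_splits)
        qed
      qed (use j v in auto)
    next
      assume "\<not> aval s' (C 1) < aval s' (V 24)"
      then have "j \<notin> P" using v by (auto simp: in_P_iff)
      then show "?I (Suc j) s' (out @ [])" using I by (auto simp: Suc_notin less_Suc_eq)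
    next
      assume "\<not> aval s' (V 0 .mod V 24) < aval s' (C 1)"
      then have "j \<notin> P" using v fr by (auto simp: in_P_iff mod_less_1)
      then show "?I (Suc j) s' (out @ [])" using I by (auto simp: Suc_notin less_Suc_eq)
    qed (use R_100 in auto)
  qed (use s P_le in \<open>auto simp: hb_def ends[unfolded Suc_eq_plus1[symmetric]]\<close>)
  show ?thesis unfolding primes_p_def
    by (intro wq_SetV_Sq loop) (use s0 z R_100 m_RR m2 in auto)
qed

end

section \<open>Tables of the basis, the traces and the reduction\<close>

definition tab_loop :: stmt where
  "tab_loop = For 24 1 (IfLt (C 0) (Rd 0 (V 24)) (IfEq (V 20 .div V 4 .mod V 24) (C 0)
     (Sq (SetV 25 (C 0)) (SetV 26 (V 26 .* (V 24 .- C 1)))) (SetV 26 (C 0 .- V 26))))"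

definition tables :: stmt where
  "tables = Sq (SetV 5 (C 0)) (For 20 0 (Sq (SetV 25 (C 1)) (Sq (SetV 26 (V 4)) (Sq tab_loop
     (Sq (IfEq (V 20 .mod V 4) (C 0) (SetA 2 (V 20) (V 26)) (SetA 2 (V 20) (C 0)))
     (Sq (SetA 1 (V 20) (V 25)) (SetV 5 (V 5 .+ V 25))))))))"

definition sign_loop :: stmt where
  "sign_loop = For 24 1 (IfLt (C 0) (Rd 0 (V 24)) (IfEq (V 20 .div V 4 .mod V 24) (C 0) (SetV 26 (C 0 .- V 26))
     (IfEq (V 20 .div V 4 .mod V 24) (V 21 .div V 4 .mod V 24) (SetV 26 (V 26)) (SetV 26 (C 0)))))"

definition sign_tab :: stmt where
  "sign_tab = For 20 0 (For 21 0 (Sq (IfEq (V 20 .mod V 4) (V 21 .mod V 4) (SetV 26 (Rd 1 (V 21))) (SetV 26 (C 0)))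
     (Sq sign_loop (SetA 3 (V 20 .* V 0 .+ V 21) (V 26)))))"

lemma frame_tables [simp]:
  "mods tab_loop = {24, 25, 26}" "amods tab_loop = {}" "mods sign_loop = {24, 26}" "amods sign_loop = {}"
  by (auto simp: tab_loop_def sign_loop_def)

context alg
begin

definition base :: "state \<Rightarrow> bool" where
  "base s \<longleftrightarrow> fst s 0 = int m \<and> fst s 1 = int (m + 1) \<and> fst s 4 = int m1 \<and> (\<forall>i. snd s 0 i = (if i \<in> P then 1 else 0))"

text \<open>The product over the primes that the loop has passed; it is complete at
  \<open>j = m + 1\<close>, as the prime divisors are at most \<open>m\<close>.\<close>

definition pr :: "(nat \<Rightarrow> int) \<Rightarrow> nat \<Rightarrow> int" where "pr g j = prod g {p\<in>P. p < j}"

lemma pr_in: "j \<in> P \<Longrightarrow> pr g (Suc j) = pr g j * g j"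
  and pr_notin: "j \<notin> P \<Longrightarrow> pr g (Suc j) = pr g j"
  and pr_0: "pr g 0 = 1" and pr_end: "pr g (Suc m) = prod g P"
  using P_all by (simp_all add: pr_def P_Suc mult.commute)

text \<open>Partial products of factors bounded by the primes stay within the radical, so times
  \<open>m1\<close> they stay within \<open>m\<close>.\<close>

lemma pr_bound:
  assumes "\<And>p. p \<in> P \<Longrightarrow> \<bar>g p\<bar> \<le> int p"
  shows "\<bar>pr g j\<bar> \<le> int m0"
proof -
  have "\<bar>pr g j\<bar> \<le> (\<Prod>p\<in>{p\<in>P. p < j}. int p)"
    unfolding pr_def abs_prod using assms by (intro prod_mono) auto
  also have "\<dots> = int (\<Prod>{p\<in>P. p < j})" by simp
  also have "\<Prod>{p\<in>P. p < j} \<le> m0"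
    unfolding m0_def[symmetric] using m0_pos by (intro dvd_imp_le) (auto simp: m0_def intro: prod_dvd_prod_subset)
  finally show ?thesis by simp
qed

lemma pd_int: "int a div int m1 mod int p = 0 \<longleftrightarrow> pd p a" "int p dvd int a div int m1 \<longleftrightarrow> pd p a"
  unfolding pd_def by (simp_all flip: zdiv_int add: mod_eq_0_iff_dvd)

lemma P_ge2: "p \<in> P \<Longrightarrow> 2 \<le> p" using prime_P prime_ge_2_nat by blast

text \<open>One pass over the primes yields both the membership of \<open>a\<close> in
  \<open>E\<close> and the product in the formula for \<open>T a\<close>.\<close>

lemma wq_tab_loop:
  assumes b: "base s" and s: "fst s 20 = int a" "fst s 25 = 1" "fst s 26 = int m1"
  shows "wq tab_loop s (\<lambda>s' out. out = [] \<and> fst s' 25 = (if \<forall>p\<in>P. \<not> pd p a then 1 else 0)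
    \<and> fst s' 26 = int m1 * (\<Prod>p\<in>P. if p dvd a div m1 then int p - 1 else -1))"
proof -
  define g where "g p = (if pd p a then int p - 1 else -1)" for p
  have bnd: "\<bar>int m1 * pr g j\<bar> \<le> RR" for j
  proof -
    have "\<bar>pr g j\<bar> \<le> int m0" using P_ge2 by (intro pr_bound) (force simp: g_def)
    then have "int m1 * \<bar>pr g j\<bar> \<le> int m1 * int m0" by (intro mult_left_mono) auto
    also have "\<dots> = int m" using m_eq by (simp flip: of_nat_mult)
    finally show ?thesis using m_RR by (simp add: abs_mult)
  qed
  show ?thesis
    unfolding tab_loop_def
  proof (rule wq_For[where n = "m + 1" and I = "\<lambda>j s' out. out = [] \<and> fst s' 25 = (if \<forall>p\<in>P. p < j \<longrightarrow> \<not> pd p a then 1 else 0)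
    \<and> fst s' 26 = int m1 * pr g j"], goal_cases)
    case (10 j s' out)
    have fr: "fst s' 20 = int a" "fst s' 4 = int m1" "snd s' 0 j = (if j \<in> P then 1 else 0)"
      using 10(5)[of 20] 10(5)[of 4] 10(6)[of 0] b s by (auto simp: base_def)
    show ?case
    proof (cases "j \<in> P")
      case True
      have "int m1 * pr g (Suc j) = int m1 * pr g j * (if pd j a then int j - 1 else -1)"
        by (simp add: pr_in[OF True] g_def)
      then show ?thesis using 10(3,4) fr True R_100 bnd[of "Suc j"]
        by (intro wq_intro) (auto simp: pd_int less_Suc_eq pr_in)
    next
      case False
      then show ?thesis using 10(3,4) fr R_100 by (intro wq_intro) (auto simp: pr_notin less_Suc_eq)
    qed
  next
    case (11 s' out)
    then show ?case using P_le by (auto simp: pr_end g_def pd_def)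
  qed (use b s in \<open>auto simp: base_def hb_def pr_0\<close>)
qed

lemma m1_RR: "int m1 \<le> RR"
proof -
  have "m1 \<le> m1 * m0" using m0_pos by simp
  then show ?thesis using m_eq m_RR by linarith
qed

lemma T_bound: "\<bar>T a\<bar> \<le> int m"
proof -
  have "\<bar>\<Prod>p\<in>P. if p dvd a div m1 then int p - 1 else -1\<bar> \<le> int m0"
    using P_ge2 by (subst pr_end[symmetric], intro pr_bound) force
  then have "int m1 * \<bar>\<Prod>p\<in>P. if p dvd a div m1 then int p - 1 else -1\<bar> \<le> int m1 * int m0"
    by (intro mult_left_mono) auto
  also have "\<dots> = int m" using m_eq by (simp flip: of_nat_mult)
  finally show ?thesis by (simp add: T_def abs_mult)
qed

lemma Sg_bound: "\<bar>Sg a b\<bar> \<le> 1"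
  unfolding Sg_def by (auto simp: abs_prod intro!: prod_le_1)

abbreviation tabE :: "state \<Rightarrow> nat \<Rightarrow> bool" where
  "tabE s j \<equiv> (\<forall>i<j. snd s 1 i = (if i \<in> E then 1 else 0))"
abbreviation tabT :: "state \<Rightarrow> nat \<Rightarrow> bool" where
  "tabT s j \<equiv> (\<forall>i<j. snd s 2 i = T i)"

lemma E_Suc: "{i\<in>E. i < Suc j} = (if j \<in> E then insert j {i\<in>E. i < j} else {i\<in>E. i < j})"
  by (auto simp: less_Suc_eq)

lemma E_all: "{i\<in>E. i < m} = E" using E_less by blast

lemma wq_tables:
  assumes b: "base s"
  shows "wq tables s (\<lambda>s' out. out = [] \<and> fst s' 5 = int f \<and> tabE s' m \<and> tabT s' m)"
proof -
  let ?I = "\<lambda>j s' out. out = [] \<and> fst s' 5 = int (card {i\<in>E. i < j}) \<and> tabE s' j \<and> tabT s' j"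
  let ?p = "Sq (SetV 25 (C 1)) (Sq (SetV 26 (V 4)) (Sq tab_loop
     (Sq (IfEq (V 20 .mod V 4) (C 0) (SetA 2 (V 20) (V 26)) (SetA 2 (V 20) (C 0)))
     (Sq (SetA 1 (V 20) (V 25)) (SetV 5 (V 5 .+ V 25))))))"
  have "wq (For 20 0 ?p) s (\<lambda>s' out. out = [] \<and> fst s' 5 = int f \<and> tabE s' m \<and> tabT s' m)"
    if b: "base s" and 5: "fst s 5 = 0" for s
  proof (rule wq_For[where n = m and I = ?I], goal_cases)
    case (10 j s' out)
    have bs': "base s'" using b 10(5) 10(6)[of 0] by (auto simp: base_def)
    have loop: "wq (Sq tab_loop (Sq (IfEq (V 20 .mod V 4) (C 0) (SetA 2 (V 20) (V 26)) (SetA 2 (V 20) (C 0)))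
     (Sq (SetA 1 (V 20) (V 25)) (SetV 5 (V 5 .+ V 25))))) s1 (\<lambda>s'' o2. ?I (Suc j) s'' (out @ o2))"
      if s1: "base s1" "fst s1 20 = int j" "fst s1 25 = 1" "fst s1 26 = int m1" "?I j s1 out" for s1
    proof (rule wq_Sq, rule wq_tab_loop[OF s1(1-4)], goal_cases)
      case (1 s2 o1)
      have fr: "fst s2 20 = int j" "fst s2 4 = int m1" "?I j s2 out" using 1(3,4) s1 by (auto simp: base_def)
      have E: "fst s2 25 = (if j \<in> E then 1 else 0)" using 1(2) 10(1) by (auto simp: E_def)
      have T: "(if int j mod int m1 = 0 then fst s2 26 else 0) = T j"
        using 1(2) by (simp add: T_def dvd_eq_mod_eq_0[symmetric])
      have T': "\<bar>fst s2 26\<bar> \<le> RR" using 1(1) by (auto simp: bs_def)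
      have c: "int (card {i\<in>E. i < Suc j}) \<le> RR" "int (card {i\<in>E. i < Suc j}) = int (card {i\<in>E. i < j}) + (if j \<in> E then 1 else 0)"
      proof -
        have "card {i\<in>E. i < Suc j} \<le> card {..<m}" by (rule card_mono) (auto dest: E_less)
        then show "int (card {i\<in>E. i < Suc j}) \<le> RR" using m_RR by simp
      qed (simp add: E_Suc)
      show ?case
      proof (rule wq_Sq[where ?Q1.0 = "\<lambda>s3 o3. o3 = [] \<and> fst s3 = fst s2 \<and> snd s3 = (snd s2)(2 := (snd s2 2)(j := T j))"], goal_cases)
        case 1
        show ?case by (intro wq_intro) (use R_100 fr T T' in auto)
      next
        case (2 s3 o3)
        then show ?case using 1(2) R_100 fr E c
          by (intro wq_intro) (auto simp: less_Suc_eq)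
      qed
    qed
    show ?case
      by (intro wq_SetV_Sq loop) (use 10 bs' m1_RR R_100 in \<open>auto simp: base_def\<close>)
  qed (use b 5 E_all in \<open>auto simp: base_def hb_def\<close>)
  then show ?thesis unfolding tables_def
    by (intro wq_SetV_Sq) (use b R_100 in \<open>auto simp: base_def\<close>)
qed

lemma wq_sign_loop:
  assumes b: "base s" and s: "fst s 20 = int a" "fst s 21 = int b" "fst s 26 = (if b \<in> E \<and> a mod m1 = b mod m1 then 1 else 0)"
  shows "wq sign_loop s (\<lambda>s' out. out = [] \<and> fst s' 26 = Sg a b)"
proof -
  define g :: "nat \<Rightarrow> int" where "g p = (if pd p a then -1 else if a div m1 mod p = b div m1 mod p then 1 else 0)" for p
  define c :: int where "c = (if b \<in> E \<and> a mod m1 = b mod m1 then 1 else 0)"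
  have bnd: "\<bar>c * pr g j\<bar> \<le> RR" for j
  proof -
    have "\<bar>pr g j\<bar> \<le> 1" unfolding pr_def abs_prod by (rule prod_le_1) (auto simp: g_def)
    then show ?thesis using R_100 by (auto simp: abs_mult c_def)
  qed
  have q: "int a div int m1 mod int j = int b div int m1 mod int j \<longleftrightarrow> a div m1 mod j = b div m1 mod j" for j
    by (simp flip: zdiv_int zmod_int)
  show ?thesis
    unfolding sign_loop_def
  proof (rule wq_For[where n = "m + 1" and I = "\<lambda>j s' out. out = [] \<and> fst s' 26 = c * pr g j"], goal_cases)
    case (10 j s' out)
    have fr: "fst s' 20 = int a" "fst s' 21 = int b" "fst s' 4 = int m1" "snd s' 0 j = (if j \<in> P then 1 else 0)"
      using 10(5)[of 20] 10(5)[of 21] 10(5)[of 4] 10(6)[of 0] assms by (auto simp: base_def)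
    show ?case
    proof (cases "j \<in> P")
      case True
      have "c * pr g (Suc j) = c * pr g j * (if pd j a then -1 else if a div m1 mod j = b div m1 mod j then 1 else 0)"
        by (simp add: pr_in[OF True] g_def)
      then show ?thesis using 10(3,4) fr True R_100 bnd[of "Suc j"] bnd[of j]
        by (intro wq_intro) (auto simp: pd_int q split: if_splits)
    next
      case False
      then show ?thesis using 10(3,4) fr R_100 by (intro wq_intro) (auto simp: pr_notin)
    qed
  next
    case (11 s' out)
    then show ?case by (simp add: pr_end Sg_def c_def g_def)
  qed (use assms in \<open>auto simp: base_def hb_def pr_0 c_def\<close>)
qed

lemma index_eq: "b < m \<Longrightarrow> b' < m \<Longrightarrow> a * m + b = a' * m + b' \<longleftrightarrow> a = a' \<and> b = b'" for a b :: nat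
  by (metis add.commute div_mult_self3 mod_mult_self3 mod_less div_less add_0 less_zeroE m_pos add_right_imp_eq)

lemma wq_sign_tab:
  assumes b: "base s" and E: "tabE s m"
  shows "wq sign_tab s (\<lambda>s' out. out = [] \<and> (\<forall>a<m. \<forall>b<m. snd s' 3 (a * m + b) = Sg a b))"
  unfolding sign_tab_def
proof (rule wq_For[where n = m and I = "\<lambda>j s' out. out = [] \<and> (\<forall>a<j. \<forall>b<m. snd s' 3 (a * m + b) = Sg a b)"], goal_cases)
  case (10 a s1 out)
  have b1: "base s1" "tabE s1 m" using b E 10(5) 10(6)[of 0] 10(6)[of 1] by (auto simp: base_def)
  show ?case
  proof (rule wq_For[where n = m and I = "\<lambda>j s' out. out = [] \<and> (\<forall>a'<a. \<forall>b<m. snd s' 3 (a' * m + b) = Sg a' b)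
      \<and> (\<forall>b<j. snd s' 3 (a * m + b) = Sg a b)"], goal_cases)
    case (10 b s2 out2)
    have b2: "base s2" "tabE s2 m" "fst s2 20 = int a"
      using b1 10(5) 10(6)[of 0] 10(6)[of 1] \<open>fst s1 20 = int a\<close> by (auto simp: base_def)
    have am: "a < m" "b < m" by fact+
    have nat_ix: "nat (int a * int m + int b) = a * m + b" by (simp flip: of_nat_mult of_nat_add)
    have c: "int a mod int m1 = int b mod int m1 \<longleftrightarrow> a mod m1 = b mod m1" by (simp flip: zmod_int)
    show ?case
    proof (rule wq_Sq[where ?Q1.0 = "\<lambda>s3 o3. o3 = [] \<and> fst s3 26 = (if b \<in> E \<and> a mod m1 = b mod m1 then 1 else 0)"], goal_cases)
      case 1
      show ?case by (intro wq_intro) (use R_100 b2 am 10(4) c in \<open>auto simp: base_def\<close>)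
    next
      case (2 s3 o3)
      have b3: "base s3" "fst s3 20 = int a" "fst s3 21 = int b" using 2(3,4) b2 10(4) by (auto simp: base_def)
      show ?case
      proof (rule wq_Sq, rule wq_sign_loop[OF b3(1-3)], goal_cases)
        case (2 s4 o4)
        have fr: "fst s4 20 = int a" "fst s4 21 = int b" "fst s4 0 = int m" "snd s4 = snd s2"
          using 2(3,4) b3 \<open>\<And>k. k \<notin> amods _ \<Longrightarrow> snd s3 k = snd s2 k\<close> by (auto simp: base_def fun_eq_iff)
        show ?case using 2(2) fr 10(3) R_100 Sg_bound[of a b] am nat_ix \<open>o3 = [] \<and> _\<close>
          by (intro wq_intro) (auto simp: less_Suc_eq index_eq)
      qed (use 2 in auto)
    qed
  qed (use 10 b1 in \<open>auto simp: base_def hb_def less_Suc_eq\<close>)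
qed (use b in \<open>auto simp: base_def hb_def\<close>)

end

section \<open>Parameters and exhaustive search\<close>

definition params :: "nat \<Rightarrow> stmt" where
  "params K = Sq (SetV 6 (C 2 .* V 5)) (Sq (SetV 7 (C (int K) .* V 6)) (Sq (SetV 9 (C (int K) .* V 3 .* V 6))
     (Sq (SetV 8 (C (int K) .* C (int K) .* V 3 .* V 6 .* V 7)) (Sq (SetV 10 (C 2 .* V 9 .+ C 1))
     (Sq (SetV 11 (C 1)) (Sq (SetV 12 (C 1)) (For 23 5 (Sq (SetV 11 (V 11 .* V 8)) (SetV 12 (V 12 .* V 10))))))))))"

text \<open>Writes the digits of the number in register \<open>src\<close>, in the base held in register \<open>b\<close> and shifted by
  \<open>off\<close>, to the entries of the array \<open>k\<close> that belong to the basis \<open>E\<close>.\<close>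

definition digits_p :: "nat \<Rightarrow> nat \<Rightarrow> nat \<Rightarrow> aexp \<Rightarrow> stmt" where
  "digits_p k src b off = Sq (SetV 18 (V src)) (For 20 0 (IfEq (Rd 1 (V 20)) (C 1)
     (Sq (SetA k (V 20) (V 18 .mod V b .- off)) (SetV 18 (V 18 .div V b))) (SetA k (V 20) (C 0))))"

definition dsum :: "nat \<Rightarrow> nat \<Rightarrow> nat \<Rightarrow> aexp \<Rightarrow> stmt" where
  "dsum v1 v2 r e = For v1 0 (For v2 0 (SetV r (V r .+ e)))"

text \<open>Multiplies \<open>u\<close> by \<open>x\<close>, reduces to the basis through the table
  \<open>Sg\<close>, and centres the result modulo \<open>N\<close>; adding and subtracting
  \<open>N div 2\<close> does the centring.\<close>

definition conv_p :: stmt where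
  "conv_p = For 21 0 (Sq (SetV 30 (C 0)) (Sq (dsum 20 22 30 (Rd 4 (V 20) .* Rd 5 (V 22) .* Rd 3 ((V 20 .+ V 22) .mod V 0 .* V 0 .+ V 21)))
     (SetA 6 (V 21) ((V 30 .+ V 8 .div C 2) .mod V 8 .- V 8 .div C 2))))"

definition value_p :: stmt where
  "value_p = Sq (SetV 19 (C 0)) (dsum 20 21 19 (Rd 2 ((V 20 .+ (V 0 .- V 21)) .mod V 0)
     .* (V 7 .* V 7 .* Rd 5 (V 20) .* Rd 5 (V 21) .+ Rd 6 (V 20) .* Rd 6 (V 21))))"

text \<open>Register 15 is 0 as long as no positive value was met; \<open>x = 0\<close> has value 0
  and is rejected by the first test.\<close>

definition min_p :: stmt where
  "min_p = IfLt (C 0) (V 19) (IfEq (V 15) (C 0) (SetV 15 (V 19)) (IfLt (V 19) (V 15) (SetV 15 (V 19))))"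

definition xloop :: stmt where
  "xloop = For 17 12 (Sq (digits_p 5 17 10 (V 9)) (Sq conv_p (Sq value_p min_p)))"

text \<open>The maximum starts at -1, below every recorded minimum, so that the first
  \<open>u\<close> is always taken.\<close>

definition search :: stmt where
  "search = Sq (SetV 13 (C (-1))) (Sq (SetV 14 (C 0)) (For 16 11 (Sq (digits_p 4 16 8 (C 0)) (Sq (SetV 15 (C 0)) (Sq xloop
     (IfLt (V 13) (V 15) (Sq (SetV 13 (V 15)) (SetV 14 (V 16)))))))))"

lemma frame_search [simp]:
  "mods (digits_p k src b off) = {18, 20}" "amods (digits_p k src b off) = {k}"
  "mods (dsum v1 v2 r e) = {v1, v2, r}" "amods (dsum v1 v2 r e) = {}"
  "mods conv_p = {20, 21, 22, 30}" "amods conv_p = {6}"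
  "mods value_p = {19, 20, 21}" "amods value_p = {}"
  "mods min_p = {15}" "amods min_p = {}"
  "mods xloop = {15, 17, 18, 19, 20, 21, 22, 30}" "amods xloop = {5, 6}"
  by (auto simp: digits_p_def dsum_def conv_p_def value_p_def min_p_def xloop_def)

context alg
begin

lemma pow_RR: "j \<le> f \<Longrightarrow> int (NN ^ j) \<le> RR" "j \<le> f \<Longrightarrow> int ((2 * BB + 1) ^ j) \<le> RR"
proof -
  assume j: "j \<le> f"
  have "NN ^ j * 1 \<le> NN ^ f * (2 * BB + 1) ^ f" using j NN_pos by (intro mult_le_mono power_increasing) auto
  then show "int (NN ^ j) \<le> RR" by (intro XX_RR) (simp add: XX_def)
  have "1 * (2 * BB + 1) ^ j \<le> NN ^ f * (2 * BB + 1) ^ f" using j NN_pos by (intro mult_le_mono power_increasing) auto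
  then show "int ((2 * BB + 1) ^ j) \<le> RR" by (intro XX_RR) (simp add: XX_def)
qed

lemma f_le_m: "f \<le> m" using card_mono[of "{..<m}" E] E_less by auto

lemma wq_params:
  assumes s: "fst s 5 = int f" "fst s 3 = int L"
  shows "wq (params K) s (\<lambda>s' out. out = [] \<and> fst s' 6 = 2 * int f \<and> fst s' 7 = int tt \<and> fst s' 8 = int NN \<and> fst s' 9 = int BB
    \<and> fst s' 10 = int (2 * BB + 1) \<and> fst s' 11 = int (NN ^ f) \<and> fst s' 12 = int ((2 * BB + 1) ^ f))"
proof -
  let ?I = "\<lambda>j s' out. out = [] \<and> fst s' 11 = int (NN ^ j) \<and> fst s' 12 = int ((2 * BB + 1) ^ j)"
  let ?p = "Sq (SetV 11 (V 11 .* V 8)) (SetV 12 (V 12 .* V 10))"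
  have loop: "wq (For 23 5 ?p) s (\<lambda>s' out. out = [] \<and> fst s' 6 = 2 * int f \<and> fst s' 7 = int tt \<and> fst s' 8 = int NN \<and> fst s' 9 = int BB
    \<and> fst s' 10 = int (2 * BB + 1) \<and> fst s' 11 = int (NN ^ f) \<and> fst s' 12 = int ((2 * BB + 1) ^ f))"
    if s: "fst s 5 = int f" "fst s 11 = 1" "fst s 12 = 1" "fst s 6 = 2 * int f" "fst s 7 = int tt" "fst s 8 = int NN" "fst s 9 = int BB"
      "fst s 10 = int (2 * BB + 1)" for s
  proof (rule wq_mono, rule wq_For[where n = f and I = ?I and Q = "?I f"], goal_cases)
    case (10 j s' out)
    have fr: "fst s' 8 = int NN" "fst s' 10 = int (2 * BB + 1)" using 10(5)[of 8] 10(5)[of 10] s by auto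
    have "int (NN ^ j) * int NN = int (NN ^ Suc j)" "int ((2 * BB + 1) ^ j) * int (2 * BB + 1) = int ((2 * BB + 1) ^ Suc j)"
      by (simp_all only: power_Suc2 of_nat_mult)
    then show ?case using fr 10(3) pow_RR[of "Suc j"] 10(1)
      by (intro wq_intro) (auto simp del: of_nat_power of_nat_mult of_nat_add power_Suc)
  qed (use s f_le_m in \<open>auto simp: hb_def\<close>)
  have e: "2 * int f \<le> RR" "int tt = int K * (2 * int f)" "int BB = int K * int L * (2 * int f)"
    "int NN = int K * int K * int L * (2 * int f) * int tt" "int (2 * BB + 1) = 2 * int BB + 1"
    using f_le_m m_RR by (simp_all add: tt_def BB_def NN_def)
  have BR: "int BB \<le> RR" using NN_RR(4) by simp
  show ?thesis unfolding params_def
    by (intro wq_SetV_Sq loop)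
      (use s e NN_RR R_100 BR in \<open>auto simp del: of_nat_mult of_nat_add simp: abs_of_nonneg\<close>)
qed

text \<open>The position of \<open>a\<close> in \<open>E\<close>; with it the numbers below
  \<open>b ^ card E\<close> enumerate all digit functions on \<open>E\<close>.\<close>

definition rk :: "nat \<Rightarrow> nat" where "rk a = card {i\<in>E. i < a}"
definition dig :: "nat \<Rightarrow> nat \<Rightarrow> nat \<Rightarrow> nat" where "dig b W a = W div b ^ rk a mod b"

lemma rk_Suc: "rk (Suc a) = (if a \<in> E then Suc (rk a) else rk a)"
  by (simp add: rk_def E_Suc)

text \<open>The loop changes registers 18 and 20 while \<open>off\<close> is read in every round, so
  the value of \<open>off\<close> is assumed in all states that agree with \<open>s\<close> on the
  other registers.\<close>

lemma wq_digits:
  assumes k: "k < 16" "k \<noteq> 1" and r: "src < 32" "b < 32" "b \<noteq> 18" "b \<noteq> 20" and s: "fst s src = int W" "fst s b = int Bd" "fst s 0 = int m" "tabE s m"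
    and off: "\<And>s'. (\<And>x. x \<noteq> 18 \<Longrightarrow> x \<noteq> 20 \<Longrightarrow> fst s' x = fst s x) \<Longrightarrow> chk RR s' off \<and> aval s' off = z" "leaves off = 1"
    and bnd: "\<And>d. d < Bd \<Longrightarrow> \<bar>int d - z\<bar> \<le> RR" and Bd: "0 < Bd"
  shows "wq (digits_p k src b off) s (\<lambda>s' out. out = [] \<and> (\<forall>a<m. snd s' k a = (if a \<in> E then int (dig Bd W a) - z else 0)))"
proof -
  let ?p = "IfEq (Rd 1 (V 20)) (C 1) (Sq (SetA k (V 20) (V 18 .mod V b .- off)) (SetV 18 (V 18 .div V b))) (SetA k (V 20) (C 0))"
  let ?I = "\<lambda>j s' out. out = [] \<and> fst s' 18 = int (W div Bd ^ rk j) \<and> (\<forall>a<j. snd s' k a = (if a \<in> E then int (dig Bd W a) - z else 0))"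
  have loop: "wq (For 20 0 ?p) s1 (\<lambda>s' out. out = [] \<and> (\<forall>a<m. snd s' k a = (if a \<in> E then int (dig Bd W a) - z else 0)))"
    if s1: "fst s1 18 = int W" "\<And>x. x \<noteq> 18 \<Longrightarrow> fst s1 x = fst s x" "snd s1 = snd s" and WR: "int W \<le> RR" for s1
  proof (rule wq_For[where n = m and I = ?I], goal_cases)
    case (10 j s' out)
    have fr: "fst s' b = int Bd" "snd s' 1 j = (if j \<in> E then 1 else 0)"
      using 10(5)[of b] 10(6)[of 1] 10(1) r k s s1 by auto
    have o: "chk RR s' off" "aval s' off = z" using off(1)[of s'] 10(5) s1(2) by auto
    have o2: "chk RR (fst s', X) off" "aval (fst s', X) off = z" for X using off(1)[of "(fst s', X)"] 10(5) s1(2) by auto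
    have d: "int (W div Bd ^ rk j) mod int Bd = int (dig Bd W j)" by (simp add: dig_def zmod_int)
    have dB: "\<bar>int (dig Bd W j) - z\<bar> \<le> RR" using bnd[of "dig Bd W j"] Bd by (simp add: dig_def)
    have q: "int (W div Bd ^ rk j) div int Bd = int (W div Bd ^ Suc (rk j))" by (simp only: power_Suc2 div_mult2_eq zdiv_int)
    have qR: "int (W div c) \<le> RR" for c using WR by (meson div_le_dividend of_nat_mono order_trans)
    show ?case
      by (intro wq_intro)
        (use 10(3,4) fr k r R_100 o o2 d dB q qR[of "Bd ^ Suc (rk j)"] off(2) in \<open>auto simp: less_Suc_eq rk_Suc simp del: of_nat_power power_Suc of_nat_div\<close>)
  qed (use s1 s k r in \<open>auto simp: hb_def rk_def\<close>)
  have "int W \<le> RR" if "bs RR s" using that s(1) by (auto simp: bs_def dest: spec[of _ src])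
  then have "wq (SetV 18 (V src)) s (\<lambda>s1 out. out = [] \<and> s1 = ((fst s)(18 := int W), snd s) \<and> int W \<le> RR)" if "bs RR s"
    using that s r by (intro wq_SetV) auto
  then have "wq (SetV 18 (V src)) s (\<lambda>s1 out. out = [] \<and> s1 = ((fst s)(18 := int W), snd s) \<and> int W \<le> RR)"
    by (auto simp: wq_def)
  then show ?thesis unfolding digits_p_def
  proof (rule wq_Sq, goal_cases)
    case (1 s1 o1)
    then have "o1 = []" and s1: "s1 = ((fst s)(18 := int W), snd s)" "int W \<le> RR" by auto
    show ?case unfolding \<open>o1 = []\<close> append_Nil by (rule loop) (auto simp: s1)
  qed
qed

lemma sum_abs_le: "(\<And>i. i < (n::nat) \<Longrightarrow> \<bar>F i :: int\<bar> \<le> c) \<Longrightarrow> \<bar>\<Sum>i<n. F i\<bar> \<le> int n * c"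
  using order_trans[OF sum_abs sum_bounded_above[of "{..<n}" "\<lambda>i. \<bar>F i\<bar>" c]] by simp

text \<open>A uniform bound \<open>b\<close> for the summands bounds all partial sums by
  \<open>m * (m * b)\<close>, which keeps the accumulator within \<open>RR\<close>.\<close>

lemma wq_dsum:
  assumes v: "v1 < 32" "v2 < 32" "r < 32" "v1 \<noteq> v2" "r \<noteq> v1" "r \<noteq> v2" "v1 \<noteq> 0" "v2 \<noteq> 0" "r \<noteq> 0"
    and s: "fst s 0 = int m" "fst s r = z"
    and e: "\<And>s' a c. a < m \<Longrightarrow> c < m \<Longrightarrow> fst s' v1 = int a \<Longrightarrow> fst s' v2 = int c \<Longrightarrow>
      (\<And>x. x \<noteq> v1 \<Longrightarrow> x \<noteq> v2 \<Longrightarrow> x \<noteq> r \<Longrightarrow> fst s' x = fst s x) \<Longrightarrow> snd s' = snd s \<Longrightarrow> chk RR s' e \<and> aval s' e = F a c"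
    and l: "leaves e \<le> 14" and Fb: "\<And>a c. a < m \<Longrightarrow> c < m \<Longrightarrow> \<bar>F a c\<bar> \<le> b" and R: "\<bar>z\<bar> + int m * (int m * b) \<le> RR"
  shows "wq (dsum v1 v2 r e) s (\<lambda>s' out. out = [] \<and> fst s' r = z + (\<Sum>a<m. \<Sum>c<m. F a c))"
  unfolding dsum_def
proof (rule wq_For[where n = m and I = "\<lambda>j s' out. out = [] \<and> fst s' r = z + (\<Sum>a<j. \<Sum>c<m. F a c)"], goal_cases)
  case (10 a s1 out)
  have b0: "0 \<le> b" using Fb[OF 10(1) 10(1)] by simp
  show ?case
  proof (rule wq_For[where n = m and I = "\<lambda>j s' out. out = [] \<and> fst s' r = z + (\<Sum>a<a. \<Sum>c<m. F a c) + (\<Sum>c<j. F a c)"], goal_cases)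
    case (10 c s2 out2)
    have fr: "fst s2 x = fst s x" if "x \<noteq> v1" "x \<noteq> v2" "x \<noteq> r" for x
      using that 10(5)[of x] \<open>\<And>x. x \<notin> _ \<Longrightarrow> fst s1 x = fst s x\<close>[of x] by auto
    have fr2: "snd s2 = snd s" using 10(6) \<open>\<And>k. k \<notin> _ \<Longrightarrow> snd s1 k = snd s k\<close> by auto
    have v1: "fst s2 v1 = int a" using 10(5)[of v1] v \<open>fst s1 v1 = int a\<close> by auto
    have ee: "chk RR s2 e" "aval s2 e = F a c" using e[OF \<open>a < m\<close> 10(1) v1 10(4) fr fr2] by auto
    have "\<bar>\<Sum>a<a. \<Sum>c<m. F a c\<bar> \<le> int a * (int m * b)"
      using \<open>a < m\<close> by (intro sum_abs_le Fb; simp)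
    moreover have "\<bar>\<Sum>c<Suc c. F a c\<bar> \<le> int (Suc c) * b"
      using \<open>a < m\<close> 10(1) by (intro sum_abs_le Fb; simp)
    moreover have "int (Suc c) * b \<le> int m * b" using 10(1) b0 by (intro mult_right_mono) auto
    moreover have "int (Suc a) * (int m * b) \<le> int m * (int m * b)" using \<open>a < m\<close> b0 by (intro mult_right_mono) auto
    ultimately have "\<bar>z + (\<Sum>a<a. \<Sum>c<m. F a c) + (\<Sum>c<Suc c. F a c)\<bar> \<le> RR"
      using R by (simp only: of_nat_Suc distrib_right mult_1_left)
    then show ?case
      by (intro wq_SetV) (use ee l 10(3) v in \<open>auto simp: add.assoc\<close>)
  qed (use 10 s v in \<open>auto simp: hb_def\<close>)
qed (use s v in \<open>auto simp: hb_def\<close>)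

text \<open>The centred residue. For a short vector \<open>cen_unique\<close> shows that it is the
  only candidate for \<open>u x + N y\<close>, so \<open>y\<close> need not be searched.\<close>

definition cen :: "int \<Rightarrow> int" where "cen z = (z + int NN div 2) mod int NN - int NN div 2"
definition rs :: "(nat \<Rightarrow> int) \<Rightarrow> (nat \<Rightarrow> int) \<Rightarrow> nat \<Rightarrow> int" where "rs u x b = cen (red (conv u x) b)"
definition val :: "(nat \<Rightarrow> int) \<Rightarrow> (nat \<Rightarrow> int) \<Rightarrow> int" where
  "val u x = (\<Sum>a<m. \<Sum>b<m. T ((a + (m - b)) mod m) * (int tt * int tt * x a * x b + rs u x a * rs u x b))"

text \<open>Product and reduction merged into one double sum over the table \<open>Sg\<close>, as
  the program computes it.\<close>

lemma red_conv: "red (conv u x) b = (\<Sum>a<m. \<Sum>c<m. u a * x c * Sg ((a + c) mod m) b)"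
proof -
  have "red (conv u x) b = (\<Sum>e<m. \<Sum>a<m. \<Sum>c<m. if (a + c) mod m = e then u a * x c * Sg e b else 0)"
    unfolding red_def conv_def sum_distrib_right by (intro sum.cong refl) auto
  also have "\<dots> = (\<Sum>a<m. \<Sum>e<m. \<Sum>c<m. if (a + c) mod m = e then u a * x c * Sg e b else 0)"
    by (rule sum.swap)
  also have "\<dots> = (\<Sum>a<m. \<Sum>c<m. \<Sum>e<m. if (a + c) mod m = e then u a * x c * Sg e b else 0)"
    by (intro sum.cong refl sum.swap)
  also have "\<dots> = (\<Sum>a<m. \<Sum>c<m. u a * x c * Sg ((a + c) mod m) b)"
    using m_pos by (intro sum.cong refl) simp
  finally show ?thesis .
qed

lemma cen_bound: "\<bar>cen z\<bar> \<le> int NN"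
proof -
  have "0 \<le> (z + int NN div 2) mod int NN" "(z + int NN div 2) mod int NN < int NN" using NN_pos by auto
  moreover have "0 \<le> int NN div 2" "int NN div 2 \<le> int NN" by auto
  ultimately show ?thesis unfolding cen_def by linarith
qed

definition tabs :: "state \<Rightarrow> bool" where
  "tabs s \<longleftrightarrow> fst s 0 = int m \<and> fst s 5 = int f \<and> tabE s m \<and> tabT s m \<and> (\<forall>a<m. \<forall>b<m. snd s 3 (a * m + b) = Sg a b)
    \<and> fst s 7 = int tt \<and> fst s 8 = int NN \<and> fst s 9 = int BB
    \<and> fst s 10 = int (2 * BB + 1) \<and> fst s 11 = int (NN ^ f) \<and> fst s 12 = int ((2 * BB + 1) ^ f)"

lemma tabs_frame:
  assumes "tabs s" "\<And>x. x \<in> {0, 5, 7, 8, 9, 10, 11, 12} \<Longrightarrow> fst s' x = fst s x" "\<And>k. k \<in> {1, 2, 3} \<Longrightarrow> snd s' k = snd s k"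
  shows "tabs s'"
  using assms(1) assms(3)[of 1] assms(3)[of 2] assms(3)[of 3] by (simp add: tabs_def assms(2))

lemma big_RR: "int m * (int m * (int m * (int tt * int tt * int BB * int BB + int NN * int NN))) \<le> RR"
  "int m * (int m * (int NN * int BB)) \<le> RR"
proof -
  have m4: "m * m * m \<le> 100 * m ^ 4" "m * m \<le> 100 * m ^ 4"
    using power_increasing[of 3 4 m] power_increasing[of 2 4 m] m_pos by (simp_all add: power3_eq_cube power2_eq_square)
  have "(m * m * m) * (tt * tt * BB * BB + NN * NN) \<le> AA" "(m * m) * (NN * BB) \<le> AA"
    unfolding AA_def by (intro mult_le_mono m4; simp)+
  from this[THEN AA_RR] show "int m * (int m * (int m * (int tt * int tt * int BB * int BB + int NN * int NN))) \<le> RR"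
    "int m * (int m * (int NN * int BB)) \<le> RR" by (simp_all add: mult_ac)
qed

lemma wq_conv:
  assumes s: "tabs s" "\<forall>a<m. snd s 4 a = u a" "\<forall>a<m. snd s 5 a = x a"
    and b: "\<And>a. \<bar>u a\<bar> \<le> int NN" "\<And>a. \<bar>x a\<bar> \<le> int BB"
  shows "wq conv_p s (\<lambda>s' out. out = [] \<and> (\<forall>b<m. snd s' 6 b = rs u x b))"
  unfolding conv_p_def
proof (rule wq_For[where n = m and I = "\<lambda>j s' out. out = [] \<and> (\<forall>b<j. snd s' 6 b = rs u x b)"], goal_cases)
  case (10 j s1 out)
  have t1: "tabs s1" by (rule tabs_frame[OF s(1)]) (use 10(5,6) in auto)
  have ux: "\<forall>a<m. snd s1 4 a = u a" "\<forall>a<m. snd s1 5 a = x a" using s 10(6)[of 4] 10(6)[of 5] by auto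
  show ?case
  proof (intro wq_SetV_Sq, goal_cases)
    case 5
    let ?s = "((fst s1)(30 := aval s1 (C 0)), snd s1)"
    show ?case
    proof (rule wq_Sq[OF wq_dsum[where z = 0 and F = "\<lambda>a c. u a * x c * Sg ((a + c) mod m) j" and b = "int NN * int BB"]], goal_cases)
      case (12 s2 a c)
      have "nat ((int a + int c) mod int m * int m + int j) = (a + c) mod m * m + j"
        by (simp flip: of_nat_mult of_nat_add zmod_int)
      moreover have "0 \<le> (int a + int c) mod int m * int m + int j"
        using m_pos by (intro add_nonneg_nonneg mult_nonneg_nonneg) auto
      moreover have "fst s2 21 = int j" "fst s2 0 = int m" using 12(5)[of 21] 12(5)[of 0] 10(4) t1 by (auto simp: tabs_def)
      moreover have "snd s2 = snd s1" using 12(6) by simp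
      moreover have "snd s1 3 ((a + c) mod m * m + j) = Sg ((a + c) mod m) j" using t1 10(1) m_pos by (simp add: tabs_def)
      ultimately show ?case using 12(1-4) ux by simp
    next
      case (14 a c)
      have "\<bar>u a * x c\<bar> * \<bar>Sg ((a + c) mod m) j\<bar> \<le> int NN * int BB * 1"
        unfolding abs_mult by (intro mult_mono b Sg_bound) auto
      then show ?case by (simp add: abs_mult)
    next
      case (16 s2 o2)
      have z: "fst s2 30 = red (conv u x) j" using 16(2) by (simp add: red_conv)
      have fr: "fst s2 21 = int j" "fst s2 8 = int NN" "snd s2 = snd s1" using 16(3)[of 21] 16(3)[of 8] 16(4) 10(4) t1 by (auto simp: tabs_def fun_eq_iff)
      have c: "\<bar>rs u x j\<bar> \<le> RR" using cen_bound[of "red (conv u x) j"] NN_RR(1) by (simp add: rs_def)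
      show ?case using 16(2) z fr c 10(3) R_100
        by (intro wq_SetA) (auto simp: rs_def cen_def less_Suc_eq)
    qed (use 10(4) t1 big_RR in \<open>auto simp: tabs_def\<close>)
  qed (use R_100 in auto)
qed (use s in \<open>auto simp: tabs_def hb_def\<close>)

lemma wq_value:
  assumes s: "tabs s" "\<forall>a<m. snd s 5 a = x a" "\<forall>a<m. snd s 6 a = rs u x a" and b: "\<And>a. \<bar>x a\<bar> \<le> int BB"
  shows "wq value_p s (\<lambda>s' out. out = [] \<and> fst s' 19 = val u x)"
  unfolding value_p_def
proof (intro wq_SetV_Sq, goal_cases)
  case 5
  let ?b = "int m * (int tt * int tt * int BB * int BB + int NN * int NN)"
  show ?case
  proof (rule wq_mono[OF wq_dsum[where z = 0 and b = ?b
      and F = "\<lambda>a b. T ((a + (m - b)) mod m) * (int tt * int tt * x a * x b + rs u x a * rs u x b)"]], goal_cases)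
    case (12 s2 a c)
    have "int a + (int m - int c) = int (a + (m - c))" using 12(2) by simp
    then have "(int a + (int m - int c)) mod int m = int ((a + (m - c)) mod m)" by (simp only: zmod_int)
    moreover have "fst s2 7 = int tt" "fst s2 0 = int m" "snd s2 = snd s"
      using 12(5)[of 7] 12(5)[of 0] 12(6) s by (auto simp: tabs_def)
    moreover have "snd s 2 ((a + (m - c)) mod m) = T ((a + (m - c)) mod m)" using s m_pos by (simp add: tabs_def)
    ultimately show ?case using 12(1-4) s by simp
  next
    case (14 a c)
    have "\<bar>int tt * int tt * x a * x c\<bar> \<le> int tt * int tt * int BB * int BB"
      unfolding abs_mult by (intro mult_mono b) auto
    moreover have "\<bar>rs u x a * rs u x c\<bar> \<le> int NN * int NN"
      unfolding abs_mult rs_def by (intro mult_mono cen_bound) auto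
    ultimately have "\<bar>int tt * int tt * x a * x c + rs u x a * rs u x c\<bar> \<le> int tt * int tt * int BB * int BB + int NN * int NN"
      by linarith
    then show ?case unfolding abs_mult[of "T _"] by (intro mult_mono T_bound) auto
  next
    case (15)
    show ?case using big_RR(1) by simp
  qed (use s in \<open>auto simp: tabs_def val_def\<close>)
qed (use R_100 in auto)

end

section \<open>Output of the Gram matrix\<close>

definition two_rows :: stmt where
  "two_rows = Sq (For 20 0 (Sq (SetA 7 (V 20) (C 0)) (SetA 7 (V 0 .+ V 20) (Rd 4 (V 20))))) (SetA 7 (C 0) (V 8))"

text \<open>All inner products are integers, so each is followed by the denominator 1.\<close>

definition entry_p :: stmt where
  "entry_p = Sq (SetV 30 (V 27 .* V 28 .* V 7 .* V 7 .* Rd 2 ((V 20 .+ (V 0 .- V 21)) .mod V 0)))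
     (Sq (dsum 22 23 30 (Rd 7 (V 27 .* V 0 .+ V 22) .* Rd 7 (V 28 .* V 0 .+ V 23)
        .* Rd 2 ((V 20 .+ V 22 .+ ((V 0 .- V 21) .+ (V 0 .- V 23))) .mod V 0)))
     (Sq (Wr (V 30)) (Wr (C 1))))"

definition row_p :: stmt where
  "row_p = For 21 0 (IfLt (C 0) (Rd 1 (V 21)) entry_p)"

definition rows_p :: stmt where
  "rows_p = For 20 0 (IfLt (C 0) (Rd 1 (V 20)) (For 28 31 row_p))"

definition gram_p :: stmt where
  "gram_p = Sq (digits_p 4 14 8 (C 0)) (Sq (SetV 31 (C 2)) (Sq two_rows (For 27 31 rows_p)))"

definition algorithm :: "nat \<Rightarrow> stmt" where
  "algorithm K = Sq primes_p (Sq (SetV 4 (V 0 .div V 2)) (Sq tables (Sq sign_tab (Sq (params K) (Sq search gram_p)))))"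

lemma frame_gram [simp]:
  "mods two_rows = {20}" "amods two_rows = {7}"
  "mods entry_p = {22, 23, 30}" "amods entry_p = {}"
  "mods row_p = {21, 22, 23, 30}" "amods row_p = {}"
  "mods rows_p = {20, 21, 22, 23, 28, 30}" "amods rows_p = {}"
  "mods search = {13, 14, 15, 16, 17, 18, 19, 20, 21, 22, 30}" "amods search = {4, 5, 6}"
  "mods tables = {5, 20, 24, 25, 26}" "amods tables = {1, 2}"
  "mods sign_tab = {20, 21, 24, 26}" "amods sign_tab = {3}"
  "mods (params K) = {6, 7, 8, 9, 10, 11, 12, 23}" "amods (params K) = {}"
  "mods primes_p = {1, 2, 3, 23, 24, 25}" "amods primes_p = {0}"
  by (auto simp: two_rows_def entry_p_def row_p_def rows_p_def search_def tables_def sign_tab_def params_def primes_p_def)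

context alg
begin

abbreviation dgx :: "nat \<Rightarrow> nat \<Rightarrow> int" where
  "dgx X \<equiv> \<lambda>a. if a \<in> E then int (dig (2 * BB + 1) X a) - int BB else 0"

text \<open>The first disjunct is the default before any positive value has occurred; the second
  says that \<open>v\<close> is the least positive value so far.\<close>

definition minI :: "(nat \<Rightarrow> int) \<Rightarrow> nat \<Rightarrow> int \<Rightarrow> bool" where
  "minI u j v \<longleftrightarrow> (v = 0 \<and> (\<forall>X<j. val u (dgx X) \<le> 0)) \<or>
     (0 < v \<and> (\<exists>X<j. v = val u (dgx X)) \<and>
       (\<forall>X<j. 0 < val u (dgx X) \<longrightarrow>
          v \<le> val u (dgx X)))"

abbreviation dgu :: "nat \<Rightarrow> nat \<Rightarrow> int" where
  "dgu W \<equiv> \<lambda>a. if a \<in> E then int (dig NN W a) else 0"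

lemma dig_less: "0 < b \<Longrightarrow> dig b W a < b" by (simp add: dig_def)

lemma dgx_bound: "\<bar>dgx X a\<bar> \<le> int BB"
  using dig_less[of "2 * BB + 1" X a] by auto

lemma dgu_bound: "\<bar>dgu W a\<bar> \<le> int NN"
  using dig_less[of NN W a] NN_pos by auto

lemma minI_Suc:
  assumes "minI u j v"
  shows "minI u (Suc j) (if 0 < val u (dgx j) \<and> (v = 0 \<or> val u (dgx j) < v) then val u (dgx j) else v)"
  using assms unfolding minI_def less_Suc_eq
  by (cases "0 < val u (dgx j)"; cases "v = 0"; cases "val u (dgx j) < v") (auto intro: less_imp_le)

lemma wq_min: "wq min_p s (\<lambda>s' out. out = [] \<and> fst s' 15 =
   (if 0 < fst s 19 \<and> (fst s 15 = 0 \<or> fst s 19 < fst s 15) then fst s 19 else fst s 15))"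
proof -
  have "wq min_p s (\<lambda>s' out. out = [] \<and> fst s' 15 =
   (if 0 < fst s 19 \<and> (fst s 15 = 0 \<or> fst s 19 < fst s 15) then fst s 19 else fst s 15))" if "bs RR s"
  proof -
    have "\<bar>fst s 19\<bar> \<le> RR" using that by (auto simp: bs_def)
    then show ?thesis unfolding min_p_def by (intro wq_intro) (use R_100 in auto)
  qed
  then show ?thesis by (auto simp: wq_def)
qed

lemma wq_xloop:
  assumes s: "tabs s" "\<forall>a<m. snd s 4 a = u a" "fst s 15 = 0" and u: "\<And>a. \<bar>u a\<bar> \<le> int NN"
  shows "wq xloop s (\<lambda>s' out. out = [] \<and> minI u ((2 * BB + 1) ^ f) (fst s' 15))"
  unfolding xloop_def
proof (rule wq_For[where n = "(2 * BB + 1) ^ f" and I = "\<lambda>j s' out. out = [] \<and> minI u j (fst s' 15)"], goal_cases)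
  case (10 X s1 out)
  have t1: "tabs s1" by (rule tabs_frame[OF s(1)]) (use 10(5,6) in auto)
  have u1: "\<forall>a<m. snd s1 4 a = u a" using s 10(6)[of 4] by auto
  show ?case
  proof (rule wq_Sq[OF wq_digits[where W = X and Bd = "2 * BB + 1" and z = "int BB"]], goal_cases)
    case (13 d)
    then have "\<bar>int d - int BB\<bar> \<le> int BB" by auto
    also have "\<dots> \<le> RR" using NN_RR(4) by simp
    finally show ?case .
  next
    case (15 s2 o2)
    have t2: "tabs s2" by (rule tabs_frame[OF t1]) (use 15(3,4) in auto)
    have u2: "\<forall>a<m. snd s2 4 a = u a" using u1 15(4)[of 4] by auto
    have x2: "\<forall>a<m. snd s2 5 a = dgx X a" using 15(2) by simp
    have m2: "fst s2 15 = fst s1 15" using 15(3) by simp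
    show ?case
    proof (rule wq_Sq[OF wq_conv[OF t2 u2 x2 u dgx_bound]], goal_cases)
      case (1 s3 o3)
      have t3: "tabs s3" by (rule tabs_frame[OF t2]) (use 1(3,4) in auto)
      have x3: "\<forall>a<m. snd s3 5 a = dgx X a" "\<forall>a<m. snd s3 6 a = rs u (dgx X) a" "fst s3 15 = fst s1 15"
        using x2 1(2) 1(4)[of 5] 1(3)[of 15] m2 by auto
      show ?case
      proof (rule wq_Sq[OF wq_value[OF t3 x3(1,2) dgx_bound]], goal_cases)
        case (1 s4 o4)
        have e: "fst s4 15 = fst s1 15" "fst s4 19 = val u (dgx X)" using 1(2,3) x3(3) by auto
        show ?case
          by (rule wq_mono[OF wq_min]) (use minI_Suc[of u X "fst s1 15"] 10(3) 15(2) 1(2) \<open>o3 = [] \<and> _\<close> e in auto)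
      qed
    qed
  qed (use t1 10(4) in \<open>auto simp: tabs_def\<close>)
qed (use s in \<open>auto simp: tabs_def hb_def minI_def\<close>)

abbreviation best :: "nat \<Rightarrow> (nat \<Rightarrow> int) \<Rightarrow> bool" where
  "best W g \<equiv> \<forall>V<NN ^ f. minI (dgu V) ((2 * BB + 1) ^ f) (g V) \<and> g V \<le> g W"

lemma wq_search:
  assumes s: "tabs s"
  shows "wq search s (\<lambda>s' out. out = [] \<and> (\<exists>W g. W < NN ^ f \<and> fst s' 14 = int W \<and>
     best W g))"
proof -
  let ?p = "Sq (digits_p 4 16 8 (C 0)) (Sq (SetV 15 (C 0)) (Sq xloop
     (IfLt (V 13) (V 15) (Sq (SetV 13 (V 15)) (SetV 14 (V 16))))))"
  let ?I = "\<lambda>j (s'::state) out. out = [] \<and> (\<exists>g. (\<forall>V<j. minI (dgu V) ((2 * BB + 1) ^ f) (g V) \<and> g V \<le> fst s' 13) \<and>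
    (if j = 0 then fst s' 13 = -1 else \<exists>W<j. fst s' 14 = int W \<and> g W = fst s' 13))"
  have loop: "wq (For 16 11 ?p) s (\<lambda>s' out. out = [] \<and> (\<exists>W g. W < NN ^ f \<and> fst s' 14 = int W \<and>
     best W g))"
    if s: "tabs s" "fst s 13 = -1" for s
  proof (rule wq_For[where n = "NN ^ f" and I = ?I], goal_cases)
    case (10 W s1 out)
    have t1: "tabs s1" by (rule tabs_frame[OF s(1)]) (use 10(5,6) in auto)
    obtain g where g: "\<forall>V<W. minI (dgu V) ((2 * BB + 1) ^ f) (g V) \<and> g V \<le> fst s1 13"
      "if W = 0 then fst s1 13 = -1 else \<exists>W'<W. fst s1 14 = int W' \<and> g W' = fst s1 13" and out: "out = []"
      using 10(3) by auto
    show ?case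
    proof (rule wq_Sq[OF wq_digits[where W = W and Bd = NN and z = 0]], goal_cases)
      case (13 d)
      then show ?case using NN_RR(1) by simp
    next
      case (15 s2 o2)
      have t2: "tabs s2" by (rule tabs_frame[OF t1]) (use 15(3,4) in auto)
      have u2: "\<forall>a<m. snd s2 4 a = dgu W a" using 15(2) by simp
      have r2: "fst s2 13 = fst s1 13" "fst s2 14 = fst s1 14" "fst s2 16 = int W" using 15(3) 10(4) by auto
      show ?case
      proof (intro wq_SetV_Sq, goal_cases)
        case 5
        let ?s = "((fst s2)(15 := aval s2 (C 0)), snd s2)"
        have t3: "tabs ?s" by (rule tabs_frame[OF t2]) auto
        have u3: "\<forall>a<m. snd ?s 4 a = dgu W a" "fst ?s 15 = 0" using u2 by auto
        show ?case
        proof (rule wq_Sq[OF wq_xloop[OF t3 u3 dgu_bound]], goal_cases)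
          case (1 s4 o4)
          have r4: "fst s4 13 = fst s1 13" "fst s4 14 = fst s1 14" "fst s4 16 = int W" using 1(3) r2 by auto
          define v where "v = fst s4 15"
          have v: "minI (dgu W) ((2 * BB + 1) ^ f) v" using 1(2) by (simp add: v_def)
          then have v0: "0 \<le> v" by (auto simp: minI_def)
          let ?g = "g(W := v)"
          have o: "o2 = []" "o4 = []" using 15(2) 1(2) by auto
          have vR: "\<bar>v\<bar> \<le> RR" "int W \<le> RR" using 1(1) r4(3) unfolding v_def bs_def by (auto dest: spec[of _ 16])
          show ?case
          proof (cases "fst s1 13 < v")
            case True
            have "\<forall>V<Suc W. minI (dgu V) ((2 * BB + 1) ^ f) (?g V) \<and> ?g V \<le> v"
              using g(1) v True by (auto simp: less_Suc_eq)
            then have I: "?I (Suc W) s' (out @ o2 @ [] @ o4 @ [])" if "fst s' 13 = v" "fst s' 14 = int W" for s'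
              using that out o by (auto intro!: exI[of _ ?g] exI[of _ W])
            show ?thesis unfolding o out append_Nil
              by (intro wq_IfLt wq_SetV_Sq wq_SetV I[unfolded o out append_Nil])
                (use r4 v_def vR True in auto)
          next
            case False
            with v0 have W0: "W \<noteq> 0" using g(2) by (auto split: if_splits)
            then obtain W' where W': "W' < W" "fst s1 14 = int W'" "g W' = fst s1 13" using g(2) by auto
            have "\<forall>V<Suc W. minI (dgu V) ((2 * BB + 1) ^ f) (?g V) \<and> ?g V \<le> fst s4 13"
              using g(1) v False r4 by (auto simp: less_Suc_eq)
            then have I: "?I (Suc W) s4 (out @ o2 @ [] @ o4 @ [])"
              using W' out o r4 by (auto intro!: exI[of _ ?g] exI[of _ W'])
            show ?thesis unfolding o out append_Nil
              by (rule wq_IfLt) (use r4 v_def False I[unfolded o out append_Nil] in auto)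
          qed
        qed
      qed (use R_100 in auto)
    qed (use t1 10(4) NN_pos R_100 in \<open>auto simp: tabs_def\<close>)
  next
    case (11 s' out)
    have "NN ^ f \<noteq> 0" using NN_pos by simp
    with 11 obtain g W where "\<forall>V<NN ^ f. minI (dgu V) ((2 * BB + 1) ^ f) (g V) \<and> g V \<le> fst s' 13"
      "W < NN ^ f" "fst s' 14 = int W" "g W = fst s' 13" "out = []" by auto
    then show ?case by (intro conjI exI[of _ W] exI[of _ g]) simp_all
  qed (use s in \<open>auto simp: tabs_def hb_def\<close>)
  show ?thesis unfolding search_def
    by (intro wq_SetV_Sq loop tabs_frame[OF s]) (use R_100 in auto)
qed

text \<open>First components of the generators \<open>(N, 0)\<close> and \<open>(u, t)\<close>; the
  second component is \<open>t\<close> times the row index \<open>h\<close>, which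
  \<open>entry\<close> uses directly.\<close>

definition rowv :: "(nat \<Rightarrow> int) \<Rightarrow> nat \<Rightarrow> nat \<Rightarrow> int" where
  "rowv u h c = (if h = 0 then if c = 0 then int NN else 0 else u c)"
text \<open>The trace of \<open>(r \<zeta>^a)\<close> times the conjugate of
  \<open>(s \<zeta>^b)\<close> for first components \<open>r\<close> and \<open>s\<close>, expanded
  in powers of \<open>\<zeta>\<close>; the second components contribute only if both rows are of the
  second kind.\<close>

definition entry :: "(nat \<Rightarrow> int) \<Rightarrow> nat \<Rightarrow> nat \<Rightarrow> nat \<Rightarrow> nat \<Rightarrow> int" where
  "entry u h a h' b = int h * int h' * int tt * int tt * T ((a + (m - b)) mod m)
     + (\<Sum>c<m. \<Sum>d<m. rowv u h c * rowv u h' d * T ((a + c + ((m - b) + (m - d))) mod m))"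
definition entries :: "(nat \<Rightarrow> int) \<Rightarrow> nat \<Rightarrow> nat \<Rightarrow> nat \<Rightarrow> int list" where
  "entries u h a h' = concat (map (\<lambda>b. if b \<in> E then [entry u h a h' b, 1] else []) [0..<m])"
abbreviation block :: "(nat \<Rightarrow> int) \<Rightarrow> nat \<Rightarrow> int list" where
  "block u h \<equiv> concat (map (\<lambda>a. if a \<in> E then concat (map (entries u h a) [0..<2]) else []) [0..<m])"
definition gram_out :: "(nat \<Rightarrow> int) \<Rightarrow> int list" where
  "gram_out u = concat (map (block u) [0..<2])"

definition gst :: "(nat \<Rightarrow> int) \<Rightarrow> state \<Rightarrow> bool" where
  "gst u s \<longleftrightarrow> tabs s \<and> fst s 31 = 2 \<and> (\<forall>h<2. \<forall>c<m. snd s 7 (h * m + c) = rowv u h c)"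

lemma gst_frame:
  assumes "gst u s" "\<And>x. x \<in> {0, 5, 7, 8, 9, 10, 11, 12, 31} \<Longrightarrow> fst s' x = fst s x" "\<And>k. snd s' k = snd s k"
  shows "gst u s'"
proof -
  have "tabs s'" by (rule tabs_frame[of s]) (use assms in \<open>auto simp: gst_def\<close>)
  then show ?thesis using assms(1) by (simp add: gst_def assms(2,3))
qed

lemma wq_two_rows:
  assumes s: "tabs s" "fst s 31 = 2" "\<forall>a<m. snd s 4 a = u a"
  shows "wq two_rows s (\<lambda>s' out. out = [] \<and> gst u s')"
proof -
  let ?I = "\<lambda>j (s'::state) out. out = [] \<and> (\<forall>c<j. snd s' 7 c = 0 \<and> snd s' 7 (m + c) = u c)"
  have loop: "wq (For 20 0 (Sq (SetA 7 (V 20) (C 0)) (SetA 7 (V 0 .+ V 20) (Rd 4 (V 20))))) s (?I m)"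
  proof (rule wq_For[where n = m and I = ?I], goal_cases)
    case (10 j s1 out)
    have fr: "fst s1 0 = int m" "snd s1 4 j = u j" using s 10(5)[of 0] 10(6)[of 4] 10(1) by (auto simp: tabs_def)
    have uR: "\<bar>u j\<bar> \<le> RR" unfolding fr(2)[symmetric] using 10(2) by (simp add: bs_def)
    have ix: "nat (int m + int j) = m + j" by simp
    show ?case by (intro wq_SetA_Sq wq_SetA) (use fr uR 10(1,3,4) R_100 ix in \<open>auto simp: less_Suc_eq\<close>)
  qed (use s in \<open>auto simp: tabs_def hb_def\<close>)
  show ?thesis unfolding two_rows_def
  proof (rule wq_Sq[OF loop], goal_cases)
    case (1 s1 o1)
    have t: "tabs s1" by (rule tabs_frame[OF s(1)]) (use 1(3,4) in auto)
    have 31: "fst s1 31 = 2" using 1(3) s by auto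
    have 7: "fst s1 8 = int NN" using t by (simp add: tabs_def)
    have z: "\<forall>c<m. snd s1 7 c = 0 \<and> snd s1 7 (m + c) = u c" and o1: "o1 = []" using 1(2) by auto
    have g: "gst u (fst s1, (snd s1)(7 := (snd s1 7)(0 := int NN)))"
      unfolding gst_def
    proof (intro conjI allI impI)
      show "tabs (fst s1, (snd s1)(7 := (snd s1 7)(0 := int NN)))" by (rule tabs_frame[OF t]) auto
      fix h c :: nat assume hc: "h < 2" "c < m"
      show "snd (fst s1, (snd s1)(7 := (snd s1 7)(0 := int NN))) 7 (h * m + c) = rowv u h c"
        using hc m_pos z by (auto simp: less_2_cases_iff rowv_def)
    qed (use 31 in auto)
    show ?case by (intro wq_SetA) (use g 7 R_100 NN_RR(1) o1 in auto)
  qed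
qed

lemma wq_entry:
  assumes s: "gst u s" "fst s 27 = int h" "fst s 20 = int a" "fst s 28 = int h'" "fst s 21 = int b"
    and l: "h < 2" "h' < 2" "a < m" "b < m" and u: "\<And>a. \<bar>u a\<bar> \<le> int NN"
  shows "wq entry_p s (\<lambda>s' out. out = [entry u h a h' b, 1])"
proof -
  define z where "z = int h * int h' * int tt * int tt * T ((a + (m - b)) mod m)"
  have rb: "\<bar>rowv u h c\<bar> \<le> int NN" for h c using u[of c] by (auto simp: rowv_def)
  have zb: "\<bar>z\<bar> \<le> int m * (int tt * int tt)"
  proof -
    have "\<bar>z\<bar> = (int h * int h') * (int tt * int tt) * \<bar>T ((a + (m - b)) mod m)\<bar>" by (simp add: z_def abs_mult mult_ac)
    also have "\<dots> \<le> 1 * (int tt * int tt) * int m" using l by (intro mult_mono T_bound) (auto simp: less_2_cases_iff)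
    finally show ?thesis by (simp add: mult_ac)
  qed
  let ?b = "int m * (int NN * int NN)"
  have tot: "\<bar>z\<bar> + int m * (int m * ?b) \<le> RR"
  proof -
    have "int tt * int tt * 1 \<le> int tt * int tt * (int BB * int BB)"
      using BB_pos by (intro mult_left_mono) (auto simp flip: of_nat_mult)
    then have "int m * (int tt * int tt) \<le> int m * (int tt * int tt * int BB * int BB)"
      by (intro mult_left_mono) (simp_all add: mult_ac)
    also have "\<dots> * 1 \<le> int m * (int tt * int tt * int BB * int BB) * (int m * int m)"
      using m_pos by (intro mult_left_mono) (auto simp flip: of_nat_mult)
    finally have "int m * (int tt * int tt) \<le> int m * (int m * (int m * (int tt * int tt * int BB * int BB)))"
      by (simp add: mult_ac)
    with zb big_RR(1) show ?thesis by (simp add: distrib_left)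
  qed
  have g: "fst s 0 = int m" "fst s 7 = int tt" "tabT s m" "\<forall>h<2. \<forall>c<m. snd s 7 (h * m + c) = rowv u h c"
    using s(1) by (auto simp: gst_def tabs_def)
  have Ts: "snd s 2 (x mod m) = T (x mod m)" for x using g(3) m_pos by simp
  have ab: "(int a + (int m - int b)) mod int m = int ((a + (m - b)) mod m)"
  proof -
    have "int a + (int m - int b) = int (a + (m - b))" using l by simp
    then show ?thesis by (simp only: zmod_int)
  qed
  have main: "wq (Sq (dsum 22 23 30 (Rd 7 (V 27 .* V 0 .+ V 22) .* Rd 7 (V 28 .* V 0 .+ V 23)
        .* Rd 2 ((V 20 .+ V 22 .+ ((V 0 .- V 21) .+ (V 0 .- V 23))) .mod V 0)))
     (Sq (Wr (V 30)) (Wr (C 1)))) s0 (\<lambda>s' out. out = [entry u h a h' b, 1])"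
    if s0: "fst s0 30 = z" "\<And>x. x \<noteq> 30 \<Longrightarrow> fst s0 x = fst s x" "snd s0 = snd s" for s0
  proof (rule wq_Sq[OF wq_dsum[where z = z and b = ?b and F = "\<lambda>c d. rowv u h c * rowv u h' d * T ((a + c + ((m - b) + (m - d))) mod m)"]], goal_cases)
    case (12 s2 c d)
    have r: "fst s2 27 = int h" "fst s2 20 = int a" "fst s2 28 = int h'" "fst s2 21 = int b" "fst s2 0 = int m" "snd s2 = snd s"
      using 12(5,6) s0 s g by auto
    have "nat (int h * int m + int c) = h * m + c" for h c by (simp flip: of_nat_mult of_nat_add)
    moreover have "int a + int c + (int m - int b + (int m - int d)) = int (a + c + ((m - b) + (m - d)))" using 12 l by simp
    then have "(int a + int c + (int m - int b + (int m - int d))) mod int m = int ((a + c + ((m - b) + (m - d))) mod m)"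
      by (simp only: zmod_int)
    ultimately show ?case using r 12(1-4) g(4) l Ts[of "a + c + ((m - b) + (m - d))"] by simp
  next
    case (14 c d)
    have "\<bar>rowv u h c * rowv u h' d\<bar> * \<bar>T ((a + c + ((m - b) + (m - d))) mod m)\<bar> \<le> (int NN * int NN) * int m"
      unfolding abs_mult by (intro mult_mono rb T_bound) auto
    then show ?case by (simp add: abs_mult mult_ac)
  next
    case (15) show ?case by (rule tot)
  next
    case (16 s2 o2)
    show ?case
      by (rule wq_Sq[OF wq_Wr[where Q = "\<lambda>s' out. out = [entry u h a h' b]"]]; (rule wq_Wr)?)
        (use 16(2) R_100 in \<open>auto simp: entry_def z_def\<close>)
  qed (use s0 g in auto)
  have zR: "\<bar>z\<bar> \<le> RR" using tot by (smt (verit) mult_nonneg_nonneg of_nat_0_le_iff)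
  show ?thesis unfolding entry_p_def
    by (intro wq_SetV_Sq main) (use s g ab Ts[of "a + (m - b)"] zR R_100 in \<open>auto simp: z_def\<close>)
qed

lemma concat_map_Suc: "concat (map F [0..<Suc j]) = concat (map F [0..<j]) @ F j"
  by simp

lemma wq_row:
  assumes s: "gst u s" "fst s 27 = int h" "fst s 20 = int a" "fst s 28 = int h'"
    and l: "h < 2" "h' < 2" "a < m" and u: "\<And>a. \<bar>u a\<bar> \<le> int NN"
  shows "wq row_p s (\<lambda>s' out. out = entries u h a h')"
  unfolding row_p_def
proof (rule wq_For[where n = m and I = "\<lambda>j s' out. out = concat (map (\<lambda>b. if b \<in> E then [entry u h a h' b, 1] else []) [0..<j])"], goal_cases)
  case (10 b s1 out)
  have g: "gst u s1" by (rule gst_frame[OF s(1)]) (use 10(5,6) in auto)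
  have r: "fst s1 27 = int h" "fst s1 20 = int a" "fst s1 28 = int h'" using s 10(5) by auto
  have E: "snd s1 1 b = (if b \<in> E then 1 else 0)" using g 10(1) by (simp add: gst_def tabs_def)
  show ?case
  proof (rule wq_IfLt, goal_cases)
    case 5
    then have "b \<in> E" using E 10(4) by (auto split: if_splits)
    then show ?case using 10(3) by (intro wq_mono[OF wq_entry[OF g r 10(4) l 10(1) u]]) simp
  next
    case 6
    then have "b \<notin> E" using E 10(4) by auto
    then show ?case using 10(3) by simp
  qed (use 10(4) R_100 in auto)
qed (use s in \<open>auto simp: gst_def tabs_def hb_def entries_def\<close>)

lemma wq_rows:
  assumes s: "gst u s" "fst s 27 = int h" and l: "h < 2" and u: "\<And>a. \<bar>u a\<bar> \<le> int NN"
  shows "wq rows_p s (\<lambda>s' out. out = block u h)"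
  unfolding rows_p_def
proof (rule wq_For[where n = m and I = "\<lambda>j s' out. out = concat (map (\<lambda>a. if a \<in> E then concat (map (entries u h a) [0..<2]) else []) [0..<j])"], goal_cases)
  case (10 a s1 out)
  have g: "gst u s1" by (rule gst_frame[OF s(1)]) (use 10(5,6) in auto)
  have r: "fst s1 27 = int h" using s 10(5) by auto
  have E: "snd s1 1 a = (if a \<in> E then 1 else 0)" using g 10(1) by (simp add: gst_def tabs_def)
  show ?case
  proof (rule wq_IfLt, goal_cases)
    case 5
    then have aE: "a \<in> E" using E 10(4) by (auto split: if_splits)
    have "wq (For 28 31 row_p) s1 (\<lambda>s' o2. o2 = concat (map (entries u h a) [0..<2]))"
    proof (rule wq_For[where n = 2 and I = "\<lambda>j s' out. out = concat (map (entries u h a) [0..<j])"], goal_cases)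
      case (10 h' s2 out2)
      have g2: "gst u s2" by (rule gst_frame[OF g]) (use 10(5,6) in auto)
      have r2: "fst s2 27 = int h" "fst s2 20 = int a" using r 10(5) \<open>fst s1 20 = int a\<close> by auto
      show ?case using 10(3) by (intro wq_mono[OF wq_row[OF g2 r2 10(4) l 10(1) \<open>a < m\<close> u]]) (simp only: concat_map_Suc)
    qed (use g in \<open>auto simp: gst_def hb_def\<close>)
    then show ?case by (rule wq_mono) (use 10(3) aE in simp)
  next
    case 6
    then have "a \<notin> E" using E 10(4) by auto
    then show ?case using 10(3) by simp
  qed (use 10(4) R_100 in auto)
qed (use s in \<open>auto simp: gst_def tabs_def hb_def\<close>)

lemma wq_gram:
  assumes s: "tabs s" "fst s 14 = int W"
  shows "wq gram_p s (\<lambda>s' out. out = gram_out (dgu W))"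
  unfolding gram_p_def
proof (rule wq_Sq[OF wq_digits[where W = W and Bd = NN and z = 0]], goal_cases)
  case (13 d)
  then show ?case using NN_RR(1) by simp
next
  case (15 s1 o1)
  have t1: "tabs s1" by (rule tabs_frame[OF s(1)]) (use 15(3,4) in auto)
  have u1: "\<forall>a<m. snd s1 4 a = dgu W a" and o1: "o1 = []" using 15(2) by simp_all
  show ?case unfolding o1 append_Nil
  proof (intro wq_SetV_Sq, goal_cases)
    case 5
    have t2: "tabs ((fst s1)(31 := 2), snd s1)" by (rule tabs_frame[OF t1]) auto
    show ?case unfolding aval.simps
    proof (rule wq_Sq[OF wq_two_rows[OF t2, where u = "dgu W"]], goal_cases)
      case 2 show ?case using u1 by simp
    next
      case (3 s3 o3)
      have g: "gst (dgu W) s3" and o3: "o3 = []" using 3 by auto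
      show ?case unfolding o3 append_Nil
      proof (rule wq_For[where n = 2 and I = "\<lambda>j s' out. out = concat (map (block (dgu W)) [0..<j])"], goal_cases)
        case (10 h s4 out)
        have g4: "gst (dgu W) s4" by (rule gst_frame[OF g]) (use 10(5,6) in auto)
        show ?case using 10(3) by (intro wq_mono[OF wq_rows[OF g4 10(4,1) dgu_bound]]) (simp only: concat_map_Suc)
      qed (use g in \<open>auto simp: gst_def hb_def gram_out_def\<close>)
    qed simp
  qed (use R_100 in auto)
qed (use s NN_pos R_100 in \<open>auto simp: tabs_def\<close>)

lemma wq_algorithm:
  "wq (algorithm K) ((\<lambda>_. 0)(0 := int m), \<lambda>_ _. 0) (\<lambda>s' out. \<exists>W g. out = gram_out (dgu W) \<and> W < NN ^ f \<and>
     best W g)"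
  unfolding algorithm_def
proof (rule wq_Sq[OF wq_primes], goal_cases)
  case (3 s1 o1)
  then have o1: "o1 = []" and s1: "fst s1 1 = int (m + 1)" "fst s1 2 = int m0" "fst s1 3 = int L" "fst s1 0 = int m"
    "\<forall>i. snd s1 0 i = (if i \<in> P then 1 else 0)" by auto
  have d: "int m div int m0 = int m1" by (simp add: m1_def zdiv_int)
  let ?s = "((fst s1)(4 := aval s1 (V 0 .div V 2)), snd s1)"
  have b: "base ?s" and L3: "fst ?s 3 = int L" using s1 d by (auto simp: base_def)
  show ?case unfolding o1 append_Nil
  proof (intro wq_SetV_Sq, goal_cases)
    case 5
    show ?case
    proof (rule wq_Sq[OF wq_tables[OF b]], goal_cases)
      case (1 s2 o2)
      have b2: "base s2" and E2: "tabE s2 m" and r2: "tabT s2 m" "fst s2 5 = int f" "fst s2 3 = int L" "o2 = []"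
        using b 1 L3 by (auto simp: base_def)
      show ?case unfolding r2 append_Nil
      proof (rule wq_Sq[OF wq_sign_tab[OF b2 E2]], goal_cases)
        case (1 s3 o3)
        have r3: "fst s3 5 = int f" "fst s3 3 = int L" "o3 = []" "fst s3 0 = int m" "tabE s3 m" "tabT s3 m"
          "\<forall>a<m. \<forall>b<m. snd s3 3 (a * m + b) = Sg a b"
          using 1 r2 E2 b2 by (auto simp: base_def)
        show ?case unfolding r3(3) append_Nil
        proof (rule wq_Sq[OF wq_params[OF r3(1,2)]], goal_cases)
          case (1 s4 o4)
          have t4: "tabs s4" "o4 = []" using 1(2) 1(3)[of 0] 1(3)[of 5] 1(4)[of 1] 1(4)[of 2] 1(4)[of 3] r3 by (auto simp: tabs_def)
          show ?case unfolding t4(2) append_Nil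
          proof (rule wq_Sq[OF wq_search[OF t4(1)]], goal_cases)
            case (1 s5 o5)
            then obtain W g where W: "W < NN ^ f" "fst s5 14 = int W"
              "best W g" and o5: "o5 = []" by auto
            have t5: "tabs s5" by (rule tabs_frame[OF t4(1)]) (use 1(3,4) in auto)
            show ?case unfolding o5 append_Nil
              by (rule wq_mono[OF wq_gram[OF t5 W(2)]]) (use W in auto)
          qed
        qed
      qed
    qed
  qed (use s1 d m1_RR in auto)
qed simp_all

end

lemma tcost_mono: "(\<And>r. h r \<le> h' r) \<Longrightarrow> tcost h p \<le> tcost h' p"
  by (induction p) (auto intro!: add_mono mult_le_mono)

text \<open>The cost is bounded by a polynomial of degree 4 in \<open>a\<close> times the two search
  ranges. Naming the powers of \<open>a\<close> reduces the claim to a comparison of coefficients;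
  writing the ranges as successors keeps them positive.\<close>

lemma tcost_algorithm:
  assumes h: "\<And>r. h r = (if r = 11 then Suc x else if r = 12 then Suc y else if r = 31 then 2 else Suc (a::nat))"
  shows "tcost h (algorithm K) \<le> 2000 * (a + 1) ^ 4 * ((x + 1) * (y + 1))"
proof -
  define b where "b = a * a"
  define c where "c = b * a"
  define d where "d = b * b"
  have p4: "(a + 1) ^ 4 = d + 4 * c + 6 * b + 4 * a + 1"
    by (simp add: d_def c_def b_def eval_nat_numeral algebra_simps)
  have e: "a * a = b" "a * b = c" "a * (a * z) = b * z" "a * (b * z) = c * z" "b * b = d" "b * (b * z) = d * z" "a * c = d" "a * (c * z) = d * z" for z
    by (simp_all add: b_def c_def d_def algebra_simps)
  show ?thesis
    unfolding p4
    by (simp add: algorithm_def primes_p_def prime_test_def tables_def tab_loop_def sign_tab_def sign_loop_def params_def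
     search_def xloop_def digits_p_def conv_p_def value_p_def min_p_def dsum_def gram_p_def two_rows_def rows_p_def row_p_def entry_p_def h
     algebra_simps e)
qed

lemma abst_init: "abst ((\<lambda>_. 0)(0 := k)) = ((\<lambda>_. 0)(0 := k), \<lambda>_ _. 0)"
proof -
  have "0 \<noteq> arr k i" if "0 \<le> i" for k i using that by (simp add: arr_def)
  then have "(if j < 16 then ((\<lambda>_. 0)(0 := k)) (arr j (int i)) else 0) = (0::int)" for i j
    by (metis (full_types) fun_upd_other of_nat_0_le_iff)
  moreover have "(if x < 32 then ((\<lambda>_. 0)(0 := k)) (int x) else 0) = ((\<lambda>_. 0)(0 := k)) x" for x :: nat by simp
  ultimately show ?thesis unfolding abst_def by presburger
qed

context alg
begin

abbreviation cost :: nat where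
  "cost \<equiv> 2000 * (m + 1) ^ 4 * (NN ^ f * (2 * BB + 1) ^ f) * unit_cost (RR ^ 16)"

lemma algorithm_computes:
  obtains t W g where "computes (cstmt (algorithm K)) m t (gram_out (dgu W))"
    "t \<le> cost"
    "W < NN ^ f" "\<And>V. V < NN ^ f \<Longrightarrow> minI (dgu V) ((2 * BB + 1) ^ f) (g V) \<and> g V \<le> g W"
proof -
  let ?M = "(\<lambda>_. 0)(0 := int m) :: memory"
  let ?s = "((\<lambda>_. 0)(0 := int m), \<lambda>_ _. 0) :: state"
  have mR: "int m \<le> RR" using m_RR by simp
  have "RR ^ 1 \<le> RR ^ 16" using R_100 by (intro power_increasing) auto
  then have b: "bnd (RR ^ 16) ?M" using mR by (auto simp: bnd_def)
  define Q where "Q out \<longleftrightarrow> (\<exists>W g. out = gram_out (dgu W) \<and> W < NN ^ f \<and>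
     best W g)" for out
  have bs: "bs RR ?s" using mR by (auto simp: bs_def)
  have "wq (algorithm K) ?s (\<lambda>s' out. Q out)" unfolding Q_def by (rule wq_algorithm)
  from this[unfolded wq_def, THEN mp, OF bs]
  have "xp (RR ^ 16) (cstmt (algorithm K)) ?M (tcost hb (algorithm K)) (\<lambda>M' out. (bs RR (abst M') \<and> Q out) \<and>
       unchanged (algorithm K) ?s (abst M'))"
    using b abst_init[of "int m"] unfolding wp_def by blast
  then obtain t M' out where e: "exec (cstmt (algorithm K)) ?M t M' out" "t \<le> tcost hb (algorithm K) * unit_cost (RR ^ 16)" "Q out"
    unfolding xp_def by blast
  obtain W g where W: "out = gram_out (dgu W)" "W < NN ^ f"
    "best W g" using e(3) unfolding Q_def by blast
  \<comment> \<open>Loop bounds enlarged to the shape that \<open>tcost_algorithm\<close>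
    expects.\<close>
  define h where "h r = (if r = 11 then Suc (NN ^ f - 1) else if r = 12 then Suc ((2 * BB + 1) ^ f - 1) else if r = 31 then 2 else Suc m)" for r :: nat
  have "tcost hb (algorithm K) \<le> tcost h (algorithm K)"
    using NN_pos m2 by (intro tcost_mono) (auto simp: hb_def h_def)
  also have "\<dots> \<le> 2000 * (m + 1) ^ 4 * ((NN ^ f - 1 + 1) * ((2 * BB + 1) ^ f - 1 + 1))"
    by (rule tcost_algorithm) (simp add: h_def)
  also have "\<dots> = 2000 * (m + 1) ^ 4 * (NN ^ f * (2 * BB + 1) ^ f)" using NN_pos by simp
  finally have "t \<le> cost"
    using e(2) by (meson le_trans mult_le_mono1)
  then show thesis using that[of t W g] e(1) W unfolding computes_def by blast
qed

section \<open>Optimality of the output\<close>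

text \<open>\<open>V\<close> is built along \<open>E\<close>; a new digit at position
  \<open>rk j\<close> is a multiple of \<open>b\<close> times every lower place value and leaves the
  lower digits alone.\<close>

lemma digits_surj:
  assumes b: "0 < b" and h: "\<And>a. a \<in> E \<Longrightarrow> h a < b"
  obtains V where "V < b ^ f" "\<And>a. a \<in> E \<Longrightarrow> dig b V a = h a"
proof -
  have "\<exists>V<b ^ rk j. \<forall>a\<in>E. a < j \<longrightarrow> dig b V a = h a" for j
  proof (induction j)
    case (Suc j)
    then obtain V where V: "V < b ^ rk j" "\<forall>a\<in>E. a < j \<longrightarrow> dig b V a = h a" by blast
    show ?case
    proof (cases "j \<in> E")
      case True
      let ?V = "V + h j * b ^ rk j"
      have "?V < b ^ rk j + h j * b ^ rk j" using V by simp
      also have "\<dots> = (h j + 1) * b ^ rk j" by simp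
      also have "\<dots> \<le> b * b ^ rk j" using h[OF True] by (intro mult_le_mono1) simp
      finally have lt: "?V < b ^ rk (Suc j)" using True by (simp add: rk_Suc)
      have "dig b ?V j = h j" using V(1) h[OF True] b by (simp add: dig_def)
      moreover have "dig b ?V a = h a" if a: "a \<in> E" "a < j" for a
      proof -
        have "{i\<in>E. i < a} \<subset> {i\<in>E. i < j}" using a by auto
        then have "rk a < rk j" unfolding rk_def by (intro psubset_card_mono) auto
        then obtain d where d: "rk j = rk a + Suc d" using less_iff_Suc_add by auto
        have e: "h j * b ^ rk j = b ^ rk a * (b * (h j * b ^ d))" by (simp add: d power_add mult_ac)
        have "?V div b ^ rk a = V div b ^ rk a + b * (h j * b ^ d)" unfolding e using b by simp
        then have "dig b ?V a = dig b V a" by (simp add: dig_def)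
        then show ?thesis using V a by simp
      qed
      ultimately show ?thesis using lt by (auto simp: less_Suc_eq)
    qed (use V in \<open>auto simp: rk_Suc less_Suc_eq\<close>)
  qed (auto simp: rk_def)
  from this[of m] obtain V where "V < b ^ rk m" "\<forall>a\<in>E. a < m \<longrightarrow> dig b V a = h a" by blast
  moreover have "rk m = f" by (simp add: rk_def E_all)
  ultimately show thesis using that E_less by auto
qed

lemma nQ_int: "nQ (ic c) = real_of_int (\<Sum>a<m. \<Sum>b<m. c a * c b * T ((a + (m - b)) mod m))"
proof -
  have "nQ (ic c) = nQ (rc (\<lambda>a. real_of_int (c a)))" by simp
  then show ?thesis by (simp add: nQ_B B_def del: of_real_of_int_eq)
qed

lemma val_nQ: "real_of_int (val u x) = (real tt)\<^sup>2 * nQ (ic x) + nQ (ic (rs u x))"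
  unfolding nQ_int val_def sum_distrib_left
  by (simp add: sum_distrib_left sum.distrib[symmetric] distrib_left power2_eq_square mult_ac)

lemma cen_zero: "cen 0 = 0"
proof -
  have "int NN div 2 mod int NN = int NN div 2" using NN_pos by (intro mod_pos_pos_trivial) auto
  then show ?thesis by (simp add: cen_def)
qed

lemma latQ_red: "latQ NN u x y = nQ (ic (\<lambda>a. red (conv u x) a + int NN * y a))"
  unfolding latQ_def by (rule nQ_cong) (simp add: hat_add hat_cmult hat_red)

text \<open>The floor quotient in \<open>cen\<close> gives \<open>y\<close>; outside
  \<open>E\<close> it vanishes because \<open>N div 2 div N = 0\<close>.\<close>

lemma rs_shift: obtains y where "y \<in> ZE" "rs u x = (\<lambda>a. red (conv u x) a + int NN * y a)"
proof
  let ?y = "\<lambda>a. - ((red (conv u x) a + int NN div 2) div int NN)"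
  show e: "rs u x = (\<lambda>a. red (conv u x) a + int NN * ?y a)"
    by (auto simp: rs_def cen_def minus_div_mult_eq_mod[symmetric] algebra_simps)
  have "int NN div 2 div int NN = 0" using NN_pos by (intro div_pos_pos_trivial) auto
  then show "?y \<in> ZE" by (simp add: ZE_def red_supp)
qed

lemma cen_unique: "2 * \<bar>z + int NN * y\<bar> < int NN \<Longrightarrow> cen z = z + int NN * y"
proof -
  assume *: "2 * \<bar>z + int NN * y\<bar> < int NN"
  have "(z + int NN div 2) mod int NN = ((z + int NN * y) + int NN div 2) mod int NN"
    by (metis add.assoc add.commute mod_mult_self2)
  also have "\<dots> = (z + int NN * y) + int NN div 2"
  proof (rule mod_pos_pos_trivial)
    have "0 \<le> v + n div 2" "v + n div 2 < n" if "2 * \<bar>v\<bar> < n" for v n :: int using that by presburger+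
    from this[OF *] show "0 \<le> z + int NN * y + int NN div 2" "z + int NN * y + int NN div 2 < int NN" by auto
  qed
  finally show ?thesis by (simp add: cen_def)
qed

lemma coef_small:
  assumes "x \<in> ZE" "real L * nQ (ic x) \<le> real m * s\<^sup>2" "0 \<le> s"
  shows "real_of_int \<bar>x a\<bar> \<le> s"
proof -
  have "real m * (real_of_int (x a))\<^sup>2 \<le> real L * nQ (ic x)" using assms(1) by (intro coef_bound_int) (auto simp: ZE_def)
  then have "real m * (real_of_int (x a))\<^sup>2 \<le> real m * s\<^sup>2" using assms(2) by linarith
  then have "(real_of_int (x a))\<^sup>2 \<le> s\<^sup>2" using m_pos by simp
  then show ?thesis using assms(3) by (simp add: abs_le_square_iff[symmetric])
qed

lemma nQ_pos: "x \<in> ZE \<Longrightarrow> x \<noteq> (\<lambda>_. 0) \<Longrightarrow> 0 < nQ (ic x)"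
  using nQ_ge[of x] m_pos L_pos by (smt (verit) of_nat_0_less_iff zero_less_mult_pos)

text \<open>For \<open>u0\<close> every value with \<open>x\<close> nonzero is a squared norm in its
  lattice, so its recorded minimum, and hence the maximum \<open>g W\<close>, exceeds
  \<open>\<rho>\<close>. For \<open>W\<close>, a vector of squared norm at most
  \<open>\<rho>\<close> would have been seen: the bound on \<open>u x + N y\<close> makes this
  component the centred residue, and the bound on \<open>nQ (ic x)\<close> puts \<open>x\<close>
  into the search range.\<close>

lemma optimal_u:
  assumes good: "u0 \<in> box NN" "\<And>x y. x \<in> ZE \<Longrightarrow> y \<in> ZE \<Longrightarrow> (x, y) \<noteq> (\<lambda>_. 0, \<lambda>_. 0) \<Longrightarrow> \<rho> < (real tt)\<^sup>2 * nQ (ic x) + latQ NN u0 x y"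
    and \<rho>: "0 \<le> \<rho>" "real L * \<rho> \<le> real m * (real tt * real BB)\<^sup>2" "4 * real L * \<rho> < real m * (real NN)\<^sup>2"
    and W: "\<And>V. V < NN ^ f \<Longrightarrow> minI (dgu V) ((2 * BB + 1) ^ f) (g V) \<and> g V \<le> g W" "W < NN ^ f"
    and xy: "x \<in> ZE" "y \<in> ZE" "(x, y) \<noteq> (\<lambda>_. 0, \<lambda>_. 0)"
  shows "\<rho> < (real tt)\<^sup>2 * nQ (ic x) + latQ NN (dgu W) x y"
proof (rule ccontr)
  assume small: "\<not> ?thesis"
  have x_surj: "\<exists>X<(2 * BB + 1) ^ f. x = dgx X" if x: "x \<in> ZE" "\<And>a. \<bar>x a\<bar> \<le> int BB" for x
  proof -
    have xb: "- int BB \<le> x a" "x a \<le> int BB" for a using x(2)[of a] by auto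
    have n: "nat (x a + int BB) < 2 * BB + 1" for a using xb[of a] by linarith
    obtain X where X: "X < (2 * BB + 1) ^ f" "\<And>a. a \<in> E \<Longrightarrow> dig (2 * BB + 1) X a = nat (x a + int BB)"
      by (rule digits_surj[of "2 * BB + 1" "\<lambda>a. nat (x a + int BB)"]) (use n in auto)
    have "x = dgx X"
    proof
      fix a show "x a = dgx X a" using X(2)[of a] xb(1)[of a] x(1) by (cases "a \<in> E") (auto simp: ZE_def)
    qed
    with X(1) show ?thesis by blast
  qed
  obtain V0 where V0: "V0 < NN ^ f" "u0 = dgu V0"
  proof -
    have u0: "0 \<le> u0 a" "u0 a < int NN" for a using good(1) by (auto simp: box_def)
    have n: "nat (u0 a) < NN" for a using u0[of a] by linarith
    obtain V where V: "V < NN ^ f" "\<And>a. a \<in> E \<Longrightarrow> dig NN V a = nat (u0 a)"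
      by (rule digits_surj[of NN "\<lambda>a. nat (u0 a)"]) (use NN_pos n in auto)
    have "u0 = dgu V"
    proof
      fix a show "u0 a = dgu V a" using V(2)[of a] u0(1)[of a] good(1) by (cases "a \<in> E") (auto simp: ZE_def box_def)
    qed
    with V(1) that show thesis by blast
  qed
  have dgxZE: "dgx X \<in> ZE" for X by (simp add: ZE_def)
  have val_big: "\<rho> < real_of_int (val u0 x)" if x: "x \<in> ZE" "x \<noteq> (\<lambda>_. 0)" for x
  proof -
    obtain y where y: "y \<in> ZE" "rs u0 x = (\<lambda>a. red (conv u0 x) a + int NN * y a)" by (rule rs_shift)
    have "real_of_int (val u0 x) = (real tt)\<^sup>2 * nQ (ic x) + latQ NN u0 x y"
      unfolding val_nQ y(2) latQ_red ..
    then show ?thesis using good(2)[OF x(1) y(1)] x(2) by simp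
  qed
  have red0: "red (conv u (\<lambda>_. 0)) a = 0" for u a by (simp add: red_conv)
  have val0: "val u0 (\<lambda>_. 0) = 0" by (simp add: val_def rs_def red0 cen_zero)
  \<comment> \<open>The minimum recorded for \<open>u0\<close> must not be the default 0: a unit
    vector lies in the search range as \<open>BB\<close> is positive, and its value is
    positive.\<close>
  have gW: "\<rho> < real_of_int (g W)"
  proof -
    obtain a0 where a0: "a0 \<in> E" using f_pos by (metis card_gt_0_iff ex_in_conv)
    let ?e = "\<lambda>a. if a = a0 then 1 else 0 :: int"
    have e: "?e \<in> ZE" "\<bar>?e a\<bar> \<le> int BB" for a using a0 BB_pos by (auto simp: ZE_def)
    obtain X where X: "X < (2 * BB + 1) ^ f" "?e = dgx X" using x_surj[OF e] by blast
    have "?e a0 \<noteq> 0" by simp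
    then have ne: "?e \<noteq> (\<lambda>_. 0)" by metis
    have pos: "0 < val u0 (dgx X)" using val_big[OF e(1) ne] \<rho>(1) unfolding X(2) by linarith
    have "minI u0 ((2 * BB + 1) ^ f) (g V0)" using W(1)[OF V0(1)] V0(2) by simp
    moreover have "\<not> (\<forall>X<(2 * BB + 1) ^ f. val u0 (dgx X) \<le> 0)" using pos X(1) not_le by blast
    ultimately obtain X' where X': "g V0 = val u0 (dgx X')" "0 < g V0" unfolding minI_def by blast
    then have "dgx X' \<noteq> (\<lambda>_. 0)" using val0 by (metis less_irrefl)
    then have "\<rho> < real_of_int (g V0)" using val_big[OF dgxZE[of X']] X'(1) by simp
    then show ?thesis using W(1)[OF V0(1)] by linarith
  qed
  let ?u = "dgu W"
  let ?z = "\<lambda>a. red (conv ?u x) a + int NN * y a"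
  have zZE: "?z \<in> ZE" using xy(2) by (simp add: ZE_def red_supp)
  have sum: "(real tt)\<^sup>2 * nQ (ic x) + nQ (ic ?z) \<le> \<rho>" using small by (simp add: latQ_red)
  have z1: "nQ (ic ?z) \<le> \<rho>" and x1: "(real tt)\<^sup>2 * nQ (ic x) \<le> \<rho>"
    using sum nQ_nonneg[of "ic ?z"] mult_nonneg_nonneg[OF zero_le_power2[of "real tt"] nQ_nonneg[of "ic x"]] by linarith+
  have z2: "2 * \<bar>?z a\<bar> < int NN" for a
  proof -
    define v where "v = real_of_int (?z a)"
    have "real m * v\<^sup>2 \<le> real L * nQ (ic ?z)" unfolding v_def using zZE by (intro coef_bound_int) (auto simp: ZE_def)
    also have "\<dots> \<le> real L * \<rho>" using z1 by (intro mult_left_mono) auto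
    finally have "real m * (2 * v)\<^sup>2 < real m * (real NN)\<^sup>2" using \<rho>(3) by (simp add: power_mult_distrib)
    then have "(2 * v)\<^sup>2 < (real NN)\<^sup>2" using m_pos by simp
    then have "\<bar>2 * v\<bar>\<^sup>2 < (real NN)\<^sup>2" by (simp only: power2_abs)
    then have "\<bar>2 * v\<bar> < real NN" by (rule power2_less_imp_less) simp
    then show ?thesis unfolding v_def by linarith
  qed
  have rsz: "rs ?u x = ?z" using cen_unique[OF z2] by (auto simp: rs_def)
  show False
  proof (cases "x = (\<lambda>_. 0)")
    case True
    then have "2 * \<bar>int NN * y a\<bar> < int NN" for a using z2[of a] by (simp add: red0)
    then have "y a = 0" for a
    proof -
      have "2 * (int NN * \<bar>y a\<bar>) < int NN * 1" using \<open>2 * \<bar>int NN * y a\<bar> < int NN\<close> by (simp add: abs_mult)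
      then have "int NN * \<bar>y a\<bar> < int NN * 1" using mult_nonneg_nonneg[of "int NN" "\<bar>y a\<bar>"] by linarith
      then show "y a = 0" using NN_pos by simp
    qed
    then show False using True xy(3) by auto
  next
    case False
    have "real L * nQ (ic x) \<le> real m * (real BB)\<^sup>2"
    proof -
      have "(real tt)\<^sup>2 * (real L * nQ (ic x)) \<le> real L * \<rho>" using mult_left_mono[OF x1, of "real L"] by (simp add: mult_ac)
      also have "\<dots> \<le> (real tt)\<^sup>2 * (real m * (real BB)\<^sup>2)" using \<rho>(2) by (simp add: power_mult_distrib mult_ac)
      finally show ?thesis using tt_pos by simp
    qed
    then have r: "real_of_int \<bar>x a\<bar> \<le> real_of_int (int BB)" for a
      unfolding of_int_of_nat_eq by (intro coef_small xy) auto
    have "\<bar>x a\<bar> \<le> int BB" for a using r[of a] by (simp only: of_int_le_iff)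
    from x_surj[OF xy(1) this] obtain X where X: "X < (2 * BB + 1) ^ f" "x = dgx X" by blast
    have v: "real_of_int (val ?u x) \<le> \<rho>" using sum by (simp add: val_nQ rsz)
    have "0 < (real tt)\<^sup>2 * nQ (ic x)" using nQ_pos[OF xy(1) False] tt_pos by simp
    then have "0 < real_of_int (val ?u x)" unfolding val_nQ using nQ_nonneg[of "ic (rs ?u x)"] by linarith
    then have v0: "0 < val ?u (dgx X)" using X(2) by simp
    have "minI ?u ((2 * BB + 1) ^ f) (g W)" using W(1)[OF W(2)] by simp
    moreover have "\<not> (\<forall>X<(2 * BB + 1) ^ f. val ?u (dgx X) \<le> 0)" using v0 X(1) not_le by blast
    ultimately have "g W \<le> val ?u (dgx X)" using v0 X(1) unfolding minI_def by blast
    then have "g W \<le> val ?u x" using X(2) by simp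
    then show False using gW v by linarith
  qed
qed

end

lemma sum_double: "(\<Sum>i<2 * n. g i) = (\<Sum>i<n. g i) + (\<Sum>i<n. g (n + i))" for n :: nat
proof -
  have "(\<Sum>i<n + k. g i) = (\<Sum>i<n. g i) + (\<Sum>i<k. g (n + i))" for k :: nat
    by (induction k) (simp_all add: add.assoc)
  from this[of n] show ?thesis by (simp add: mult_2)
qed

lemma concat_if: "concat (map (\<lambda>a. if Q a then F a else []) xs) = concat (map F (filter Q xs))"
  by (induction xs) auto

lemma upt_double: "[0..<2 * n] = [0..<n] @ map ((+) n) [0..<n]"
proof -
  have "[0..<n + n] = [0..<n] @ [n..<n + n]" by (rule upt_add_eq_append) simp
  moreover have "[n..<n + n] = map ((+) n) [0..<n]" by (rule nth_equalityI) auto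
  ultimately show ?thesis by (simp add: mult_2)
qed

lemma concat_blocks:
  "concat (map (\<lambda>h. concat (map (G h) [0..<n])) [0..<2]) = concat (map (\<lambda>i. G (i div n) (i mod n)) [0..<2 * n])"
proof -
  have 2: "[0..<2] = [0, Suc 0]" by (simp add: upt_rec)
  have A: "map (\<lambda>i. G (i div n) (i mod n)) [0..<n] = map (G 0) [0..<n]" by (rule map_cong) auto
  have B: "map (\<lambda>i. G ((n + i) div n) ((n + i) mod n)) [0..<n] = map (G (Suc 0)) [0..<n]" by (rule map_cong) auto
  show ?thesis unfolding upt_double 2
    by (simp only: map_append map_map o_def A B concat_append list.map concat.simps append_Nil2)
qed

lemma nth_concat_uniform:
  assumes "\<And>i. i < n \<Longrightarrow> length (F i) = l"
  shows "length (concat (map F [0..<n])) = n * l"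
    and "i < n \<Longrightarrow> r < l \<Longrightarrow> concat (map F [0..<n]) ! (i * l + r) = F i ! r"
proof -
  have *: "length (concat (map F [0..<n])) = n * l \<and> (\<forall>i<n. \<forall>r<l. concat (map F [0..<n]) ! (i * l + r) = F i ! r)"
    using assms
  proof (induction n)
    case (Suc n)
    then have IH: "length (concat (map F [0..<n])) = n * l" "\<And>i r. i < n \<Longrightarrow> r < l \<Longrightarrow> concat (map F [0..<n]) ! (i * l + r) = F i ! r"
      by auto
    have "(concat (map F [0..<n]) @ F n) ! (i * l + r) = F i ! r" if i: "i < Suc n" "r < l" for i r
    proof (cases "i = n")
      case False
      then have "i * l + r < (i + 1) * l" "(i + 1) * l \<le> n * l" using i by (simp, intro mult_le_mono1) simp
      then have "i * l + r < n * l" by linarith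
      then show ?thesis using IH i False by (simp add: nth_append)
    qed (use IH i in \<open>simp add: nth_append\<close>)
    moreover have "length (concat (map F [0..<n]) @ F n) = Suc n * l" using IH Suc.prems[of n] by simp
    ultimately show ?case by simp
  qed simp
  show "length (concat (map F [0..<n])) = n * l" using * by blast
  show "i < n \<Longrightarrow> r < l \<Longrightarrow> concat (map F [0..<n]) ! (i * l + r) = F i ! r" using * by blast
qed

section \<open>The output describes the lattice\<close>

context alg
begin

definition BI :: "(nat \<Rightarrow> int) \<Rightarrow> (nat \<Rightarrow> int) \<Rightarrow> int" where
  "BI c d = (\<Sum>a<m. \<Sum>b<m. c a * d b * T ((a + (m - b)) mod m))"

lemma BI_hat: "of_int (BI c d) = (\<Sum>k\<in>Kc. hat (ic c) k * cnj (hat (ic d) k))"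
proof -
  have e: "B (\<lambda>a. real_of_int (c a)) (\<lambda>a. real_of_int (d a)) = real_of_int (BI c d)"
    by (simp add: BI_def B_def)
  show ?thesis
    using B_hat[of "\<lambda>a. real_of_int (c a)" "\<lambda>a. real_of_int (d a)", unfolded e] by simp
qed

text \<open>Polarisation of the norm identity; the trace form is symmetric because its values are
  integers and so equal their conjugates.\<close>

lemma inner_comb:
  assumes "c \<in> ZE" "d \<in> ZE"
  shows "(\<Sum>l<f. comb f bR (\<lambda>l. real_of_int (c (ev l))) l * comb f bR (\<lambda>l. real_of_int (d (ev l))) l) = real_of_int (BI c d)"
proof -
  let ?c = "\<lambda>l. real_of_int (c (ev l))" and ?d = "\<lambda>l. real_of_int (d (ev l))"
  have e: "nsq f (comb f bR (\<lambda>l. real_of_int (c (ev l)))) = real_of_int (BI c c)" if "c \<in> ZE" for c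
    unfolding bR_nsq nQ_up_real[OF that] nQ_int BI_def ..
  have cd: "(\<lambda>a. c a + d a) \<in> ZE" using assms by (simp add: ZE_def)
  have "nsq f (comb f bR (\<lambda>l. ?c l + ?d l)) = nsq f (comb f bR ?c) + nsq f (comb f bR ?d) + 2 * (\<Sum>l<f. comb f bR ?c l * comb f bR ?d l)"
    by (simp add: nsq_def comb_add power2_sum sum.distrib sum_distrib_left mult.assoc)
  moreover have "nsq f (comb f bR (\<lambda>l. ?c l + ?d l)) = real_of_int (BI (\<lambda>a. c a + d a) (\<lambda>a. c a + d a))"
    using e[OF cd] by simp
  moreover have "BI (\<lambda>a. c a + d a) (\<lambda>a. c a + d a) = BI c c + BI d d + 2 * BI c d"
  proof -
    have "BI (\<lambda>a. c a + d a) (\<lambda>a. c a + d a) = BI c c + BI d d + (BI c d + BI d c)"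
      by (simp add: BI_def sum.distrib[symmetric] algebra_simps)
    moreover have "BI d c = BI c d"
    proof -
      have "complex_of_int (BI d c) = cnj (of_int (BI c d))"
        unfolding BI_hat by (simp add: mult.commute)
      then have "complex_of_int (BI d c) = of_int (BI c d)" by simp
      then show ?thesis by (simp only: of_int_eq_iff)
    qed
    ultimately show ?thesis by simp
  qed
  ultimately show ?thesis using e[OF assms(1)] e[OF assms(2)] by simp
qed

definition dl :: "nat \<Rightarrow> nat \<Rightarrow> int" where "dl a = (\<lambda>c. if c = a then 1 else 0)"

text \<open>First components of the basis vectors; \<open>Xr\<close> gives the second ones before
  scaling by \<open>t\<close>. Both are ring elements, so that inner products become traces.\<close>

definition Zr :: "(nat \<Rightarrow> int) \<Rightarrow> nat \<Rightarrow> nat \<Rightarrow> int" where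
  "Zr u i = (if i < f then (\<lambda>e. int NN * dl (ev i) e) else red (conv u (dl (ev (i - f)))))"
definition Xr :: "nat \<Rightarrow> nat \<Rightarrow> int" where
  "Xr i = (if i < f then (\<lambda>_. 0) else dl (ev (i - f)))"
text \<open>The basis \<open>(N \<zeta>\<^sup>a, 0)\<close>, \<open>(u \<zeta>\<^sup>a, t \<zeta>\<^sup>a)\<close> for \<open>a \<in> E\<close>, in coordinates in which \<open>bR\<close> is the basis \<open>E\<close> of \<open>R\<close>.\<close>

definition Bm :: "(nat \<Rightarrow> int) \<Rightarrow> nat \<Rightarrow> nat \<Rightarrow> real" where
  "Bm u = (\<lambda>i j. if i < f then (if j < f then real NN * bR i j else 0)
     else if j < f then comb f bR (\<lambda>l. real_of_int (red (conv u (dl (ev (i - f)))) (ev l))) j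
     else real tt * bR (i - f) (j - f))"

lemma ev_inj: "i < f \<Longrightarrow> j < f \<Longrightarrow> ev i = ev j \<longleftrightarrow> i = j"
  by (metis idx_ev)

lemma dl_ZE: "a \<in> E \<Longrightarrow> dl a \<in> ZE" by (auto simp: dl_def ZE_def)

lemma ev_m: "i < f \<Longrightarrow> ev i < m" using ev_E E_less by blast

lemma comb_dl: "i < f \<Longrightarrow> comb f bR (\<lambda>l. real_of_int (dl (ev i) (ev l))) j = bR i j"
proof -
  assume i: "i < f"
  have "comb f bR (\<lambda>l. real_of_int (dl (ev i) (ev l))) j = (\<Sum>l<f. if l = i then bR l j else 0)"
    unfolding comb_def using i by (intro sum.cong refl) (auto simp: dl_def ev_inj)
  then show ?thesis using i by simp
qed

lemma Bm_eq:
  assumes "i < 2 * f"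
  shows "j < f \<Longrightarrow> Bm u i j = comb f bR (\<lambda>l. real_of_int (Zr u i (ev l))) j"
    "j < f \<Longrightarrow> Bm u i (f + j) = real tt * comb f bR (\<lambda>l. real_of_int (Xr i (ev l))) j"
proof -
  show "Bm u i j = comb f bR (\<lambda>l. real_of_int (Zr u i (ev l))) j" if j: "j < f"
  proof (cases "i < f")
    case True
    have "comb f bR (\<lambda>l. real_of_int (Zr u i (ev l))) j = real NN * comb f bR (\<lambda>l. real_of_int (dl (ev i) (ev l))) j"
      using True by (simp add: Zr_def comb_def sum_distrib_left mult.assoc)
    then show ?thesis using True j by (simp add: Bm_def comb_dl)
  qed (use j in \<open>simp add: Bm_def Zr_def\<close>)
  show "Bm u i (f + j) = real tt * comb f bR (\<lambda>l. real_of_int (Xr i (ev l))) j" if j: "j < f"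
  proof (cases "i < f")
    case False
    then have "i - f < f" using assms by simp
    from comb_dl[OF this] show ?thesis using False j by (simp add: Bm_def Xr_def)
  qed (simp add: Bm_def Xr_def comb_def)
qed

lemma Zr_ZE: "i < 2 * f \<Longrightarrow> Zr u i \<in> ZE"
  using ev_E[of i] by (auto simp: Zr_def ZE_def red_supp dl_def)
lemma Xr_ZE: "i < 2 * f \<Longrightarrow> Xr i \<in> ZE"
  using ev_E[of "i - f"] by (auto simp: Xr_def ZE_def dl_def)

lemma Bm_inner:
  assumes "i < 2 * f" "j < 2 * f"
  shows "(\<Sum>k<2 * f. Bm u i k * Bm u j k) = real_of_int (BI (Zr u i) (Zr u j) + int tt * int tt * BI (Xr i) (Xr j))"
proof -
  have "(\<Sum>k<2 * f. Bm u i k * Bm u j k)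
     = (\<Sum>k<f. comb f bR (\<lambda>l. real_of_int (Zr u i (ev l))) k * comb f bR (\<lambda>l. real_of_int (Zr u j (ev l))) k)
     + (real tt * real tt) * (\<Sum>k<f. comb f bR (\<lambda>l. real_of_int (Xr i (ev l))) k * comb f bR (\<lambda>l. real_of_int (Xr j (ev l))) k)"
    unfolding sum_double sum_distrib_left using Bm_eq[OF assms(1)] Bm_eq[OF assms(2)]
    by (simp add: mult_ac)
  also have "\<dots> = real_of_int (BI (Zr u i) (Zr u j) + int tt * int tt * BI (Xr i) (Xr j))"
    by (simp only: inner_comb[OF Zr_ZE[OF assms(1)] Zr_ZE[OF assms(2)]] inner_comb[OF Xr_ZE[OF assms(1)] Xr_ZE[OF assms(2)]]) simp
  finally show ?thesis .
qed

lemma hat_dl: "a < m \<Longrightarrow> hat (ic (dl a)) k = w (int (k * a))"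
  by (simp add: hat_def dl_def if_distrib[of "\<lambda>x. x * _"] if_distrib[of of_int] cong: if_cong)

text \<open>The basis index \<open>i\<close> splits into the generator \<open>i div f\<close> and
  the exponent \<open>ev (i mod f)\<close>, the order in which the program writes the
  entries.\<close>

lemma hat_Zr:
  assumes i: "i < 2 * f" and k: "k \<in> Kc"
  shows "hat (ic (Zr u i)) k = w (int (k * ev (i mod f))) * hat (ic (rowv u (i div f))) k"
proof (cases "i < f")
  case True
  have "hat (ic (rowv u 0)) k = of_nat NN"
    using m_pos by (simp add: hat_def rowv_def if_distrib[of "\<lambda>x. x * _"] if_distrib[of of_int] cong: if_cong)
  moreover have "hat (ic (Zr u i)) k = of_nat NN * hat (ic (dl (ev i))) k"
    using True by (simp add: Zr_def hat_cmult)
  ultimately show ?thesis using True ev_m by (simp add: hat_dl)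
next
  case False
  then have d: "i div f = 1" "i mod f = i - f" using i f_pos
    by (simp_all add: le_div_geq le_mod_geq)
  have "ev (i - f) < m" using False i by (intro ev_m) simp
  then have "hat (ic (Zr u i)) k = hat (ic u) k * w (int (k * ev (i - f)))"
    using False k by (simp add: Zr_def hat_red hat_iconv hat_dl)
  moreover have "rowv u 1 = u" by (simp add: rowv_def fun_eq_iff)
  ultimately show ?thesis unfolding d by (simp add: mult.commute)
qed

lemma sum_w_T:
  assumes "b \<le> m" "d \<le> m"
  shows "(\<Sum>k\<in>Kc. w (int (k * a)) * w (int (k * c)) * cnj (w (int (k * b)) * w (int (k * d)))) = of_int (T ((a + c + ((m - b) + (m - d))) mod m))"
proof -
  have "w (int (k * a)) * w (int (k * c)) * cnj (w (int (k * b)) * w (int (k * d))) = w (int (k * ((a + c + ((m - b) + (m - d))) mod m)))" for k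
  proof -
    have "w (int (k * ((a + c + ((m - b) + (m - d))) mod m))) = w (int (k * (a + c + ((m - b) + (m - d)))))"
      by (rule w_mod)
    also have "int (k * (a + c + ((m - b) + (m - d)))) = int (k * a) + int (k * c) - int (k * b) - int (k * d) + int m * int (2 * k)"
    proof -
      have "int (a + c + ((m - b) + (m - d))) = int a + int c + (int m - int b) + (int m - int d)" using assms by simp
      then show ?thesis by (simp only: of_nat_mult) (simp add: algebra_simps)
    qed
    also have "w \<dots> = w (int (k * a)) * w (int (k * c)) * cnj (w (int (k * b)) * w (int (k * d)))"
      unfolding w_add diff_conv_add_uminus by (simp add: cnj_w mult_ac)
    finally show ?thesis ..
  qed
  then show ?thesis by (simp only: sum_Kc_w)
qed

lemma entry_eq:
  assumes ij: "i < 2 * f" "j < 2 * f"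
  shows "BI (Zr u i) (Zr u j) + int tt * int tt * BI (Xr i) (Xr j)
    = entry u (i div f) (ev (i mod f)) (j div f) (ev (j mod f))"
proof -
  let ?a = "ev (i mod f)" and ?b = "ev (j mod f)" and ?r = "rowv u (i div f)" and ?s = "rowv u (j div f)"
  have ab: "?a < m" "?b < m" using f_pos by (auto intro: ev_m)
  have "complex_of_int (BI (Zr u i) (Zr u j)) = (\<Sum>k\<in>Kc. w (int (k * ?a)) * hat (ic ?r) k * cnj (w (int (k * ?b)) * hat (ic ?s) k))"
    unfolding BI_hat by (intro sum.cong refl) (simp only: hat_Zr ij)
  also have "\<dots> = (\<Sum>k\<in>Kc. \<Sum>c<m. \<Sum>d<m. of_int (?r c) * of_int (?s d) * (w (int (k * ?a)) * w (int (k * c)) * cnj (w (int (k * ?b)) * w (int (k * d)))))"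
  proof (intro sum.cong refl)
    fix k
    have p: "hat (ic ?r) k * cnj (hat (ic ?s) k) = (\<Sum>c<m. \<Sum>d<m. of_int (?r c) * w (int (k * c)) * cnj (of_int (?s d) * w (int (k * d))))"
      unfolding hat_def cnj_sum by (rule sum_product)
    have "w (int (k * ?a)) * hat (ic ?r) k * cnj (w (int (k * ?b)) * hat (ic ?s) k)
        = w (int (k * ?a)) * cnj (w (int (k * ?b))) * (hat (ic ?r) k * cnj (hat (ic ?s) k))" by simp
    then show "w (int (k * ?a)) * hat (ic ?r) k * cnj (w (int (k * ?b)) * hat (ic ?s) k)
        = (\<Sum>c<m. \<Sum>d<m. of_int (?r c) * of_int (?s d) * (w (int (k * ?a)) * w (int (k * c)) * cnj (w (int (k * ?b)) * w (int (k * d)))))"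
      unfolding p sum_distrib_left by (simp add: mult_ac)
  qed
  also have "\<dots> = (\<Sum>c<m. \<Sum>k\<in>Kc. \<Sum>d<m. of_int (?r c) * of_int (?s d) * (w (int (k * ?a)) * w (int (k * c)) * cnj (w (int (k * ?b)) * w (int (k * d)))))"
    by (rule sum.swap)
  also have "\<dots> = (\<Sum>c<m. \<Sum>d<m. \<Sum>k\<in>Kc. of_int (?r c) * of_int (?s d) * (w (int (k * ?a)) * w (int (k * c)) * cnj (w (int (k * ?b)) * w (int (k * d)))))"
    by (intro sum.cong refl sum.swap)
  also have "\<dots> = (\<Sum>c<m. \<Sum>d<m. of_int (?r c * ?s d * T ((?a + c + ((m - ?b) + (m - d))) mod m)))"
    unfolding sum_distrib_left[symmetric] using ab by (intro sum.cong refl) (subst sum_w_T; simp)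
  finally have 1: "BI (Zr u i) (Zr u j) = (\<Sum>c<m. \<Sum>d<m. ?r c * ?s d * T ((?a + c + ((m - ?b) + (m - d))) mod m))"
    by (simp only: of_int_sum[symmetric] of_int_eq_iff)
  have X: "hat (ic (Xr i)) k = of_nat (i div f) * w (int (k * ev (i mod f)))" if i: "i < 2 * f" for i k
  proof (cases "i < f")
    case False
    then have d: "i div f = 1" "i mod f = i - f" using i f_pos by (simp_all add: le_div_geq le_mod_geq)
    have "ev (i - f) < m" using False i by (intro ev_m) simp
    then show ?thesis unfolding d using False by (simp add: Xr_def hat_dl)
  qed (simp add: Xr_def hat_def)
  \<comment> \<open>The exponents \<open>0\<close> and \<open>m\<close> are dummies that bring the
    term into the shape of \<open>sum_w_T\<close>.\<close>
  have "complex_of_int (BI (Xr i) (Xr j)) = (\<Sum>k\<in>Kc. of_nat (i div f) * of_nat (j div f) * (w (int (k * ?a)) * w (int (k * 0)) * cnj (w (int (k * ?b)) * w (int (k * m)))))"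
    unfolding BI_hat X[OF ij(1)] X[OF ij(2)] using w_dvd[of "int (_ * m)"] by (intro sum.cong refl) (simp add: mult_ac)
  also have "\<dots> = of_nat (i div f) * of_nat (j div f) * of_int (T ((?a + (m - ?b)) mod m))"
    unfolding sum_distrib_left[symmetric] using ab by (subst sum_w_T) simp_all
  finally have "complex_of_int (BI (Xr i) (Xr j)) = of_int (int (i div f) * int (j div f) * T ((?a + (m - ?b)) mod m))" by simp
  then have 2: "BI (Xr i) (Xr j) = int (i div f) * int (j div f) * T ((?a + (m - ?b)) mod m)"
    by (simp only: of_int_eq_iff)
  show ?thesis unfolding 1 2 entry_def by (simp add: mult_ac)
qed

lemma E_list: "filter (\<lambda>a. a \<in> E) [0..<m] = map ev [0..<f]"
proof -
  have "filter (\<lambda>a. a \<in> E) [0..<m] = sorted_list_of_set E"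
    by (rule sorted_distinct_set_unique) (auto simp: E_less sorted_wrt_filter)
  also have "\<dots> = map ev [0..<f]"
    by (rule nth_equalityI) (auto simp: ev_def)
  finally show ?thesis .
qed

lemma gram_out_eq:
  "gram_out u = concat (map (\<lambda>i. concat (map (\<lambda>j. [entry u (i div f) (ev (i mod f)) (j div f) (ev (j mod f)), 1]) [0..<2 * f])) [0..<2 * f])"
  unfolding gram_out_def entries_def concat_if E_list map_map o_def
  by (subst concat_blocks)+ simp

lemma gram_out_nth:
  shows "length (gram_out u) = 2 * (2 * f) * (2 * f)"
    and "i < 2 * f \<Longrightarrow> j < 2 * f \<Longrightarrow> gram_out u ! (2 * (i * (2 * f) + j)) = entry u (i div f) (ev (i mod f)) (j div f) (ev (j mod f))"
    and "i < 2 * f \<Longrightarrow> j < 2 * f \<Longrightarrow> gram_out u ! (2 * (i * (2 * f) + j) + 1) = 1"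
proof -
  let ?g = "\<lambda>i j. [entry u (i div f) (ev (i mod f)) (j div f) (ev (j mod f)), 1]"
  let ?F = "\<lambda>i. concat (map (?g i) [0..<2 * f])"
  have l: "length (?F i) = 2 * f * 2" for i by (rule nth_concat_uniform(1)) simp
  show "length (gram_out u) = 2 * (2 * f) * (2 * f)"
    unfolding gram_out_eq by (subst nth_concat_uniform(1)[OF l]) (simp add: mult_ac)
  have nth: "gram_out u ! (i * (2 * f * 2) + (j * 2 + s)) = ?g i j ! s" if "i < 2 * f" "j < 2 * f" "s < 2" for i j s
  proof -
    have "gram_out u ! (i * (2 * f * 2) + (j * 2 + s)) = ?F i ! (j * 2 + s)"
      unfolding gram_out_eq by (rule nth_concat_uniform(2)[OF l]) (use that in auto)
    also have "\<dots> = ?g i j ! s" by (rule nth_concat_uniform(2)) (use that in auto)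
    finally show ?thesis .
  qed
  show "i < 2 * f \<Longrightarrow> j < 2 * f \<Longrightarrow> gram_out u ! (2 * (i * (2 * f) + j)) = entry u (i div f) (ev (i mod f)) (j div f) (ev (j mod f))"
    using nth[of i j 0] by (simp add: algebra_simps)
  show "i < 2 * f \<Longrightarrow> j < 2 * f \<Longrightarrow> gram_out u ! (2 * (i * (2 * f) + j) + 1) = 1"
    using nth[of i j 1] by (simp add: algebra_simps)
qed

lemma red_conv_sum: "red (conv u (\<lambda>e. \<Sum>i<n. c i * d i e)) b = (\<Sum>i<n. c i * red (conv u (d i)) b)" for n :: nat
proof (induction n)
  case (Suc n)
  have "red (conv u (\<lambda>e. \<Sum>i<Suc n. c i * d i e)) b = red (conv u (\<lambda>e. \<Sum>i<n. c i * d i e)) b + c n * red (conv u (d n)) b"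
    unfolding red_conv sum_distrib_left sum.lessThan_Suc sum.distrib[symmetric]
    by (simp add: sum_distrib_left sum_distrib_right algebra_simps)
  then show ?case using Suc by simp
qed (simp add: red_conv)

lemma sum_dl: "l < f \<Longrightarrow> (\<Sum>i<f. c i * dl (ev i) (ev l)) = c l"
proof -
  assume l: "l < f"
  have "(\<Sum>i<f. c i * dl (ev i) (ev l)) = (\<Sum>i<f. if i = l then c i else 0)"
    using l by (intro sum.cong refl) (auto simp: dl_def ev_inj)
  then show ?thesis using l by simp
qed

lemma nsq_Bm:
  fixes c :: "nat \<Rightarrow> int"
  defines "x \<equiv> \<lambda>e. \<Sum>i<f. c (f + i) * dl (ev i) e" and "y \<equiv> \<lambda>e. \<Sum>i<f. c i * dl (ev i) e"
  shows "nsq (2 * f) (comb (2 * f) (Bm u) (\<lambda>i. real_of_int (c i))) = (real tt)\<^sup>2 * nQ (ic x) + latQ NN u x y"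
proof -
  define Z where "Z e = (\<Sum>i<2 * f. c i * Zr u i e)" for e
  define X where "X e = (\<Sum>i<2 * f. c i * Xr i e)" for e
  have ZX: "Z \<in> ZE" "X \<in> ZE" using Zr_ZE[of _ u] Xr_ZE by (auto simp: Z_def X_def ZE_def)
  have X: "X = x"
    unfolding X_def x_def sum_double by (simp add: Xr_def)
  have Z: "Z = (\<lambda>a. red (conv u x) a + int NN * y a)"
    unfolding Z_def x_def y_def sum_double red_conv_sum sum_distrib_left
    by (simp add: Zr_def fun_eq_iff mult_ac add.commute)
  have pull: "(\<Sum>i<2 * f. real_of_int (c i) * comb f bR (\<lambda>l. real_of_int (d i (ev l))) j)
      = comb f bR (\<lambda>l. real_of_int (\<Sum>i<2 * f. c i * d i (ev l))) j" for d j
    unfolding comb_def sum_distrib_left of_int_sum sum_distrib_right by (subst sum.swap) (simp add: mult.assoc)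
  have 1: "comb (2 * f) (Bm u) (\<lambda>i. real_of_int (c i)) j = comb f bR (\<lambda>l. real_of_int (Z (ev l))) j" if "j < f" for j
    unfolding comb_def[of "2 * f"] Z_def pull[symmetric] using that by (intro sum.cong refl) (simp add: Bm_eq)
  have 2: "comb (2 * f) (Bm u) (\<lambda>i. real_of_int (c i)) (f + j) = real tt * comb f bR (\<lambda>l. real_of_int (X (ev l))) j" if "j < f" for j
    unfolding comb_def[of "2 * f"] X_def pull[symmetric] sum_distrib_left
    using that by (intro sum.cong refl) (simp add: Bm_eq mult_ac)
  have "nsq (2 * f) (comb (2 * f) (Bm u) (\<lambda>i. real_of_int (c i)))
    = nsq f (comb f bR (\<lambda>l. real_of_int (Z (ev l)))) + (real tt)\<^sup>2 * nsq f (comb f bR (\<lambda>l. real_of_int (X (ev l))))"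
    unfolding nsq_def sum_double by (simp add: 1 2 power_mult_distrib sum_distrib_left)
  also have "\<dots> = nQ (ic Z) + (real tt)\<^sup>2 * nQ (ic X)"
    unfolding bR_nsq nQ_up_real[OF ZX(1)] nQ_up_real[OF ZX(2)] ..
  finally show ?thesis unfolding X Z latQ_red by simp
qed

text \<open>All squared norms are integers, so the set of norms has a least element and
  \<open>min_norm\<close> is attained; it then exceeds \<open>sqrt \<rho>\<close> strictly.\<close>

lemma lattice_of_u:
  assumes \<rho>: "0 < \<rho>"
    and big: "\<And>x y. x \<in> ZE \<Longrightarrow> y \<in> ZE \<Longrightarrow> (x, y) \<noteq> (\<lambda>_. 0, \<lambda>_. 0) \<Longrightarrow> \<rho> < (real tt)\<^sup>2 * nQ (ic x) + latQ NN u x y"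
  obtains \<Lambda> where "is_lattice (2 * f) \<Lambda>" "describes_lattice (2 * f) (gram_out u) \<Lambda>"
    "unit_ball_vol (real (2 * f)) * sqrt \<rho> ^ (2 * f) / (2 ^ (2 * f) * (real NN ^ f * real tt ^ f * D\<^sup>2)) < lattice_density (2 * f) \<Lambda>"
proof -
  let ?n = "2 * f" and ?\<Lambda> = "lat (2 * f) (Bm u)"
  note blk = block_tri[OF bR_tri, of "real NN" "real tt" "Bm u", OF _ _ Bm_def]
  have tri: "tri ?n (Bm u)" and vol: "lattice_vol ?n ?\<Lambda> = real NN ^ f * real tt ^ f * D\<^sup>2"
    using blk(1,2) NN_pos tt_pos lattice_vol_lat[of ?n "Bm u"] by (simp_all add: D_def)
  have basis: "int_basis ?n (rows ?n (Bm u)) ?\<Lambda>" by (rule int_basis_lat[OF tri])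
  have desc: "describes_lattice ?n (gram_out u) ?\<Lambda>"
    unfolding describes_lattice_def
  proof (intro conjI exI[of _ "rows ?n (Bm u)"] basis allI impI)
    show "length (gram_out u) = 2 * ?n * ?n" by (rule gram_out_nth(1))
    fix i j assume ij: "i < ?n" "j < ?n"
    show "0 < gram_out u ! (2 * (i * ?n + j) + 1)" using gram_out_nth(3)[OF ij] by simp
    have "(\<Sum>k<?n. rows ?n (Bm u) i k * rows ?n (Bm u) j k) = (\<Sum>k<?n. Bm u i k * Bm u j k)"
      by (simp add: rows_def)
    also have "\<dots> = real_of_int (entry u (i div f) (ev (i mod f)) (j div f) (ev (j mod f)))"
      unfolding Bm_inner[OF ij] entry_eq[OF ij] ..
    finally show "(\<Sum>k<?n. rows ?n (Bm u) i k * rows ?n (Bm u) j k)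
      = real_of_int (gram_out u ! (2 * (i * ?n + j))) / real_of_int (gram_out u ! (2 * (i * ?n + j) + 1))"
      unfolding gram_out_nth(2)[OF ij] gram_out_nth(3)[OF ij] by simp
  qed
  define S where "S = (\<lambda>x. L2_set x {..<?n}) ` (?\<Lambda> - {vzero ?n})"
  have S: "\<exists>k::nat. s = sqrt (real k) \<and> \<rho> < real k" if sS: "s \<in> S" for s
  proof -
    obtain c where c: "int_comb ?n c (rows ?n (Bm u)) \<noteq> vzero ?n" "s = L2_set (int_comb ?n c (rows ?n (Bm u))) {..<?n}"
      using sS unfolding S_def lat_def by blast
    define x where "x = (\<lambda>e. \<Sum>i<f. c (f + i) * dl (ev i) e)"
    define y where "y = (\<lambda>e. \<Sum>i<f. c i * dl (ev i) e)"
    have xy: "x \<in> ZE" "y \<in> ZE" using dl_ZE[OF ev_E] by (auto simp: x_def y_def ZE_def)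
    have "(x, y) \<noteq> (\<lambda>_. 0, \<lambda>_. 0)"
    proof
      assume "(x, y) = (\<lambda>_. 0, \<lambda>_. 0)"
      then have "c l = 0" "c (f + l) = 0" if "l < f" for l
        using sum_dl[OF that, of c] sum_dl[OF that, of "\<lambda>i. c (f + i)"] by (simp_all add: x_def y_def fun_eq_iff)
      then have "c i = 0" if "i < ?n" for i
        using that by (cases "i < f") (auto simp: not_less le_iff_add)
      then have "int_comb ?n c (rows ?n (Bm u)) = vzero ?n" by (simp add: int_comb_def vzero_def)
      with c(1) show False ..
    qed
    from big[OF xy this] have "\<rho> < nsq ?n (comb ?n (Bm u) (\<lambda>i. real_of_int (c i)))"
      unfolding nsq_Bm x_def y_def .
    moreover have "s = sqrt (nsq ?n (comb ?n (Bm u) (\<lambda>i. real_of_int (c i))))"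
      unfolding c(2) L2_set_nsq int_comb_rows by (simp add: nsq_def)
    moreover have "\<exists>z. nsq ?n (comb ?n (Bm u) (\<lambda>i. real_of_int (c i))) = real_of_int z"
      unfolding nsq_Bm latQ_red nQ_int
      by (intro exI[of _ "(int tt)\<^sup>2 * _ + _"]) (simp only: of_int_add of_int_mult of_int_power of_int_of_nat_eq)
    ultimately obtain z where z: "s = sqrt (real_of_int z)" "\<rho> < real_of_int z" by auto
    then have "real (nat z) = real_of_int z" using \<rho> by simp
    with z show ?thesis by metis
  qed
  have "S \<noteq> {}"
  proof -
    let ?c = "\<lambda>i. if i = 0 then 1 else 0 :: int"
    have "int_comb ?n ?c (rows ?n (Bm u)) \<noteq> vzero ?n"
    proof
      assume "int_comb ?n ?c (rows ?n (Bm u)) = vzero ?n"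
      with basis have "\<forall>i<?n. ?c i = 0" unfolding int_basis_def by blast
      then have "?c 0 = 0" using f_pos by (metis mult_pos_pos zero_less_numeral)
      then show False by simp
    qed
    then show ?thesis by (auto simp: S_def lat_def)
  qed
  then obtain s0 where "s0 \<in> S" by blast
  then have ex: "\<exists>k::nat. sqrt (real k) \<in> S" using S by metis
  define k0 where "k0 = (LEAST k::nat. sqrt (real k) \<in> S)"
  have k0: "sqrt (real k0) \<in> S" unfolding k0_def by (rule LeastI_ex[OF ex])
  have min: "min_norm ?n ?\<Lambda> = sqrt (real k0)"
    unfolding min_norm_def S_def[symmetric]
  proof (rule Least_equality, rule k0)
    fix s assume s: "s \<in> S"
    then obtain k :: nat where k: "s = sqrt (real k)" using S by blast
    then have "k0 \<le> k" using s unfolding k0_def by (auto intro: Least_le)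
    then show "sqrt (real k0) \<le> s" using k by simp
  qed
  obtain k1 :: nat where "sqrt (real k0) = sqrt (real k1)" "\<rho> < real k1" using S[OF k0] by blast
  then have lt: "sqrt \<rho> < sqrt (real k0)" by simp
  then have k0p: "0 < sqrt (real k0)" using \<rho> by (meson less_trans real_sqrt_gt_zero)
  have V: "0 < 2 ^ ?n * (real NN ^ f * real tt ^ f * D\<^sup>2)" using NN_pos tt_pos D_pos by simp
  have "sqrt \<rho> ^ ?n < sqrt (real k0) ^ ?n" using lt \<rho> f_pos by (intro power_strict_mono) auto
  then have "unit_ball_vol (real ?n) * sqrt \<rho> ^ ?n < unit_ball_vol (real ?n) * sqrt (real k0) ^ ?n"
    by (intro mult_strict_left_mono) auto
  from divide_strict_right_mono[OF this V]
  have "unit_ball_vol (real ?n) * sqrt \<rho> ^ ?n / (2 ^ ?n * (real NN ^ f * real tt ^ f * D\<^sup>2)) < lattice_density ?n ?\<Lambda>"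
    unfolding lattice_density_def min vol measure_closed_ball[OF k0p] .
  then show thesis using that is_lattice_lat[OF tri] desc by blast
qed

end

section \<open>Choice of the parameters\<close>

text \<open>Induction with \<open>(1 + 1 / n) ^ n \<le> exp 1 \<le> 3\<close>. A crude Stirling
  bound is enough because constant factors to the power \<open>f\<close> only change the radius by a
  constant.\<close>

lemma fact_ge: "(real n / 3) ^ n \<le> fact n"
proof (induction n)
  case (Suc n)
  show ?case
  proof (cases "n = 0")
    case False
    have "(1 + 1 / real n) ^ n \<le> exp 1"
      using False by (intro exp_ge_one_plus_x_over_n_power_n) auto
    also have "\<dots> \<le> 3" by (rule exp_le)
    finally have "(1 + 1 / real n) ^ n * (real n / 3) ^ n \<le> 3 * (real n / 3) ^ n" by (intro mult_right_mono) auto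
    moreover have "(1 + 1 / real n) ^ n * (real n / 3) ^ n = (real (Suc n) / 3) ^ n"
    proof -
      have "(1 + 1 / real n) * (real n / 3) = real (Suc n) / 3" using False by (simp add: field_simps)
      then show ?thesis by (simp only: power_mult_distrib[symmetric])
    qed
    ultimately have "(real (Suc n) / 3) ^ n \<le> 3 * fact n" using Suc by linarith
    then have "real (Suc n) / 3 * (real (Suc n) / 3) ^ n \<le> real (Suc n) / 3 * (3 * fact n)" by (intro mult_left_mono) auto
    then show ?thesis by simp
  qed simp
qed simp

context alg
begin

text \<open>The ball of radius \<open>sqrt (rho \<epsilon>)\<close> has \<open>(1 - \<epsilon> / 2) * m\<close> times the covolume as its volume.\<close>

definition Y :: "real \<Rightarrow> real" where
  "Y \<epsilon> = (1 - \<epsilon> / 2) * real m * D\<^sup>2 / unit_ball_vol (real (2 * f))"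
definition rho :: "real \<Rightarrow> real" where
  "rho \<epsilon> = real tt * real NN * root f (Y \<epsilon>)"

lemma D2_bounds: "(real m / real L) ^ f \<le> D\<^sup>2" "D\<^sup>2 \<le> real f ^ f"
proof -
  have "(real m / real L) ^ f = (sqrt (real m / real L) ^ f)\<^sup>2"
    by (simp add: power_mult[symmetric] mult.commute[of f] power_mult)
  also have "\<dots> \<le> D\<^sup>2" using D_ge by (intro power_mono) auto
  finally show "(real m / real L) ^ f \<le> D\<^sup>2" .
  have "D\<^sup>2 \<le> (sqrt (real f) ^ f)\<^sup>2" using D_le D_pos by (intro power_mono) auto
  also have "\<dots> = real f ^ f" by (simp add: power_mult[symmetric] mult.commute[of f] power_mult)
  finally show "D\<^sup>2 \<le> real f ^ f" .
qed

text \<open>The unit ball has volume \<open>pi ^ f / fact f\<close>, so the \<open>f\<close>-th root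
  of \<open>Y \<epsilon>\<close>, the ratio of the squared radius to \<open>t N\<close>, lies
  between explicit rational functions. The constant 10 dominates \<open>3 * pi\<close>, and
  \<open>m \<le> 2 ^ f\<close> cancels against \<open>2 ^ f \<le> pi ^ f\<close>.\<close>

lemma Y_bounds:
  assumes \<epsilon>: "0 < \<epsilon>" "\<epsilon> < 1" and m: "real m \<le> 2 ^ f"
  shows "(real f * real m / (10 * real L)) ^ f \<le> Y \<epsilon>" "Y \<epsilon> \<le> (real f)\<^sup>2 ^ f" "0 < Y \<epsilon>"
proof -
  have V: "unit_ball_vol (real (2 * f)) = pi ^ f / fact f" by (rule unit_ball_vol_even)
  have e: "Y \<epsilon> = ((1 - \<epsilon> / 2) * real m) * D\<^sup>2 * (fact f / pi ^ f)" unfolding Y_def V by simp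
  have one: "1 \<le> (1 - \<epsilon> / 2) * real m"
  proof -
    have "1 / 2 * 2 \<le> (1 - \<epsilon> / 2) * real m" using \<epsilon> m2 by (intro mult_mono) auto
    then show ?thesis by simp
  qed
  show "0 < Y \<epsilon>" unfolding e using one D_pos by simp
  have pi10: "3 * pi \<le> 10" "2 \<le> pi" using pi_less_4 pi_approx by simp_all
  have "(real f * real m / (10 * real L)) ^ f \<le> (real m / real L * (real f / (3 * pi))) ^ f"
  proof (rule power_mono)
    have "real f / 10 \<le> real f / (3 * pi)" using pi10 by (intro divide_left_mono) auto
    then have "real m / real L * (real f / 10) \<le> real m / real L * (real f / (3 * pi))" by (intro mult_left_mono) auto
    then show "real f * real m / (10 * real L) \<le> real m / real L * (real f / (3 * pi))" by (simp add: mult.commute)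
  qed simp
  also have "\<dots> = 1 * (real m / real L) ^ f * ((real f / 3) ^ f / pi ^ f)"
    by (simp add: power_mult_distrib power_divide)
  also have "\<dots> \<le> ((1 - \<epsilon> / 2) * real m) * D\<^sup>2 * (fact f / pi ^ f)"
    using one D2_bounds(1) fact_ge[of f] by (intro mult_mono divide_right_mono) auto
  finally show "(real f * real m / (10 * real L)) ^ f \<le> Y \<epsilon>" unfolding e .
  have "Y \<epsilon> \<le> 2 ^ f * real f ^ f * (real f ^ f / 2 ^ f)"
    unfolding e
  proof (intro mult_mono D2_bounds(2))
    show "(1 - \<epsilon> / 2) * real m \<le> 2 ^ f"
    proof -
      have "(1 - \<epsilon> / 2) * real m \<le> 1 * real m" using \<epsilon> by (intro mult_right_mono) auto
      then show ?thesis using m by linarith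
    qed
    have "(fact f :: real) \<le> real f ^ f" using fact_le_power[of f, where ?'a = real] by simp
    then show "fact f / pi ^ f \<le> real f ^ f / 2 ^ f" using pi10 by (intro frac_le power_mono) auto
  qed auto
  also have "\<dots> = (real f)\<^sup>2 ^ f" by (simp add: power2_eq_square power_mult_distrib)
  finally show "Y \<epsilon> \<le> (real f)\<^sup>2 ^ f" .
qed

text \<open>The constant \<open>300\<close> gives
  \<open>k\<^sup>2 * \<epsilon> ^ 4 \<ge> 90000\<close>, from which the four error conditions of
  \<open>exists_good_u\<close> follow with \<open>\<delta> = \<epsilon> / 16\<close>.\<close>

lemma exists_lattice:
  assumes \<epsilon>: "0 < \<epsilon>" "\<epsilon> < 1" and m: "real m \<le> 2 ^ f" and K: "300 / \<epsilon>\<^sup>2 \<le> real K"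
  obtains t out \<Lambda> where "computes (cstmt (algorithm K)) m t out"
    "t \<le> cost"
    "is_lattice (2 * f) \<Lambda>" "describes_lattice (2 * f) out \<Lambda>"
    "(1 - \<epsilon>) * real m / 2 ^ (2 * f) < lattice_density (2 * f) \<Lambda>"
proof -
  define \<beta> where "\<beta> = root f (Y \<epsilon>)"
  define \<rho> where "\<rho> = real tt * real NN * \<beta>"
  note Y = Y_bounds[OF \<epsilon> m]
  have \<beta>f: "\<beta> ^ f = Y \<epsilon>" and \<beta>p: "0 < \<beta>" using Y(3) f_pos by (simp_all add: \<beta>_def)
  have \<beta>1: "real f * real m / (10 * real L) \<le> \<beta>"
    by (rule power_le_imp_le_base[of _ "f - 1"]) (use Y(1) \<beta>f \<beta>p f_pos in auto)
  have \<beta>2: "\<beta> \<le> (real f)\<^sup>2"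
    by (rule power_le_imp_le_base[of _ "f - 1"]) (use Y(2) \<beta>f f_pos in auto)
  define F where "F = real f"
  define M where "M = real m"
  define s where "s = real tt"
  define l where "l = real L"
  define k where "k = real K"
  have FM: "1 \<le> F" "F \<le> M" "0 < l" using f_pos f_le_m L_pos by (simp_all add: F_def M_def l_def)
  have kp: "300 \<le> k * \<epsilon>\<^sup>2" using K \<epsilon> by (simp add: k_def field_simps)
  have k300: "300 \<le> k"
  proof -
    have "k * \<epsilon>\<^sup>2 \<le> k * 1" using \<epsilon> by (intro mult_left_mono) (auto simp: k_def power_le_one)
    with kp show ?thesis by simp
  qed
  have sk: "s = 2 * k * F" "0 < s" using tt_pos by (simp_all add: s_def k_def F_def tt_def)
  have N: "real NN = 2 * k\<^sup>2 * l * F * s" by (simp add: NN_def s_def k_def F_def l_def power2_eq_square)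
  have Bq: "real BB = 2 * k * l * F" by (simp add: BB_def k_def F_def l_def)
  have \<rho>: "\<rho> = 2 * k\<^sup>2 * l * F * s\<^sup>2 * \<beta>" by (simp add: \<rho>_def N s_def[symmetric] power2_eq_square)
  have \<rho>p: "0 < \<rho>" unfolding \<rho>_def using tt_pos NN_pos \<beta>p by simp
  \<comment> \<open>The loss \<open>L\<close> in the lower bound for \<open>\<beta>\<close> is
    cancelled by the factor \<open>L\<close> in \<open>NN\<close>.\<close>
  have \<rho>1: "k\<^sup>2 * F\<^sup>2 * s\<^sup>2 * M / 5 \<le> \<rho>"
  proof -
    have "2 * k\<^sup>2 * l * F * s\<^sup>2 * (F * M / (10 * l)) \<le> \<rho>"
      unfolding \<rho> using \<beta>1 FM by (intro mult_left_mono) (auto simp: F_def M_def l_def)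
    moreover have "2 * k\<^sup>2 * l * F * s\<^sup>2 * (F * M / (10 * l)) = k\<^sup>2 * F\<^sup>2 * s\<^sup>2 * M / 5"
      using FM by (simp add: power2_eq_square field_simps)
    ultimately show ?thesis by simp
  qed
  have \<rho>3: "k\<^sup>2 * F ^ 3 * s\<^sup>2 / 5 \<le> \<rho>"
  proof -
    have "k\<^sup>2 * F\<^sup>2 * s\<^sup>2 * F \<le> k\<^sup>2 * F\<^sup>2 * s\<^sup>2 * M" using FM by (intro mult_left_mono) auto
    then have "k\<^sup>2 * F ^ 3 * s\<^sup>2 \<le> k\<^sup>2 * F\<^sup>2 * s\<^sup>2 * M" by (simp add: power2_eq_square power3_eq_cube mult_ac)
    then show ?thesis using \<rho>1 by linarith
  qed
  have \<rho>2: "\<rho> \<le> 2 * k\<^sup>2 * l * s\<^sup>2 * F ^ 3"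
  proof -
    have "\<rho> \<le> 2 * k\<^sup>2 * l * F * s\<^sup>2 * F\<^sup>2"
      unfolding \<rho> using \<beta>2 FM by (intro mult_left_mono) (auto simp: F_def)
    then show ?thesis by (simp add: power2_eq_square power3_eq_cube mult_ac)
  qed
  \<comment> \<open>Enlarging the squared radius by \<open>3 * \<eta>\<close> changes it by the
    relative amount \<open>3 * \<epsilon> / (16 * f)\<close> and the volume by at most
    \<open>exp (3 * \<epsilon> / 16)\<close>.\<close>
  define \<eta> where "\<eta> = \<epsilon> * \<rho> / (16 * F)"
  have \<eta>p: "0 < \<eta>" using \<epsilon> \<rho>p FM by (simp add: \<eta>_def)
  have k2: "90000 \<le> k\<^sup>2 * \<epsilon> ^ 4"
  proof -
    have "300\<^sup>2 \<le> (k * \<epsilon>\<^sup>2)\<^sup>2" using kp by (intro power_mono) auto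
    then show ?thesis by (simp add: power_mult_distrib power_mult[symmetric])
  qed
  have e4: "\<epsilon> ^ 4 \<le> \<epsilon>" "\<epsilon> ^ 4 \<le> \<epsilon> ^ 3" using \<epsilon> power_decreasing[of 1 4 \<epsilon>] power_decreasing[of 3 4 \<epsilon>] by auto
  have k2e: "90000 \<le> k\<^sup>2 * \<epsilon>" "90000 \<le> k\<^sup>2 * \<epsilon> ^ 3"
    using k2 mult_left_mono[OF e4(1), of "k\<^sup>2"] mult_left_mono[OF e4(2), of "k\<^sup>2"] by auto
  have k2b: "2 < k\<^sup>2" using k300 power_mono[of 300 k 2] by simp
  define q where "q = l\<^sup>2 * s\<^sup>2 * F\<^sup>2 * M"
  have q: "0 < q" unfolding q_def using FM sk(2) by (intro mult_pos_pos) auto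
  have l\<rho>: "l * \<rho> \<le> 2 * k\<^sup>2 * q"
  proof -
    have "l * \<rho> \<le> l * (2 * k\<^sup>2 * l * s\<^sup>2 * F ^ 3)" using \<rho>2 FM by (intro mult_left_mono) auto
    also have "\<dots> = 2 * k\<^sup>2 * (l\<^sup>2 * s\<^sup>2 * F\<^sup>2 * F)" by (simp add: power2_eq_square power3_eq_cube mult_ac)
    also have "\<dots> \<le> 2 * k\<^sup>2 * q" unfolding q_def using FM by (intro mult_left_mono) auto
    finally show ?thesis .
  qed
  have NNq: "M * (real NN)\<^sup>2 = 4 * (k\<^sup>2 * k\<^sup>2) * q"
    by (simp add: N q_def power2_eq_square mult_ac)
  \<comment> \<open>Makes centred residues unique: a component \<open>u x + N y\<close> of squared
    norm at most \<open>\<rho>\<close> has entries below \<open>N / 2\<close>.\<close>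
  have big: "4 * l * \<rho> < M * (real NN)\<^sup>2"
  proof -
    have "4 * l * \<rho> \<le> 8 * k\<^sup>2 * q" using l\<rho> by linarith
    also have "\<dots> < 4 * (k\<^sup>2 * k\<^sup>2) * q"
    proof -
      have "2 * k\<^sup>2 < k\<^sup>2 * k\<^sup>2" using k2b by (intro mult_strict_right_mono) auto
      then have "(2 * k\<^sup>2) * q < (k\<^sup>2 * k\<^sup>2) * q" by (rule mult_strict_right_mono[OF _ q])
      then show ?thesis by linarith
    qed
    finally show ?thesis unfolding NNq .
  qed
  \<comment> \<open>Puts \<open>x\<close> into the search range: its entries are at most
    \<open>BB\<close> whenever \<open>t\<^sup>2 * nQ (ic x) \<le> \<rho>\<close>.\<close>
  have small: "l * \<rho> \<le> M * (real tt * real BB)\<^sup>2"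
  proof -
    have "M * (real tt * real BB)\<^sup>2 = 4 * k\<^sup>2 * q"
      by (simp add: Bq q_def s_def[symmetric] power2_eq_square mult_ac)
    moreover have "2 * k\<^sup>2 * q \<le> 4 * k\<^sup>2 * q" using q by simp
    ultimately show ?thesis using l\<rho> by linarith
  qed
  have sq: "(sqrt \<rho>)\<^sup>2 = \<rho>" using \<rho>p by simp
  \<comment> \<open>Cells of the ideals against the fibres (\<open>c1a\<close>, \<open>c1b\<close>):
    their sides are at most \<open>r / t\<close>, and \<open>t = K n\<close> makes this small
    against \<open>r / n\<close>.\<close>
  have c1a: "F * (\<rho> / s\<^sup>2) \<le> 2 * \<eta>"
  proof -
    have "\<rho> / (8 * k\<^sup>2 * F) * 2 \<le> \<rho> / (8 * k\<^sup>2 * F) * (k\<^sup>2 * \<epsilon>)" using k2e FM \<rho>p by (intro mult_left_mono) auto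
    moreover have "F * (\<rho> / s\<^sup>2) = \<rho> / (8 * k\<^sup>2 * F) * 2" using FM k300 by (simp add: sk power2_eq_square field_simps)
    moreover have "\<rho> / (8 * k\<^sup>2 * F) * (k\<^sup>2 * \<epsilon>) = 2 * \<eta>" using FM k300 by (simp add: \<eta>_def field_simps)
    ultimately show ?thesis by simp
  qed
  have c1b: "4 * \<rho> * (\<rho> / s\<^sup>2) / (3 * \<eta>\<^sup>2) \<le> \<epsilon> / 16"
  proof -
    have "4 * \<rho> * (\<rho> / s\<^sup>2) / (3 * \<eta>\<^sup>2) = 256 / (3 * (k\<^sup>2 * \<epsilon>\<^sup>2))"
      using FM k300 \<rho>p \<epsilon> by (simp add: \<eta>_def sk power2_eq_square field_simps)
    also have "\<dots> \<le> \<epsilon> / 16" using k2e(2) k300 \<epsilon> by (simp add: field_simps power2_eq_square power3_eq_cube)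
    finally show ?thesis .
  qed
  \<comment> \<open>Cells of \<open>t R\<close> against the ball (\<open>c2a\<close>,
    \<open>c2b\<close>): their sides are at most \<open>t * sqrt f\<close>, small against
    \<open>r / n\<close> by \<open>\<rho>3\<close>, that is, by the size of
    \<open>NN\<close>.\<close>
  have c2a: "(2 * F) * (s\<^sup>2 * F) \<le> 2 * \<eta>"
  proof -
    have "F * F * s\<^sup>2 * 80 \<le> F * F * s\<^sup>2 * (k\<^sup>2 * \<epsilon>)" using k2e by (intro mult_left_mono) auto
    then have "2 * (F * F * s\<^sup>2) \<le> \<epsilon> / (8 * F) * (k\<^sup>2 * F ^ 3 * s\<^sup>2 / 5)"
      using FM by (simp add: field_simps power3_eq_cube)
    also have "\<dots> \<le> \<epsilon> / (8 * F) * \<rho>" using \<rho>3 \<epsilon> FM by (intro mult_left_mono) auto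
    finally show ?thesis by (simp add: \<eta>_def mult_ac)
  qed
  have c2b: "4 * (\<rho> + 2 * \<eta>) * (s\<^sup>2 * F) / (3 * \<eta>\<^sup>2) \<le> \<epsilon> / 16"
  proof -
    have "\<epsilon> * \<rho> \<le> 8 * F * \<rho>" using \<epsilon> FM \<rho>p by (intro mult_right_mono) auto
    then have "2 * \<eta> \<le> \<rho>" using FM by (simp add: \<eta>_def field_simps)
    then have "4 * (\<rho> + 2 * \<eta>) * (s\<^sup>2 * F) \<le> 4 * (\<rho> + \<rho>) * (s\<^sup>2 * F)" using FM by (intro mult_right_mono) auto
    also have "\<dots> = \<rho> / (4096 * F\<^sup>2) * (32768 * (F ^ 3 * s\<^sup>2))" using FM by (simp add: field_simps power2_eq_square power3_eq_cube)
    also have "\<dots> \<le> \<rho> / (4096 * F\<^sup>2) * (3 * \<epsilon> ^ 3 * \<rho>)"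
    proof (intro mult_left_mono)
      have "32768 * (F ^ 3 * s\<^sup>2) \<le> 3 * (k\<^sup>2 * \<epsilon> ^ 3) * (F ^ 3 * s\<^sup>2) / 5"
      proof -
        have X: "0 \<le> F ^ 3 * s\<^sup>2" using FM by simp
        from mult_right_mono[OF k2e(2) X] show ?thesis using X by linarith
      qed
      also have "\<dots> = 3 * \<epsilon> ^ 3 * (k\<^sup>2 * F ^ 3 * s\<^sup>2 / 5)" by simp
      also have "\<dots> \<le> 3 * \<epsilon> ^ 3 * \<rho>" using \<rho>3 \<epsilon> by (intro mult_left_mono) auto
      finally show "32768 * (F ^ 3 * s\<^sup>2) \<le> 3 * \<epsilon> ^ 3 * \<rho>" .
    qed (use \<rho>p in auto)
    also have "\<dots> = \<epsilon> / 16 * (3 * \<eta>\<^sup>2)" using FM by (simp add: \<eta>_def power2_eq_square power3_eq_cube field_simps)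
    finally show ?thesis using \<eta>p by (subst pos_divide_le_eq) auto
  qed
  define V0 where "V0 = unit_ball_vol (real (2 * f))"
  have V0: "0 < V0" by (simp add: V0_def)
  define Q where "Q = M * real NN ^ f * s ^ f * D\<^sup>2"
  have Qp: "0 < Q" using FM NN_pos sk D_pos by (simp add: Q_def)
  have V\<rho>: "V0 * \<rho> ^ f = (1 - \<epsilon> / 2) * Q"
  proof -
    have "V0 * Y \<epsilon> = (1 - \<epsilon> / 2) * real m * D\<^sup>2" unfolding Y_def V0_def[symmetric] using V0 by simp
    moreover have "V0 * \<rho> ^ f = (V0 * Y \<epsilon>) * (real tt ^ f * real NN ^ f)"
      by (simp add: \<rho>_def power_mult_distrib \<beta>f)
    ultimately show ?thesis by (simp add: Q_def M_def s_def mult_ac)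
  qed
  have pow: "sqrt x ^ (2 * f) = x ^ f" if "0 \<le> x" for x using that by (simp add: power_mult)
  have vol: "V0 * sqrt (\<rho> + 3 * \<eta>) ^ (2 * f) < M * real NN ^ f * (1 - \<epsilon> / 16)\<^sup>2 * s ^ f * D\<^sup>2"
  proof -
    let ?x = "3 * \<epsilon> / 16"
    have "(1 + ?x / F) ^ f \<le> exp (?x / F) ^ f" using \<epsilon> FM by (intro power_mono exp_ge_add_one_self) auto
    also have "\<dots> = exp (F * (?x / F))" unfolding F_def by (rule exp_of_nat_mult[symmetric])
    also have "F * (?x / F) = ?x" using FM by simp
    finally have e1: "(1 + ?x / F) ^ f \<le> exp ?x" .
    have "\<rho> + 3 * \<eta> = \<rho> * (1 + ?x / F)" using FM by (simp add: \<eta>_def field_simps)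
    then have "(\<rho> + 3 * \<eta>) ^ f = \<rho> ^ f * (1 + ?x / F) ^ f" by (simp only: power_mult_distrib)
    moreover have "sqrt (\<rho> + 3 * \<eta>) ^ (2 * f) = (\<rho> + 3 * \<eta>) ^ f" using \<rho>p \<eta>p by (intro pow) simp
    ultimately have "V0 * sqrt (\<rho> + 3 * \<eta>) ^ (2 * f) = (V0 * \<rho> ^ f) * (1 + ?x / F) ^ f" by simp
    also have "\<dots> = (1 - \<epsilon> / 2) * Q * (1 + ?x / F) ^ f" unfolding V\<rho> ..
    also have "\<dots> \<le> (1 - \<epsilon> / 2) * Q * exp ?x" using e1 \<epsilon> Qp by (intro mult_left_mono) auto
    \<comment> \<open>The error budget: two relative errors of \<open>\<epsilon> / 16\<close> and
      the enlargement by \<open>3 * \<epsilon> / 16\<close> add up to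
      \<open>5 * \<epsilon> / 16\<close> in first order, less than the reserved
      \<open>\<epsilon> / 2\<close>.\<close>
    also have "\<dots> < (1 - \<epsilon> / 16)\<^sup>2 * Q"
    proof -
      have "1 - \<epsilon> / 2 < 1 - 5 * \<epsilon> / 16 + 3 * \<epsilon>\<^sup>2 / 128" using \<epsilon> zero_le_power2[of \<epsilon>] by linarith
      also have "\<dots> = (1 - \<epsilon> / 8) * (1 - ?x)" by (simp add: field_simps power2_eq_square)
      also have "\<dots> \<le> (1 - \<epsilon> / 16)\<^sup>2 * (1 - ?x)"
        using \<epsilon> by (intro mult_right_mono) (auto simp: power2_eq_square field_simps)
      finally have "(1 - \<epsilon> / 2) * exp ?x < (1 - \<epsilon> / 16)\<^sup>2 * (1 - ?x) * exp ?x" by (rule mult_strict_right_mono) simp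
      also have "\<dots> \<le> (1 - \<epsilon> / 16)\<^sup>2 * (exp (- ?x) * exp ?x)"
        unfolding mult.assoc using exp_ge_add_one_self[of "- ?x"] by (intro mult_left_mono mult_right_mono) auto
      also have "exp (- ?x) * exp ?x = 1" by (simp flip: exp_add)
      finally have "(1 - \<epsilon> / 2) * exp ?x < (1 - \<epsilon> / 16)\<^sup>2" by simp
      then have "(1 - \<epsilon> / 2) * exp ?x * Q < (1 - \<epsilon> / 16)\<^sup>2 * Q" by (rule mult_strict_right_mono[OF _ Qp])
      then show ?thesis by (simp add: mult_ac)
    qed
    finally show ?thesis by (simp add: Q_def mult_ac)
  qed
  have c2a': "real (2 * f) * (s\<^sup>2 * real f) \<le> 2 * \<eta>" using c2a by (simp add: F_def)
  have A: "l * \<rho> < M * (real NN)\<^sup>2"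
  proof -
    have "l * \<rho> \<le> 4 * l * \<rho>" using FM \<rho>p by simp
    then show ?thesis using big by linarith
  qed
  have "\<exists>u\<in>box NN. \<forall>x\<in>ZE. \<forall>y\<in>ZE. (x, y) \<noteq> (\<lambda>_. 0, \<lambda>_. 0) \<longrightarrow> (sqrt \<rho>)\<^sup>2 < s\<^sup>2 * nQ (ic x) + latQ NN u x y"
    by (rule exists_good_u[where \<eta> = \<eta> and \<delta> = "\<epsilon> / 16"], unfold sq)
      (use NN_pos sk \<rho>p \<eta>p A c1a c1b c2a' c2b vol \<epsilon> in \<open>simp_all add: F_def M_def l_def V0_def\<close>)
  then obtain u0 where u0: "u0 \<in> box NN"
    "\<And>x y. x \<in> ZE \<Longrightarrow> y \<in> ZE \<Longrightarrow> (x, y) \<noteq> (\<lambda>_. 0, \<lambda>_. 0) \<Longrightarrow> \<rho> < (real tt)\<^sup>2 * nQ (ic x) + latQ NN u0 x y"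
    unfolding sq s_def by blast
  obtain t W g where W: "computes (cstmt (algorithm K)) m t (gram_out (dgu W))"
    "t \<le> cost"
    "W < NN ^ f" "\<And>V. V < NN ^ f \<Longrightarrow> minI (dgu V) ((2 * BB + 1) ^ f) (g V) \<and> g V \<le> g W"
    by (rule algorithm_computes) blast
  have opt: "\<rho> < (real tt)\<^sup>2 * nQ (ic x) + latQ NN (dgu W) x y"
    if "x \<in> ZE" "y \<in> ZE" "(x, y) \<noteq> (\<lambda>_. 0, \<lambda>_. 0)" for x y
    by (rule optimal_u[OF u0 _ _ _ W(4,3) that]) (use \<rho>p small big in \<open>simp_all add: M_def l_def\<close>)
  obtain \<Lambda> where \<Lambda>: "is_lattice (2 * f) \<Lambda>" "describes_lattice (2 * f) (gram_out (dgu W)) \<Lambda>"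
    "V0 * sqrt \<rho> ^ (2 * f) / (2 ^ (2 * f) * (real NN ^ f * real tt ^ f * D\<^sup>2)) < lattice_density (2 * f) \<Lambda>"
    unfolding V0_def by (rule lattice_of_u[OF \<rho>p opt]) blast
  have "(1 - \<epsilon>) * real m / 2 ^ (2 * f) < (1 - \<epsilon> / 2) * real m / 2 ^ (2 * f)"
    using \<epsilon> m2 by (intro divide_strict_right_mono mult_strict_right_mono) auto
  also have "\<dots> = V0 * sqrt \<rho> ^ (2 * f) / (2 ^ (2 * f) * (real NN ^ f * real tt ^ f * D\<^sup>2))"
  proof -
    have "V0 * sqrt \<rho> ^ (2 * f) = (1 - \<epsilon> / 2) * real m * (real NN ^ f * real tt ^ f * D\<^sup>2)"
      unfolding pow[OF less_imp_le[OF \<rho>p]] V\<rho> by (simp add: Q_def M_def s_def mult_ac)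
    moreover have "0 < real NN ^ f * real tt ^ f * D\<^sup>2" using NN_pos tt_pos D_pos by simp
    moreover have "c / Z = X / (Z * Y)" if "X = c * Y" "0 < Y" for c X Y Z :: real using that by simp
    ultimately show ?thesis by blast
  qed
  finally have "(1 - \<epsilon>) * real m / 2 ^ (2 * f) < lattice_density (2 * f) \<Lambda>" using \<Lambda>(3) by linarith
  then show thesis using that W(1,2) \<Lambda>(1,2) by blast
qed

end

section \<open>Asymptotics of the running time\<close>

context cyc
begin

lemma P_eq: "P = prime_factors m"
  using m_pos by (auto simp: P_def in_prime_factors_iff)

text \<open>Every factor \<open>1 - 1 / p\<close> of the product formula is at least
  \<open>1 / 2\<close>.\<close>

lemma totient_lower: "real m \<le> 2 ^ card P * real (totient m)"
proof -
  have "(1 / 2) ^ card P = (\<Prod>p\<in>P. 1 / 2 :: real)" by simp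
  also have "\<dots> \<le> (\<Prod>p\<in>P. 1 - 1 / real p)"
  proof (rule prod_mono)
    fix p assume "p \<in> P"
    then have "2 \<le> real p" using prime_ge_2_nat[OF prime_P] by auto
    then show "0 \<le> (1 / 2 :: real) \<and> 1 / 2 \<le> 1 - 1 / real p" by (simp add: field_simps)
  qed
  finally have "real m * (1 / 2) ^ card P \<le> real (totient m)"
    unfolding totient_formula2[of m] P_eq by (intro mult_left_mono) auto
  then show ?thesis by (simp add: power_one_over field_simps)
qed

text \<open>Each prime \<open>p \<ge> q\<close> pays for its factor 2 with
  \<open>p powr \<eta>\<close>, and at most \<open>q\<close> primes lie below
  \<open>q\<close>.\<close>

lemma omega_bound:
  assumes \<eta>: "0 < \<eta>" and q: "2 \<le> real q powr \<eta>"
  shows "2 ^ card P \<le> 2 ^ q * real m powr \<eta>"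
proof -
  have "(2 :: real) ^ card P = (\<Prod>p\<in>P. 2)" by simp
  also have "\<dots> \<le> (\<Prod>p\<in>P. (if p < q then 2 else 1) * real p powr \<eta>)"
  proof (rule prod_mono)
    fix p assume "p \<in> P"
    then have "1 \<le> real p" using prime_ge_1_nat[OF prime_P] by auto
    then have "1 \<le> real p powr \<eta>" using \<eta> by (intro ge_one_powr_ge_zero) auto
    moreover have "real q powr \<eta> \<le> real p powr \<eta>" if "\<not> p < q" using that \<eta> by (intro powr_mono2) auto
    ultimately show "0 \<le> (2::real) \<and> 2 \<le> (if p < q then 2 else 1) * real p powr \<eta>" using q by auto
  qed
  also have "\<dots> = (\<Prod>p\<in>P. if p < q then 2 else 1) * real m0 powr \<eta>"
    by (simp add: prod.distrib prod_powr_distrib m0_def)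
  also have "\<dots> \<le> 2 ^ q * real m powr \<eta>"
  proof (rule mult_mono)
    have "(\<Prod>p\<in>P. if p < q then 2 else 1 :: real) = 2 ^ card {p\<in>P. p < q}"
      by (simp add: prod.If_cases Int_def)
    also have "card {p\<in>P. p < q} \<le> card {..<q}" by (rule card_mono) auto
    then have "(2::real) ^ card {p\<in>P. p < q} \<le> 2 ^ q" by (intro power_increasing) auto
    finally show "(\<Prod>p\<in>P. if p < q then 2 else 1 :: real) \<le> 2 ^ q" .
    have "m0 \<le> m" using m0_dvd m_pos by (rule dvd_imp_le)
    then show "real m0 powr \<eta> \<le> real m powr \<eta>" using \<eta> by (intro powr_mono2) auto
  qed auto
  finally show ?thesis .
qed

lemma L_le: "L \<le> m\<^sup>2"
proof -
  have "2 ^ card P = (\<Prod>p\<in>P. 2 :: nat)" by simp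
  also have "\<dots> \<le> m0" unfolding m0_def using prime_ge_2_nat[OF prime_P] by (intro prod_mono) auto
  also have "m0 \<le> m" using m0_dvd m_pos by (rule dvd_imp_le)
  finally have "(2 ^ card P)\<^sup>2 \<le> m\<^sup>2" by (intro power_mono) auto
  moreover have "L = (2 ^ card P)\<^sup>2" by (simp add: L_def power_mult[symmetric] mult.commute[of "card P"] power_mult)
  ultimately show ?thesis by simp
qed

end

lemma len_power2: "len (2 ^ k) = k + 2"
proof -
  have "nat ((2::int) ^ k) = 2 ^ k" by (simp add: nat_power_eq)
  then show ?thesis by (simp add: len_def floorlog_def)
qed

context alg
begin

text \<open>The word length enters only polynomially in \<open>m\<close>, although \<open>RR\<close>
  contains the exponential factor \<open>XX\<close>. The main term is the \<open>f\<close>-th power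
  of \<open>NN * (2 * BB + 1) \<le> 20 * K ^ 4 * L\<^sup>2 * f ^ 3\<close>, in which
  \<open>f ^ 3\<close> yields \<open>3 f ln f = 1.5 n ln f\<close>.\<close>

lemma cost_bound:
  "real cost
    \<le> 3520000 * 10 ^ 6 * real K ^ 6 * real m ^ 14 * (20 * real K ^ 4 * real L ^ 2 * real f ^ 3) ^ f"
proof -
  \<comment> \<open>One number dominating \<open>NN\<close>, \<open>2 * BB + 1\<close> and
    \<open>tt\<close>, so that \<open>RR\<close> is bounded by a power of \<open>H\<close>.\<close>
  define H where "H = 10 * K ^ 3 * m ^ 4"
  have K: "1 \<le> K ^ j" for j using K1 by simp
  have m1: "1 \<le> m" "16 \<le> m ^ 4" using m2 power_mono[of 2 m 4] by auto
  have H160: "160 \<le> H" unfolding H_def using K[of 3] m1 mult_le_mono[of 1 "K ^ 3" 16 "m ^ 4"] by simp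
  have N: "NN = 4 * K ^ 3 * L * f\<^sup>2" by (simp add: NN_def tt_def power2_eq_square power3_eq_cube)
  have f2: "f\<^sup>2 \<le> m\<^sup>2" using f_le_m by (intro power_mono) auto
  have NH: "NN \<le> H"
  proof -
    have "L * f\<^sup>2 \<le> m\<^sup>2 * m\<^sup>2" using L_le f2 by (rule mult_le_mono)
    also have "\<dots> = m ^ 4" by (simp flip: power_add)
    finally have "4 * K ^ 3 * (L * f\<^sup>2) \<le> 10 * K ^ 3 * m ^ 4" by (intro mult_le_mono) auto
    then show ?thesis by (simp add: N H_def mult.assoc)
  qed
  have BN: "BB \<le> NN" using K1 tt_pos by (simp add: NN_def BB_def)
  have BH: "2 * BB + 1 \<le> H"
  proof -
    have "K \<le> K ^ 3" using K1 by (simp add: self_le_power)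
    moreover have "L * f \<le> m\<^sup>2 * m" using L_le f_le_m by (rule mult_le_mono)
    moreover have "m\<^sup>2 * m \<le> m ^ 4" using power_increasing[of 3 4 m] m1 by (simp add: power2_eq_square power3_eq_cube)
    ultimately have "K * (L * f) \<le> K ^ 3 * m ^ 4" by (meson le_trans mult_le_mono)
    moreover have "1 \<le> K ^ 3 * m ^ 4" using K[of 3] m1 by simp
    ultimately have "2 * (2 * (K * (L * f))) + 1 \<le> 10 * (K ^ 3 * m ^ 4)" by linarith
    moreover have "BB = 2 * (K * (L * f))" "H = 10 * (K ^ 3 * m ^ 4)" by (simp_all add: BB_def H_def)
    ultimately show ?thesis by simp
  qed
  have tH: "tt \<le> H"
  proof -
    have "tt * 1 \<le> tt * (K * K * L * (2 * f))" using K1 L1 f_pos by (intro mult_le_mono2) (simp add: Suc_le_eq)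
    then have "tt \<le> NN" by (simp add: NN_def mult_ac)
    then show ?thesis using NH by simp
  qed
  have "NN * NN + tt * tt * BB * BB + NN * BB + 1 \<le> H ^ 5"
  proof -
    have 4: "NN * NN \<le> H ^ 4" "tt * tt * BB * BB \<le> H ^ 4" "NN * BB \<le> H ^ 4" "1 \<le> H ^ 4"
    proof -
      have BH': "BB \<le> H" using BH by simp
      have 2: "H * H \<le> H ^ 4" using power_increasing[of 2 4 H] H160 by (simp add: power2_eq_square)
      show "NN * NN \<le> H ^ 4" "NN * BB \<le> H ^ 4" using mult_le_mono[OF NH NH] mult_le_mono[OF NH BH'] 2 by linarith+
      show "tt * tt * BB * BB \<le> H ^ 4"
        using mult_le_mono[OF mult_le_mono[OF mult_le_mono[OF tH tH] BH'] BH'] by (simp add: power4_eq_xxxx)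
      show "1 \<le> H ^ 4" using H160 by simp
    qed
    have "4 * H ^ 4 \<le> H * H ^ 4" using H160 by (intro mult_le_mono1) simp
    moreover have "H ^ 5 = H * H ^ 4" by (simp add: eval_nat_numeral)
    ultimately show ?thesis using 4 by linarith
  qed
  moreover have "100 * m ^ 4 \<le> 10 * H" using K[of 3] by (simp add: H_def)
  moreover have "10 * H \<le> H * H" using H160 by simp
  ultimately have "AA \<le> (H * H) * H ^ 5" unfolding AA_def by (meson le_trans mult_le_mono)
  then have A: "AA \<le> H ^ 7" by (simp add: eval_nat_numeral)
  have "XX \<le> H ^ f * H ^ f" unfolding XX_def using NH BH by (intro mult_le_mono power_mono) auto
  also have "\<dots> \<le> H ^ (2 * m)" using f_le_m H160 by (auto simp flip: power_add intro: power_increasing)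
  finally have "AA * XX \<le> H ^ 7 * H ^ (2 * m)" using A by (intro mult_le_mono)
  also have "\<dots> \<le> H ^ (6 * m)" unfolding power_add[symmetric] using m2 H160 by (intro power_increasing) auto
  \<comment> \<open>Replacing \<open>H\<close> by \<open>2 ^ H\<close> wastes a polynomial factor in
    the length, which only affects the power of \<open>m\<close> in front.\<close>
  also have "\<dots> \<le> (2 ^ H) ^ (6 * m)" by (intro power_mono less_imp_le less_exp) (use H160 in auto)
  finally have "(AA * XX) ^ 16 \<le> ((2 ^ H) ^ (6 * m)) ^ 16" by (intro power_mono) auto
  then have "(AA * XX) ^ 16 \<le> 2 ^ (96 * m * H)" by (simp add: power_mult[symmetric] mult_ac)
  then have "RR ^ 16 \<le> 2 ^ (96 * m * H)" unfolding RR_def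
    by (metis of_nat_le_iff of_nat_power of_nat_numeral)
  moreover have "0 \<le> RR" by (simp add: RR_def)
  ultimately have "len (RR ^ 16) \<le> len (2 ^ (96 * m * H))" by (intro len_mono) simp
  also have "\<dots> = 96 * m * H + 2" by (rule len_power2)
  also have "\<dots> \<le> 100 * m * H"
  proof -
    have "1 \<le> m * H" using m1 H160 by simp
    then show ?thesis by linarith
  qed
  also have "100 * m * H = 1000 * K ^ 3 * m ^ 5"
  proof -
    have "m ^ 5 = m * m ^ 4" by (simp add: eval_nat_numeral)
    then show ?thesis by (simp add: H_def)
  qed
  finally have len: "len (RR ^ 16) \<le> 1000 * K ^ 3 * m ^ 5" .
  have "unit_cost (RR ^ 16) \<le> 11 * (1000 * K ^ 3 * m ^ 5)\<^sup>2"
    unfolding unit_cost_def using len by (intro mult_le_mono2 power_mono) auto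
  also have "\<dots> = 11 * 10 ^ 6 * K ^ 6 * m ^ 10" by (simp add: power_mult_distrib power_mult[symmetric])
  finally have U: "unit_cost (RR ^ 16) \<le> 11 * 10 ^ 6 * K ^ 6 * m ^ 10" .
  have m4: "(m + 1) ^ 4 \<le> 16 * m ^ 4"
  proof -
    have "(m + 1) ^ 4 \<le> (2 * m) ^ 4" using m1 by (intro power_mono) auto
    then show ?thesis by (simp add: power_mult_distrib)
  qed
  have G: "NN ^ f * (2 * BB + 1) ^ f \<le> (20 * K ^ 4 * L\<^sup>2 * f ^ 3) ^ f"
  proof -
    have "2 * BB + 1 \<le> 5 * K * L * f" unfolding BB_def using K1 L1 f_pos mult_le_mono[of 1 "K * L" 1 f] by simp
    then have "NN * (2 * BB + 1) \<le> (4 * K ^ 3 * L * f\<^sup>2) * (5 * K * L * f)" unfolding N by (intro mult_le_mono2)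
    also have "\<dots> = 20 * K ^ 4 * L\<^sup>2 * f ^ 3"
      by (simp add: power4_eq_xxxx power3_eq_cube power2_eq_square mult_ac)
    finally show ?thesis unfolding power_mult_distrib[symmetric] by (intro power_mono) auto
  qed
  have "cost
    \<le> 2000 * (16 * m ^ 4) * (20 * K ^ 4 * L\<^sup>2 * f ^ 3) ^ f * (11 * 10 ^ 6 * K ^ 6 * m ^ 10)"
    using m4 G U by (intro mult_le_mono) auto
  also have "\<dots> = 352000 * 10 ^ 6 * K ^ 6 * m ^ 14 * (20 * K ^ 4 * L\<^sup>2 * f ^ 3) ^ f"
  proof -
    have "m ^ 14 = m ^ 4 * m ^ 10" by (simp flip: power_add)
    then show ?thesis by (simp add: mult_ac)
  qed
  finally have "real cost
    \<le> real (352000 * 10 ^ 6 * K ^ 6 * m ^ 14 * (20 * K ^ 4 * L\<^sup>2 * f ^ 3) ^ f)" by (rule of_nat_mono)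
  also have "\<dots> \<le> 3520000 * 10 ^ 6 * real K ^ 6 * real m ^ 14 * (20 * real K ^ 4 * real L ^ 2 * real f ^ 3) ^ f"
    by simp
  finally show ?thesis .
qed

lemma cost_exp:
  assumes "t \<le> cost"
  shows "real t \<le> exp (ln (3520000 * 10 ^ 6 * real K ^ 6) + 14 * ln (real m)
    + real f * (ln (20 * real K ^ 4) + 2 * ln (real L) + 3 * ln (real f)))"
proof -
  have pos: "0 < real K" "0 < real m" "0 < real L" "0 < real f" using K1 m_pos L_pos f_pos by auto
  have "real t \<le> real cost"
    using assms by (rule of_nat_mono)
  also note cost_bound
  also have "3520000 * 10 ^ 6 * real K ^ 6 * real m ^ 14 * (20 * real K ^ 4 * real L ^ 2 * real f ^ 3) ^ f
    = exp (ln (3520000 * 10 ^ 6 * real K ^ 6)) * exp (ln (real m)) ^ 14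
      * (exp (ln (20 * real K ^ 4)) * exp (ln (real L)) ^ 2 * exp (ln (real f)) ^ 3) ^ f"
    using pos by simp
  also have "\<dots> = exp (ln (3520000 * 10 ^ 6 * real K ^ 6) + 14 * ln (real m)
    + real f * (ln (20 * real K ^ 4) + 2 * ln (real L) + 3 * ln (real f)))"
  proof -
    have "exp (14 * x) = exp x ^ 14" "exp (2 * x) = exp x ^ 2" "exp (3 * x) = exp x ^ 3" for x :: real
      using exp_of_nat_mult[of 14 x] exp_of_nat_mult[of 2 x] exp_of_nat_mult[of 3 x] by simp_all
    then show ?thesis by (simp only: exp_add exp_of_nat_mult)
  qed
  finally show ?thesis .
qed

end

lemma omega_asymp:
  assumes "0 < \<eta>"
  shows "\<exists>C\<ge>1. \<forall>m\<ge>2. 2 ^ card (cyc.P m) \<le> C * real m powr \<eta>"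
proof -
  define q where "q = nat \<lceil>2 powr (1 / \<eta>)\<rceil>"
  have "2 powr (1 / \<eta>) \<le> real q" unfolding q_def by linarith
  then have "(2 powr (1 / \<eta>)) powr \<eta> \<le> real q powr \<eta>" using assms by (intro powr_mono2) auto
  then have "2 \<le> real q powr \<eta>" using assms by (simp add: powr_powr)
  then have "2 ^ card (cyc.P m) \<le> 2 ^ q * real m powr \<eta>" if "2 \<le> m" for m
    using cyc.omega_bound[OF cyc.intro[OF that] assms] by blast
  then show ?thesis by (intro exI[of _ "2 ^ q"]) auto
qed

text \<open>Combines \<open>totient_lower\<close> with \<open>omega_asymp\<close> at the exponent
  \<open>1 / 2\<close>.\<close>

lemma totient_ge_sqrt: "\<exists>C\<ge>1. \<forall>m\<ge>2. sqrt (real m) / C \<le> real (totient m)"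
proof -
  obtain C where C: "1 \<le> C" "\<And>m. 2 \<le> m \<Longrightarrow> 2 ^ card (cyc.P m) \<le> C * real m powr (1 / 2)"
    using omega_asymp[of "1 / 2"] by auto
  have "sqrt (real m) / C \<le> real (totient m)" if m: "2 \<le> m" for m
  proof -
    have "real m \<le> 2 ^ card (cyc.P m) * real (totient m)" by (rule cyc.totient_lower[OF cyc.intro[OF m]])
    also have "\<dots> \<le> C * sqrt (real m) * real (totient m)"
      using C(2)[OF m] m by (intro mult_right_mono) (auto simp: powr_half_sqrt)
    finally have "sqrt (real m) * sqrt (real m) \<le> sqrt (real m) * (C * real (totient m))" by (simp add: mult_ac)
    then have "sqrt (real m) \<le> C * real (totient m)" by (rule mult_left_le_imp_le) (use m in simp)
    then show ?thesis using C(1) by (simp add: field_simps)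
  qed
  with C(1) show ?thesis by blast
qed

lemma totient_at_top: "filterlim (\<lambda>m. real (totient m)) at_top sequentially"
proof -
  obtain C where C: "1 \<le> C" "\<forall>m\<ge>2. sqrt (real m) / C \<le> real (totient m)" using totient_ge_sqrt by blast
  have "filterlim (\<lambda>m. sqrt (real m) / C) at_top sequentially" using C(1) by real_asymp
  then show ?thesis
    by (rule filterlim_at_top_mono) (use C(2) in \<open>auto simp: eventually_sequentially\<close>)
qed

lemma le_two_power_totient: "\<forall>\<^sub>F m in sequentially. real m \<le> 2 ^ totient m"
proof -
  obtain C where C: "1 \<le> C" "\<forall>m\<ge>2. sqrt (real m) / C \<le> real (totient m)" using totient_ge_sqrt by blast
  have "\<forall>\<^sub>F m :: nat in sequentially. ln (real m) \<le> ln 2 * (sqrt (real m) / C)" using C(1) by real_asymp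
  moreover have "\<forall>\<^sub>F m :: nat in sequentially. 2 \<le> m" by (rule eventually_ge_at_top)
  ultimately show ?thesis
  proof eventually_elim
    case (elim m)
    have "ln (real m) \<le> ln 2 * real (totient m)"
      using elim C(2) by (meson ln_2_less_1 ln_ge_zero mult_left_mono order_trans one_le_numeral)
    then have "exp (ln (real m)) \<le> exp (real (totient m) * ln 2)" by (simp add: mult.commute)
    then show ?case using elim by (simp add: exp_of_nat_mult)
  qed
qed

text \<open>With \<open>F = totient m\<close>, eventually
  \<open>m \<le> C\<^sup>2 * F\<^sup>2\<close> and \<open>C\<^sup>2 \<le> F\<close>, so
  \<open>m \<le> F ^ 3\<close>.\<close>

lemma ln_le_totient: "\<forall>\<^sub>F m in sequentially. ln (real m) \<le> 3 * ln (2 * real (totient m))"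
proof -
  obtain C where C: "1 \<le> C" "\<forall>m\<ge>2. sqrt (real m) / C \<le> real (totient m)" using totient_ge_sqrt by blast
  have "\<forall>\<^sub>F m in sequentially. C\<^sup>2 \<le> real (totient m)"
    using totient_at_top by (auto simp: filterlim_at_top)
  moreover have "\<forall>\<^sub>F m :: nat in sequentially. 2 \<le> m" by (rule eventually_ge_at_top)
  ultimately show ?thesis
  proof eventually_elim
    case (elim m)
    define F where "F = real (totient m)"
    have F: "sqrt (real m) \<le> C * F" "C\<^sup>2 \<le> F" using C elim by (auto simp: F_def field_simps)
    have "1 \<le> C\<^sup>2" using C(1) by simp
    then have F1: "1 \<le> F" using F(2) by linarith
    have "real m = (sqrt (real m))\<^sup>2" by simp
    also have "\<dots> \<le> (C * F)\<^sup>2" using F(1) by (intro power_mono) auto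
    also have "\<dots> = C\<^sup>2 * F\<^sup>2" by (simp add: power_mult_distrib)
    also have "\<dots> \<le> F * F\<^sup>2" using F(2) by (intro mult_right_mono) auto
    also have "\<dots> = F ^ 3" by (simp add: power2_eq_square power3_eq_cube)
    also have "\<dots> \<le> (2 * F) ^ 3" using F1 by (intro power_mono) auto
    finally have "ln (real m) \<le> ln ((2 * F) ^ 3)" using elim by (intro ln_mono) auto
    also have "\<dots> = real 3 * ln (2 * F)" by (rule ln_realpow)
    finally show ?case by (simp add: F_def)
  qed
qed

lemma ln_totient_at_top: "filterlim (\<lambda>m. ln (2 * real (totient m))) at_top sequentially"
  by (intro filterlim_compose[OF ln_at_top] filterlim_tendsto_pos_mult_at_top[OF tendsto_const _ totient_at_top]) simp

text \<open>\<open>2 ^ card P\<close> is below every positive power of \<open>m\<close> up to a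
  constant. The choice \<open>e / 24\<close> makes the power, and a large \<open>m\<close> the
  constant, contribute at most \<open>e * g / 4\<close> each.\<close>

lemma ln_L_tendsto: "(\<lambda>m. ln (real (cyc.L m)) / ln (2 * real (totient m))) \<longlonglongrightarrow> 0"
proof (rule tendstoI)
  fix e :: real assume e: "0 < e"
  define \<eta> where "\<eta> = e / 24"
  have "0 < \<eta>" using e by (simp add: \<eta>_def)
  then obtain C where C: "1 \<le> C" "\<And>m. 2 \<le> m \<Longrightarrow> 2 ^ card (cyc.P m) \<le> C * real m powr \<eta>"
    using omega_asymp[of \<eta>] by auto
  have "\<forall>\<^sub>F m in sequentially. max 1 (8 * ln C / e) \<le> ln (2 * real (totient m))"
    using ln_totient_at_top by (simp only: filterlim_at_top)
  moreover have "\<forall>\<^sub>F m :: nat in sequentially. 2 \<le> m" by (rule eventually_ge_at_top)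
  ultimately show "\<forall>\<^sub>F m in sequentially. dist (ln (real (cyc.L m)) / ln (2 * real (totient m))) 0 < e"
    using ln_le_totient
  proof eventually_elim
    case (elim m)
    interpret cyc m by (rule cyc.intro) (use elim in simp)
    define g where "g = ln (2 * real (totient m))"
    have g: "1 \<le> g" "8 * ln C / e \<le> g" using elim(1) by (auto simp: g_def)
    have gC: "8 * ln C \<le> e * g" using g(2) e by (simp add: field_simps)
    have L2: "real L = (2 ^ card P)\<^sup>2" by (simp add: L_def power_mult[symmetric] mult.commute[of "card P"] power_mult)
    have "ln (real L) = 2 * ln (2 ^ card P)" unfolding L2 by (simp add: ln_realpow)
    also have "\<dots> \<le> 2 * ln (C * real m powr \<eta>)" using C(2)[of m] elim(2) by (intro mult_left_mono ln_mono) auto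
    also have "\<dots> = 2 * ln C + 2 * \<eta> * ln (real m)" using C(1) elim(2) by (simp add: ln_mult ln_powr)
    also have "\<dots> \<le> 2 * ln C + 2 * \<eta> * (3 * g)" using elim(3) \<open>0 < \<eta>\<close> by (intro add_left_mono mult_left_mono) (auto simp: g_def)
    also have "\<dots> = 2 * ln C + e * g / 4" by (simp add: \<eta>_def)
    also have "\<dots> < e * g"
    proof -
      have "0 < e * g" using e g by simp
      then show ?thesis using gC by linarith
    qed
    finally have "ln (real L) / g < e" using g by (simp add: field_simps)
    moreover have "0 \<le> ln (real L) / g" using g by (simp add: L_def)
    ultimately show ?case by (simp add: g_def)
  qed
qed

lemma ln_over_totient_tendsto: "(\<lambda>m. ln (real m) / (real (totient m) * ln (2 * real (totient m)))) \<longlonglongrightarrow> 0"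
proof (rule tendsto_sandwich)
  show "(\<lambda>_. 0) \<longlonglongrightarrow> (0::real)" by simp
  show "(\<lambda>m. 3 / real (totient m)) \<longlonglongrightarrow> 0"
    by (rule tendsto_divide_0[OF tendsto_const filterlim_at_top_imp_at_infinity[OF totient_at_top]])
  have p: "\<forall>\<^sub>F m in sequentially. 1 \<le> ln (2 * real (totient m))" "\<forall>\<^sub>F m in sequentially. 1 \<le> real (totient m)"
    using ln_totient_at_top totient_at_top unfolding filterlim_at_top by blast+
  have m: "\<forall>\<^sub>F m :: nat in sequentially. 2 \<le> m" by (rule eventually_ge_at_top)
  show "\<forall>\<^sub>F m in sequentially. 0 \<le> ln (real m) / (real (totient m) * ln (2 * real (totient m)))"
    using p m by eventually_elim simp
  show "\<forall>\<^sub>F m in sequentially. ln (real m) / (real (totient m) * ln (2 * real (totient m))) \<le> 3 / real (totient m)"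
    using p ln_le_totient
  proof eventually_elim
    case (elim m)
    then have "ln (real m) / (real (totient m) * ln (2 * real (totient m)))
      \<le> 3 * ln (2 * real (totient m)) / (real (totient m) * ln (2 * real (totient m)))"
      by (intro divide_right_mono) auto
    also have "\<dots> = 3 / real (totient m)" using elim(1) by simp
    finally show ?case .
  qed
qed

theorem proposition1:
  fixes \<epsilon> :: real
  assumes "0 < \<epsilon>" and "\<epsilon> < 1"
  shows "\<exists>(p :: prog) (\<delta> :: nat \<Rightarrow> real).
    \<delta> \<longlonglongrightarrow> 0 \<and>
    (\<forall>\<^sub>F m :: nat in sequentially.
       let n = 2 * totient m in
       \<exists>t out \<Lambda>.
         computes p m t out \<and>
         real t \<le> exp (1.5 * real n * ln (real n) * (1 + \<delta> m)) \<and>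
         is_lattice n \<Lambda> \<and>
         describes_lattice n out \<Lambda> \<and>
         lattice_density n \<Lambda> > (1 - \<epsilon>) * real m / 2 ^ (2 * totient m))"
proof -
  \<comment> \<open>The constant is fixed before \<open>m\<close>, so a single program serves all
    inputs.\<close>
  define K where "K = nat \<lceil>300 / \<epsilon>\<^sup>2\<rceil>"
  have K: "300 / \<epsilon>\<^sup>2 \<le> real K" unfolding K_def by linarith
  moreover have "0 < 300 / \<epsilon>\<^sup>2" using assms by simp
  ultimately have K1: "1 \<le> K" by (cases K) auto
  define c1 where "c1 = ln (3520000 * 10 ^ 6 * real K ^ 6)"
  define c2 where "c2 = ln (20 * real K ^ 4)"
  define g where "g m = ln (2 * real (totient m))" for m
  \<comment> \<open>Exactly the surplus of the cost exponent over \<open>3 f g\<close>, relative to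
    \<open>3 f g\<close>, once \<open>ln f\<close> has been replaced by
    \<open>g = ln n\<close>.\<close>
  define \<delta> where "\<delta> m = 2 / 3 * (ln (real (cyc.L m)) / g m) + c2 / 3 * (1 / g m)
    + 14 / 3 * (ln (real m) / (real (totient m) * g m)) + c1 / 3 * (1 / (real (totient m) * g m))" for m
  have g: "filterlim g at_top sequentially" using ln_totient_at_top by (simp add: g_def[abs_def])
  have "filterlim (\<lambda>m. real (totient m) * g m) at_top sequentially"
    by (rule filterlim_at_top_mult_at_top[OF totient_at_top g])
  then have i2: "(\<lambda>m. 1 / (real (totient m) * g m)) \<longlonglongrightarrow> 0"
    by (intro tendsto_divide_0[OF tendsto_const] filterlim_at_top_imp_at_infinity)
  have i1: "(\<lambda>m. 1 / g m) \<longlonglongrightarrow> 0"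
    by (intro tendsto_divide_0[OF tendsto_const] filterlim_at_top_imp_at_infinity g)
  have "\<delta> \<longlonglongrightarrow> 2 / 3 * 0 + c2 / 3 * 0 + 14 / 3 * 0 + c1 / 3 * 0"
    unfolding \<delta>_def[abs_def]
    by (intro tendsto_add tendsto_mult tendsto_const i1 i2 ln_L_tendsto[folded g_def] ln_over_totient_tendsto[folded g_def])
  then have \<delta>: "\<delta> \<longlonglongrightarrow> 0" by simp
  have g1: "\<forall>\<^sub>F m in sequentially. 1 \<le> g m" using g unfolding filterlim_at_top by blast
  have m2: "\<forall>\<^sub>F m :: nat in sequentially. 2 \<le> m" by (rule eventually_ge_at_top)
  have "\<forall>\<^sub>F m :: nat in sequentially. let n = 2 * totient m in
       \<exists>t out \<Lambda>. computes (cstmt (algorithm K)) m t out \<and> real t \<le> exp (1.5 * real n * ln (real n) * (1 + \<delta> m)) \<and>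
         is_lattice n \<Lambda> \<and> describes_lattice n out \<Lambda> \<and> lattice_density n \<Lambda> > (1 - \<epsilon>) * real m / 2 ^ (2 * totient m)"
    using m2 g1 le_two_power_totient
  proof eventually_elim
    case (elim m)
    interpret alg m K by unfold_locales (use elim K1 in auto)
    have f: "f = totient m" by (rule card_E)
    obtain t out \<Lambda> where *: "computes (cstmt (algorithm K)) m t out"
      "t \<le> cost"
      "is_lattice (2 * f) \<Lambda>" "describes_lattice (2 * f) out \<Lambda>"
      "(1 - \<epsilon>) * real m / 2 ^ (2 * f) < lattice_density (2 * f) \<Lambda>"
      by (rule exists_lattice[OF assms _ K]) (use elim f in simp_all)
    define F where "F = real f"
    have F: "1 \<le> F" "F = real (totient m)" using f_pos by (simp_all add: F_def f Suc_le_eq)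
    have "real t \<le> exp (c1 + 14 * ln (real m) + F * (c2 + 2 * ln (real L) + 3 * ln F))"
      using cost_exp[OF *(2)] by (simp only: c1_def c2_def F_def)
    also have "\<dots> \<le> exp (c1 + 14 * ln (real m) + F * (c2 + 2 * ln (real L) + 3 * g m))"
    proof -
      have "ln F \<le> g m" unfolding g_def F(2)[symmetric] using F(1) by (intro ln_mono) auto
      then have "F * (c2 + 2 * ln (real L) + 3 * ln F) \<le> F * (c2 + 2 * ln (real L) + 3 * g m)"
        using F(1) by (intro mult_left_mono) auto
      then show ?thesis by simp
    qed
    also have "c1 + 14 * ln (real m) + F * (c2 + 2 * ln (real L) + 3 * g m) = 3 * F * g m * (1 + \<delta> m)"
      using elim(2) F(1) unfolding \<delta>_def F(2)[symmetric] by (simp add: field_simps)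
    also have "\<dots> = 1.5 * real (2 * totient m) * ln (real (2 * totient m)) * (1 + \<delta> m)"
      unfolding F(2) g_def by simp
    finally have "real t \<le> exp (1.5 * real (2 * totient m) * ln (real (2 * totient m)) * (1 + \<delta> m))" .
    then show ?case unfolding Let_def using * unfolding f by blast
  qed
  with \<delta> show ?thesis by blast
qed

end
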